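(* Let $d\ge2$, $K>0$ and $f_n\in\mathcal{B}^-_d(K)$. After passing to a subsequence, there exist a constant $K'=K'(d,K)>0$, a marked $(d+1)$-ended ribbon tree $\mathcal{T}$, and a sequence of proper injective maps $\phi_n:\mathrm{Int}(\mathcal{T})\to\mathbb{D}$ such that: (1) (Ends approximating) $\phi_n$ extends to a continuous map $\phi_n:\mathcal{T}\to\overline{\mathbb{D}}$ giving a bijection between $\epsilon(\mathcal{T})$ and $F(f_n)$ respecting the markings; (2) (Degenerating vertices) if $v\ne w\in\beta(\mathcal{T})$ then $d_{\mathbb{D}}(\phi_n(v),\phi_n(w))\to\infty$; (3) (Geodesic edges) for each edge $E=[v,w]$ of $\mathcal{T}$, $\phi_n(E)$ is the hyperbolic geodesic (segment or ray) joining $\phi_n(v)$ and $\phi_n(w)$; (4) (Critically approximating) for each $v\in\beta(\mathcal{T})$, exactly $\mathrm{val}(v)-2$ critical points of $f_n$ (counted with multiplicity) lie within a uniformly bounded hyperbolic distance of $\phi_n(v)$; (5) (Quasi-fixed) $d_{\mathbb{D}}(f_n(\phi_n(x)),\phi_n(x))\le K'$ for all $x\in\mathrm{Int}(\mathcal{T})$ and all $n$.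
   Context: $\mathcal{B}^-_d=\{\bar z\prod_{i=1}^{d-1}\frac{\bar z-a_i}{1-\overline{a_iz}}:|a_i|<1\}$. Identify $\mathbb{S}^1=\mathbb{R}/\mathbb{Z}$, $m_{-d}(t)=-dt$; $\eta_f$ is the unique quasisymmetric conjugacy on $\mathbb{S}^1$ with $\eta_f\circ m_{-d}=f\circ\eta_f$, continuous in $f$, $\eta_{m_{-d}}=\mathrm{id}$; $\mathcal{B}^-_d(K)$ is the set of $f$ with $\log|\partial_{\bar z}f(\eta_f(x))|\le K$ at every fixed point $x$ of $m_{-d}$. $F(f)$ is the set of repelling fixed points of $f$ on $\mathbb{S}^1$, with $\eta_f(1)$ its marked point. $d_{\mathbb{D}}$ is the hyperbolic metric. For a finite tree, an end is a vertex $v$ with $\mathcal{T}-\{v\}$ connected and a branch point is a vertex with $\mathcal{T}-\{v\}$ having $\ge3$ components; $\epsilon(\mathcal{T})$, $\beta(\mathcal{T})$ denote these sets and $\mathrm{Int}(\mathcal{T})=\mathcal{T}\setminus\epsilon(\mathcal{T})$. A ribbon structure is a planar embedding up to isotopy. A marked $(d+1)$-ended ribbon tree is a finite ribbon tree whose vertex set is $\beta(\mathcal{T})\cup\epsilon(\mathcal{T})$, with $|\epsilon(\mathcal{T})|=d+1$ and one marked end. $\mathrm{val}(v)$ is the valence. *)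

theory Defs
  imports "HOL-Complex_Analysis.Complex_Analysis"
begin

section \<open>Anti-holomorphic Blaschke products\<close>

text \<open>f(z) = conj z * prod_i (conj z - a_i) / (1 - conj (a_i z)).\<close>
definition blaschke_anti :: "complex list \<Rightarrow> complex \<Rightarrow> complex" where
  "blaschke_anti a z =
     cnj z * (\<Prod>i<length a. (cnj z - a ! i) / (1 - cnj (a ! i * z)))"

text \<open>The family B^-_d.\<close>
definition Bminus :: "nat \<Rightarrow> (complex \<Rightarrow> complex) set" where
  "Bminus d = {blaschke_anti a | a. length a = d - 1 \<and> (\<forall>x\<in>set a. cmod x < 1)}"

text \<open>Wirtinger derivative d/d(conj z) of an anti-holomorphic map f:
  f = g o conj with g holomorphic, and d_zbar f (z) = g'(conj z).\<close>
definition dbar :: "(complex \<Rightarrow> complex) \<Rightarrow> complex \<Rightarrow> complex" where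
  "dbar f z = deriv (\<lambda>w. f (cnj w)) (cnj z)"

section \<open>The circle R/Z and quasisymmetric homeomorphisms\<close>

text \<open>Maps of the circle R/Z are represented as 1-periodic maps real => complex
  landing on the unit circle, via t |-> exp(2 pi i t).\<close>
definition circ :: "real \<Rightarrow> complex" where
  "circ t = cis (2 * pi * t)"

text \<open>A quasisymmetric homeomorphism of the circle: it has a lift h which is a
  homeomorphism of R commuting with the deck translation (up to orientation)
  and satisfies the quasisymmetry (M-condition).\<close>
definition qs_circle_homeo :: "(real \<Rightarrow> complex) \<Rightarrow> bool" where
  "qs_circle_homeo \<eta> \<longleftrightarrow> (\<exists>h M.
     continuous_on UNIV h \<and>
     ((strict_mono h \<and> (\<forall>t. h (t + 1) = h t + 1)) \<or>
      (strict_mono (\<lambda>t. - h t) \<and> (\<forall>t. h (t + 1) = h t - 1))) \<and>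
     M \<ge> 1 \<and>
     (\<forall>x t. t > 0 \<longrightarrow> \<bar>h (x + t) - h x\<bar> \<le> M * \<bar>h x - h (x - t)\<bar>
                    \<and> \<bar>h x - h (x - t)\<bar> \<le> M * \<bar>h (x + t) - h x\<bar>) \<and>
     (\<forall>t. \<eta> t = circ (h t)))"

text \<open>The conjugacy family: eta d f is the quasisymmetric conjugacy with
  eta_f o m_{-d} = f o eta_f, continuous in f (uniform topology on the closed
  disk), normalised by eta_{m_{-d}} = id (m_{-d} corresponds to z |-> conj z ^ d).\<close>
definition eta_family_ok :: "nat \<Rightarrow> ((complex \<Rightarrow> complex) \<Rightarrow> real \<Rightarrow> complex) \<Rightarrow> bool" where
  "eta_family_ok d E \<longleftrightarrow>
     (\<forall>f. f \<notin> Bminus d \<longrightarrow> E f = (\<lambda>_. 0)) \<and>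
     (\<forall>f\<in>Bminus d. qs_circle_homeo (E f) \<and>
        (\<forall>t. E f (- real d * t) = f (E f t))) \<and>
     (\<forall>f\<in>Bminus d. \<forall>\<epsilon>>0. \<exists>\<delta>>0. \<forall>g\<in>Bminus d.
        (\<forall>z. cmod z \<le> 1 \<longrightarrow> cmod (g z - f z) < \<delta>) \<longrightarrow>
        (\<forall>t. cmod (E g t - E f t) < \<epsilon>)) \<and>
     E (\<lambda>z. cnj z ^ d) = circ"

definition eta :: "nat \<Rightarrow> (complex \<Rightarrow> complex) \<Rightarrow> real \<Rightarrow> complex" where
  "eta d = (THE E. eta_family_ok d E)"

text \<open>B^-_d(K).\<close>
definition BminusK :: "nat \<Rightarrow> real \<Rightarrow> (complex \<Rightarrow> complex) set" where
  "BminusK d K = {f \<in> Bminus d. \<forall>x::real. (- real d * x - x) \<in> \<int> \<longrightarrow>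
                     ln (cmod (dbar f (eta d f x))) \<le> K}"

text \<open>F(f): repelling fixed points on the unit circle; marked point eta_f(1),
  where 1 in R/Z is the class of 0.\<close>
definition rep_fix :: "(complex \<Rightarrow> complex) \<Rightarrow> complex set" where
  "rep_fix f = {z. cmod z = 1 \<and> f z = z \<and> cmod (dbar f z) > 1}"

definition marked_point :: "nat \<Rightarrow> (complex \<Rightarrow> complex) \<Rightarrow> complex" where
  "marked_point d f = eta d f 0"

section \<open>Hyperbolic geometry of the disk\<close>

definition hdist :: "complex \<Rightarrow> complex \<Rightarrow> real" where
  "hdist z w = 2 * artanh (cmod (z - w) / cmod (1 - cnj w * z))"

definition mob_to0 :: "complex \<Rightarrow> complex \<Rightarrow> complex" where
  "mob_to0 p z = (z - p) / (1 - cnj p * z)"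

definition mob_from0 :: "complex \<Rightarrow> complex \<Rightarrow> complex" where
  "mob_from0 p w = (w + p) / (1 + cnj p * w)"

text \<open>Geodesic segment from p in the open disk to q in the closed disk (a ray
  if q is on the circle): the image of the radial segment [0, T_p q] under the
  isometry T_p^{-1}.\<close>
definition hgeod_from :: "complex \<Rightarrow> complex \<Rightarrow> complex set" where
  "hgeod_from p q = {mob_from0 p (of_real s * mob_to0 p q) | s. s \<in> {0..1}}"

text \<open>Geodesic joining two points of the closed disk, at least one interior.
  (Two ideal endpoints never occur here since d >= 2.)\<close>
definition hgeod :: "complex \<Rightarrow> complex \<Rightarrow> complex set" where
  "hgeod p q = (if cmod p < 1 then hgeod_from p q
                else if cmod q < 1 then hgeod_from q p else {})"

section \<open>Critical points with multiplicity\<close>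

definition crit_mult :: "(complex \<Rightarrow> complex) \<Rightarrow> complex \<Rightarrow> nat" where
  "crit_mult f c = nat (zorder (deriv (\<lambda>w. f (cnj w))) (cnj c))"

text \<open>Number of critical points of f in the disk, with multiplicity, within
  hyperbolic distance R of p.\<close>
definition crit_count :: "(complex \<Rightarrow> complex) \<Rightarrow> complex \<Rightarrow> real \<Rightarrow> nat" where
  "crit_count f p R =
     (\<Sum>c\<in>{c. cmod c < 1 \<and> dbar f c = 0 \<and> hdist c p \<le> R}. crit_mult f c)"

section \<open>Finite (ribbon) trees\<close>

text \<open>A finite graph with vertex set V :: nat set and edges E given as ordered
  pairs (v,w) with v < w.\<close>
definition adj :: "(nat \<times> nat) set \<Rightarrow> (nat \<times> nat) set" where
  "adj E = E \<union> E\<inverse>"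

definition is_tree :: "nat set \<Rightarrow> (nat \<times> nat) set \<Rightarrow> bool" where
  "is_tree V E \<longleftrightarrow> finite V \<and> V \<noteq> {} \<and>
     E \<subseteq> {(v, w). v \<in> V \<and> w \<in> V \<and> v < w} \<and>
     card E + 1 = card V \<and>
     (\<forall>v\<in>V. \<forall>w\<in>V. (v, w) \<in> (adj E)\<^sup>*)"

definition nbrs :: "(nat \<times> nat) set \<Rightarrow> nat \<Rightarrow> nat set" where
  "nbrs E v = {w. (v, w) \<in> adj E}"

definition val :: "(nat \<times> nat) set \<Rightarrow> nat \<Rightarrow> nat" where
  "val E v = card (nbrs E v)"

text \<open>In a tree, T - {v} is connected iff val v <= 1 and has val v components;
  so ends are the valence-one vertices and branch points those of valence >= 3.\<close>
definition ends :: "nat set \<Rightarrow> (nat \<times> nat) set \<Rightarrow> nat set" where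
  "ends V E = {v \<in> V. val E v = 1}"

definition branch :: "nat set \<Rightarrow> (nat \<times> nat) set \<Rightarrow> nat set" where
  "branch V E = {v \<in> V. val E v \<ge> 3}"

text \<open>Ribbon structure (planar embedding up to isotopy) = rotation system: a
  cyclic ordering of the neighbours of each vertex.\<close>
definition ribbon :: "nat set \<Rightarrow> (nat \<times> nat) set \<Rightarrow> (nat \<Rightarrow> nat \<Rightarrow> nat) \<Rightarrow> bool" where
  "ribbon V E rot \<longleftrightarrow> (\<forall>v\<in>V. bij_betw (rot v) (nbrs E v) (nbrs E v) \<and>
      (\<forall>u\<in>nbrs E v. \<forall>w\<in>nbrs E v. \<exists>k. (rot v ^^ k) u = w))"

definition marked_ribbon_tree ::
  "nat \<Rightarrow> nat set \<Rightarrow> (nat \<times> nat) set \<Rightarrow> nat \<Rightarrow> (nat \<Rightarrow> nat \<Rightarrow> nat) \<Rightarrow> bool" where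
  "marked_ribbon_tree k V E m rot \<longleftrightarrow> is_tree V E \<and> ribbon V E rot \<and>
     V = branch V E \<union> ends V E \<and> card (ends V E) = k \<and> m \<in> ends V E"

section \<open>Maps from the geometric realisation\<close>

text \<open>Points of the realisation: a vertex (Inl v), or an edge point
  (Inr (e, t)), e \<in> E, 0 < t < 1 (t = 0 is fst e, t = 1 is snd e).
  A map T -> closed disk is given by vertex images pv and edge paths pe.\<close>
definition interior_pts :: "nat set \<Rightarrow> (nat \<times> nat) set \<Rightarrow> (nat + ((nat \<times> nat) \<times> real)) set" where
  "interior_pts V E = Inl ` branch V E \<union> {Inr (e, t) | e t. e \<in> E \<and> 0 < t \<and> t < 1}"

definition tmap :: "(nat \<Rightarrow> complex) \<Rightarrow> ((nat \<times> nat) \<Rightarrow> real \<Rightarrow> complex)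
                     \<Rightarrow> nat + ((nat \<times> nat) \<times> real) \<Rightarrow> complex" where
  "tmap pv pe x = (case x of Inl v \<Rightarrow> pv v | Inr (e, t) \<Rightarrow> pe e t)"

text \<open>Parameters of an edge lying in Int(T).\<close>
definition edge_int_dom :: "nat set \<Rightarrow> (nat \<times> nat) set \<Rightarrow> nat \<times> nat \<Rightarrow> real set" where
  "edge_int_dom V E e = {t \<in> {0..1}. (t = 0 \<longrightarrow> fst e \<notin> ends V E) \<and> (t = 1 \<longrightarrow> snd e \<notin> ends V E)}"

text \<open>pv, pe define a continuous map T -> closed disk whose restriction to
  Int(T) is a proper injective map into the open disk.\<close>
definition good_tree_map :: "nat set \<Rightarrow> (nat \<times> nat) set \<Rightarrow> (nat \<Rightarrow> complex)
      \<Rightarrow> ((nat \<times> nat) \<Rightarrow> real \<Rightarrow> complex) \<Rightarrow> bool" where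
  "good_tree_map V E pv pe \<longleftrightarrow>
     (\<forall>e\<in>E. continuous_on {0..1} (pe e) \<and> pe e 0 = pv (fst e) \<and> pe e 1 = pv (snd e)
            \<and> pe e ` {0..1} \<subseteq> cball 0 1) \<and>
     (\<forall>x\<in>interior_pts V E. cmod (tmap pv pe x) < 1) \<and>
     inj_on (tmap pv pe) (interior_pts V E) \<and>
     (\<forall>e\<in>E. \<forall>C. compact C \<and> C \<subseteq> ball 0 1 \<longrightarrow>
        compact {t \<in> edge_int_dom V E e. pe e t \<in> C})"

end

(* Conjugating with the Cayley transform that sends the marked fixed point to infinity, the other d
   fixed points become reals t_0 < ... < t_(d-1). After passing to a subsequence all ratios of gaps
   t_(i+1) - t_i converge, and the intervals whose inner gaps are negligible against both neighbouring
   gaps form a laminar family: its inclusion tree, with one more end for infinity, is the tree. A cluster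
   with more than one point is mapped to the point above its left end at height twice its width, and an
   edge to the geodesic between the images of its vertices.

   Julia's inequality with multipliers at most exp K at two fixed points shows that a point seen under a
   definite angle from a fixed point is moved a bounded distance, which is the quasi-fixed property.
   Seen from the vertex of a cluster, its children and infinity are k + 1 separated fixed points with
   bounded multipliers; the limit of the recentred maps is therefore a Blaschke product of degree at least k,
   and at least k - 1 critical points stay near the vertex. These numbers add up to d - 1,
   the total number of critical points, so the counts are exact.

   The conjugacy eta is built from the linearising coordinate of an expanding lift to the line; it only
   serves to identify the repelling fixed points and their multiplier bounds. *)
theory Submission
  imports Defs "HOL-Computational_Algebra.Fundamental_Theorem_Algebra" "HOL-Real_Asymp.Real_Asymp"
begin

section \<open>Blaschke products and their critical points\<close>

text \<open>\<open>eta\<close> is a definite description, so nothing is known about it before its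
  family is shown to exist and to be unique. The obstacle is that a quasisymmetric conjugacy is
  determined only up to the 2 (d + 1) symmetries t -> +-t + k / (d + 1) of multiplication by -d on
  R/Z. The choice is made at the power map and carried to f by continuity, along the path that
  scales the zeros of f. The recentred maps converge only inside the open disk, since zeros may
  escape to the circle, and derivatives at boundary fixed points need not converge. Julia's
  inequality replaces them: it concerns interior values and a fixed multiplier bound, so it survives
  the limit and forces the limits of the fixed points to be fixed. The height (twice the width) and
  the requirement that a width be less than half of each neighbouring gap are tuned to each other.
  They keep every edge inside the cones |\<zeta> - t_j| <= 2 Im \<zeta>, so the bound K' comes from
  exp K alone, and they keep the edges of different clusters apart, which gives injectivity.\<close>

definition bprod :: "nat set \<Rightarrow> (nat \<Rightarrow> complex) \<Rightarrow> complex \<Rightarrow> complex" where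
  "bprod I b w = (\<Prod>i\<in>I. mob_to0 (b i) w)"

text \<open>Numerator times denominator of \<open>mob_to0 b\<close>; the roots b and 1 / cnj b are
  mirror images in the circle.\<close>

definition blq :: "complex \<Rightarrow> complex poly" where
  "blq b = [:- b, 1:] * [:1, - cnj b:]"

text \<open>Numerator of the derivative of the product, over the squared denominator. Being
  polynomial in w, it still makes sense in limits where some zeros reach the circle.\<close>

definition bcrit :: "nat set \<Rightarrow> (nat \<Rightarrow> complex) \<Rightarrow> complex poly" where
  "bcrit I b = (\<Sum>j\<in>I. smult (of_real (1 - (cmod (b j))\<^sup>2)) (\<Prod>i\<in>I - {j}. blq (b i)))"

text \<open>Sum of the Poisson kernels of the zeros; on the circle it is the modulus of the
  derivative.\<close>

definition bmult :: "nat set \<Rightarrow> (nat \<Rightarrow> complex) \<Rightarrow> complex \<Rightarrow> real" where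
  "bmult I b w = (\<Sum>j\<in>I. (1 - (cmod (b j))\<^sup>2) / (cmod (w - b j))\<^sup>2)"

lemma poly_blq: "poly (blq b) w = (w - b) * (1 - cnj b * w)"
  by (simp add: blq_def algebra_simps)

lemma mob_den_nz:
  assumes "cmod b < 1" "cmod w \<le> 1"
  shows "1 - cnj b * w \<noteq> 0"
proof
  assume "1 - cnj b * w = 0"
  then have "cmod b * cmod w = 1"
    by (metis complex_mod_cnj eq_iff_diff_eq_0 norm_mult norm_one)
  moreover have "cmod b * cmod w \<le> cmod b * 1"
    using assms by (intro mult_left_mono) auto
  ultimately show False using assms by linarith
qed

lemma norm_mult_cnj_diff:
  "(cmod (1 - cnj b * w))\<^sup>2 - (cmod (w - b))\<^sup>2 = (1 - (cmod b)\<^sup>2) * (1 - (cmod w)\<^sup>2)"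
  unfolding cmod_power2 by (simp add: algebra_simps power2_eq_square)

lemma mob_circle_num_den:
  assumes "cmod w = 1"
  shows "cmod (1 - cnj b * w) = cmod (w - b)"
  using norm_mult_cnj_diff[of b w] assms by simp

lemma mob_to0_norm_eq1:
  assumes "cmod b < 1" "cmod w = 1"
  shows "cmod (mob_to0 b w) = 1"
  using assms mob_circle_num_den[of w b] mob_den_nz[of b w]
  by (auto simp: mob_to0_def norm_divide)

lemma one_minus_mob_to0_norm_sq:
  assumes "cmod b < 1" "cmod w \<le> 1"
  shows "1 - (cmod (mob_to0 b w))\<^sup>2 = (1 - (cmod b)\<^sup>2) * (1 - (cmod w)\<^sup>2) / (cmod (1 - cnj b * w))\<^sup>2"
  using mob_den_nz[OF assms] norm_mult_cnj_diff[of b w]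
  by (simp add: mob_to0_def norm_divide power_divide field_simps)

lemma mob_to0_norm_le1:
  assumes "cmod b < 1" "cmod w \<le> 1"
  shows "cmod (mob_to0 b w) \<le> 1"
proof -
  have "1 - (cmod (mob_to0 b w))\<^sup>2 \<ge> 0"
    unfolding one_minus_mob_to0_norm_sq[OF assms] using assms
    by (intro divide_nonneg_nonneg mult_nonneg_nonneg) (auto simp: power_le_one)
  then show ?thesis by (simp add: abs_square_le_1)
qed

lemma mob_to0_norm_less1:
  assumes "cmod b < 1" "cmod w < 1"
  shows "cmod (mob_to0 b w) < 1"
proof -
  have "1 - (cmod (mob_to0 b w))\<^sup>2 > 0"
    using one_minus_mob_to0_norm_sq[of b w] assms mob_den_nz[of b w]
    by (auto simp: abs_square_less_1 intro!: divide_pos_pos mult_pos_pos)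
  then show ?thesis by (simp add: abs_square_less_1)
qed

lemma mob_to0_deriv:
  assumes "1 - cnj b * w \<noteq> 0"
  shows "(mob_to0 b has_field_derivative of_real (1 - (cmod b)\<^sup>2) / (1 - cnj b * w)\<^sup>2) (at w)"
  unfolding mob_to0_def[abs_def] using assms
  by (auto intro!: derivative_eq_intros simp: divide_simps power2_eq_square)
     (auto simp: algebra_simps simp flip: complex_norm_square power2_eq_square)

lemma bprod_deriv:
  assumes "\<And>i. i \<in> I \<Longrightarrow> 1 - cnj (b i) * w \<noteq> 0"
  shows "(bprod I b has_field_derivative
           poly (bcrit I b) w / (\<Prod>i\<in>I. (1 - cnj (b i) * w))\<^sup>2) (at w)"
proof (cases "finite I")
  case True
  let ?q = "\<lambda>i. 1 - cnj (b i) * w"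
  have "(bprod I b has_field_derivative
     (\<Sum>j\<in>I. (of_real (1 - (cmod (b j))\<^sup>2) / (?q j)\<^sup>2) * (\<Prod>i\<in>I-{j}. mob_to0 (b i) w))) (at w)"
    unfolding bprod_def[abs_def]
    by (intro has_field_derivative_prod mob_to0_deriv assms)
  also have "(\<Sum>j\<in>I. (of_real (1 - (cmod (b j))\<^sup>2) / (?q j)\<^sup>2) * (\<Prod>i\<in>I-{j}. mob_to0 (b i) w))
     = (\<Sum>j\<in>I. (of_real (1 - (cmod (b j))\<^sup>2) * (\<Prod>i\<in>I-{j}. poly (blq (b i)) w)) / (\<Prod>i\<in>I. (?q i)\<^sup>2))"
  proof (rule sum.cong[OF refl])
    fix j assume j: "j \<in> I"
    have "(\<Prod>i\<in>I-{j}. mob_to0 (b i) w) = (\<Prod>i\<in>I-{j}. poly (blq (b i)) w / (?q i)\<^sup>2)"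
      using assms by (intro prod.cong) (auto simp: mob_to0_def poly_blq power2_eq_square)
    also have "\<dots> = (\<Prod>i\<in>I-{j}. poly (blq (b i)) w) / (\<Prod>i\<in>I-{j}. (?q i)\<^sup>2)"
      by (rule prod_dividef)
    finally have 1: "(\<Prod>i\<in>I-{j}. mob_to0 (b i) w) = (\<Prod>i\<in>I-{j}. poly (blq (b i)) w) / (\<Prod>i\<in>I-{j}. (?q i)\<^sup>2)" .
    have 2: "(\<Prod>i\<in>I. (?q i)\<^sup>2) = (?q j)\<^sup>2 * (\<Prod>i\<in>I-{j}. (?q i)\<^sup>2)"
      using True j by (rule prod.remove)
    show "of_real (1 - (cmod (b j))\<^sup>2) / (?q j)\<^sup>2 * (\<Prod>i\<in>I-{j}. mob_to0 (b i) w) =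
      of_real (1 - (cmod (b j))\<^sup>2) * (\<Prod>i\<in>I-{j}. poly (blq (b i)) w) / (\<Prod>i\<in>I. (?q i)\<^sup>2)"
      unfolding 1 2 by simp
  qed
  also have "\<dots> = poly (bcrit I b) w / (\<Prod>i\<in>I. ?q i)\<^sup>2"
    by (simp add: bcrit_def poly_sum poly_prod sum_divide_distrib prod_power_distrib)
  finally show ?thesis .
qed (simp add: bprod_def[abs_def] bcrit_def)

lemma poly_blq_circle:
  assumes "cmod w = 1"
  shows "poly (blq b) w = w * of_real ((cmod (w - b))\<^sup>2)"
proof -
  have "w * cnj w = 1" using assms by (simp flip: complex_norm_square)
  then have "1 - cnj b * w = w * cnj (w - b)" by (simp add: algebra_simps)
  then have "poly (blq b) w = w * ((w - b) * cnj (w - b))" by (simp add: poly_blq)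
  then show ?thesis by (simp only: complex_norm_square)
qed

text \<open>On the circle \<open>blq b\<close> is w times a positive number, so all summands are
  positive multiples of one power of w and cannot cancel.\<close>

lemma bcrit_circle:
  assumes "finite I" "\<And>i. i \<in> I \<Longrightarrow> cmod (b i) < 1" "cmod w = 1"
  shows "poly (bcrit I b) w = w ^ (card I - 1) * of_real (bmult I b w * (\<Prod>i\<in>I. (cmod (w - b i))\<^sup>2))"
proof -
  have nz: "cmod (w - b i) \<noteq> 0" if "i \<in> I" for i
    using assms(2)[OF that] assms(3) by auto
  have "poly (bcrit I b) w = (\<Sum>j\<in>I. w ^ (card I - 1) * of_real ((1 - (cmod (b j))\<^sup>2) / (cmod (w - b j))\<^sup>2 * (\<Prod>i\<in>I. (cmod (w - b i))\<^sup>2)))"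
    unfolding bcrit_def poly_sum
  proof (rule sum.cong[OF refl])
    fix j assume j: "j \<in> I"
    have "poly (\<Prod>i\<in>I-{j}. blq (b i)) w = (\<Prod>i\<in>I-{j}. w * of_real ((cmod (w - b i))\<^sup>2))"
      by (simp add: poly_prod poly_blq_circle[OF assms(3)])
    also have "\<dots> = w ^ (card I - 1) * of_real (\<Prod>i\<in>I-{j}. (cmod (w - b i))\<^sup>2)"
      using assms(1) j by (simp add: prod.distrib)
    finally show "poly (smult (of_real (1 - (cmod (b j))\<^sup>2)) (\<Prod>i\<in>I - {j}. blq (b i))) w =
         w ^ (card I - 1) * of_real ((1 - (cmod (b j))\<^sup>2) / (cmod (w - b j))\<^sup>2 * (\<Prod>i\<in>I. (cmod (w - b i))\<^sup>2))"
      using nz[OF j] by (simp add: prod.remove[OF assms(1) j])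
  qed
  then show ?thesis
    unfolding bmult_def sum_distrib_right of_real_sum sum_distrib_left .
qed

lemma bmult_pos:
  assumes "finite I" "I \<noteq> {}" "\<And>i. i \<in> I \<Longrightarrow> cmod (b i) < 1" "cmod w = 1"
  shows "bmult I b w > 0"
  unfolding bmult_def
proof (intro sum_pos divide_pos_pos)
  fix i assume i: "i \<in> I"
  show "1 - (cmod (b i))\<^sup>2 > 0" using assms(3)[OF i] by (simp add: abs_square_less_1)
  show "(cmod (w - b i))\<^sup>2 > 0" using assms(3)[OF i] assms(4) by auto
qed (use assms in auto)

lemma bprod_deriv_norm_circle:
  assumes "finite I" "\<And>i. i \<in> I \<Longrightarrow> cmod (b i) < 1" "cmod w = 1"
  shows "cmod (deriv (bprod I b) w) = bmult I b w"
proof -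
  have nz: "1 - cnj (b i) * w \<noteq> 0" if "i \<in> I" for i
    using mob_den_nz assms that by auto
  have p: "bmult I b w \<ge> 0"
    unfolding bmult_def using assms(2) by (intro sum_nonneg divide_nonneg_nonneg) (auto simp: power_le_one less_imp_le)
  have "deriv (bprod I b) w = poly (bcrit I b) w / (\<Prod>i\<in>I. (1 - cnj (b i) * w))\<^sup>2"
    using nz by (intro DERIV_imp_deriv bprod_deriv)
  moreover have "(\<Prod>i\<in>I. (cmod (w - b i))\<^sup>2) = (cmod (\<Prod>i\<in>I. (1 - cnj (b i) * w)))\<^sup>2"
    by (simp add: mob_circle_num_den[OF assms(3)] prod_power_distrib flip: prod_norm)
  moreover have "cmod (\<Prod>i\<in>I. (1 - cnj (b i) * w)) \<noteq> 0"
    using nz assms(1) by (auto simp: norm_eq_zero)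
  ultimately show ?thesis
    using p assms by (simp add: bcrit_circle norm_mult norm_divide norm_power abs_mult)
qed

section \<open>Self-reciprocal polynomials and the zeros of the derivative\<close>

lemma bcrit_self_reciprocal:
  assumes "finite I" "\<And>i. i \<in> I \<Longrightarrow> cmod (b i) < 1" "cmod w = 1"
  shows "w ^ (2 * (card I - 1)) * cnj (poly (bcrit I b) w) = poly (bcrit I b) w"
proof -
  have w: "w * cnj w = 1" using assms by (simp flip: complex_norm_square)
  have "w ^ (2 * (card I - 1)) * cnj (w ^ (card I - 1)) = w ^ (card I - 1) * (w * cnj w) ^ (card I - 1)"
    by (simp add: mult_2 power_add power_mult_distrib)
  then show ?thesis by (simp add: bcrit_circle[OF assms] w mult.assoc[symmetric])
qed

lemma bcrit_circle_nonzero: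
  assumes "finite I" "I \<noteq> {}" "\<And>i. i \<in> I \<Longrightarrow> cmod (b i) < 1" "cmod w = 1"
  shows "poly (bcrit I b) w \<noteq> 0"
proof -
  have "w \<noteq> b i" if "i \<in> I" for i using assms(3)[OF that] assms(4) by auto
  moreover have "bmult I b w > 0" using bmult_pos assms by blast
  ultimately show ?thesis using assms by (auto simp: bcrit_circle)
qed

lemma infinite_unit_circle: "infinite {w::complex. cmod w = 1}"
proof -
  have "connected (sphere (0::complex) 1)" by (rule connected_sphere) simp
  moreover have "1 \<in> sphere (0::complex) 1" "-1 \<in> sphere (0::complex) 1" "(1::complex) \<noteq> -1" by auto
  ultimately have "infinite (sphere (0::complex) 1)" by (metis connected_finite_iff_sing empty_iff singletonD)
  moreover have "sphere (0::complex) 1 = {w. cmod w = 1}" by (auto simp: sphere_def dist_norm)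
  ultimately show ?thesis by simp
qed

lemma poly_eq_on_circle:
  fixes p q :: "complex poly"
  assumes "\<And>w. cmod w = 1 \<Longrightarrow> poly p w = poly q w"
  shows "p = q"
proof (rule ccontr)
  assume "p \<noteq> q"
  then have "finite {w. poly (p - q) w = 0}" by (intro poly_roots_finite) auto
  moreover have "{w. cmod w = 1} \<subseteq> {w. poly (p - q) w = 0}" using assms by auto
  ultimately show False using infinite_unit_circle finite_subset by blast
qed

text \<open>With q the reversed polynomial with conjugated coefficients, the circle identity becomes
  w^(2m) q = w^(deg p) p between polynomials. Comparing degrees, where deg q <= deg p, relates m to
  deg p.\<close>

lemma self_reciprocal_poly:
  fixes p :: "complex poly"
  assumes "\<And>w. cmod w = 1 \<Longrightarrow> w ^ (2 * m) * cnj (poly p w) = poly p w" and "p \<noteq> 0"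
  shows "w \<noteq> 0 \<Longrightarrow> w ^ (2 * m) * cnj (poly p (1 / cnj w)) = poly p w"
    and "m \<le> degree p" and "m = 0 \<Longrightarrow> degree p = 0"
proof -
  define q where "q = reflect_poly (map_poly cnj p)"
  have q: "w ^ degree p * cnj (poly p (1 / cnj w)) = poly q w" if "w \<noteq> 0" for w
  proof -
    have "poly q w = w ^ degree p * poly (map_poly cnj p) (1 / w)"
      using that by (simp add: q_def poly_reflect_poly_nz inverse_eq_divide degree_map_poly)
    also have "poly (map_poly cnj p) (1 / w) = cnj (poly p (1 / cnj w))"
      by (metis poly_cnj complex_cnj_divide complex_cnj_one complex_cnj_cnj)
    finally show ?thesis ..
  qed
  have c1: "1 / cnj w = w" if "cmod w = 1" for w
  proof -
    have "w * cnj w = 1" using that by (simp flip: complex_norm_square)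
    then show ?thesis by (auto simp: divide_eq_eq)
  qed
  have eq: "monom 1 (2 * m) * q = monom 1 (degree p) * p"
  proof (rule poly_eq_on_circle)
    fix w :: complex assume w: "cmod w = 1"
    then have nz: "w \<noteq> 0" by auto
    have "poly (monom 1 (2 * m) * q) w = w ^ (2*m) * (w ^ degree p * cnj (poly p w))"
      using q[OF nz] c1[OF w] by (simp add: poly_monom)
    also have "\<dots> = w ^ degree p * poly p w"
      unfolding mult.left_commute[of "w ^ (2*m)"] assms(1)[OF w] ..
    finally show "poly (monom 1 (2 * m) * q) w = poly (monom 1 (degree p) * p) w"
      by (simp add: poly_monom)
  qed
  show "w ^ (2 * m) * cnj (poly p (1 / cnj w)) = poly p w" if "w \<noteq> 0"
  proof -
    have "w ^ (2*m) * poly q w = w ^ degree p * poly p w"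
      using arg_cong[OF eq, of "\<lambda>r. poly r w"] by (simp add: poly_monom)
    then have "w ^ degree p * (w ^ (2 * m) * cnj (poly p (1 / cnj w))) = w ^ degree p * poly p w"
      unfolding q[OF that, symmetric] mult.left_commute[of "w ^ (2*m)"] .
    then show ?thesis using that by simp
  qed
  have "q \<noteq> 0" using eq assms(2) by auto
  then have "2 * m + degree q = degree p + degree p"
    using arg_cong[OF eq, of degree] assms(2) by (simp add: degree_mult_eq monom_eq_0_iff degree_monom_eq)
  moreover have "degree q \<le> degree p"
    unfolding q_def using degree_reflect_poly_le[of "map_poly cnj p"] by (simp add: degree_map_poly)
  ultimately show "m \<le> degree p" "m = 0 \<Longrightarrow> degree p = 0" by linarith+
qed

lemma poly_blq_circle_nonzero: "cmod c < 1 \<Longrightarrow> cmod w = 1 \<Longrightarrow> poly (blq c) w \<noteq> 0"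
  by (auto simp: poly_blq_circle)

text \<open>Induction on m: a root exists by the fundamental theorem of algebra, can be taken inside
  the disk by reflection, and is divided out together with its mirror image. There are m factors
  rather than half the degree, since a root at 0 has its mirror image at infinity and costs only one
  degree.\<close>

lemma self_reciprocal_factor:
  fixes p :: "complex poly"
  assumes "\<And>w. cmod w = 1 \<Longrightarrow> w ^ (2 * m) * cnj (poly p w) = poly p w"
    and "\<And>w. cmod w = 1 \<Longrightarrow> poly p w \<noteq> 0"
  shows "\<exists>\<kappa> c. \<kappa> \<noteq> 0 \<and> (\<forall>i. cmod (c i) < 1) \<and> p = smult \<kappa> (\<Prod>i<m. blq (c i))"
  using assms
proof (induction m arbitrary: p)
  case 0
  have nz: "p \<noteq> 0" using "0.prems"(2)[of 1] by auto
  have "degree p = 0" using self_reciprocal_poly(3)[OF "0.prems"(1) nz] by simp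
  then obtain k where "p = [:k:]" by (meson degree_eq_zeroE)
  then show ?case using nz by (intro exI[of _ k] exI[of _ "\<lambda>_. 0"]) auto
next
  case (Suc m)
  have nz: "p \<noteq> 0" using Suc.prems(2)[of 1] by auto
  note rec = self_reciprocal_poly(1)[OF Suc.prems(1) nz]
  have "degree p \<noteq> 0" using self_reciprocal_poly(2)[OF Suc.prems(1) nz] by simp
  then have "\<not> constant (poly p)" by (simp add: constant_degree)
  then obtain a where a: "poly p a = 0" using fundamental_theorem_of_algebra by blast
  obtain c where c: "cmod c < 1" "poly p c = 0"
  proof (cases "cmod a < 1")
    case False
    with a Suc.prems(2) have "cmod a > 1" by force
    then have "cmod (1 / cnj a) < 1" "1 / cnj a \<noteq> 0" by (auto simp: norm_divide divide_simps)
    moreover have "poly p (1 / cnj a) = 0" using rec[of "1 / cnj a"] a calculation by simp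
    ultimately show ?thesis using that by blast
  qed (use a that in blast)
  obtain p1 where p1: "p = [:- c, 1:] * p1" using c(2) poly_eq_0_iff_dvd by (metis dvdE)
  obtain p2 where p2: "p1 = [:1, - cnj c:] * p2"
  proof (cases "c = 0")
    case False
    have "poly p (1 / cnj c) = 0" using rec[of "1 / cnj c"] False c by simp
    moreover have "1 / cnj c \<noteq> c"
    proof
      assume "1 / cnj c = c"
      then have "cmod (c * cnj c) = 1" using False by (simp add: field_simps)
      then have "cmod c * cmod c = 1" by (simp add: norm_mult)
      moreover have "cmod c * cmod c < 1 * 1" using c(1) by (intro mult_strict_mono') auto
      ultimately show False by simp
    qed
    ultimately have "poly p1 (1 / cnj c) = 0" unfolding p1 poly_mult by simp
    then obtain p3 where "p1 = [:- (1 / cnj c), 1:] * p3" using poly_eq_0_iff_dvd by (metis dvdE)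
    moreover have "[:- (1 / cnj c), 1:] = smult (- 1 / cnj c) [:1, - cnj c:]" using False by simp
    ultimately have "p1 = [:1, - cnj c:] * smult (- 1 / cnj c) p3"
      by (simp only: mult_smult_left mult_smult_right)
    then show ?thesis using that by blast
  next
    case True
    then have "p1 = [:1, - cnj c:] * p1" by simp
    then show ?thesis using that by blast
  qed
  have pp: "p = blq c * p2" by (simp only: p1 p2 blq_def mult.assoc)
  have "\<exists>\<kappa> d. \<kappa> \<noteq> 0 \<and> (\<forall>i. cmod (d i) < 1) \<and> p2 = smult \<kappa> (\<Prod>i<m. blq (d i))"
  proof (rule Suc.IH)
    fix w :: complex assume w: "cmod w = 1"
    show "poly p2 w \<noteq> 0" using Suc.prems(2)[OF w] by (auto simp: pp)
    let ?r = "complex_of_real ((cmod (w - c))\<^sup>2)"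
    have b: "poly (blq c) w = w * ?r" by (rule poly_blq_circle[OF w])
    have ww: "w * cnj w = 1" using w by (simp flip: complex_norm_square)
    have "w ^ (2 * Suc m) * cnj (w * ?r * poly p2 w) = w * ?r * poly p2 w"
      using Suc.prems(1)[OF w] unfolding pp poly_mult b .
    also have "w ^ (2 * Suc m) * cnj (w * ?r * poly p2 w) = (w * cnj w) * (w * ?r * (w ^ (2 * m) * cnj (poly p2 w)))"
      by (simp add: algebra_simps)
    finally have "w * ?r * (w ^ (2 * m) * cnj (poly p2 w)) = w * ?r * poly p2 w" by (simp add: ww)
    moreover have "w * ?r \<noteq> 0" using poly_blq_circle_nonzero[OF c(1) w] b by simp
    ultimately show "w ^ (2 * m) * cnj (poly p2 w) = poly p2 w" using mult_left_cancel by blast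
  qed
  then obtain \<kappa> e where e: "\<kappa> \<noteq> 0" "\<forall>i. cmod (e i) < 1" "p2 = smult \<kappa> (\<Prod>i<m. blq (e i))" by blast
  define e' where "e' = e(m := c)"
  have "(\<Prod>i<m. blq (e' i)) = (\<Prod>i<m. blq (e i))" by (intro prod.cong) (auto simp: e'_def)
  then have "p = smult \<kappa> (\<Prod>i<Suc m. blq (e' i))"
    by (simp add: pp e e'_def mult.commute)
  then show ?case using e c by (intro exI[of _ \<kappa>] exI[of _ e']) (auto simp: e'_def)
qed

lemma bcrit_factor:
  assumes "finite I" "I \<noteq> {}" "\<And>i. i \<in> I \<Longrightarrow> cmod (b i) < 1"
  obtains \<kappa> c where "\<kappa> \<noteq> 0" "\<And>i. cmod (c i) < 1" "bcrit I b = smult \<kappa> (\<Prod>i<card I - 1. blq (c i))"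
proof -
  have "\<exists>\<kappa> c. \<kappa> \<noteq> 0 \<and> (\<forall>i. cmod (c i) < 1) \<and> bcrit I b = smult \<kappa> (\<Prod>i<card I - 1. blq (c i))"
    by (rule self_reciprocal_factor) (use bcrit_self_reciprocal bcrit_circle_nonzero assms in auto)
  then show ?thesis using that by blast
qed

text \<open>Trades the \<open>zorder\<close> count for a list of zeros with repetitions: h is a
  nonvanishing cofactor, and the points are conjugated because the derivative is taken in the
  variable cnj z.\<close>

lemma crit_count_eq_card:
  fixes m :: nat
  assumes "h holomorphic_on ball 0 1" "\<And>w. w \<in> ball 0 1 \<Longrightarrow> h w \<noteq> 0"
    and "\<And>i. i < m \<Longrightarrow> cmod (c i) < 1"
    and eq: "\<And>w. w \<in> ball 0 1 \<Longrightarrow> deriv (\<lambda>w. f (cnj w)) w = h w * (\<Prod>i<m. (w - c i))"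
  shows "crit_count f p R = card {i. i < m \<and> hdist (cnj (c i)) p \<le> R}"
proof -
  let ?S = "{i. i < m \<and> hdist (cnj (c i)) p \<le> R}"
  let ?C = "{z. cmod z < 1 \<and> dbar f z = 0 \<and> hdist z p \<le> R}"
  have C: "?C = (\<lambda>i. cnj (c i)) ` ?S"
  proof (intro set_eqI iffI)
    fix z assume "z \<in> ?C"
    then have z: "cnj z \<in> ball 0 1" "dbar f z = 0" "hdist z p \<le> R" by auto
    then have "h (cnj z) * (\<Prod>i<m. (cnj z - c i)) = 0" using eq[of "cnj z"] by (simp add: dbar_def)
    then have "(\<Prod>i<m. (cnj z - c i)) = 0" using assms(2)[OF z(1)] by simp
    then obtain i where "i \<in> {..<m}" "cnj z - c i = 0"
      using prod_zero_iff[of "{..<m}" "\<lambda>i. cnj z - c i"] by blast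
    then have "i < m" "cnj z = c i" by auto
    then have "z = cnj (c i)" by (metis complex_cnj_cnj)
    then show "z \<in> (\<lambda>i. cnj (c i)) ` ?S" using z \<open>i < m\<close> by (intro image_eqI[of _ _ i]) auto
  next
    fix z assume "z \<in> (\<lambda>i. cnj (c i)) ` ?S"
    then obtain i where i: "i < m" "hdist (cnj (c i)) p \<le> R" "z = cnj (c i)" by auto
    then have "deriv (\<lambda>w. f (cnj w)) (c i) = 0" using eq[of "c i"] assms(3)[of i] by auto
    then show "z \<in> ?C" using i assms(3)[of i] by (auto simp: dbar_def)
  qed
  have mult: "crit_mult f z = card {i \<in> ?S. cnj (c i) = z}" if z: "z \<in> ?C" for z
  proof -
    let ?A = "{i. i < m \<and> c i = cnj z}" and ?B = "{i. i < m \<and> c i \<noteq> cnj z}"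
    have split: "{..<m} = ?A \<union> ?B" by auto
    have "zorder (deriv (\<lambda>w. f (cnj w))) (cnj z) = int (card ?A)"
    proof (rule zorder_eqI)
      show "open (ball (0::complex) 1)" by simp
      show "cnj z \<in> ball 0 1" using z by simp
      show "(\<lambda>w. h w * (\<Prod>i\<in>?B. (w - c i))) holomorphic_on ball 0 1"
        using assms(1) by (intro holomorphic_intros)
      show "h (cnj z) * (\<Prod>i\<in>?B. (cnj z - c i)) \<noteq> 0"
        using assms(2)[of "cnj z"] z by auto
      fix w :: complex assume w: "w \<in> ball 0 1" "w \<noteq> cnj z"
      have "(\<Prod>i<m. (w - c i)) = (\<Prod>i\<in>?A. (w - c i)) * (\<Prod>i\<in>?B. (w - c i))"
        unfolding split by (intro prod.union_disjoint) auto
      also have "(\<Prod>i\<in>?A. (w - c i)) = (\<Prod>i\<in>?A. (w - cnj z))" by (intro prod.cong) auto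
      finally show "deriv (\<lambda>w. f (cnj w)) w = h w * (\<Prod>i\<in>?B. (w - c i)) * (w - cnj z) powi int (card ?A)"
        using eq[OF w(1)] by (simp add: mult_ac)
    qed
    moreover have "cnj (c i) = z \<longleftrightarrow> c i = cnj z" for i by (metis complex_cnj_cnj)
    then have "?A = {i \<in> ?S. cnj (c i) = z}" using z by auto
    ultimately show ?thesis by (simp add: crit_mult_def)
  qed
  have "crit_count f p R = (\<Sum>z\<in>?C. card {i \<in> ?S. cnj (c i) = z})"
    unfolding crit_count_def by (intro sum.cong refl mult)
  also have "\<dots> = (\<Sum>z\<in>(\<lambda>i. cnj (c i)) ` ?S. \<Sum>i\<in>{i \<in> ?S. cnj (c i) = z}. 1)"
    unfolding C by simp
  also have "\<dots> = (\<Sum>i\<in>?S. 1)" by (rule sum.image_gen[symmetric]) simp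
  finally show ?thesis by simp
qed

section \<open>Julia's inequality at boundary points\<close>

lemma weighted_cauchy_schwarz2:
  fixes x y :: real
  assumes "0 \<le> x" "0 \<le> y" "0 \<le> r" "0 \<le> u1" "0 \<le> u2" "0 \<le> v1" "0 \<le> v2"
    and "x\<^sup>2 \<le> u1 * v1" "y\<^sup>2 \<le> u2 * v2"
  shows "(x + r * y)\<^sup>2 \<le> (u1 + u2) * (v1 + r\<^sup>2 * v2)"
proof -
  have "x \<le> sqrt u1 * sqrt v1" "y \<le> sqrt u2 * sqrt v2"
    using assms by (simp_all add: real_le_rsqrt flip: real_sqrt_mult)
  then have "(x + r * y)\<^sup>2 \<le> (sqrt u1 * sqrt v1 + r * (sqrt u2 * sqrt v2))\<^sup>2"
    using assms by (intro power_mono add_mono mult_left_mono) auto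
  also have "\<dots> = (u1 + u2) * (v1 + r\<^sup>2 * v2) - (sqrt u1 * r * sqrt v2 - sqrt u2 * sqrt v1)\<^sup>2"
    unfolding power2_diff power2_sum using assms by (simp add: power_mult_distrib algebra_simps)
  finally show ?thesis by (smt (verit) zero_le_power2)
qed

text \<open>For a single factor Julia's inequality is an identity; this supplies the new factor in
  the induction over the product.\<close>

lemma one_minus_cnj_mob_to0_mult:
  assumes "cmod b < 1" "cmod x = 1" "cmod z \<le> 1"
  shows "(cmod (1 - cnj (mob_to0 b x) * mob_to0 b z))\<^sup>2 * (1 - (cmod z)\<^sup>2)
    = (1 - (cmod b)\<^sup>2) / (cmod (x - b))\<^sup>2 * (1 - (cmod (mob_to0 b z))\<^sup>2) * (cmod (1 - cnj x * z))\<^sup>2"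
proof -
  have n1: "1 - b * cnj x \<noteq> 0" using mob_den_nz[of b x] assms
    by (metis complex_cnj_cnj complex_cnj_diff complex_cnj_mult complex_cnj_one complex_cnj_zero_iff order_refl)
  have n2: "1 - cnj b * z \<noteq> 0" using mob_den_nz[of b z] assms by simp
  have gen: "1 - A / C * (B / D) = (C * D - A * B) / (C * D)" if "C \<noteq> 0" "D \<noteq> 0" for A B C D :: complex
    using that by (simp add: divide_simps)
  have "1 - cnj (mob_to0 b x) * mob_to0 b z
      = ((1 - b * cnj x) * (1 - cnj b * z) - (cnj x - cnj b) * (z - b)) / ((1 - b * cnj x) * (1 - cnj b * z))"
    using gen[OF n1 n2, of "cnj x - cnj b" "z - b"] by (simp add: mob_to0_def)
  also have "(1 - b * cnj x) * (1 - cnj b * z) - (cnj x - cnj b) * (z - b) = of_real (1 - (cmod b)\<^sup>2) * (1 - cnj x * z)"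
    using complex_norm_square[of b] by (simp add: algebra_simps)
  finally have "(cmod (1 - cnj (mob_to0 b x) * mob_to0 b z))\<^sup>2
     = ((1 - (cmod b)\<^sup>2) * cmod (1 - cnj x * z) / (cmod (1 - b * cnj x) * cmod (1 - cnj b * z)))\<^sup>2"
    using assms by (simp add: norm_mult norm_divide power_mult_distrib power_divide del: of_real_diff)
  moreover have "cmod (1 - b * cnj x) = cmod (x - b)"
    using mob_circle_num_den[OF assms(2), of b] by (metis complex_cnj_cnj complex_cnj_diff complex_cnj_mult complex_cnj_one complex_mod_cnj)
  ultimately show ?thesis
    using one_minus_mob_to0_norm_sq[of b z] assms
    by (simp add: power_divide power_mult_distrib power2_eq_square mult_ac)
qed

lemma bprod_norm_le1:
  assumes "\<And>i. i \<in> I \<Longrightarrow> cmod (b i) < 1" "cmod z \<le> 1"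
  shows "cmod (bprod I b z) \<le> 1"
  unfolding bprod_def prod_norm[symmetric] using assms by (intro prod_le_1) (auto intro: mob_to0_norm_le1)

text \<open>Julia's inequality. For a product the two kernels add up, so it is the Cauchy--Schwarz
  inequality for the kernel \<open>(1 - cnj (B w) * B z) / (1 - cnj w * z)\<close>.\<close>

lemma bprod_julia:
  assumes "finite I" "\<And>i. i \<in> I \<Longrightarrow> cmod (b i) < 1" "cmod x = 1" "cmod z \<le> 1"
  shows "(cmod (1 - cnj (bprod I b x) * bprod I b z))\<^sup>2 * (1 - (cmod z)\<^sup>2)
    \<le> bmult I b x * (1 - (cmod (bprod I b z))\<^sup>2) * (cmod (1 - cnj x * z))\<^sup>2"
  using assms(1,2)
proof (induction I rule: finite_induct)
  case empty
  then show ?case by (simp add: bprod_def bmult_def)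
next
  case (insert j I)
  let ?M = "mob_to0 (b j)" and ?B = "bprod I b" and ?E = "(cmod (1 - cnj x * z))\<^sup>2"
  let ?s = "sqrt (1 - (cmod z)\<^sup>2)" and ?a = "(1 - (cmod (b j))\<^sup>2) / (cmod (x - b j))\<^sup>2"
  let ?P = "cmod (1 - cnj (?M x) * ?M z)" and ?Q = "cmod (1 - cnj (?B x) * ?B z)" and ?r = "cmod (?M z)"
  have bj: "cmod (b j) < 1" and bI: "\<And>i. i \<in> I \<Longrightarrow> cmod (b i) < 1" using insert.prems by auto
  have s: "?s\<^sup>2 = 1 - (cmod z)\<^sup>2" using assms(4) by (simp add: power_le_one)
  have exp: "bprod (insert j I) b w = ?M w * ?B w" for w
    using insert.hyps by (simp add: bprod_def)
  have r: "?r \<le> 1" using mob_to0_norm_le1[OF bj assms(4)] .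
  have t: "cmod (?B z) \<le> 1" using bprod_norm_le1[OF bI assms(4)] .
  \<comment> \<open>1 - M N = (1 - M) + M (1 - N): the product rule that makes the multipliers add
    up.\<close>
  have "cmod (1 - cnj (?M x * ?B x) * (?M z * ?B z))
      = cmod ((1 - cnj (?M x) * ?M z) + cnj (?M x) * ?M z * (1 - cnj (?B x) * ?B z))"
    by (simp add: algebra_simps)
  also have "\<dots> \<le> ?P + cmod (cnj (?M x) * ?M z * (1 - cnj (?B x) * ?B z))" by (rule norm_triangle_ineq)
  also have "\<dots> = ?P + ?r * ?Q" using mob_to0_norm_eq1[OF bj assms(3)] by (simp add: norm_mult)
  finally have "(cmod (1 - cnj (?M x * ?B x) * (?M z * ?B z)))\<^sup>2 * ?s\<^sup>2 \<le> (?P + ?r * ?Q)\<^sup>2 * ?s\<^sup>2"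
    by (intro mult_right_mono power_mono) auto
  also have "\<dots> = (?P * ?s + ?r * (?Q * ?s))\<^sup>2" by (simp add: power_mult_distrib[symmetric] algebra_simps)
  also have "\<dots> \<le> (?a + bmult I b x) * ((1 - ?r\<^sup>2) * ?E + ?r\<^sup>2 * ((1 - (cmod (?B z))\<^sup>2) * ?E))"
  proof (rule weighted_cauchy_schwarz2)
    show "(?P * ?s)\<^sup>2 \<le> ?a * ((1 - ?r\<^sup>2) * ?E)"
      using one_minus_cnj_mob_to0_mult[OF bj assms(3,4)] by (simp add: power_mult_distrib s mult.assoc)
    show "(?Q * ?s)\<^sup>2 \<le> bmult I b x * ((1 - (cmod (?B z))\<^sup>2) * ?E)"
      using insert.IH[OF bI] by (simp add: power_mult_distrib s mult.assoc)
    show "0 \<le> ?a" using bj by (simp add: power_le_one)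
    show "0 \<le> bmult I b x" unfolding bmult_def using bI
      by (intro sum_nonneg divide_nonneg_nonneg) (auto simp: power_le_one less_imp_le)
    show "0 \<le> ?P * ?s" "0 \<le> ?Q * ?s" using assms(4) by (auto simp: power_le_one)
    show "0 \<le> (1 - ?r\<^sup>2) * ?E" "0 \<le> (1 - (cmod (?B z))\<^sup>2) * ?E"
      using r t by (auto simp: power_le_one)
  qed auto
  also have "\<dots> = bmult (insert j I) b x * (1 - (cmod (?M z * ?B z))\<^sup>2) * ?E"
    using insert.hyps by (simp add: bmult_def norm_mult power_mult_distrib algebra_simps)
  finally show ?case unfolding exp s .
qed

section \<open>Normal forms in the disk\<close>

lemma mob_from0_eq: "mob_from0 p = mob_to0 (- p)"
  by (simp add: fun_eq_iff mob_from0_def mob_to0_def)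

lemma cnj_mob_to0: "cnj (mob_to0 p z) = mob_to0 (cnj p) (cnj z)"
  by (simp add: mob_to0_def)

lemma mob_to0_diff:
  assumes "1 - cnj p * x \<noteq> 0" "1 - cnj p * z \<noteq> 0"
  shows "mob_to0 p x - mob_to0 p z = (x - z) * of_real (1 - (cmod p)\<^sup>2) / ((1 - cnj p * x) * (1 - cnj p * z))"
proof -
  have "mob_to0 p x - mob_to0 p z = ((x - p) * (1 - cnj p * z) - (z - p) * (1 - cnj p * x)) / ((1 - cnj p * x) * (1 - cnj p * z))"
    unfolding mob_to0_def using assms by (simp add: diff_frac_eq)
  also have "(x - p) * (1 - cnj p * z) - (z - p) * (1 - cnj p * x) = (x - z) * of_real (1 - (cmod p)\<^sup>2)"
    using complex_norm_square[of p] by (simp add: algebra_simps)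
  finally show ?thesis .
qed

lemma one_minus_norm_sq_pos: "cmod p < 1 \<Longrightarrow> 1 - (cmod p)\<^sup>2 > 0"
  by (simp add: abs_square_less_1)

text \<open>The composition vanishes where \<open>mob_to0 a\<close> takes the value b, that is at
  \<open>mob_to0 (- a) b\<close>, and two disk automorphisms with the same zero differ by a
  unimodular factor, which is written out here.\<close>

lemma mob_to0_comp:
  assumes "cmod a < 1" "cmod b < 1" "cmod w \<le> 1"
  shows "mob_to0 b (mob_to0 a w) = (1 + cnj a * b) / (1 + a * cnj b) * mob_to0 (mob_to0 (- a) b) w"
proof -
  have n1: "1 - cnj a * w \<noteq> 0" using mob_den_nz assms by blast
  have n2: "1 + cnj a * b \<noteq> 0" using mob_den_nz[of "- a" b] assms by simp
  then have n3: "1 + a * cnj b \<noteq> 0" by (metis complex_cnj_add complex_cnj_cnj complex_cnj_mult complex_cnj_one complex_cnj_zero_iff)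
  have m: "cmod (mob_to0 (- a) b) < 1" using mob_to0_norm_less1[of "- a" b] assms by simp
  have e: "mob_to0 (- a) b = (b + a) / (1 + cnj a * b)" by (simp add: mob_to0_def)
  then have ce: "cnj (mob_to0 (- a) b) = (cnj b + cnj a) / (1 + a * cnj b)" by simp
  have n4: "1 - cnj (mob_to0 (- a) b) * w \<noteq> 0" using mob_den_nz[OF m assms(3)] .
  have n5: "1 - cnj b * mob_to0 a w \<noteq> 0" using mob_den_nz[OF assms(2) mob_to0_norm_le1[OF assms(1,3)]] .
  have l: "mob_to0 b (mob_to0 a w) = ((w - a) - b * (1 - cnj a * w)) / ((1 - cnj a * w) - cnj b * (w - a))"
  proof -
    have "mob_to0 b (mob_to0 a w) = (((w - a) - b * (1 - cnj a * w)) / (1 - cnj a * w)) / (((1 - cnj a * w) - cnj b * (w - a)) / (1 - cnj a * w))"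
    proof -
      have "mob_to0 a w - b = ((w - a) - b * (1 - cnj a * w)) / (1 - cnj a * w)"
        unfolding mob_to0_def using n1 by (simp add: diff_divide_distrib)
      moreover have "1 - cnj b * mob_to0 a w = ((1 - cnj a * w) - cnj b * (w - a)) / (1 - cnj a * w)"
        unfolding mob_to0_def using n1 by (simp add: diff_divide_distrib right_diff_distrib)
      ultimately show ?thesis unfolding mob_to0_def[of b] by simp
    qed
    then show ?thesis using n1 by simp
  qed
  have r: "(1 + cnj a * b) / (1 + a * cnj b) * mob_to0 (mob_to0 (- a) b) w
     = ((1 + cnj a * b) * (w - mob_to0 (- a) b)) / ((1 + a * cnj b) * (1 - cnj (mob_to0 (- a) b) * w))"
    by (simp add: mob_to0_def[of "mob_to0 (- a) b"])
  have "(1 + cnj a * b) * (w - mob_to0 (- a) b) = (w - a) - b * (1 - cnj a * w)"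
    unfolding e using n2 by (simp add: right_diff_distrib) (simp add: algebra_simps)
  moreover have "(1 + a * cnj b) * (1 - cnj (mob_to0 (- a) b) * w) = (1 - cnj a * w) - cnj b * (w - a)"
    unfolding ce using n3 by (simp add: right_diff_distrib) (simp add: algebra_simps)
  ultimately show ?thesis unfolding l r by simp
qed

lemma mob_to0_inverse:
  assumes "cmod a < 1" "cmod w \<le> 1"
  shows "mob_to0 a (mob_to0 (- a) w) = w" "mob_to0 (- a) (mob_to0 a w) = w"
proof -
  have "mob_to0 (- a) (mob_to0 a w) = w" if "cmod a < 1" for a
  proof -
    have "1 - cnj a * a \<noteq> 0" using mob_den_nz[of a a] that by simp
    then have e: "(1 + cnj a * - a) / (1 + a * cnj (- a)) = 1" by (simp add: mult.commute)
    have "mob_to0 (mob_to0 (- a) (- a)) w = w" by (simp add: mob_to0_def)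
    then show ?thesis using mob_to0_comp[of a "- a" w] that assms(2) unfolding e by simp
  qed
  from this[of a] this[of "- a"] assms(1) show "mob_to0 a (mob_to0 (- a) w) = w" "mob_to0 (- a) (mob_to0 a w) = w"
    by auto
qed

text \<open>Each factor is moved by \<open>mob_to0_comp\<close>; the unimodular factors are
  collected in u.\<close>

lemma bprod_precomp:
  assumes "cmod a < 1" "finite I" "\<And>i. cmod (b i) < 1"
  obtains u b' where "cmod u = 1" "\<And>i. cmod (b' i) < 1"
    "\<And>w. cmod w \<le> 1 \<Longrightarrow> bprod I b (mob_to0 a w) = u * bprod I b' w"
proof
  let ?u = "\<Prod>i\<in>I. (1 + cnj a * b i) / (1 + a * cnj (b i))"
  have "cmod ((1 + cnj a * b i) / (1 + a * cnj (b i))) = 1" for i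
  proof -
    have "1 + cnj a * b i \<noteq> 0" using mob_den_nz[of "- a" "b i"] assms(1) assms(3)[of i] by simp
    moreover have "1 + a * cnj (b i) = cnj (1 + cnj a * b i)" by simp
    ultimately show ?thesis by (simp only: norm_divide complex_mod_cnj) simp
  qed
  then show "cmod ?u = 1" unfolding prod_norm[symmetric] by (simp only: prod.neutral_const)
  show "cmod (mob_to0 (- a) (b i)) < 1" for i
    using mob_to0_norm_less1[of "- a" "b i"] assms(1) assms(3)[of i] by simp
  show "bprod I b (mob_to0 a w) = ?u * bprod I (\<lambda>i. mob_to0 (- a) (b i)) w" if "cmod w \<le> 1" for w
    unfolding bprod_def prod.distrib[symmetric]
    by (intro prod.cong refl mob_to0_comp assms that)
qed

lemma prod_linear_factors:
  fixes p :: "complex poly"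
  assumes "p \<noteq> 0"
  obtains b where "p = smult (lead_coeff p) (\<Prod>i<degree p. [:- b i, 1:])"
proof -
  have "\<exists>b. p = smult (lead_coeff p) (\<Prod>i<n. [:- b i, 1:])" if "degree p = n" "p \<noteq> 0" for n and p :: "complex poly"
    using that
  proof (induction n arbitrary: p)
    case 0
    then show ?case by (auto elim: degree_eq_zeroE)
  next
    case (Suc n)
    then have "\<not> constant (poly p)" by (simp add: constant_degree)
    then obtain a where "poly p a = 0" using fundamental_theorem_of_algebra by blast
    then obtain q where q: "p = [:- a, 1:] * q" using poly_eq_0_iff_dvd by (metis dvdE)
    with Suc.prems have q0: "q \<noteq> 0" by auto
    have "degree p = Suc (degree q)" using q q0 by (simp add: degree_mult_eq del: mult_pCons_left)
    with Suc.prems have "degree q = n" by simp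
    with Suc.IH q0 obtain b where b: "q = smult (lead_coeff q) (\<Prod>i<n. [:- b i, 1:])" by blast
    have l: "lead_coeff p = lead_coeff q" unfolding q lead_coeff_mult by simp
    define b' where "b' = b(n := a)"
    have "(\<Prod>i<n. [:- b' i, 1:]) = (\<Prod>i<n. [:- b i, 1:])" by (intro prod.cong) (auto simp: b'_def)
    then have "(\<Prod>i<Suc n. [:- b' i, 1:]) = (\<Prod>i<n. [:- b i, 1:]) * [:- a, 1:]"
      unfolding prod.lessThan_Suc by (simp only: b'_def fun_upd_same)
    then have "smult (lead_coeff p) (\<Prod>i<Suc n. [:- b' i, 1:]) = [:- a, 1:] * smult (lead_coeff q) (\<Prod>i<n. [:- b i, 1:])"
      by (simp only: l mult_smult_right mult.commute)
    also have "\<dots> = p" using b q by simp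
    finally show ?case by metis
  qed
  then show ?thesis using that assms by blast
qed

text \<open>With u B = P / Q the composition is (P - p Q) / (Q - cnj p P). Outside the open disk |Q|
  <= |P|, also at infinity, so the numerator has d roots and all lie inside; the denominator is a
  multiple of the reflection of the numerator in the circle.\<close>

lemma bprod_postcomp:
  assumes "cmod p < 1" "cmod u = 1" "\<And>i. cmod (b i) < 1"
  obtains u' b' where "cmod u' = 1" "\<And>i. cmod (b' i) < 1"
    "\<And>w. cmod w \<le> 1 \<Longrightarrow> mob_to0 p (u * bprod {..<d} b w) = u' * bprod {..<d} b' w"
proof -
  have degree_prod_le: "degree (\<Prod>i<n. [:1, - cnj (b i):]) \<le> n" for n
  proof -
    have "degree (\<Prod>i<n. [:1, - cnj (b i):]) \<le> (\<Sum>i<n. degree [:1, - cnj (b i):])"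
      using degree_prod_sum_le[of "{..<n}" "\<lambda>i. [:1, - cnj (b i):]"] by (simp add: o_def)
    also have "\<dots> \<le> (\<Sum>i<n. 1)" by (intro sum_mono) auto
    finally show ?thesis by simp
  qed
  define P where "P = smult u (\<Prod>i<d. [:- b i, 1:])"
  define Q where "Q = (\<Prod>i<d. [:1, - cnj (b i):])"
  define R where "R = P - smult p Q"
  have PQ: "poly P w = u * (\<Prod>i<d. (w - b i))" "poly Q w = (\<Prod>i<d. (1 - cnj (b i) * w))" for w
    by (simp_all add: P_def Q_def poly_prod algebra_simps)
  have u0: "u \<noteq> 0" using assms(2) by auto
  have degP: "degree P = d"
    using u0 by (simp add: P_def degree_prod_eq_sum_degree)
  have degQ: "degree Q \<le> d"
    unfolding Q_def by (rule degree_prod_le)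
  have cP: "coeff P d = u"
  proof -
    have "coeff P d = lead_coeff P" by (simp add: degP)
    also have "\<dots> = u" by (simp add: P_def lead_coeff_smult lead_coeff_prod)
    finally show ?thesis .
  qed
  have cQ: "cmod (coeff Q d) \<le> 1"
  proof -
    have "coeff (\<Prod>i<n. [:1, - cnj (b i):]) n = (\<Prod>i<n. - cnj (b i))" for n
    proof (induction n)
      case (Suc n)
      have "degree (\<Prod>i<n. [:1, - cnj (b i):]) \<le> n"
        by (rule degree_prod_le)
      then have "coeff (\<Prod>i<n. [:1, - cnj (b i):]) (Suc n) = 0" by (simp add: coeff_eq_0)
      then show ?case using Suc by (simp add: mult.commute)
    qed simp
    then have "cmod (coeff Q d) = (\<Prod>i<d. cmod (b i))" by (simp add: Q_def flip: prod_norm)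
    also have "\<dots> \<le> 1" using assms(3) by (intro prod_le_1) (auto intro: less_imp_le)
    finally show ?thesis .
  qed
  \<comment> \<open>The top coefficient of P has modulus 1, that of Q at most 1, and |p| < 1, so
    subtracting p Q cannot lower the degree.\<close>
  have cR: "coeff R d \<noteq> 0"
  proof
    assume "coeff R d = 0"
    then have "u = p * coeff Q d" by (simp add: R_def cP)
    then have "1 = cmod p * cmod (coeff Q d)" using assms(2) by (simp add: norm_mult[symmetric])
    also have "\<dots> \<le> cmod p * 1" using cQ by (intro mult_left_mono) auto
    finally show False using assms(1) by simp
  qed
  have degR: "degree R = d"
  proof (rule antisym)
    show "degree R \<le> d" unfolding R_def using degP degQ by (intro degree_diff_le) (auto intro: order.trans[OF degree_smult_le])
    show "d \<le> degree R" using cR by (rule le_degree)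
  qed
  have "R \<noteq> 0" using cR by auto
  then obtain b' where b': "R = smult (lead_coeff R) (\<Prod>i<d. [:- b' i, 1:])" using prod_linear_factors degR by metis
  define l where "l = lead_coeff R"
  have l0: "l \<noteq> 0" using \<open>R \<noteq> 0\<close> by (simp add: l_def)
  have R: "poly R w = l * (\<Prod>i<d. (w - b' i))" for w
  proof -
    have "poly R w = poly (smult l (\<Prod>i<d. [:- b' i, 1:])) w" unfolding l_def using b' by metis
    then show ?thesis by (simp add: poly_prod)
  qed
  have R': "poly R w = poly P w - p * poly Q w" for w by (simp add: R_def)
  have root: "cmod (b' i) < 1" if "i < d" for i
  proof (rule ccontr)
    assume "\<not> cmod (b' i) < 1"
    then have ge: "cmod (b' i) \<ge> 1" by simp
    let ?w = "b' i"
    have "poly R ?w = 0" using that by (auto simp: R)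
    then have "cmod (poly P ?w) = cmod p * cmod (poly Q ?w)" by (simp add: R' norm_mult[symmetric])
    moreover have "cmod (poly Q ?w) \<le> cmod (poly P ?w)"
      unfolding PQ norm_mult assms(2) mult_1_left prod_norm[symmetric]
    proof (intro prod_mono conjI norm_ge_zero)
      fix j
      have "(cmod (1 - cnj (b j) * ?w))\<^sup>2 \<le> (cmod (?w - b j))\<^sup>2"
        using norm_mult_cnj_diff[of "b j" ?w] ge one_minus_norm_sq_pos[OF assms(3)[of j]]
        by (smt (verit) mult_nonneg_nonpos one_le_power)
      then show "cmod (1 - cnj (b j) * ?w) \<le> cmod (?w - b j)" by (rule power2_le_imp_le) simp
    qed
    moreover have "poly P ?w \<noteq> 0"
    proof -
      have "?w \<noteq> b j" for j using assms(3)[of j] ge by auto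
      then show ?thesis using u0 by (simp add: PQ)
    qed
    moreover have "cmod p * cmod (poly Q ?w) \<le> cmod p * cmod (poly P ?w)"
      using calculation(2) by (intro mult_left_mono) auto
    ultimately have "cmod (poly P ?w) \<le> cmod p * cmod (poly P ?w)" by linarith
    moreover have "cmod (poly P ?w) > 0" using \<open>poly P ?w \<noteq> 0\<close> by (rule zero_less_norm_iff[THEN iffD2])
    then have "cmod p * cmod (poly P ?w) < 1 * cmod (poly P ?w)" using assms(1) by (intro mult_strict_right_mono)
    ultimately show False by linarith
  qed
  have refl: "poly Q w - cnj p * poly P w = cnj l * u * (\<Prod>i<d. (1 - cnj (b' i) * w))"
    if w: "w \<noteq> 0" for w
  proof -
    let ?v = "1 / cnj w"
    have fac: "w * cnj (?v - z) = 1 - cnj z * w" "w * cnj (1 - cnj z * ?v) = w - z" for z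
      using w by (simp_all add: field_simps)
    have Pr: "w ^ d * cnj (poly P ?v) = cnj u * poly Q w"
    proof -
      have "w ^ d * cnj (poly P ?v) = cnj u * (\<Prod>i<d. w * cnj (?v - b i))" by (simp add: PQ prod.distrib)
      then show ?thesis unfolding fac PQ .
    qed
    have Qr: "w ^ d * cnj (poly Q ?v) = poly P w / u"
    proof -
      have "w ^ d * cnj (poly Q ?v) = (\<Prod>i<d. w * cnj (1 - cnj (b i) * ?v))" by (simp add: PQ prod.distrib)
      then show ?thesis unfolding fac using u0 by (simp add: PQ)
    qed
    have "w ^ d * cnj (poly R ?v) = cnj l * (\<Prod>i<d. w * cnj (?v - b' i))" by (simp add: R prod.distrib)
    then have "w ^ d * cnj (poly R ?v) = cnj l * (\<Prod>i<d. 1 - cnj (b' i) * w)" unfolding fac .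
    moreover have "w ^ d * cnj (poly R ?v) = w ^ d * cnj (poly P ?v) - cnj p * (w ^ d * cnj (poly Q ?v))"
      by (simp add: R' algebra_simps)
    ultimately have "cnj u * poly Q w - cnj p * (poly P w / u) = cnj l * (\<Prod>i<d. 1 - cnj (b' i) * w)"
      unfolding Pr Qr by simp
    then have "u * (cnj u * poly Q w - cnj p * (poly P w / u)) = u * (cnj l * (\<Prod>i<d. 1 - cnj (b' i) * w))" by simp
    moreover have uu: "u * cnj u = 1" using assms(2) by (simp flip: complex_norm_square)
    moreover have "u * (cnj u * poly Q w - cnj p * (poly P w / u)) = (u * cnj u) * poly Q w - cnj p * poly P w"
      using u0 by (simp add: right_diff_distrib)
    ultimately have "(u * cnj u) * poly Q w - cnj p * poly P w = u * (cnj l * (\<Prod>i<d. 1 - cnj (b' i) * w))"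
      by (metis (no_types))
    then show ?thesis by (simp add: uu mult_ac)
  qed
  define b'' where "b'' = (\<lambda>i. if i < d then b' i else 0)"
  define u' where "u' = l / (cnj l * u)"
  have "cmod u' = 1" using l0 assms(2) by (simp add: u'_def norm_divide norm_mult)
  moreover have "cmod (b'' i) < 1" for i using root by (simp add: b''_def)
  moreover have "mob_to0 p (u * bprod {..<d} b w) = u' * bprod {..<d} b'' w" if w: "cmod w \<le> 1" for w
  proof -
    have Q0: "poly Q w \<noteq> 0" using mob_den_nz[OF assms(3) w] by (simp add: PQ)
    have B: "u * bprod {..<d} b w = poly P w / poly Q w"
      by (simp add: bprod_def mob_to0_def PQ prod_dividef)
    have den: "poly Q w - cnj p * poly P w = cnj l * u * (\<Prod>i<d. (1 - cnj (b' i) * w))"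
    proof (cases "w = 0")
      case True
      \<comment> \<open>The reflection identity extends to 0 by polynomial identity.\<close>
      have "poly (Q - smult (cnj p) P) x = poly (smult (cnj l * u) (\<Prod>i<d. [:1, - cnj (b' i):])) x" if "cmod x = 1" for x
      proof -
        have "x \<noteq> 0" using that by auto
        from refl[OF this] show ?thesis
          by (simp add: poly_prod mult_ac)
      qed
      then have "Q - smult (cnj p) P = smult (cnj l * u) (\<Prod>i<d. [:1, - cnj (b' i):])"
        by (rule poly_eq_on_circle)
      from arg_cong[OF this, of "\<lambda>q. poly q w"] show ?thesis by (simp add: poly_prod algebra_simps)
    next
      case False
      from refl[OF this] show ?thesis .
    qed
    have "mob_to0 p (poly P w / poly Q w) = (poly P w - p * poly Q w) / (poly Q w - cnj p * poly P w)"
      using Q0 unfolding mob_to0_def by (simp add: divide_simps)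
    also have "\<dots> = (l * (\<Prod>i<d. (w - b' i))) / (cnj l * u * (\<Prod>i<d. (1 - cnj (b' i) * w)))"
      unfolding den R'[symmetric] R ..
    also have "\<dots> = u' * bprod {..<d} b' w" by (simp add: u'_def bprod_def mob_to0_def prod_dividef)
    also have "bprod {..<d} b' w = bprod {..<d} b'' w" by (simp add: bprod_def b''_def)
    finally show ?thesis unfolding B .
  qed
  ultimately show ?thesis using that by blast
qed

lemma holomorphic_onI_mob:
  assumes "\<And>w. w \<in> S \<Longrightarrow> 1 - cnj b * w \<noteq> 0"
  shows "mob_to0 b holomorphic_on S"
  unfolding mob_to0_def[abs_def] using assms by (intro holomorphic_intros) auto

lemma blaschke_anti_eq_bprod:
  "blaschke_anti a z = bprod {..<Suc (length a)} (\<lambda>i. if i < length a then a ! i else 0) (cnj z)"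
  by (simp add: blaschke_anti_def bprod_def mob_to0_def)

lemma Bminus_bprod:
  assumes "f \<in> Bminus d" "d \<ge> 1"
  obtains b where "\<And>i. cmod (b i) < 1" "f = (\<lambda>z. bprod {..<d} b (cnj z))"
proof -
  obtain a where a: "f = blaschke_anti a" "length a = d - 1" "\<forall>x\<in>set a. cmod x < 1"
    using assms by (auto simp: Bminus_def)
  show ?thesis
  proof (rule that)
    show "cmod (if i < length a then a ! i else 0) < 1" for i using a(3) by auto
    show "f = (\<lambda>z. bprod {..<d} (\<lambda>i. if i < length a then a ! i else 0) (cnj z))"
      using a assms(2) by (simp add: fun_eq_iff blaschke_anti_eq_bprod)
  qed
qed

lemma dbar_bprod: "dbar (\<lambda>z. bprod I b (cnj z)) z = deriv (bprod I b) (cnj z)"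
  by (simp add: dbar_def)

lemma norm_one_minus_cnj_mult_circle:
  assumes "cmod x = 1"
  shows "cmod (1 - cnj x * z) = cmod (x - z)"
  using mob_circle_num_den[of x z] assms
  by (metis complex_cnj_cnj complex_cnj_diff complex_cnj_mult complex_cnj_one complex_mod_cnj mult.commute)

lemma Bminus_julia:
  assumes "f \<in> Bminus d" "d \<ge> 1" "cmod x = 1" "f x = x" "cmod z \<le> 1"
  shows "(cmod (x - f z))\<^sup>2 * (1 - (cmod z)\<^sup>2) \<le> cmod (dbar f x) * (1 - (cmod (f z))\<^sup>2) * (cmod (x - z))\<^sup>2"
proof -
  obtain b where b: "\<And>i. cmod (b i) < 1" "f = (\<lambda>z. bprod {..<d} b (cnj z))"
    using Bminus_bprod assms by blast
  have d: "cmod (dbar f x) = bmult {..<d} b (cnj x)"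
    unfolding b(2) dbar_bprod using b(1) assms(3) by (intro bprod_deriv_norm_circle) auto
  have "(cmod (1 - cnj (bprod {..<d} b (cnj x)) * bprod {..<d} b (cnj z)))\<^sup>2 * (1 - (cmod (cnj z))\<^sup>2)
    \<le> bmult {..<d} b (cnj x) * (1 - (cmod (bprod {..<d} b (cnj z)))\<^sup>2) * (cmod (1 - cnj (cnj x) * cnj z))\<^sup>2"
    by (rule bprod_julia) (use b assms in auto)
  moreover have "bprod {..<d} b (cnj w) = f w" for w by (simp add: b(2))
  moreover have "cmod (1 - cnj (cnj x) * cnj z) = cmod (x - z)"
    using norm_one_minus_cnj_mult_circle[of "cnj x" "cnj z"] assms(3)
    by (metis complex_cnj_diff complex_mod_cnj)
  ultimately show ?thesis
    using norm_one_minus_cnj_mult_circle[OF assms(3)] assms(4) d by simp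
qed

lemma Bminus_norm_less1:
  assumes "f \<in> Bminus d" "d \<ge> 1" "cmod z < 1"
  shows "cmod (f z) < 1"
proof -
  obtain b where b: "\<And>i. cmod (b i) < 1" "f = (\<lambda>z. bprod {..<d} b (cnj z))"
    using Bminus_bprod assms by blast
  have "cmod (f z) = cmod (mob_to0 (b 0) (cnj z)) * cmod (bprod ({..<d} - {0}) b (cnj z))"
    using assms(2) prod.remove[of "{..<d}" 0 "\<lambda>i. mob_to0 (b i) (cnj z)"] by (simp add: b(2) bprod_def norm_mult)
  also have "\<dots> \<le> cmod (mob_to0 (b 0) (cnj z)) * 1"
    using b assms(3) by (intro mult_left_mono bprod_norm_le1) auto
  also have "\<dots> < 1" using mob_to0_norm_less1[of "b 0" "cnj z"] b assms(3) by simp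
  finally show ?thesis .
qed

lemma mob_to0_scaled_inequality:
  assumes "cmod p < 1" "cmod x \<le> 1" "cmod w \<le> 1" "cmod z \<le> 1"
    and "(cmod (x - w))\<^sup>2 * (1 - (cmod z)\<^sup>2) \<le> L * (1 - (cmod w)\<^sup>2) * (cmod (x - z))\<^sup>2"
  shows "(cmod (mob_to0 p x - mob_to0 p w))\<^sup>2 * (1 - (cmod (mob_to0 p z))\<^sup>2)
    \<le> L * (1 - (cmod (mob_to0 p w))\<^sup>2) * (cmod (mob_to0 p x - mob_to0 p z))\<^sup>2"
proof -
  let ?k = "1 - (cmod p)\<^sup>2" and ?q = "\<lambda>z. cmod (1 - cnj p * z)"
  have k: "?k > 0" using one_minus_norm_sq_pos assms by blast
  have q: "?q x > 0" "?q w > 0" "?q z > 0" using mob_den_nz[OF assms(1)] assms by auto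
  have n: "1 - cnj p * x \<noteq> 0" "1 - cnj p * w \<noteq> 0" "1 - cnj p * z \<noteq> 0" using mob_den_nz[OF assms(1)] assms by auto
  have kk: "cmod (of_real ?k) = ?k" using k by (simp del: of_real_diff)
  have "(cmod (mob_to0 p x - mob_to0 p w))\<^sup>2 * (1 - (cmod (mob_to0 p z))\<^sup>2)
     = ((cmod (x - w))\<^sup>2 * (1 - (cmod z)\<^sup>2)) * (?k ^ 3 / ((?q x)\<^sup>2 * (?q w)\<^sup>2 * (?q z)\<^sup>2))"
    unfolding mob_to0_diff[OF n(1,2)] one_minus_mob_to0_norm_sq[OF assms(1,4)] norm_mult norm_divide kk
    by (simp add: power_divide power_mult_distrib power2_eq_square power3_eq_cube mult_ac)
  also have "\<dots> \<le> (L * (1 - (cmod w)\<^sup>2) * (cmod (x - z))\<^sup>2) * (?k ^ 3 / ((?q x)\<^sup>2 * (?q w)\<^sup>2 * (?q z)\<^sup>2))"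
    using assms(5) k by (intro mult_right_mono) auto
  also have "\<dots> = L * (1 - (cmod (mob_to0 p w))\<^sup>2) * (cmod (mob_to0 p x - mob_to0 p z))\<^sup>2"
    unfolding mob_to0_diff[OF n(1,3)] one_minus_mob_to0_norm_sq[OF assms(1,3)] norm_mult norm_divide kk
    by (simp add: power_divide power_mult_distrib power2_eq_square power3_eq_cube mult_ac)
  finally show ?thesis .
qed

text \<open>Normal form of f seen from p: all data are points of the closed disk, so subsequences
  can be extracted even when p runs to the boundary. The c i are the d - 1 critical points, with
  repetitions and up to conjugation, in the recentred coordinate.\<close>

lemma Bminus_recentre:
  assumes "f \<in> Bminus d" "d \<ge> 1" "cmod p < 1"
  obtains u b c \<kappa> where "cmod u = 1" "\<And>i. cmod (b i) < 1" "\<And>i. cmod (c i) < 1" "\<kappa> \<noteq> 0"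
    "\<And>z. cmod z \<le> 1 \<Longrightarrow> mob_to0 p (f (mob_to0 (- p) z)) = u * bprod {..<d} b (cnj z)"
    "bcrit {..<d} b = smult \<kappa> (\<Prod>i<d - 1. blq (c i))"
    "\<And>q R. crit_count f q R = card {i. i < d - 1 \<and> hdist (mob_to0 (- p) (cnj (c i))) q \<le> R}"
proof -
  obtain b0 where b0: "\<And>i. cmod (b0 i) < 1" "f = (\<lambda>z. bprod {..<d} b0 (cnj z))"
    using Bminus_bprod assms by blast
  let ?m = "mob_to0 (- cnj p)" and ?n = "mob_to0 (cnj p)"
  obtain u1 b1 where b1: "cmod u1 = 1" "\<And>i. cmod (b1 i) < 1"
    "\<And>w. cmod w \<le> 1 \<Longrightarrow> bprod {..<d} b0 (?m w) = u1 * bprod {..<d} b1 w"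
    using bprod_precomp[of "- cnj p" "{..<d}" b0] assms(3) b0(1) by auto
  obtain u b where ub: "cmod u = 1" "\<And>i. cmod (b i) < 1"
    "\<And>w. cmod w \<le> 1 \<Longrightarrow> mob_to0 p (u1 * bprod {..<d} b1 w) = u * bprod {..<d} b w"
    by (rule bprod_postcomp[OF assms(3) b1(1,2), of d]) (rule that)
  obtain \<kappa> c where c: "\<kappa> \<noteq> 0" "\<And>i. cmod (c i) < 1" "bcrit {..<d} b = smult \<kappa> (\<Prod>i<d - 1. blq (c i))"
    using bcrit_factor[of "{..<d}" b] ub(2) assms(2) by (auto simp: lessThan_empty_iff)
  have norm: "mob_to0 p (f (mob_to0 (- p) z)) = u * bprod {..<d} b (cnj z)" if "cmod z \<le> 1" for z
    using b1(3)[of "cnj z"] ub(3)[of "cnj z"] that by (simp add: b0(2) cnj_mob_to0)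
  have p': "cmod (cnj p) < 1" "cmod (- cnj p) < 1" "cmod (- p) < 1" using assms(3) by auto
  let ?G = "\<lambda>w. u * bprod {..<d} b w"
  have G1: "cmod (?G w) < 1" if "cmod w < 1" for w
  proof -
    have "cmod (f (mob_to0 (- p) (cnj w))) < 1"
      by (intro Bminus_norm_less1[OF assms(1,2)] mob_to0_norm_less1) (use that assms in auto)
    then show ?thesis using norm[of "cnj w"] mob_to0_norm_less1[OF assms(3)] that by (metis complex_cnj_cnj complex_mod_cnj less_imp_le)
  qed
  have fG: "f (cnj v) = mob_to0 (- p) (?G (?n v))" if "cmod v < 1" for v
  proof -
    have z: "cmod (mob_to0 p (cnj v)) < 1" using mob_to0_norm_less1[OF assms(3)] that by simp
    have "mob_to0 p (f (cnj v)) = ?G (?n v)"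
      using norm[OF less_imp_le[OF z]] mob_to0_inverse(2)[OF assms(3), of "cnj v"] that by (simp add: cnj_mob_to0)
    then show ?thesis
      using mob_to0_inverse(2)[OF assms(3), of "f (cnj v)"] Bminus_norm_less1[OF assms(1,2), of "cnj v"] that by simp
  qed
  define c' where "c' = (\<lambda>i. ?m (c i))"
  have c': "cmod (c' i) < 1" for i unfolding c'_def using mob_to0_norm_less1 p' c(2) by blast
  have c'': "?n (c' i) = c i" for i using mob_to0_inverse(1)[OF p'(1), of "c i"] c(2)[of i] by (simp add: c'_def)
  let ?k = "of_real (1 - (cmod p)\<^sup>2) :: complex"
  have k: "?k \<noteq> 0" using one_minus_norm_sq_pos[OF assms(3)] by (simp del: of_real_diff)
  \<comment> \<open>Chain rule factors of the Moebius maps, times what remains of each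
    \<open>blq (c i)\<close> after its root is written as \<open>v - c' i\<close>. Nothing here
    vanishes in the disk, so multiplicities are read off the linear factors.\<close>
  define h where "h = (\<lambda>v. ?k / (1 + cnj p * ?G (?n v))\<^sup>2 * (u * \<kappa> / (\<Prod>i<d. (1 - cnj (b i) * ?n v))\<^sup>2) * (?k / (1 - p * v)\<^sup>2)
     * (\<Prod>i<d - 1. ?k / ((1 - p * v) * (1 - p * c' i)) * (1 - cnj (c i) * ?n v)))"
  have den: "1 - p * v \<noteq> 0" if "cmod v < 1" for v using mob_den_nz[OF p'(1), of v] that by simp
  have n1: "cmod (?n v) < 1" if "cmod v < 1" for v using mob_to0_norm_less1[OF p'(1) that] .
  have den2: "1 + cnj p * ?G (?n v) \<noteq> 0" if "cmod v < 1" for v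
    using mob_den_nz[OF p'(3), of "?G (?n v)"] G1[OF n1[OF that]] by simp
  have den3: "(\<Prod>i<d. (1 - cnj (b i) * ?n v)) \<noteq> 0" if "cmod v < 1" for v
    using mob_den_nz[OF ub(2)] n1[OF that] by (auto simp: less_imp_le)
  have u0: "u \<noteq> 0" using ub(1) by auto
  have der: "deriv (\<lambda>w. f (cnj w)) v = h v * (\<Prod>i<d - 1. (v - c' i))" if v: "cmod v < 1" for v
  proof -
    have ev: "eventually (\<lambda>w. f (cnj w) = mob_to0 (- p) (?G (?n w))) (nhds v)"
    proof -
      have "eventually (\<lambda>w. w \<in> ball 0 1) (nhds v)" using v by (intro eventually_nhds_in_open) auto
      then show ?thesis by eventually_elim (auto intro: fG)
    qed
    have d1: "(?n has_field_derivative ?k / (1 - p * v)\<^sup>2) (at v)"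
      using mob_to0_deriv[of "cnj p" v] den[OF v] by simp
    have d2: "(bprod {..<d} b has_field_derivative poly (bcrit {..<d} b) (?n v) / (\<Prod>i<d. (1 - cnj (b i) * ?n v))\<^sup>2) (at (?n v))"
      by (intro bprod_deriv mob_den_nz ub(2) less_imp_le n1 v)
    have d3: "((\<lambda>w. bprod {..<d} b (?n w)) has_field_derivative
        poly (bcrit {..<d} b) (?n v) / (\<Prod>i<d. (1 - cnj (b i) * ?n v))\<^sup>2 * (?k / (1 - p * v)\<^sup>2)) (at v)"
      by (rule DERIV_chain2[OF d2 d1])
    have d4: "((\<lambda>w. ?G (?n w)) has_field_derivative
        u * (poly (bcrit {..<d} b) (?n v) / (\<Prod>i<d. (1 - cnj (b i) * ?n v))\<^sup>2 * (?k / (1 - p * v)\<^sup>2))) (at v)"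
      by (rule DERIV_cmult[OF d3])
    have d5: "(mob_to0 (- p) has_field_derivative ?k / (1 + cnj p * ?G (?n v))\<^sup>2) (at (?G (?n v)))"
      using mob_to0_deriv[of "- p" "?G (?n v)"] den2[OF v] by simp
    have d6: "((\<lambda>w. mob_to0 (- p) (?G (?n w))) has_field_derivative
       ?k / (1 + cnj p * ?G (?n v))\<^sup>2 * (u * (poly (bcrit {..<d} b) (?n v) / (\<Prod>i<d. (1 - cnj (b i) * ?n v))\<^sup>2 * (?k / (1 - p * v)\<^sup>2)))) (at v)"
      by (rule DERIV_chain2[OF d5 d4])
    have "deriv (\<lambda>w. f (cnj w)) v = deriv (\<lambda>w. mob_to0 (- p) (?G (?n w))) v"
      by (rule deriv_cong_ev[OF ev refl])
    also have "\<dots> = ?k / (1 + cnj p * ?G (?n v))\<^sup>2 * (u * (poly (bcrit {..<d} b) (?n v) / (\<Prod>i<d. (1 - cnj (b i) * ?n v))\<^sup>2 * (?k / (1 - p * v)\<^sup>2)))"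
      by (rule DERIV_imp_deriv[OF d6])
    also have "poly (bcrit {..<d} b) (?n v) = \<kappa> * ((\<Prod>i<d - 1. (?k / ((1 - p * v) * (1 - p * c' i)) * (1 - cnj (c i) * ?n v))) * (\<Prod>i<d - 1. v - c' i))"
    proof -
      have "poly (blq (c i)) (?n v) = (?k / ((1 - p * v) * (1 - p * c' i)) * (1 - cnj (c i) * ?n v)) * (v - c' i)" for i
      proof -
        have "?n v - c i = ?n v - ?n (c' i)" by (simp add: c'')
        also have "\<dots> = (v - c' i) * ?k / ((1 - p * v) * (1 - p * c' i))"
          using mob_to0_diff[of "cnj p" v "c' i"] den[OF v] den[OF c'] by simp
        finally show ?thesis by (simp add: poly_blq)
      qed
      then show ?thesis unfolding prod.distrib[symmetric] by (simp add: c(3) poly_prod)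
    qed
    finally show ?thesis unfolding h_def by (simp add: mult_ac del: of_real_diff)
  qed
  have hnz: "h v \<noteq> 0" if "cmod v < 1" for v
  proof -
    have "1 - cnj (c i) * ?n v \<noteq> 0" for i using mob_den_nz[OF c(2)] n1[OF that] by (auto simp: less_imp_le)
    moreover have "1 - p * c' i \<noteq> 0" for i using den[OF c'] .
    ultimately show ?thesis
      unfolding h_def using k u0 c(1) den[OF that] den2[OF that] den3[OF that] by (auto simp del: of_real_diff)
  qed
  have nh: "?n holomorphic_on ball 0 1"
    using den by (intro holomorphic_onI_mob) auto
  have hh: "h holomorphic_on ball 0 1"
  proof -
    have "(\<lambda>v. bprod {..<d} b (?n v)) holomorphic_on ball 0 1"
      unfolding bprod_def mob_to0_def[of "b _"]
      using mob_den_nz[OF ub(2)] n1 by (intro holomorphic_intros nh) (auto simp: less_imp_le)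
    then show ?thesis
      unfolding h_def using den den2 den3 den[OF c'] by (intro holomorphic_intros nh) auto
  qed
  have "crit_count f q R = card {i. i < d - 1 \<and> hdist (mob_to0 (- p) (cnj (c i))) q \<le> R}" for q R
  proof -
    have "crit_count f q R = card {i. i < d - 1 \<and> hdist (cnj (c' i)) q \<le> R}"
      by (rule crit_count_eq_card[of h]) (use hh hnz c' der in auto)
    then show ?thesis by (simp add: c'_def cnj_mob_to0)
  qed
  then show ?thesis using that ub(1,2) c norm by blast
qed

section \<open>Limits of Blaschke products\<close>

text \<open>On the circle cnj z = 1 / z, which turns the fixed point equation into a polynomial
  equation of degree \<open>card I + 1\<close>.\<close>

lemma bprod_circle_fixed_card:
  assumes "finite I" "\<And>i. i \<in> I \<Longrightarrow> cmod (b i) < 1"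
    and "S \<subseteq> {z. cmod z = 1 \<and> u * bprod I b (cnj z) = z}"
  shows "finite S" "card S \<le> card I + 1"
proof -
  define p where "p = [:0, 1:] * (\<Prod>i\<in>I. [:- cnj (b i), 1:]) - smult u (\<Prod>i\<in>I. [:1, - b i:])"
  have d1: "degree (\<Prod>i\<in>I. [:1, - b i:]) \<le> card I"
  proof -
    have "degree (\<Prod>i\<in>I. [:1, - b i:]) \<le> (\<Sum>i\<in>I. degree [:1, - b i:])"
      using degree_prod_sum_le[OF assms(1), of "\<lambda>i. [:1, - b i:]"] by (simp add: o_def)
    also have "\<dots> \<le> (\<Sum>i\<in>I. 1)" by (intro sum_mono) auto
    finally show ?thesis by simp
  qed
  have nz: "(\<Prod>i\<in>I. [:- cnj (b i), 1:]) \<noteq> 0" using assms(1) by simp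
  have d2: "degree (\<Prod>i\<in>I. [:- cnj (b i), 1:]) = card I"
    by (simp add: degree_prod_eq_sum_degree)
  then have d3: "degree ([:0, 1:] * (\<Prod>i\<in>I. [:- cnj (b i), 1:])) = card I + 1"
    using nz by (simp add: degree_mult_eq del: mult_pCons_left)
  have "degree p = card I + 1"
    unfolding p_def diff_conv_add_uminus using d1 d3
    by (subst degree_add_eq_left) (auto intro: le_less_trans[OF degree_smult_le])
  then have p: "p \<noteq> 0" "degree p = card I + 1" by auto
  have "S \<subseteq> {z. poly p z = 0}"
  proof
    fix z assume "z \<in> S"
    then have z: "cmod z = 1" "u * bprod I b (cnj z) = z" using assms(3) by auto
    have zz: "z * cnj z = 1" using z(1) by (simp flip: complex_norm_square)
    then have z0: "z \<noteq> 0" by auto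
    have e: "mob_to0 (b i) (cnj z) = (1 - b i * z) / (z - cnj (b i))" for i
    proof -
      have "cnj z = 1 / z" using zz z0 by (simp add: field_simps)
      then have "cnj z - b i = (1 - b i * z) / z" "1 - cnj (b i) * cnj z = (z - cnj (b i)) / z"
        using z0 by (simp_all add: field_simps)
      then show ?thesis using z0 by (simp add: mob_to0_def)
    qed
    have n: "z - cnj (b i) \<noteq> 0" if "i \<in> I" for i using assms(2)[OF that] z(1) by auto
    have "u * (\<Prod>i\<in>I. (1 - b i * z)) = z * (\<Prod>i\<in>I. (z - cnj (b i)))"
      using z(2) n assms(1) unfolding bprod_def e prod_dividef
      by (auto simp: field_simps)
    then show "z \<in> {z. poly p z = 0}" by (simp add: p_def poly_prod mult.commute)
  qed
  moreover have "finite {z. poly p z = 0}" using p(1) by (rule poly_roots_finite)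
  moreover have "card {z. poly p z = 0} \<le> degree p" using p(1) by (rule card_poly_roots_bound)
  ultimately show "finite S" "card S \<le> card I + 1" using p(2) by (auto intro: finite_subset dest: card_mono)
qed

lemma finite_family_subsequence:
  fixes X :: "'i \<Rightarrow> nat \<Rightarrow> 'a :: metric_space"
  assumes "finite I" "\<And>i. i \<in> I \<Longrightarrow> compact (C i)" "\<And>i n. i \<in> I \<Longrightarrow> X i n \<in> C i"
  obtains r l where "strict_mono (r :: nat \<Rightarrow> nat)" "\<And>i. i \<in> I \<Longrightarrow> l i \<in> C i \<and> (\<lambda>n. X i (r n)) \<longlonglongrightarrow> l i"
proof -
  have "\<exists>r l. strict_mono (r :: nat \<Rightarrow> nat) \<and> (\<forall>i\<in>I. l i \<in> C i \<and> (\<lambda>n. X i (r n)) \<longlonglongrightarrow> l i)"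
    using assms
  proof (induction I rule: finite_induct)
    case empty
    show ?case by (intro exI[of _ id]) (auto simp: strict_mono_def)
  next
    case (insert j I)
    then obtain r l where r: "strict_mono (r :: nat \<Rightarrow> nat)" "\<forall>i\<in>I. l i \<in> C i \<and> (\<lambda>n. X i (r n)) \<longlonglongrightarrow> l i" by auto
    have "\<forall>n. X j (r n) \<in> C j" using insert.prems by auto
    moreover have "seq_compact (C j)" using insert.prems(1)[of j] by (simp add: compact_imp_seq_compact)
    ultimately obtain m s where s: "m \<in> C j" "strict_mono (s :: nat \<Rightarrow> nat)" "((\<lambda>n. X j (r n)) \<circ> s) \<longlonglongrightarrow> m"
      by (metis seq_compact_def)
    have "(\<lambda>n. X i (r (s n))) \<longlonglongrightarrow> l i" if "i \<in> I" for i
      using LIMSEQ_subseq_LIMSEQ[OF _ s(2), of "\<lambda>n. X i (r n)" "l i"] r(2) that by (simp add: o_def)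
    then have "\<forall>i\<in>insert j I. (l(j := m)) i \<in> C i \<and> (\<lambda>n. X i ((r \<circ> s) n)) \<longlonglongrightarrow> (l(j := m)) i"
      using r s insert.hyps by (auto simp: o_def)
    then show ?case using strict_mono_o[OF r(1) s(2)] by blast
  qed
  then show ?thesis using that by blast
qed

section \<open>Counting zeros in the open disk and passing to limits\<close>

definition disk_zeros :: "complex poly \<Rightarrow> nat" where
  "disk_zeros p = size (filter_mset (\<lambda>z. cmod z < 1) (proots p))"

lemma disk_zeros_mult: "p \<noteq> 0 \<Longrightarrow> q \<noteq> 0 \<Longrightarrow> disk_zeros (p * q) = disk_zeros p + disk_zeros q"
  by (simp add: disk_zeros_def proots_mult)

lemma disk_zeros_smult: "k \<noteq> 0 \<Longrightarrow> disk_zeros (smult k p) = disk_zeros p"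
  by (simp add: disk_zeros_def)

lemma disk_zeros_prod:
  assumes "finite I" "\<And>i. i \<in> I \<Longrightarrow> p i \<noteq> 0"
  shows "disk_zeros (\<Prod>i\<in>I. p i) = (\<Sum>i\<in>I. disk_zeros (p i))"
  using assms by (induction I rule: finite_induct) (simp_all add: disk_zeros_mult, simp add: disk_zeros_def)

lemma blq_nonzero: "blq c \<noteq> 0"
  unfolding blq_def by (rule no_zero_divisors) auto

lemma disk_zeros_eq_0:
  assumes "\<And>z. cmod z < 1 \<Longrightarrow> poly p z \<noteq> 0"
  shows "disk_zeros p = 0"
proof -
  have "p \<noteq> 0" using assms[of 0] by auto
  then have "set_mset (filter_mset (\<lambda>z. cmod z < 1) (proots p)) = {}" using assms by auto
  then have "filter_mset (\<lambda>z. cmod z < 1) (proots p) = {#}" by (simp only: set_mset_eq_empty_iff)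
  then show ?thesis by (simp add: disk_zeros_def)
qed

lemma disk_zeros_blq:
  assumes "cmod c \<le> 1"
  shows "disk_zeros (blq c) = (if cmod c < 1 then 1 else 0)"
proof -
  have "disk_zeros [:1, - cnj c:] = 0"
  proof (rule disk_zeros_eq_0)
    fix z :: complex assume z: "cmod z < 1"
    have "cmod (cnj c * z) \<le> 1 * cmod z" using assms by (simp add: norm_mult mult_left_le_one_le)
    then have "cnj c * z \<noteq> 1" using z by auto
    then show "poly [:1, - cnj c:] z \<noteq> 0" by (simp add: mult.commute)
  qed
  moreover have "proots [:- c, 1:] = {#c#}" by simp
  ultimately have "disk_zeros (blq c) = size (filter_mset (\<lambda>z. cmod z < 1) {#c#})"
    unfolding blq_def by (subst disk_zeros_mult) (auto simp: disk_zeros_def)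
  then show ?thesis by simp
qed

lemma disk_zeros_prod_blq:
  assumes "finite I" "\<And>i. i \<in> I \<Longrightarrow> cmod (c i) \<le> 1"
  shows "disk_zeros (\<Prod>i\<in>I. blq (c i)) = card {i\<in>I. cmod (c i) < 1}"
proof -
  have "disk_zeros (\<Prod>i\<in>I. blq (c i)) = (\<Sum>i\<in>I. disk_zeros (blq (c i)))"
    by (intro disk_zeros_prod assms(1) blq_nonzero)
  also have "\<dots> = (\<Sum>i\<in>I. if cmod (c i) < 1 then 1 else 0)"
    by (intro sum.cong refl disk_zeros_blq assms(2))
  also have "\<dots> = card {i\<in>I. cmod (c i) < 1}"
    using assms(1) by (simp flip: sum.inter_filter)
  finally show ?thesis .
qed

text \<open>A zero on the circle has weight 1 - |b|^2 = 0, so its own summand vanishes; in every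
  other summand it leaves the factor \<open>blq b\<close>, which has no root in the open
  disk.\<close>

lemma bcrit_degenerate:
  assumes "finite I" "\<And>i. i \<in> I \<Longrightarrow> cmod (b i) \<le> 1"
  defines "G \<equiv> {i\<in>I. cmod (b i) < 1}"
  shows "bcrit I b = (\<Prod>i\<in>I - G. blq (b i)) * bcrit G b"
proof -
  have "bcrit I b = (\<Sum>j\<in>G. smult (of_real (1 - (cmod (b j))\<^sup>2)) (\<Prod>i\<in>I - {j}. blq (b i)))"
    unfolding bcrit_def
  proof (rule sum.mono_neutral_right)
    show "\<forall>j\<in>I - G. smult (of_real (1 - (cmod (b j))\<^sup>2)) (\<Prod>i\<in>I - {j}. blq (b i)) = 0"
    proof
      fix j assume "j \<in> I - G"
      then have "cmod (b j) = 1" using assms(2)[of j] by (auto simp: G_def)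
      then show "smult (of_real (1 - (cmod (b j))\<^sup>2)) (\<Prod>i\<in>I - {j}. blq (b i)) = 0" by simp
    qed
  qed (use assms in auto)
  also have "\<dots> = (\<Sum>j\<in>G. (\<Prod>i\<in>I - G. blq (b i)) * smult (of_real (1 - (cmod (b j))\<^sup>2)) (\<Prod>i\<in>G - {j}. blq (b i)))"
  proof (rule sum.cong[OF refl])
    fix j assume j: "j \<in> G"
    have "I - {j} = (I - G) \<union> (G - {j})" using j by (auto simp: G_def)
    then have "(\<Prod>i\<in>I - {j}. blq (b i)) = (\<Prod>i\<in>I - G. blq (b i)) * (\<Prod>i\<in>G - {j}. blq (b i))"
      using assms(1) by (simp add: G_def, intro prod.union_disjoint) auto
    then show "smult (of_real (1 - (cmod (b j))\<^sup>2)) (\<Prod>i\<in>I - {j}. blq (b i)) =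
      (\<Prod>i\<in>I - G. blq (b i)) * smult (of_real (1 - (cmod (b j))\<^sup>2)) (\<Prod>i\<in>G - {j}. blq (b i))"
      by (simp only: mult_smult_right)
  qed
  finally show ?thesis by (simp only: bcrit_def sum_distrib_left)
qed

lemma tendsto_poly_blq:
  assumes "(\<lambda>n. c n) \<longlonglongrightarrow> c'"
  shows "(\<lambda>n. poly (blq (c n)) w) \<longlonglongrightarrow> poly (blq c') w"
  unfolding poly_blq by (intro tendsto_intros assms)

lemma tendsto_poly_bcrit:
  assumes "\<And>i. i \<in> I \<Longrightarrow> (\<lambda>n. b n i) \<longlonglongrightarrow> \<beta> i"
  shows "(\<lambda>n. poly (bcrit I (b n)) w) \<longlonglongrightarrow> poly (bcrit I \<beta>) w"
  unfolding bcrit_def poly_sum poly_smult poly_prod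
  by (intro tendsto_intros tendsto_poly_blq assms) auto

text \<open>Both forms of \<open>bcrit\<close> converge to one polynomial. By
  \<open>bcrit_degenerate\<close> it has at least as many roots in the disk as there are zeros that
  stay inside, less one; in the factored form its roots in the disk are limits of critical
  points.\<close>

lemma critical_limit_count:
  assumes b: "\<And>n i. cmod (b n i) < 1" "\<And>i. i < d \<Longrightarrow> (\<lambda>n. b n i) \<longlonglongrightarrow> \<beta> i"
    and c: "\<And>n i. cmod (c n i) < 1" "\<And>i. i < d \<Longrightarrow> (\<lambda>n. c n i) \<longlonglongrightarrow> \<gamma> i"
    and N: "\<And>n. bcrit {..<d} (b n) = smult (\<kappa> n) (\<Prod>i<d - 1. blq (c n i))"
  shows "card {i. i < d \<and> cmod (\<beta> i) < 1} \<le> card {i. i < d - 1 \<and> cmod (\<gamma> i) < 1} + 1"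
proof -
  let ?G = "{i \<in> {..<d}. cmod (\<beta> i) < 1}"
  show ?thesis
  proof (cases "?G = {}")
    case False
    have \<beta>1: "cmod (\<beta> i) \<le> 1" if "i < d" for i
      by (rule LIMSEQ_le_const2[OF tendsto_norm[OF b(2)[OF that]]]) (use b(1) in \<open>auto intro: less_imp_le\<close>)
    have \<gamma>1: "cmod (\<gamma> i) \<le> 1" if "i < d" for i
      by (rule LIMSEQ_le_const2[OF tendsto_norm[OF c(2)[OF that]]]) (use c(1) in \<open>auto intro: less_imp_le\<close>)
    obtain k e where ke: "k \<noteq> 0" "\<And>i. cmod (e i) < 1" "bcrit ?G \<beta> = smult k (\<Prod>i<card ?G - 1. blq (e i))"
      by (rule bcrit_factor[of ?G \<beta>]) (use False in auto)
    have deg: "bcrit {..<d} \<beta> = (\<Prod>i\<in>{..<d} - ?G. blq (\<beta> i)) * bcrit ?G \<beta>"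
      using bcrit_degenerate[of "{..<d}" \<beta>] \<beta>1 by auto
    have nz: "(\<Prod>i\<in>A. blq (x i)) \<noteq> 0" if "finite A" for A :: "nat set" and x using that by (simp add: blq_nonzero)
    have nzG: "bcrit ?G \<beta> \<noteq> 0" unfolding ke(3) using ke(1) by (auto simp: blq_nonzero)
    have nzN: "bcrit {..<d} \<beta> \<noteq> 0" unfolding deg using nzG by (auto simp: blq_nonzero)
    let ?R = "\<Prod>i<d - 1. blq (\<gamma> i)"
    have conv: "(\<lambda>n. \<kappa> n * poly (\<Prod>i<d - 1. blq (c n i)) w) \<longlonglongrightarrow> poly (bcrit {..<d} \<beta>) w" for w
    proof -
      have "(\<lambda>n. poly (bcrit {..<d} (b n)) w) \<longlonglongrightarrow> poly (bcrit {..<d} \<beta>) w"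
        by (intro tendsto_poly_bcrit) (use b in auto)
      then show ?thesis unfolding N by simp
    qed
    have convR: "(\<lambda>n. poly (\<Prod>i<d - 1. blq (c n i)) w) \<longlonglongrightarrow> poly ?R w" for w
      unfolding poly_prod by (intro tendsto_intros tendsto_poly_blq c(2)) auto
    \<comment> \<open>Evaluating at a point where the limit product is nonzero shows that the
      constants \<kappa> n converge.\<close>
    obtain w0 where w0: "poly ?R w0 \<noteq> 0"
      using nz[of "{..<d - 1}" \<gamma>] poly_all_0_iff_0 by blast
    define q where "q = poly (bcrit {..<d} \<beta>) w0 / poly ?R w0"
    have "(\<lambda>n. \<kappa> n * poly (\<Prod>i<d - 1. blq (c n i)) w0 / poly (\<Prod>i<d - 1. blq (c n i)) w0) \<longlonglongrightarrow> q"
      unfolding q_def by (intro tendsto_divide conv convR w0)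
    moreover have "eventually (\<lambda>n. poly (\<Prod>i<d - 1. blq (c n i)) w0 \<noteq> 0) sequentially"
      using tendsto_imp_eventually_ne[OF convR w0] .
    then have "eventually (\<lambda>n. \<kappa> n * poly (\<Prod>i<d - 1. blq (c n i)) w0 / poly (\<Prod>i<d - 1. blq (c n i)) w0 = \<kappa> n) sequentially"
      by eventually_elim simp
    ultimately have q: "\<kappa> \<longlonglongrightarrow> q" using Lim_transform_eventually by fast
    have "poly (bcrit {..<d} \<beta>) w = poly (smult q ?R) w" for w
    proof -
      have "(\<lambda>n. \<kappa> n * poly (\<Prod>i<d - 1. blq (c n i)) w) \<longlonglongrightarrow> q * poly ?R w"
        by (intro tendsto_mult q convR)
      with conv[of w] have "poly (bcrit {..<d} \<beta>) w = q * poly ?R w" by (rule LIMSEQ_unique)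
      then show ?thesis by simp
    qed
    then have eq: "bcrit {..<d} \<beta> = smult q ?R"
      by (intro poly_eq_poly_eq_iff[THEN iffD1] ext)
    then have q0: "q \<noteq> 0" using nzN by auto
    have "card ?G - 1 = disk_zeros (bcrit ?G \<beta>)"
      unfolding ke(3) using ke(1,2) by (simp add: disk_zeros_smult disk_zeros_prod_blq less_imp_le)
    also have "\<dots> \<le> disk_zeros (bcrit {..<d} \<beta>)"
      unfolding deg using nzG nz[of "{..<d} - ?G" \<beta>] by (simp add: disk_zeros_mult)
    also have "\<dots> = card {i\<in>{..<d - 1}. cmod (\<gamma> i) < 1}"
      unfolding eq disk_zeros_smult[OF q0] by (intro disk_zeros_prod_blq) (auto intro!: \<gamma>1)
    finally show ?thesis by simp
  next
    case True
    then have "{i. i < d \<and> cmod (\<beta> i) < 1} = {}" by auto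
    then show ?thesis by (simp only: card.empty zero_le)
  qed
qed

text \<open>The cause of degree loss in the limit: a factor whose zero reaches the circle
  degenerates to a constant.\<close>

lemma mob_to0_unimodular:
  assumes "cmod b = 1" "w \<noteq> b"
  shows "mob_to0 b w = - b"
proof -
  have bb: "b * cnj b = 1" using assms by (simp flip: complex_norm_square)
  have "(- b) * (1 - cnj b * w) = (b * cnj b) * w - b" by (simp add: algebra_simps)
  then have e: "w - b = (- b) * (1 - cnj b * w)" unfolding bb by simp
  have "1 - cnj b * w \<noteq> 0"
  proof
    assume h: "1 - cnj b * w = 0"
    have "w - b = 0" unfolding e h by (rule mult_zero_right)
    then show False using assms(2) by (simp only: right_minus_eq)
  qed
  then show ?thesis unfolding mob_to0_def e by (rule nonzero_mult_div_cancel_right)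
qed

text \<open>Inside the disk the maps converge to a product over the zeros that do not escape.
  Julia's inequality with the fixed bound L passes to the limit and, along the radius ending at
  \<open>\<eta> j\<close>, forces the limit map to fix that point. The fixed points of the limit are
  then counted by its degree.\<close>

lemma boundary_fixed_limit_count:
  assumes u: "\<And>n. cmod (u n) = 1" "u \<longlonglongrightarrow> U"
    and b: "\<And>n i. cmod (b n i) < 1" "\<And>i. i < d \<Longrightarrow> (\<lambda>n. b n i) \<longlonglongrightarrow> \<beta> i"
    and y: "finite J" "\<And>n j. j \<in> J \<Longrightarrow> cmod (y n j) = 1" "\<And>j. j \<in> J \<Longrightarrow> (\<lambda>n. y n j) \<longlonglongrightarrow> \<eta> j" "inj_on \<eta> J"
    and L: "L \<ge> 0"
    and J: "\<And>n j z. j \<in> J \<Longrightarrow> cmod z < 1 \<Longrightarrow>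
       (cmod (y n j - u n * bprod {..<d} (b n) (cnj z)))\<^sup>2 * (1 - (cmod z)\<^sup>2)
         \<le> L * (1 - (cmod (u n * bprod {..<d} (b n) (cnj z)))\<^sup>2) * (cmod (y n j - z))\<^sup>2"
  shows "card J \<le> card {i. i < d \<and> cmod (\<beta> i) < 1} + 1"
proof (cases "J = {}")
  case False
  let ?G = "{i \<in> {..<d}. cmod (\<beta> i) < 1}"
  define U' where "U' = U * (\<Prod>i\<in>{..<d} - ?G. - \<beta> i)"
  define g where "g = (\<lambda>z. U' * bprod ?G \<beta> (cnj z))"
  have \<beta>1: "cmod (\<beta> i) \<le> 1" if "i < d" for i
    by (rule LIMSEQ_le_const2[OF tendsto_norm[OF b(2)[OF that]]]) (use b(1) in \<open>auto intro: less_imp_le\<close>)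
  have conv: "(\<lambda>n. u n * bprod {..<d} (b n) (cnj z)) \<longlonglongrightarrow> g z" if z: "cmod z < 1" for z
  proof -
    have "(\<lambda>n. mob_to0 (b n i) (cnj z)) \<longlonglongrightarrow> mob_to0 (\<beta> i) (cnj z)" if "i < d" for i
    proof -
      have "cmod (cnj (\<beta> i) * cnj z) \<le> 1 * cmod z" using \<beta>1[OF that] by (simp add: norm_mult mult_left_le_one_le)
      then have "1 - cnj (\<beta> i) * cnj z \<noteq> 0" using z by auto
      then show ?thesis unfolding mob_to0_def by (intro tendsto_intros b(2) that)
    qed
    then have "(\<lambda>n. u n * bprod {..<d} (b n) (cnj z)) \<longlonglongrightarrow> U * (\<Prod>i<d. mob_to0 (\<beta> i) (cnj z))"
      unfolding bprod_def by (intro tendsto_mult u(2) tendsto_prod) auto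
    also have "(\<Prod>i<d. mob_to0 (\<beta> i) (cnj z)) = (\<Prod>i\<in>{..<d} - ?G. mob_to0 (\<beta> i) (cnj z)) * bprod ?G \<beta> (cnj z)"
      unfolding bprod_def by (rule prod.subset_diff) auto
    also have "(\<Prod>i\<in>{..<d} - ?G. mob_to0 (\<beta> i) (cnj z)) = (\<Prod>i\<in>{..<d} - ?G. - \<beta> i)"
    proof (intro prod.cong refl mob_to0_unimodular)
      fix i assume "i \<in> {..<d} - ?G"
      then show "cmod (\<beta> i) = 1" using \<beta>1[of i] by auto
      then show "cnj z \<noteq> \<beta> i" using z by (metis complex_mod_cnj less_irrefl)
    qed
    finally show ?thesis by (simp add: g_def U'_def mult.assoc)
  qed
  have g1: "cmod (g z) \<le> 1" if z: "cmod z < 1" for z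
  proof (rule LIMSEQ_le_const2[OF tendsto_norm[OF conv[OF z]]])
    show "\<exists>N. \<forall>n\<ge>N. cmod (u n * bprod {..<d} (b n) (cnj z)) \<le> 1"
      using u(1) bprod_norm_le1[of "{..<d}" "b _" "cnj z"] b(1) z by (auto simp: norm_mult less_imp_le)
  qed
  have fixd: "g (\<eta> j) = \<eta> j" if j: "j \<in> J" for j
  proof -
    have \<eta>1: "cmod (\<eta> j) = 1"
      using tendsto_norm[OF y(3)[OF j]] by (simp add: y(2)[OF j] LIMSEQ_const_iff)
    have ineq: "(cmod (\<eta> j - g z))\<^sup>2 * (1 - (cmod z)\<^sup>2) \<le> L * (cmod (\<eta> j - z))\<^sup>2" if z: "cmod z < 1" for z
    proof -
      have "(\<lambda>n. (cmod (y n j - u n * bprod {..<d} (b n) (cnj z)))\<^sup>2 * (1 - (cmod z)\<^sup>2))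
          \<longlonglongrightarrow> (cmod (\<eta> j - g z))\<^sup>2 * (1 - (cmod z)\<^sup>2)"
        by (intro tendsto_intros conv z y(3) j)
      moreover have "(\<lambda>n. L * (1 - (cmod (u n * bprod {..<d} (b n) (cnj z)))\<^sup>2) * (cmod (y n j - z))\<^sup>2)
          \<longlonglongrightarrow> L * (1 - (cmod (g z))\<^sup>2) * (cmod (\<eta> j - z))\<^sup>2"
        by (intro tendsto_intros conv z y(3) j)
      ultimately have "(cmod (\<eta> j - g z))\<^sup>2 * (1 - (cmod z)\<^sup>2) \<le> L * (1 - (cmod (g z))\<^sup>2) * (cmod (\<eta> j - z))\<^sup>2"
        by (rule LIMSEQ_le) (use J[OF j z] in blast)
      also have "\<dots> \<le> L * 1 * (cmod (\<eta> j - z))\<^sup>2"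
        using L g1[OF z] by (intro mult_right_mono mult_left_mono) auto
      finally show ?thesis by simp
    qed
    have cont: "isCont g (\<eta> j)"
    proof -
      have "isCont (\<lambda>z. mob_to0 (\<beta> i) (cnj z)) (\<eta> j)" if "i \<in> ?G" for i
        unfolding mob_to0_def using mob_den_nz[of "\<beta> i" "cnj (\<eta> j)"] that \<eta>1 by (intro continuous_intros) auto
      then show ?thesis unfolding g_def bprod_def by (intro continuous_intros) auto
    qed
    let ?s = "\<lambda>n. 1 - 1 / (real n + 2)"
    have s: "(\<lambda>n. 1 / (real n + 2)) \<longlonglongrightarrow> 0" by real_asymp
    have "(\<lambda>n. complex_of_real (?s n) * \<eta> j) \<longlonglongrightarrow> of_real (1 - 0) * \<eta> j"
      by (intro tendsto_intros s)
    then have s1: "(\<lambda>n. complex_of_real (?s n) * \<eta> j) \<longlonglongrightarrow> \<eta> j" by simp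
    \<comment> \<open>At distance \<tau> from the boundary point the right side is at most L
      \<tau>^2, while the factor 1 - |z|^2 on the left is at least \<tau>.\<close>
    have "(cmod (\<eta> j - g (of_real (?s n) * \<eta> j)))\<^sup>2 \<le> L * (1 / (real n + 2))" for n
    proof -
      define \<tau> where "\<tau> = 1 / (real n + 2)"
      have t: "0 < \<tau>" "\<tau> < 1" by (auto simp: \<tau>_def)
      have n1: "cmod (of_real (1 - \<tau>) * \<eta> j) = 1 - \<tau>" unfolding norm_mult \<eta>1 norm_of_real using t by simp
      have n2: "cmod (\<eta> j - of_real (1 - \<tau>) * \<eta> j) = \<tau>"
      proof -
        have "\<eta> j - of_real (1 - \<tau>) * \<eta> j = of_real \<tau> * \<eta> j" by (simp add: algebra_simps)
        then show ?thesis unfolding norm_mult \<eta>1 using t by (simp add: norm_mult \<eta>1)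
      qed
      have "(cmod (\<eta> j - g (of_real (1 - \<tau>) * \<eta> j)))\<^sup>2 * (1 - (1 - \<tau>)\<^sup>2) \<le> L * \<tau>\<^sup>2"
        using ineq[of "of_real (1 - \<tau>) * \<eta> j"] unfolding n1 n2 using t by simp
      moreover have "\<tau> \<le> 1 - (1 - \<tau>)\<^sup>2"
      proof -
        have "1 - (1 - \<tau>)\<^sup>2 - \<tau> = \<tau> * (1 - \<tau>)" by (simp only: power2_eq_square) algebra
        also have "\<dots> \<ge> 0" using t by (intro mult_nonneg_nonneg) auto
        finally show ?thesis by linarith
      qed
      then have "(cmod (\<eta> j - g (of_real (1 - \<tau>) * \<eta> j)))\<^sup>2 * \<tau> \<le> (cmod (\<eta> j - g (of_real (1 - \<tau>) * \<eta> j)))\<^sup>2 * (1 - (1 - \<tau>)\<^sup>2)"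
        by (intro mult_left_mono) auto
      ultimately have "(cmod (\<eta> j - g (of_real (1 - \<tau>) * \<eta> j)))\<^sup>2 * \<tau> \<le> (L * \<tau>) * \<tau>"
        by (simp only: power2_eq_square mult.assoc)
      then show ?thesis unfolding \<tau>_def[symmetric] using t(1) by (rule mult_right_le_imp_le)
    qed
    moreover have "(\<lambda>n. (cmod (\<eta> j - g (of_real (?s n) * \<eta> j)))\<^sup>2) \<longlonglongrightarrow> (cmod (\<eta> j - g (\<eta> j)))\<^sup>2"
      by (intro tendsto_intros isCont_tendsto_compose[OF cont] s1)
    moreover have "(\<lambda>n. L * (1 / (real n + 2))) \<longlonglongrightarrow> L * 0" by (intro tendsto_intros s)
    ultimately have "(cmod (\<eta> j - g (\<eta> j)))\<^sup>2 \<le> L * 0" by (meson LIMSEQ_le)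
    then show ?thesis by simp
  qed
  have "\<eta> ` J \<subseteq> {z. cmod z = 1 \<and> U' * bprod ?G \<beta> (cnj z) = z}"
  proof
    fix z assume "z \<in> \<eta> ` J"
    then obtain j where j: "j \<in> J" "z = \<eta> j" by auto
    have "cmod (\<eta> j) = 1"
      using tendsto_norm[OF y(3)[OF j(1)]] by (simp add: y(2)[OF j(1)] LIMSEQ_const_iff)
    then show "z \<in> {z. cmod z = 1 \<and> U' * bprod ?G \<beta> (cnj z) = z}" using fixd[OF j(1)] j(2) by (simp add: g_def)
  qed
  then have "card (\<eta> ` J) \<le> card ?G + 1" by (intro bprod_circle_fixed_card(2)[of ?G \<beta>]) auto
  then show ?thesis using card_image[OF y(4)] by simp
qed auto

lemma hdist_mob: "hdist z p = 2 * artanh (cmod (mob_to0 p z))"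
  by (simp add: hdist_def mob_to0_def norm_divide)

text \<open>By contradiction: for every k take a map with too few critical points within distance k,
  recentre it, and let zeros, critical points and fixed points converge along a subsequence. Each of
  the two limit counts loses 1, whence the 2; a critical point whose limit is inside the disk stays
  at bounded distance.\<close>

lemma crit_count_lower_bound:
  fixes f :: "nat \<Rightarrow> complex \<Rightarrow> complex" and p :: "nat \<Rightarrow> complex" and x :: "nat \<Rightarrow> 'j \<Rightarrow> complex"
  assumes d: "d \<ge> 1" and f: "\<And>n. f n \<in> Bminus d" and p: "\<And>n. cmod (p n) < 1" and L: "L \<ge> 0" and J: "finite J"
    and x: "\<And>n j. j \<in> J \<Longrightarrow> cmod (x n j) = 1" "\<And>n j. j \<in> J \<Longrightarrow> f n (x n j) = x n j"
      "\<And>n j. j \<in> J \<Longrightarrow> cmod (dbar (f n) (x n j)) \<le> L"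
    and \<delta>: "\<delta> > 0" "\<And>n i j. i \<in> J \<Longrightarrow> j \<in> J \<Longrightarrow> i \<noteq> j \<Longrightarrow> \<delta> \<le> cmod (mob_to0 (p n) (x n i) - mob_to0 (p n) (x n j))"
  shows "\<exists>R N. \<forall>n\<ge>N. card J \<le> crit_count (f n) (p n) R + 2"
proof (rule ccontr)
  assume "\<not> ?thesis"
  then have "\<forall>k. \<exists>n. crit_count (f n) (p n) (real k) + 2 < card J" by (meson not_le)
  \<comment> \<open>The indices s k need not increase; only the radius k has to tend to
    infinity.\<close>
  then obtain s where s: "\<And>k. crit_count (f (s k)) (p (s k)) (real k) + 2 < card J" by metis
  define Good where "Good = (\<lambda>k (u, b, c, \<kappa>).
      cmod u = 1 \<and> (\<forall>i::nat. cmod (b i) < 1) \<and> (\<forall>i::nat. cmod (c i) < 1) \<and>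
      (\<forall>z. cmod z \<le> 1 \<longrightarrow> mob_to0 (p (s k)) (f (s k) (mob_to0 (- p (s k)) z)) = u * bprod {..<d} b (cnj z)) \<and>
      bcrit {..<d} b = smult \<kappa> (\<Prod>i<d - 1. blq (c i)) \<and>
      (\<forall>q R. crit_count (f (s k)) q R = card {i. i < d - 1 \<and> hdist (mob_to0 (- p (s k)) (cnj (c i))) q \<le> R}))"
  have "\<exists>q. Good k q" for k
  proof (rule Bminus_recentre[OF f[of "s k"] d p[of "s k"]], goal_cases)
    case (1 u b c \<kappa>)
    then show ?case by (intro exI[of _ "(u, b, c, \<kappa>)"]) (simp add: Good_def)
  qed
  then obtain Q where Q: "\<And>k. Good k (Q k)" by metis
  define u where "u = (\<lambda>k. fst (Q k))"
  define b where "b = (\<lambda>k. fst (snd (Q k)))"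
  define c where "c = (\<lambda>k. fst (snd (snd (Q k))))"
  define \<kappa> where "\<kappa> = (\<lambda>k. snd (snd (snd (Q k))))"
  have Q1: "cmod (u k) = 1" "cmod (b k i) < 1" "cmod (c k i) < 1"
    "cmod z \<le> 1 \<Longrightarrow> mob_to0 (p (s k)) (f (s k) (mob_to0 (- p (s k)) z)) = u k * bprod {..<d} (b k) (cnj z)"
    "bcrit {..<d} (b k) = smult (\<kappa> k) (\<Prod>i<d - 1. blq (c k i))"
    "crit_count (f (s k)) q R = card {i. i < d - 1 \<and> hdist (mob_to0 (- p (s k)) (cnj (c k i))) q \<le> R}" for k i z q R
    using Q[of k] by (auto simp: Good_def u_def b_def c_def \<kappa>_def split: prod.splits)
  define y where "y = (\<lambda>k j. mob_to0 (p (s k)) (x (s k) j))"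
  have y1: "cmod (y k j) = 1" if "j \<in> J" for k j
    unfolding y_def using mob_to0_norm_eq1[OF p x(1)[OF that]] .
  \<comment> \<open>One index set for all quantities that must converge together: zeros, critical
    points, fixed points and the unimodular factor.\<close>
  let ?I = "(Inl ` (Inl ` {..<d} \<union> Inr ` {..<d}) \<union> Inr ` (Inl ` J \<union> {Inr ()})) :: ((nat + nat) + ('j + unit)) set"
  define X :: "(nat + nat) + ('j + unit) \<Rightarrow> nat \<Rightarrow> complex"
    where "X = (\<lambda>i k. case i of Inl (Inl i) \<Rightarrow> b k i | Inl (Inr i) \<Rightarrow> c k i | Inr (Inl j) \<Rightarrow> y k j | Inr (Inr _) \<Rightarrow> u k)"
  obtain r l where r: "strict_mono (r :: nat \<Rightarrow> nat)" and l: "\<And>i. i \<in> ?I \<Longrightarrow> l i \<in> cball 0 1 \<and> (\<lambda>n. X i (r n)) \<longlonglongrightarrow> l i"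
  proof (rule finite_family_subsequence[of ?I "\<lambda>_. cball 0 1" X])
    show "finite ?I" using J by auto
    show "X i n \<in> cball 0 1" if "i \<in> ?I" for i n
      using that Q1(1-3) y1 by (auto simp: X_def less_imp_le)
  qed auto
  define \<beta> where "\<beta> = (\<lambda>i. l (Inl (Inl i)))"
  define \<gamma> where "\<gamma> = (\<lambda>i. l (Inl (Inr i)))"
  define \<eta> where "\<eta> = (\<lambda>j. l (Inr (Inl j)))"
  have lims: "(\<lambda>n. b (r n) i) \<longlonglongrightarrow> \<beta> i" "(\<lambda>n. c (r n) i) \<longlonglongrightarrow> \<gamma> i" if "i < d" for i
    using l[of "Inl (Inl i)"] l[of "Inl (Inr i)"] that by (auto simp: X_def \<beta>_def \<gamma>_def)
  have limy: "(\<lambda>n. y (r n) j) \<longlonglongrightarrow> \<eta> j" if "j \<in> J" for j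
    using l[of "Inr (Inl j)"] that by (auto simp: X_def \<eta>_def)
  have limu: "(\<lambda>n. u (r n)) \<longlonglongrightarrow> l (Inr (Inr ()))"
    using l[of "Inr (Inr ())"] by (auto simp: X_def)
  have inj: "inj_on \<eta> J"
  proof (rule inj_onI, rule ccontr)
    fix i j assume ij: "i \<in> J" "j \<in> J" "\<eta> i = \<eta> j" "i \<noteq> j"
    have "(\<lambda>n. cmod (y (r n) i - y (r n) j)) \<longlonglongrightarrow> cmod (\<eta> i - \<eta> j)"
      by (intro tendsto_intros limy ij)
    moreover have "\<delta> \<le> cmod (y (r n) i - y (r n) j)" for n using \<delta>(2)[OF ij(1,2,4)] by (simp add: y_def)
    ultimately have "\<delta> \<le> cmod (\<eta> i - \<eta> j)" by (intro LIMSEQ_le_const) auto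
    then show False using ij \<delta>(1) by simp
  qed
  have "card J \<le> card {i. i < d \<and> cmod (\<beta> i) < 1} + 1"
  proof (rule boundary_fixed_limit_count[where u = "\<lambda>n. u (r n)" and b = "\<lambda>n. b (r n)" and y = "\<lambda>n. y (r n)" and L = L])
    fix n j z assume j: "j \<in> J" and z: "cmod (z::complex) < 1"
    let ?p = "p (s (r n))" and ?f = "f (s (r n))" and ?x = "x (s (r n)) j"
    let ?\<zeta> = "mob_to0 (- ?p) z"
    have \<zeta>: "cmod ?\<zeta> < 1" using mob_to0_norm_less1[of "- ?p" z] p z by simp
    have f\<zeta>: "cmod (?f ?\<zeta>) < 1" by (rule Bminus_norm_less1[OF f d \<zeta>])
    have "(cmod (?x - ?f ?\<zeta>))\<^sup>2 * (1 - (cmod ?\<zeta>)\<^sup>2) \<le> cmod (dbar ?f ?x) * (1 - (cmod (?f ?\<zeta>))\<^sup>2) * (cmod (?x - ?\<zeta>))\<^sup>2"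
      by (rule Bminus_julia[OF f d]) (use x j \<zeta> in auto)
    also have "\<dots> \<le> L * (1 - (cmod (?f ?\<zeta>))\<^sup>2) * (cmod (?x - ?\<zeta>))\<^sup>2"
      using x(3)[OF j] f\<zeta> by (intro mult_right_mono) (auto simp: power_le_one)
    finally have "(cmod (mob_to0 ?p ?x - mob_to0 ?p (?f ?\<zeta>)))\<^sup>2 * (1 - (cmod (mob_to0 ?p ?\<zeta>))\<^sup>2)
      \<le> L * (1 - (cmod (mob_to0 ?p (?f ?\<zeta>)))\<^sup>2) * (cmod (mob_to0 ?p ?x - mob_to0 ?p ?\<zeta>))\<^sup>2"
      using x(1)[OF j] \<zeta> f\<zeta> by (intro mob_to0_scaled_inequality p) auto
    moreover have "mob_to0 ?p ?\<zeta> = z" using mob_to0_inverse(1)[of ?p z] p z by simp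
    moreover have "mob_to0 ?p (?f ?\<zeta>) = u (r n) * bprod {..<d} (b (r n)) (cnj z)" using Q1(4)[of z] z by simp
    ultimately show "(cmod (y (r n) j - u (r n) * bprod {..<d} (b (r n)) (cnj z)))\<^sup>2 * (1 - (cmod z)\<^sup>2)
      \<le> L * (1 - (cmod (u (r n) * bprod {..<d} (b (r n)) (cnj z)))\<^sup>2) * (cmod (y (r n) j - z))\<^sup>2"
      by (simp add: y_def)
  qed (use Q1 lims limu limy y1 J L inj in auto)
  also have "card {i. i < d \<and> cmod (\<beta> i) < 1} \<le> card {i. i < d - 1 \<and> cmod (\<gamma> i) < 1} + 1"
    by (rule critical_limit_count[where b = "\<lambda>n. b (r n)" and c = "\<lambda>n. c (r n)" and \<kappa> = "\<lambda>n. \<kappa> (r n)"])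
       (use Q1 lims in auto)
  finally have le: "card J \<le> card {i. i < d - 1 \<and> cmod (\<gamma> i) < 1} + 2" by simp
  have "eventually (\<lambda>n. \<forall>i\<in>{i. i < d - 1 \<and> cmod (\<gamma> i) < 1}. 2 * artanh (cmod (c (r n) i)) \<le> real (r n)) sequentially"
  proof (rule eventually_ball_finite)
    show "\<forall>i\<in>{i. i < d - 1 \<and> cmod (\<gamma> i) < 1}. eventually (\<lambda>n. 2 * artanh (cmod (c (r n) i)) \<le> real (r n)) sequentially"
    proof
      fix i assume i: "i \<in> {i. i < d - 1 \<and> cmod (\<gamma> i) < 1}"
      have "(\<lambda>n. 2 * artanh (cmod (c (r n) i))) \<longlonglongrightarrow> 2 * artanh (cmod (\<gamma> i))"
        using i by (intro tendsto_intros lims) (auto intro: less_le_trans[of "- 1" 0])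
      then have 1: "eventually (\<lambda>n. 2 * artanh (cmod (c (r n) i)) < 2 * artanh (cmod (\<gamma> i)) + 1) sequentially"
        by (rule order_tendstoD) simp
      have 2: "eventually (\<lambda>n. 2 * artanh (cmod (\<gamma> i)) + 1 \<le> real n) sequentially"
        using filterlim_real_sequentially by (simp add: filterlim_at_top)
      from 1 2 show "eventually (\<lambda>n. 2 * artanh (cmod (c (r n) i)) \<le> real (r n)) sequentially"
      proof eventually_elim
        case (elim n)
        have "real n \<le> real (r n)" using seq_suble[OF r] by simp
        then show ?case using elim by linarith
      qed
    qed
  qed auto
  then obtain n where n: "\<forall>i\<in>{i. i < d - 1 \<and> cmod (\<gamma> i) < 1}. 2 * artanh (cmod (c (r n) i)) \<le> real (r n)"
    using eventually_happens'[OF sequentially_bot] by blast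
  have h: "hdist (mob_to0 (- p (s (r n))) (cnj (c (r n) i))) (p (s (r n))) = 2 * artanh (cmod (c (r n) i))" for i
    using mob_to0_inverse(1)[OF p[of "s (r n)"], of "cnj (c (r n) i)"] Q1(3)[of "r n" i] by (simp add: hdist_mob)
  have "card {i. i < d - 1 \<and> cmod (\<gamma> i) < 1} \<le> crit_count (f (s (r n))) (p (s (r n))) (real (r n))"
    unfolding Q1(6) h using n by (intro card_mono) auto
  then show False using le s[of "r n"] by linarith
qed

section \<open>Expanding circle maps and the conjugacy\<close>

text \<open>\<phi> lifts a circle map of degree -d and \<psi> is the modulus of its derivative. The
  Lipschitz bound on ln \<psi> is the regularity from which quasisymmetry of the conjugacy
  follows.\<close>

locale expanding_circle_lift =
  fixes d :: nat and \<phi> \<psi> :: "real \<Rightarrow> real" and \<mu> C L :: real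
  assumes d2: "d \<ge> 2"
    and period: "\<phi> (t + 1) = \<phi> t - real d"
    and deriv: "(\<phi> has_real_derivative - \<psi> t) (at t)"
    and expand: "\<mu> \<le> \<psi> t"
    and mu: "\<mu> > 1"
    and bound: "\<bar>\<phi> t + real d * t\<bar> \<le> C"
    and distort: "\<bar>ln (\<psi> s) - ln (\<psi> t)\<bar> \<le> L * \<bar>s - t\<bar>"
    and L: "L \<ge> 0"
begin

lemma phi_cont: "isCont \<phi> t"
  using deriv DERIV_isCont by blast

lemma mean_value:
  assumes "s < t"
  obtains z where "s < z" "z < t" "\<phi> s - \<phi> t = \<psi> z * (t - s)"
proof -
  obtain z where "s < z" "z < t" "\<phi> t - \<phi> s = (t - s) * - \<psi> z"
    using MVT2[OF assms, of \<phi> "\<lambda>z. - \<psi> z"] deriv by blast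
  then show ?thesis using that[of z] by (simp add: algebra_simps)
qed

lemma psi_pos: "\<psi> t > 0"
  using expand[of t] mu by linarith

lemma expanding: "s \<le> t \<Longrightarrow> \<mu> * (t - s) \<le> \<phi> s - \<phi> t"
proof (cases "s = t")
  case False
  assume "s \<le> t"
  with False have "s < t" by simp
  then obtain z where z: "\<phi> s - \<phi> t = \<psi> z * (t - s)" by (rule mean_value)
  show ?thesis unfolding z using expand[of z] \<open>s < t\<close> by (intro mult_right_mono) auto
qed simp

lemma abs_expanding: "\<mu> * \<bar>t - s\<bar> \<le> \<bar>\<phi> t - \<phi> s\<bar>"
  using expanding[of s t] expanding[of t s] mu by (cases "s \<le> t") auto

lemma phi_decreasing: "s < t \<Longrightarrow> \<phi> t < \<phi> s"
proof -
  assume "s < t"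
  then have "0 < \<mu> * (t - s)" using mu by simp
  then show ?thesis using expanding[of s t] \<open>s < t\<close> by simp
qed

lemma period_int: "\<phi> (t + of_int m) = \<phi> t - real d * of_int m"
proof -
  have n: "\<phi> (t + real n) = \<phi> t - real d * real n" for t n
  proof (induction n)
    case (Suc n)
    have e: "t + real (Suc n) = (t + real n) + 1" by simp
    show ?case unfolding e period Suc.IH by (simp add: algebra_simps)
  qed simp
  show ?thesis
  proof (cases "m \<ge> 0")
    case True
    then show ?thesis using n[of t "nat m"] by simp
  next
    case False
    then show ?thesis using n[of "t + of_int m" "nat (- m)"] by simp
  qed
qed

lemma funpow_period: "(\<phi> ^^ n) (t + of_int m) = (\<phi> ^^ n) t + (- real d) ^ n * of_int m"
proof (induction n arbitrary: m t)
  case (Suc n)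
  have "(\<phi> ^^ Suc n) (t + of_int m) = (\<phi> ^^ n) (\<phi> t + of_int (- int d * m))"
    by (simp add: funpow_Suc_right period_int del: funpow.simps)
  then show ?case unfolding Suc.IH by (simp add: funpow_Suc_right algebra_simps del: funpow.simps)
qed simp

lemma funpow_expanding: "s \<le> t \<Longrightarrow> \<mu> ^ n * (t - s) \<le> (- 1) ^ n * ((\<phi> ^^ n) t - (\<phi> ^^ n) s)"
proof (induction n arbitrary: s t)
  case (Suc n)
  have le: "\<mu> * (t - s) \<le> \<phi> s - \<phi> t" using expanding Suc.prems by blast
  moreover have "0 \<le> \<mu> * (t - s)" using mu Suc.prems by simp
  ultimately have "\<phi> t \<le> \<phi> s" by linarith
  from Suc.IH[OF this] have "\<mu> ^ n * (\<phi> s - \<phi> t) \<le> (- 1) ^ Suc n * ((\<phi> ^^ Suc n) t - (\<phi> ^^ Suc n) s)"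
    by (simp add: funpow_Suc_right algebra_simps del: funpow.simps)
  moreover have "\<mu> ^ Suc n * (t - s) \<le> \<mu> ^ n * (\<phi> s - \<phi> t)"
    using mult_left_mono[OF le, of "\<mu> ^ n"] mu by (simp add: mult_ac)
  ultimately show ?case by linarith
qed simp

lemma funpow_abs_expanding: "\<mu> ^ n * \<bar>t - s\<bar> \<le> \<bar>(\<phi> ^^ n) t - (\<phi> ^^ n) s\<bar>"
proof -
  have *: "\<mu> ^ n * (t - s) \<le> \<bar>(\<phi> ^^ n) t - (\<phi> ^^ n) s\<bar>" if "s \<le> t" for s t
  proof -
    have "(- 1) ^ n * ((\<phi> ^^ n) t - (\<phi> ^^ n) s) \<le> \<bar>(- 1) ^ n * ((\<phi> ^^ n) t - (\<phi> ^^ n) s)\<bar>" by simp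
    also have "\<dots> = \<bar>(\<phi> ^^ n) t - (\<phi> ^^ n) s\<bar>" by (simp add: abs_mult power_abs)
    finally show ?thesis using funpow_expanding[OF that] by (rule order.trans[rotated])
  qed
  show ?thesis using *[of s t] *[of t s] by (cases "s \<le> t") auto
qed

text \<open>The linearising coordinate: \<open>K\<close> is the limit of \<open>\<phi>\<^sup>n / (-d)\<^sup>n\<close>.\<close>

definition term_K :: "nat \<Rightarrow> real \<Rightarrow> real" where
  "term_K n s = (\<phi> ((\<phi> ^^ n) s) + real d * (\<phi> ^^ n) s) / (- real d) ^ Suc n"

definition K :: "real \<Rightarrow> real" where
  "K s = s + (\<Sum>n. term_K n s)"

lemma partial_K: "s + (\<Sum>i<n. term_K i s) = (\<phi> ^^ n) s / (- real d) ^ n"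
proof (induction n)
  case (Suc n)
  have "real d \<noteq> 0" using d2 by simp
  have "s + (\<Sum>i<Suc n. term_K i s) = (\<phi> ^^ n) s / (- real d) ^ n + term_K n s"
    using Suc by simp
  also have "\<dots> = (\<phi> ^^ Suc n) s / (- real d) ^ Suc n"
    using \<open>real d \<noteq> 0\<close> by (simp add: term_K_def add_divide_distrib)
  finally show ?case .
qed simp

lemma term_K_bound: "norm (term_K n s) \<le> C * (1 / real d) ^ Suc n"
proof -
  have "norm (term_K n s) = \<bar>\<phi> ((\<phi> ^^ n) s) + real d * (\<phi> ^^ n) s\<bar> / real d ^ Suc n"
    by (simp add: term_K_def abs_mult power_abs)
  also have "\<dots> \<le> C / real d ^ Suc n" using bound by (intro divide_right_mono) auto
  finally show ?thesis by (simp add: power_divide)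
qed

lemma summable_bound: "summable (\<lambda>n. C * (1 / real d) ^ Suc n)"
proof -
  have "summable (\<lambda>n. (1 / real d) ^ n)" using d2 by (intro summable_geometric) auto
  then show ?thesis by (intro summable_mult) (simp only: summable_Suc_iff)
qed

text \<open>Since \<phi> differs from multiplication by -d by at most C, the terms are dominated by
  the geometric series C / d^(n+1).\<close>

lemma K_uniform_limit: "uniform_limit UNIV (\<lambda>n s. \<Sum>i<n. term_K i s) (\<lambda>s. \<Sum>i. term_K i s) sequentially"
  by (intro Weierstrass_m_test[where M = "\<lambda>n. C * (1 / real d) ^ Suc n"] term_K_bound summable_bound)

lemma K_limit: "(\<lambda>n. (\<phi> ^^ n) s / (- real d) ^ n) \<longlonglongrightarrow> K s"
proof -
  have "(\<lambda>n. \<Sum>i<n. term_K i s) \<longlonglongrightarrow> (\<Sum>i. term_K i s)"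
    using tendsto_uniform_limitI[OF K_uniform_limit, of s] by simp
  then have "(\<lambda>n. s + (\<Sum>i<n. term_K i s)) \<longlonglongrightarrow> K s" unfolding K_def by (intro tendsto_intros)
  then show ?thesis unfolding partial_K .
qed

lemma funpow_cont: "continuous_on UNIV (\<phi> ^^ n)"
proof (induction n)
  case (Suc n)
  have "continuous_on UNIV \<phi>" using phi_cont continuous_at_imp_continuous_on by blast
  then have "continuous_on UNIV (\<phi> \<circ> (\<phi> ^^ n))"
    using Suc by (intro continuous_on_compose) (auto intro: continuous_on_subset)
  then show ?case by (simp add: o_def)
qed (simp add: id_def)

lemma K_cont: "continuous_on UNIV K"
proof -
  have "continuous_on UNIV (\<lambda>s. \<Sum>i<n. term_K i s)" for n
  proof -
    have eq: "(\<lambda>s. \<Sum>i<n. term_K i s) = (\<lambda>s. (\<phi> ^^ n) s / (- real d) ^ n - s)"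
      using partial_K[of _ n] by (auto simp: fun_eq_iff algebra_simps)
    show ?thesis unfolding eq using d2 by (intro continuous_intros funpow_cont) auto
  qed
  then have "continuous_on UNIV (\<lambda>s. \<Sum>i. term_K i s)"
    by (intro uniform_limit_theorem[OF _ K_uniform_limit]) auto
  then show ?thesis unfolding K_def[abs_def] by (intro continuous_intros)
qed

lemma K_phi: "K (\<phi> s) = - real d * K s"
proof -
  have "(\<lambda>n. (- real d) * ((\<phi> ^^ Suc n) s / (- real d) ^ Suc n)) \<longlonglongrightarrow> - real d * K s"
    using LIMSEQ_Suc[OF K_limit[of s]] by (rule tendsto_mult_left)
  moreover have "(- real d) * ((\<phi> ^^ Suc n) s / (- real d) ^ Suc n) = (\<phi> ^^ n) (\<phi> s) / (- real d) ^ n" for n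
    using d2 by (simp add: funpow_Suc_right del: funpow.simps)
  ultimately have "(\<lambda>n. (\<phi> ^^ n) (\<phi> s) / (- real d) ^ n) \<longlonglongrightarrow> - real d * K s" by simp
  then show ?thesis using K_limit LIMSEQ_unique by blast
qed

lemma K_funpow: "K ((\<phi> ^^ n) s) = (- real d) ^ n * K s"
  by (induction n) (simp_all add: K_phi)

lemma K_period_int: "K (s + of_int m) = K s + of_int m"
proof -
  have "(\<phi> ^^ n) (s + of_int m) / (- real d) ^ n = (\<phi> ^^ n) s / (- real d) ^ n + of_int m" for n
    unfolding funpow_period using d2 by (simp add: add_divide_distrib)
  then have "(\<lambda>n. (\<phi> ^^ n) s / (- real d) ^ n + of_int m) \<longlonglongrightarrow> K (s + of_int m)"
    using K_limit[of "s + of_int m"] by simp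
  moreover have "(\<lambda>n. (\<phi> ^^ n) s / (- real d) ^ n + of_int m) \<longlonglongrightarrow> K s + of_int m"
    by (intro tendsto_intros K_limit)
  ultimately show ?thesis by (rule LIMSEQ_unique)
qed

lemma K_mono: "s \<le> t \<Longrightarrow> K s \<le> K t"
proof -
  assume st: "s \<le> t"
  have "(\<phi> ^^ n) s / (- real d) ^ n \<le> (\<phi> ^^ n) t / (- real d) ^ n" for n
  proof -
    have "0 \<le> \<mu> ^ n * (t - s)" using st mu by simp
    also have "\<dots> \<le> (- 1) ^ n * ((\<phi> ^^ n) t - (\<phi> ^^ n) s)" by (rule funpow_expanding[OF st])
    finally have "0 \<le> (- 1) ^ n * ((\<phi> ^^ n) t - (\<phi> ^^ n) s) / real d ^ n" by (intro divide_nonneg_nonneg) auto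
    also have "\<dots> = ((\<phi> ^^ n) t - (\<phi> ^^ n) s) / (- real d) ^ n"
      by (cases "even n") (auto simp: power_minus_odd diff_divide_distrib)
    finally show ?thesis by (simp add: diff_divide_distrib)
  qed
  then show ?thesis by (intro LIMSEQ_le[OF K_limit K_limit]) auto
qed

text \<open>As a limit, K is only weakly monotone. Expansion drives the iterates of two distinct
  points at least a period apart, where the values of K differ by at least 1, and
  \<open>K_funpow\<close> carries the difference back.\<close>

lemma K_strict_mono: "strict_mono K"
proof (rule strict_monoI)
  fix s t :: real assume st: "s < t"
  obtain n where "1 / (t - s) < \<mu> ^ n" using real_arch_pow[OF mu] by blast
  then have n: "\<mu> ^ n * (t - s) \<ge> 1" using st by (simp add: divide_less_eq)
  let ?s = "(\<phi> ^^ n) s" and ?t = "(\<phi> ^^ n) t"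
  have "\<bar>?t - ?s\<bar> \<ge> 1" using n funpow_abs_expanding[of n t s] st by simp
  then have "?s + 1 \<le> ?t \<or> ?t + 1 \<le> ?s" by linarith
  then have "\<bar>K ?t - K ?s\<bar> \<ge> 1"
    using K_mono[of "?s + 1" ?t] K_mono[of "?t + 1" ?s] K_period_int[of ?s 1] K_period_int[of ?t 1] by auto
  then have "K s \<noteq> K t" unfolding K_funpow by auto
  then show "K s < K t" using K_mono[of s t] st by simp
qed

lemma K_surj: "\<exists>s. K s = y"
proof -
  define n where "n = \<lceil>\<bar>y - K 0\<bar>\<rceil>"
  have "K (0 + of_int (- n)) \<le> y" "y \<le> K (0 + of_int n)"
    unfolding K_period_int n_def by linarith+
  moreover have "0 + of_int (- n) \<le> (0::real) + of_int n" unfolding n_def by simp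
  ultimately show ?thesis using IVT'[of K "0 + of_int (- n)" y "0 + of_int n"] K_cont
    by (meson continuous_on_subset subset_UNIV)
qed

definition H :: "real \<Rightarrow> real" where "H = inv K"

lemma K_inj: "inj K" using K_strict_mono strict_mono_eq by (auto simp: inj_def)

lemma H_K: "H (K s) = s" unfolding H_def using K_inj by (rule inv_f_f)

lemma K_H: "K (H t) = t" unfolding H_def using K_surj by (metis f_inv_into_f rangeI)

lemma H_strict_mono: "strict_mono H"
proof (rule strict_monoI)
  fix s t :: real assume "s < t"
  then have "K (H s) < K (H t)" unfolding K_H .
  then show "H s < H t" using K_strict_mono strict_mono_less by blast
qed

lemma H_cont: "continuous_on UNIV H"
proof (rule continuous_at_imp_continuous_on, rule ballI)
  fix t :: real
  have "isCont H (K (H t))"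
    by (rule isCont_inverse_function[where d = 1]) (use H_K K_cont in \<open>auto simp: continuous_on_eq_continuous_at\<close>)
  then show "isCont H t" unfolding K_H .
qed

lemma H_period_int: "H (t + of_int m) = H t + of_int m"
  using K_period_int[of "H t" m] H_K[of "H t + of_int m"] by (simp add: K_H)

lemma H_period: "H (t + 1) = H t + 1"
  using H_period_int[of t 1] by simp

lemma H_conj: "H (- real d * t) = \<phi> (H t)"
  using K_phi[of "H t"] H_K[of "\<phi> (H t)"] by (simp add: K_H)

lemma H_funpow: "H ((- real d) ^ n * t) = (\<phi> ^^ n) (H t)"
proof (induction n)
  case (Suc n)
  then show ?case using H_conj[of "(- real d) ^ n * t"] by (simp add: mult_ac)
qed simp

lemma H_bound: "\<bar>H t - H 0 - t\<bar> \<le> 1"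
proof -
  have "H (of_int \<lfloor>t\<rfloor>) \<le> H t" "H t \<le> H (of_int (\<lfloor>t\<rfloor> + 1))"
    using H_strict_mono by (auto simp: strict_mono_less_eq)
  then show ?thesis using H_period_int[of 0 "\<lfloor>t\<rfloor>"] H_period_int[of 0 "\<lfloor>t\<rfloor> + 1"] by simp linarith
qed

lemma H_diff_upper:
  assumes "0 \<le> t" "t \<le> real n"
  shows "H (x + t) - H x \<le> real n"
proof -
  have "H (x + t) \<le> H (x + of_int (int n))" using assms H_strict_mono by (simp add: strict_mono_less_eq)
  then show ?thesis unfolding H_period_int by simp
qed

lemma H_diff_lower:
  assumes "real n \<le> t"
  shows "real n \<le> H (x + t) - H x"
proof -
  have "H (x + of_int (int n)) \<le> H (x + t)" using assms H_strict_mono by (simp add: strict_mono_less_eq)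
  then show ?thesis unfolding H_period_int by simp
qed

text \<open>Bounded distortion, in a form which needs no derivative of the iterates.\<close>

lemma one_step_distortion:
  assumes "(a < b \<and> b < c) \<or> (c < b \<and> b < a)"
  shows "\<bar>b - a\<bar> * \<bar>\<phi> c - \<phi> b\<bar> \<le> exp (L * \<bar>c - a\<bar>) * \<bar>c - b\<bar> * \<bar>\<phi> b - \<phi> a\<bar>"
proof -
  have *: "\<exists>z. \<bar>\<phi> u - \<phi> v\<bar> = \<psi> z * \<bar>u - v\<bar> \<and> min u v < z \<and> z < max u v" if "u \<noteq> v" for u v
  proof (cases "u < v")
    case True
    then obtain z where "u < z" "z < v" "\<phi> u - \<phi> v = \<psi> z * (v - u)" by (rule mean_value)
    then show ?thesis using True phi_decreasing[OF True] by (intro exI[of _ z]) auto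
  next
    case False
    with that have "v < u" by simp
    then obtain z where "v < z" "z < u" "\<phi> v - \<phi> u = \<psi> z * (u - v)" by (rule mean_value)
    then show ?thesis using \<open>v < u\<close> phi_decreasing[OF \<open>v < u\<close>] by (intro exI[of _ z]) auto
  qed
  obtain z where z: "\<bar>\<phi> c - \<phi> b\<bar> = \<psi> z * \<bar>c - b\<bar>" "min c b < z" "z < max c b" using *[of c b] assms by auto
  obtain y where y: "\<bar>\<phi> b - \<phi> a\<bar> = \<psi> y * \<bar>b - a\<bar>" "min b a < y" "y < max b a" using *[of b a] assms by auto
  have "\<bar>z - y\<bar> \<le> \<bar>c - a\<bar>" using z y assms by (auto simp: min_def max_def)
  then have "L * \<bar>z - y\<bar> \<le> L * \<bar>c - a\<bar>" using L by (rule mult_left_mono)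
  then have "ln (\<psi> z) \<le> L * \<bar>c - a\<bar> + ln (\<psi> y)" using distort[of z y] by linarith
  then have "exp (ln (\<psi> z)) \<le> exp (L * \<bar>c - a\<bar> + ln (\<psi> y))" by (rule exp_le_cancel_iff[THEN iffD2])
  then have "\<psi> z \<le> exp (L * \<bar>c - a\<bar>) * \<psi> y" using psi_pos by (simp add: exp_add)
  then have "\<psi> z * (\<bar>c - b\<bar> * \<bar>b - a\<bar>) \<le> exp (L * \<bar>c - a\<bar>) * \<psi> y * (\<bar>c - b\<bar> * \<bar>b - a\<bar>)"
    by (rule mult_right_mono) auto
  then show ?thesis unfolding z(1) y(1) by (simp add: mult_ac)
qed

text \<open>The one-step estimate is iterated. Each interval is shorter than the final one by a
  power of 1 / \<mu>, so the exponents form a geometric series and stay bounded in terms of the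
  final length.\<close>

lemma distortion:
  assumes "(a < b \<and> b < c) \<or> (c < b \<and> b < a)"
  shows "\<bar>b - a\<bar> * \<bar>(\<phi> ^^ n) c - (\<phi> ^^ n) b\<bar>
    \<le> exp (L * (\<Sum>j<n. (1 / \<mu>) ^ Suc j) * \<bar>(\<phi> ^^ n) c - (\<phi> ^^ n) a\<bar>) * \<bar>c - b\<bar> * \<bar>(\<phi> ^^ n) b - (\<phi> ^^ n) a\<bar>"
  using assms
proof (induction n arbitrary: a b c)
  case 0
  then show ?case by (simp add: mult.commute)
next
  case (Suc n)
  let ?R = "\<lambda>n. \<Sum>j<n. (1 / \<mu>) ^ Suc j" and ?F = "\<phi> ^^ Suc n"
  have F: "(\<phi> ^^ n) (\<phi> x) = ?F x" for x by (simp add: funpow_Suc_right del: funpow.simps)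
  have ord: "(\<phi> a < \<phi> b \<and> \<phi> b < \<phi> c) \<or> (\<phi> c < \<phi> b \<and> \<phi> b < \<phi> a)"
    using Suc.prems phi_decreasing by auto
  have pos: "\<bar>\<phi> c - \<phi> b\<bar> > 0" using ord by auto
  have 1: "\<bar>b - a\<bar> * \<bar>\<phi> c - \<phi> b\<bar> \<le> exp (L * \<bar>c - a\<bar>) * \<bar>c - b\<bar> * \<bar>\<phi> b - \<phi> a\<bar>"
    by (rule one_step_distortion[OF Suc.prems])
  have 2: "\<bar>\<phi> b - \<phi> a\<bar> * \<bar>?F c - ?F b\<bar> \<le> exp (L * ?R n * \<bar>?F c - ?F a\<bar>) * \<bar>\<phi> c - \<phi> b\<bar> * \<bar>?F b - ?F a\<bar>"
    using Suc.IH[OF ord] unfolding F .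
  have "\<mu> ^ Suc n * \<bar>c - a\<bar> \<le> \<bar>?F c - ?F a\<bar>" by (rule funpow_abs_expanding)
  then have "\<bar>c - a\<bar> \<le> (1 / \<mu>) ^ Suc n * \<bar>?F c - ?F a\<bar>"
    using mu by (simp add: power_divide pos_le_divide_eq mult.commute)
  then have "L * \<bar>c - a\<bar> \<le> L * ((1 / \<mu>) ^ Suc n * \<bar>?F c - ?F a\<bar>)" using L by (rule mult_left_mono)
  then have 3: "exp (L * \<bar>c - a\<bar>) * exp (L * ?R n * \<bar>?F c - ?F a\<bar>) \<le> exp (L * ?R (Suc n) * \<bar>?F c - ?F a\<bar>)"
    unfolding exp_add[symmetric] by (simp add: algebra_simps)
  have "(\<bar>b - a\<bar> * \<bar>?F c - ?F b\<bar>) * \<bar>\<phi> c - \<phi> b\<bar> = (\<bar>b - a\<bar> * \<bar>\<phi> c - \<phi> b\<bar>) * \<bar>?F c - ?F b\<bar>" by (simp only: mult_ac)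
  also have "\<dots> \<le> (exp (L * \<bar>c - a\<bar>) * \<bar>c - b\<bar> * \<bar>\<phi> b - \<phi> a\<bar>) * \<bar>?F c - ?F b\<bar>" using 1 by (rule mult_right_mono) simp
  also have "\<dots> = (exp (L * \<bar>c - a\<bar>) * \<bar>c - b\<bar>) * (\<bar>\<phi> b - \<phi> a\<bar> * \<bar>?F c - ?F b\<bar>)" by (simp only: mult_ac)
  also have "\<dots> \<le> (exp (L * \<bar>c - a\<bar>) * \<bar>c - b\<bar>) * (exp (L * ?R n * \<bar>?F c - ?F a\<bar>) * \<bar>\<phi> c - \<phi> b\<bar> * \<bar>?F b - ?F a\<bar>)"
    using 2 by (rule mult_left_mono) simp
  also have "\<dots> = (exp (L * \<bar>c - a\<bar>) * exp (L * ?R n * \<bar>?F c - ?F a\<bar>)) * (\<bar>c - b\<bar> * \<bar>?F b - ?F a\<bar> * \<bar>\<phi> c - \<phi> b\<bar>)" by (simp only: mult_ac)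
  also have "\<dots> \<le> exp (L * ?R (Suc n) * \<bar>?F c - ?F a\<bar>) * (\<bar>c - b\<bar> * \<bar>?F b - ?F a\<bar> * \<bar>\<phi> c - \<phi> b\<bar>)"
    using 3 by (rule mult_right_mono) simp
  also have "\<dots> = (exp (L * ?R (Suc n) * \<bar>?F c - ?F a\<bar>) * \<bar>c - b\<bar> * \<bar>?F b - ?F a\<bar>) * \<bar>\<phi> c - \<phi> b\<bar>" by (simp only: mult_ac)
  finally show ?case using pos by (rule mult_right_le_imp_le)
qed

text \<open>Lengths t >= 1 are compared by counting periods. A shorter t is enlarged by (-d)^n until
  d^n t lies between 1 and d, where the image lengths also lie between 1 and d;
  \<open>distortion\<close> transfers the comparison back to the original scale.\<close>

lemma H_quasisymmetric:
  "\<exists>M\<ge>1. \<forall>x t. t > 0 \<longrightarrow> \<bar>H (x + t) - H x\<bar> \<le> M * \<bar>H x - H (x - t)\<bar> \<and> \<bar>H x - H (x - t)\<bar> \<le> M * \<bar>H (x + t) - H x\<bar>"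
proof -
  define M0 where "M0 = exp (L * (1 / (\<mu> - 1)) * (2 * real d)) * real d"
  define M where "M = max 4 M0"
  have main: "\<bar>H y - H x\<bar> \<le> M * \<bar>H z - H y\<bar>"
    if t: "t > 0" and xyz: "(y = x + t \<and> z = y + t) \<or> (y = x - t \<and> z = y - t)" for x y z t
  proof (cases "t \<ge> 1")
    case True
    define n where "n = nat \<lfloor>t\<rfloor>"
    have n: "real n \<le> t" "t \<le> real (Suc n)" "n \<ge> 1" using True unfolding n_def by linarith+
    have up: "H (w + t) - H w \<le> real (Suc n)" and lo: "real n \<le> H (w + t) - H w" for w
      using H_diff_upper[of t "Suc n" w] H_diff_lower[of n t w] n t by auto
    have "\<bar>H y - H x\<bar> \<le> real (Suc n)" "real n \<le> \<bar>H z - H y\<bar>"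
      using up[of x] lo[of x] up[of y] lo[of y] up[of z] lo[of z] xyz by auto
    moreover have "real (Suc n) \<le> 4 * real n" using n(3) by simp
    moreover have "4 * real n \<le> M * real n" by (intro mult_right_mono) (auto simp: M_def)
    moreover have "M * real n \<le> M * \<bar>H z - H y\<bar>" using calculation(2) by (intro mult_left_mono) (auto simp: M_def)
    ultimately show ?thesis by linarith
  next
    case False
    have d1: "real d > 1" using d2 by simp
    have "\<exists>n. real d ^ n * t \<ge> 1"
    proof -
      obtain n where "1 / t < real d ^ n" using real_arch_pow[OF d1] by blast
      then show ?thesis using t by (intro exI[of _ n]) (simp add: divide_less_eq)
    qed
    then have "\<exists>n. real d ^ n * t \<ge> 1 \<and> (\<forall>m<n. \<not> real d ^ m * t \<ge> 1)" by (rule exists_least_iff[THEN iffD1])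
    then obtain n where n: "real d ^ n * t \<ge> 1" "\<forall>m<n. \<not> real d ^ m * t \<ge> 1" by blast
    have "n \<noteq> 0" using n(1) False by (cases n) auto
    then obtain m where m: "n = Suc m" using not0_implies_Suc by blast
    then have "real d ^ m * t < 1" using n(2) by auto
    then have "real d * (real d ^ m * t) \<le> real d * 1" using d1 by (intro mult_left_mono) auto
    then have up: "real d ^ n * t \<le> real d" unfolding m by (simp add: mult.assoc)
    let ?D = "(- real d) ^ n" and ?T = "real d ^ n * t"
    let ?F = "\<phi> ^^ n"
    have len: "1 \<le> \<bar>H v - H u\<bar>" "\<bar>H v - H u\<bar> \<le> real d" if "\<bar>v - u\<bar> = ?T" for u v
    proof -
      have "v = u + ?T \<or> u = v + ?T" using that by linarith
      then show "1 \<le> \<bar>H v - H u\<bar>" "\<bar>H v - H u\<bar> \<le> real d"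
        using H_diff_lower[of 1 ?T u] H_diff_lower[of 1 ?T v] H_diff_upper[of ?T d u] H_diff_upper[of ?T d v] n(1) up by auto
    qed
    have T: "\<bar>?D * y - ?D * x\<bar> = ?T" "\<bar>?D * z - ?D * y\<bar> = ?T"
      unfolding right_diff_distrib[symmetric] abs_mult power_abs using xyz t by auto
    have F: "?F (H w) = H (?D * w)" for w by (rule H_funpow[symmetric])
    have yx: "1 \<le> \<bar>?F (H y) - ?F (H x)\<bar>" "\<bar>?F (H y) - ?F (H x)\<bar> \<le> real d"
      and zy: "1 \<le> \<bar>?F (H z) - ?F (H y)\<bar>" "\<bar>?F (H z) - ?F (H y)\<bar> \<le> real d"
      unfolding F using len T by auto
    have ord: "(H x < H y \<and> H y < H z) \<or> (H z < H y \<and> H y < H x)"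
      using xyz t H_strict_mono by (auto simp: strict_mono_less)
    let ?R = "\<Sum>j<n. (1 / \<mu>) ^ Suc j"
    have R: "?R \<le> 1 / (\<mu> - 1)"
    proof -
      have "(\<Sum>j<n. (1 / \<mu>) ^ Suc j) = (1 / \<mu>) * (\<Sum>j<n. (1 / \<mu>) ^ j)" by (simp add: sum_distrib_left)
      also have "(\<Sum>j<n. (1 / \<mu>) ^ j) = (1 - (1 / \<mu>) ^ n) / (1 - 1 / \<mu>)"
        using mu by (simp add: sum_gp_strict)
      also have "(1 / \<mu>) * ((1 - (1 / \<mu>) ^ n) / (1 - 1 / \<mu>)) = (1 - (1 / \<mu>) ^ n) / (\<mu> - 1)"
        using mu by (simp add: field_simps)
      also have "\<dots> \<le> 1 / (\<mu> - 1)" using mu by (intro divide_right_mono) auto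
      finally show ?thesis .
    qed
    have "L * ?R * \<bar>?F (H z) - ?F (H x)\<bar> \<le> L * (1 / (\<mu> - 1)) * (2 * real d)"
      using L R mu yx zy by (intro mult_mono mult_left_mono) auto
    then have e: "exp (L * ?R * \<bar>?F (H z) - ?F (H x)\<bar>) \<le> exp (L * (1 / (\<mu> - 1)) * (2 * real d))" by simp
    have "\<bar>H y - H x\<bar> * 1 \<le> \<bar>H y - H x\<bar> * \<bar>?F (H z) - ?F (H y)\<bar>" using zy by (intro mult_left_mono) auto
    also have "\<dots> \<le> exp (L * ?R * \<bar>?F (H z) - ?F (H x)\<bar>) * \<bar>H z - H y\<bar> * \<bar>?F (H y) - ?F (H x)\<bar>"
      by (rule distortion[OF ord])
    also have "\<dots> \<le> exp (L * (1 / (\<mu> - 1)) * (2 * real d)) * \<bar>H z - H y\<bar> * real d"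
      using e yx by (intro mult_mono mult_right_mono) auto
    also have "\<dots> = M0 * \<bar>H z - H y\<bar>" by (simp add: M0_def)
    also have "\<dots> \<le> M * \<bar>H z - H y\<bar>" by (intro mult_right_mono) (auto simp: M_def)
    finally show ?thesis by simp
  qed
  have "\<bar>H (x + t) - H x\<bar> \<le> M * \<bar>H x - H (x - t)\<bar> \<and> \<bar>H x - H (x - t)\<bar> \<le> M * \<bar>H (x + t) - H x\<bar>" if "t > 0" for x t
    using main[OF that, of x "x + t" "x - t"] main[OF that, of x "x - t" "x + t"]
      main[OF that, of "x" "x - t" "x"] main[OF that, where x = "x + t" and y = x and z = "x - t"]
      main[OF that, where x = "x - t" and y = x and z = "x + t"] by (simp add: abs_minus_commute)
  moreover have "M \<ge> 1" by (simp add: M_def)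
  ultimately show ?thesis by blast
qed

text \<open>In the coordinate K the map is multiplication by -d, and m / (d + 1) is the fixed point
  of x -> -d x + m. The deviation B of K(g t) from the affine solution is continuous and periodic,
  hence bounded; but it is multiplied by -d when t is, hence zero.\<close>

lemma conjugacy_rigid:
  assumes "continuous_on UNIV g" "\<sigma> = 1 \<or> \<sigma> = - 1" "\<And>t. g (t + 1) = g t + \<sigma>"
    and "\<And>t. g (- real d * t) = \<phi> (g t) + of_int m"
  shows "g t = H (\<sigma> * t + of_int m / (real d + 1))"
proof -
  define B where "B = (\<lambda>t. K (g t) - \<sigma> * t - of_int m / (real d + 1))"
  have d1: "real d > 1" "real d + 1 \<noteq> 0" using d2 by auto
  have B: "B (- real d * t) = - real d * B t" for t
  proof -
    have "K (g (- real d * t)) = - real d * K (g t) + of_int m" unfolding assms(4) K_period_int K_phi ..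
    moreover have "of_int m - of_int m / (real d + 1) = real d * (of_int m / (real d + 1))"
      using d1 by (simp add: field_simps)
    ultimately show ?thesis unfolding B_def by (simp add: algebra_simps)
  qed
  have Bn: "B ((- real d) ^ n * t) = (- real d) ^ n * B t" for n t
  proof (induction n)
    case (Suc n)
    then show ?case using B[of "(- real d) ^ n * t"] by (simp add: mult_ac)
  qed simp
  have "K (g (t + 1)) = K (g t) + \<sigma>" for t
    using assms(2) K_period_int[of "g t" 1] K_period_int[of "g t" "- 1"] by (auto simp: assms(3))
  then have Bper: "B (t + 1) = B t" for t unfolding B_def by (simp add: distrib_left)
  have Bnat: "B (t + real n) = B t" for t n
  proof (induction n)
    case (Suc n)
    have e: "t + real (Suc n) = (t + real n) + 1" by simp
    show ?case unfolding e Bper Suc.IH ..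
  qed simp
  have Bint: "B (t + of_int j) = B t" for t j
    using Bnat[of t "nat j"] Bnat[of "t + of_int j" "nat (- j)"] by (cases "j \<ge> 0") auto
  have "continuous_on UNIV B"
    unfolding B_def using continuous_on_compose2[OF K_cont assms(1)] d1 by (auto intro!: continuous_intros)
  then have "compact (B ` {0..1})" by (intro compact_continuous_image) (auto intro: continuous_on_subset)
  then have "bounded (B ` {0..1})" by (rule compact_imp_bounded)
  then obtain M where "\<forall>y\<in>B ` {0..1}. norm y \<le> M" unfolding bounded_iff by blast
  then have M: "\<And>s. s \<in> {0..1} \<Longrightarrow> \<bar>B s\<bar> \<le> M" by simp
  have Bb: "\<bar>B s\<bar> \<le> M" for s
  proof -
    have "B s = B (frac s)" using Bint[of "frac s" "\<lfloor>s\<rfloor>"] by (simp add: frac_def)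
    then show ?thesis using M[of "frac s"] frac_lt_1[of s] by (simp add: less_imp_le)
  qed
  have "B t = 0" for t
  proof (rule ccontr)
    assume "B t \<noteq> 0"
    obtain n where "(M + 1) / \<bar>B t\<bar> < real d ^ n" using real_arch_pow[OF d1(1)] by blast
    then have "real d ^ n * \<bar>B t\<bar> \<ge> M + 1" using \<open>B t \<noteq> 0\<close> by (simp add: divide_less_eq)
    moreover have "\<bar>B ((- real d) ^ n * t)\<bar> = real d ^ n * \<bar>B t\<bar>" unfolding Bn by (simp add: abs_mult power_abs)
    ultimately show False using Bb[of "(- real d) ^ n * t"] by linarith
  qed
  then have "K (g t) = \<sigma> * t + of_int m / (real d + 1)" by (simp add: B_def algebra_simps)
  then show ?thesis using H_K[of "g t"] by simp
qed

text \<open>Expansion turns the two conjugacy equations into e(t) <= (e(-d t) + \<epsilon>) / \<mu>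
  for e(t) = |H t - h t|. Both maps stay near translations, so e is bounded, and iteration leaves
  the fixed point \<epsilon> / (\<mu> - 1) of the recursion. For \<epsilon> = 0 this is
  uniqueness.\<close>

lemma conjugacy_stable:
  assumes h: "strict_mono h" "\<And>t. h (t + 1) = h t + 1" "\<And>t. h (- real d * t) = \<theta> (h t)"
    and \<epsilon>: "\<And>t. \<bar>\<phi> t - \<theta> t\<bar> \<le> \<epsilon>"
  shows "\<bar>H t - h t\<bar> \<le> \<epsilon> / (\<mu> - 1)"
proof -
  have h_nat: "h (t + real n) = h t + real n" for t n
  proof (induction n)
    case (Suc n)
    have e: "t + real (Suc n) = (t + real n) + 1" by simp
    show ?case unfolding e assms(2) Suc.IH by simp
  qed simp
  have h_int: "h (t + of_int j) = h t + of_int j" for t j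
    using h_nat[of t "nat j"] h_nat[of "t + of_int j" "nat (- j)"] by (cases "j \<ge> 0") auto
  have "\<bar>h t - h 0 - t\<bar> \<le> 1" for t
  proof -
    have "h (of_int \<lfloor>t\<rfloor>) \<le> h t" "h t \<le> h (of_int (\<lfloor>t\<rfloor> + 1))"
      using h(1) by (auto simp: strict_mono_less_eq)
    then show ?thesis using h_int[of 0 "\<lfloor>t\<rfloor>"] h_int[of 0 "\<lfloor>t\<rfloor> + 1"] by simp linarith
  qed
  then have b: "\<bar>H t - h t\<bar> \<le> \<bar>H 0 - h 0\<bar> + 2" for t using H_bound[of t] by (smt (verit))
  have step: "\<bar>H t - h t\<bar> \<le> (1 / \<mu>) * (\<bar>H (- real d * t) - h (- real d * t)\<bar> + \<epsilon>)" for t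
  proof -
    have "\<mu> * \<bar>H t - h t\<bar> \<le> \<bar>\<phi> (H t) - \<phi> (h t)\<bar>" by (rule abs_expanding)
    also have "\<dots> \<le> \<bar>\<phi> (H t) - \<theta> (h t)\<bar> + \<epsilon>" using \<epsilon>[of "h t"] by linarith
    finally show ?thesis using mu unfolding H_conj assms(3) by (simp add: field_simps)
  qed
  have e0: "\<epsilon> \<ge> 0" using \<epsilon>[of 0] by linarith
  have "\<bar>H t - h t\<bar> - \<epsilon> / (\<mu> - 1) \<le> (1 / \<mu>) ^ n * (\<bar>H 0 - h 0\<bar> + 2)" for n t
  proof (induction n arbitrary: t)
    case 0
    have "\<epsilon> / (\<mu> - 1) \<ge> 0" using e0 mu by simp
    then show ?case using b[of t] by simp
  next
    case (Suc n)
    let ?s = "- real d * t"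
    have "\<epsilon> / (\<mu> - 1) = (1 / \<mu>) * (\<epsilon> / (\<mu> - 1) + \<epsilon>)" using mu by (simp add: field_simps)
    then have "\<bar>H t - h t\<bar> - \<epsilon> / (\<mu> - 1) \<le> (1 / \<mu>) * (\<bar>H ?s - h ?s\<bar> + \<epsilon>) - (1 / \<mu>) * (\<epsilon> / (\<mu> - 1) + \<epsilon>)"
      using step[of t] by linarith
    also have "\<dots> = (1 / \<mu>) * (\<bar>H ?s - h ?s\<bar> - \<epsilon> / (\<mu> - 1))" by (simp add: algebra_simps)
    also have "\<dots> \<le> (1 / \<mu>) * ((1 / \<mu>) ^ n * (\<bar>H 0 - h 0\<bar> + 2))"
      using mu by (intro mult_left_mono Suc.IH) auto
    finally show ?case by (simp add: mult.assoc)
  qed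
  moreover have "(\<lambda>n. (1 / \<mu>) ^ n * (\<bar>H 0 - h 0\<bar> + 2)) \<longlonglongrightarrow> 0 * (\<bar>H 0 - h 0\<bar> + 2)"
    using mu by (intro tendsto_mult LIMSEQ_realpow_zero tendsto_const) auto
  ultimately have "\<bar>H t - h t\<bar> - \<epsilon> / (\<mu> - 1) \<le> 0 * (\<bar>H 0 - h 0\<bar> + 2)"
    by (meson LIMSEQ_le_const)
  then show ?thesis by simp
qed

end

section \<open>Lifts of Blaschke products to the real line\<close>

lemma norm_circ [simp]: "cmod (circ t) = 1"
  by (simp add: circ_def)

lemma circ_add: "circ (s + t) = circ s * circ t"
  by (simp add: circ_def cis_mult distrib_left)

lemma circ_minus: "circ (- t) = cnj (circ t)"
  by (simp add: circ_def cis_cnj)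

lemma circ_of_int [simp]: "circ (of_int m) = 1"
  by (simp add: circ_def cis_multiple_2pi)

lemma circ_add_int [simp]: "circ (t + of_int m) = circ t"
  by (simp add: circ_add)

lemma circ_eq_iff: "circ s = circ t \<longleftrightarrow> (\<exists>m::int. s = t + of_int m)"
proof
  assume "circ s = circ t"
  then have "sin (2 * pi * s) = sin (2 * pi * t)" "cos (2 * pi * s) = cos (2 * pi * t)"
    by (simp_all add: circ_def complex_eq_iff)
  then obtain m :: int where "2 * pi * s = 2 * pi * t + 2 * pi * of_int m"
    using sin_cos_eq_iff by (metis mult.commute mult.left_commute)
  then have "2 * pi * s = 2 * pi * (t + of_int m)" by (simp add: algebra_simps)
  then show "\<exists>m::int. s = t + of_int m" by auto
qed auto

lemma circ_surj:
  assumes "cmod z = 1"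
  obtains t where "circ t = z"
proof -
  have "z = cis (Arg z)" using assms cis_Arg[of z] by (metis div_by_1 norm_zero of_real_1 sgn_eq zero_neq_one)
  then have "circ (Arg z / (2 * pi)) = z" by (simp add: circ_def)
  then show ?thesis using that by blast
qed

lemma circ_diff_le: "cmod (circ s - circ t) \<le> 2 * pi * \<bar>s - t\<bar>"
proof -
  have "circ s - circ t = circ t * (circ (s - t) - 1)"
    using circ_add[of t "s - t"] by (simp add: algebra_simps)
  then have "cmod (circ s - circ t) = cmod (circ (s - t) - 1)" by (simp add: norm_mult)
  also have "\<dots> = cmod (exp (\<i> * of_real (2 * pi * (s - t))) - 1)" by (simp add: circ_def cis_conv_exp)
  also have "\<dots> = 2 * \<bar>sin (2 * pi * (s - t) / 2)\<bar>" by (rule dist_exp_i_1)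
  also have "\<dots> \<le> 2 * \<bar>2 * pi * (s - t) / 2\<bar>" by (intro mult_left_mono abs_sin_x_le_abs_x) auto
  also have "\<dots> = 2 * pi * \<bar>s - t\<bar>" by (simp add: abs_mult)
  finally show ?thesis .
qed

lemma continuous_on_circ: "continuous_on S circ"
  unfolding circ_def[abs_def] by (intro continuous_intros)

text \<open>On [\<epsilon>, 1 - \<epsilon>] the distance of \<open>circ u\<close> from 1 has a
  positive minimum by compactness; for \<epsilon> > 1/2 that interval is empty and rounding does
  it.\<close>

lemma circ_near_one:
  assumes "\<epsilon> > 0"
  obtains \<delta> where "\<delta> > 0" "\<And>u. cmod (circ u - 1) < \<delta> \<Longrightarrow> \<exists>k::int. \<bar>u - of_int k\<bar> < \<epsilon>"
proof (cases "\<epsilon> > 1 / 2")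
  case True
  have "\<bar>u - of_int (round u)\<bar> < \<epsilon>" for u :: real
    using of_int_round_abs_le[of u] True by linarith
  then show ?thesis using that[of 1] by auto
next
  case False
  have "continuous_on {\<epsilon>..1 - \<epsilon>} (\<lambda>u. cmod (circ u - 1))" by (intro continuous_intros continuous_on_circ)
  then obtain m where m: "m \<in> {\<epsilon>..1 - \<epsilon>}" "\<forall>u\<in>{\<epsilon>..1 - \<epsilon>}. cmod (circ m - 1) \<le> cmod (circ u - 1)"
    using continuous_attains_inf[of "{\<epsilon>..1 - \<epsilon>}" "\<lambda>u. cmod (circ u - 1)"] False by auto
  have "circ m \<noteq> circ 0"
  proof
    assume "circ m = circ 0"
    then obtain k :: int where "m = of_int k" unfolding circ_eq_iff by auto
    with m(1) assms have "0 < k" "k < 1" by auto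
    then show False by simp
  qed
  then have pos: "cmod (circ m - 1) > 0" by (simp add: circ_def)
  have "\<exists>k::int. \<bar>u - of_int k\<bar> < \<epsilon>" if "cmod (circ u - 1) < cmod (circ m - 1)" for u
  proof (rule ccontr)
    assume no: "\<not> ?thesis"
    have "circ (frac u) = circ u" using circ_add_int[of "frac u" "\<lfloor>u\<rfloor>"] by (simp add: frac_def)
    then have "frac u \<notin> {\<epsilon>..1 - \<epsilon>}" using m(2) that by fastforce
    moreover have "frac u \<ge> \<epsilon>"
    proof (rule ccontr)
      assume "\<not> frac u \<ge> \<epsilon>"
      then have "\<bar>u - of_int \<lfloor>u\<rfloor>\<bar> < \<epsilon>" using frac_ge_0[of u] by (simp add: frac_def)
      then show False using no by blast
    qed
    moreover have "1 - frac u \<ge> \<epsilon>"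
    proof (rule ccontr)
      assume "\<not> 1 - frac u \<ge> \<epsilon>"
      then have "\<bar>u - of_int (\<lfloor>u\<rfloor> + 1)\<bar> < \<epsilon>" using frac_lt_1[of u] by (simp add: frac_def)
      then show False using no by blast
    qed
    ultimately show False by auto
  qed
  then show ?thesis using that pos by blast
qed

text \<open>For u = 1 - b circ t, a factor of the product equals cnj (circ t) times u / cnj u. As u
  stays in the right half-plane, the principal logarithm is a continuous argument; twice Im (Ln u),
  divided by 2 pi, gives the first term.\<close>

definition blift :: "nat \<Rightarrow> (nat \<Rightarrow> complex) \<Rightarrow> real \<Rightarrow> real" where
  "blift d b t = (\<Sum>i<d. Im (Ln (1 - b i * circ t)) / pi - t)"

lemma one_minus_mult_circ:
  assumes "cmod b < 1"
  shows "1 - b * circ t \<noteq> 0" "Re (1 - b * circ t) > 0"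
proof -
  have "Re (b * circ t) < 1" using complex_Re_le_cmod[of "b * circ t"] assms by (simp add: norm_mult)
  then show "Re (1 - b * circ t) > 0" by simp
  then show "1 - b * circ t \<noteq> 0" by (metis less_irrefl zero_complex.simps(1))
qed

lemma mob_to0_cnj_circ:
  assumes "cmod b < 1"
  shows "mob_to0 b (cnj (circ t)) = circ (Im (Ln (1 - b * circ t)) / pi - t)"
proof -
  let ?u = "1 - b * circ t"
  have u: "?u \<noteq> 0" using one_minus_mult_circ(1)[OF assms] .
  have zz: "circ t * cnj (circ t) = 1" by (simp flip: complex_norm_square)
  have "circ (Im (Ln ?u) / pi) = cis (Im (Ln ?u)) * cis (Im (Ln ?u))"
    by (simp add: circ_def cis_mult)
  also have "cis (Im (Ln ?u)) = sgn ?u" using u by (simp add: Arg_eq_Im_Ln[symmetric] cis_Arg)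
  also have "sgn ?u * sgn ?u = ?u / cnj ?u"
    using u complex_norm_square[of ?u] by (simp add: sgn_eq power2_eq_square)
  finally have "circ (Im (Ln ?u) / pi - t) = (?u / cnj ?u) * cnj (circ t)"
    using circ_add[of "Im (Ln ?u) / pi" "- t"] by (simp add: circ_minus)
  also have "\<dots> = (cnj (circ t) * ?u) / (1 - cnj b * cnj (circ t))" by simp
  also have "cnj (circ t) * ?u = cnj (circ t) - b * (circ t * cnj (circ t))" by (simp add: algebra_simps)
  finally show ?thesis by (simp add: mob_to0_def zz)
qed

lemma circ_sum: "circ (\<Sum>i\<in>A. f i) = (\<Prod>i\<in>A. circ (f i))"
  by (induction A rule: infinite_finite_induct) (auto simp: circ_add, auto simp: circ_def)

lemma bprod_cnj_circ:
  assumes "\<And>i. cmod (b i) < 1"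
  shows "bprod {..<d} b (cnj (circ t)) = circ (blift d b t)"
  unfolding bprod_def blift_def circ_sum by (intro prod.cong refl mob_to0_cnj_circ assms)

lemma blift_period:
  "blift d b (t + 1) = blift d b t - real d"
proof -
  have "circ (t + 1) = circ t" using circ_add_int[of t 1] by simp
  then show ?thesis by (simp add: blift_def sum_subtractf algebra_simps)
qed

lemma blift_bound:
  assumes "\<And>i. cmod (b i) < 1"
  shows "\<bar>blift d b t + real d * t\<bar> \<le> real d"
proof -
  have "blift d b t + real d * t = (\<Sum>i<d. Im (Ln (1 - b i * circ t)) / pi)"
    by (simp add: blift_def sum_subtractf)
  also have "\<bar>\<dots>\<bar> \<le> (\<Sum>i<d. \<bar>Im (Ln (1 - b i * circ t)) / pi\<bar>)" by (rule sum_abs)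
  also have "\<dots> \<le> (\<Sum>i<d. 1)"
  proof (intro sum_mono)
    fix i
    have "\<bar>Im (Ln (1 - b i * circ t))\<bar> \<le> pi"
      using Im_Ln_le_pi mpi_less_Im_Ln one_minus_mult_circ[OF assms] by (metis abs_le_iff less_imp_le minus_le_iff)
    then show "\<bar>Im (Ln (1 - b i * circ t)) / pi\<bar> \<le> 1" by (simp add: divide_le_eq)
  qed
  finally show ?thesis by simp
qed

lemma kernel_Re:
  assumes "w \<noteq> (1::complex)"
  shows "1 + 2 * Re (w / (1 - w)) = (1 - (cmod w)\<^sup>2) / (cmod (1 - w))\<^sup>2"
proof -
  define D where "D = (cmod (1 - w))\<^sup>2"
  have pos: "D \<noteq> 0" using assms by (simp add: D_def)
  have r: "Re (w / (1 - w)) = (Re w - (cmod w)\<^sup>2) / D"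
    unfolding cmod_power2 Re_divide D_def by (simp add: power2_eq_square algebra_simps)
  have "D = 1 - 2 * Re w + (cmod w)\<^sup>2"
    unfolding cmod_power2 D_def by (simp add: power2_eq_square algebra_simps)
  then have m: "1 - (cmod w)\<^sup>2 = D + 2 * (Re w - (cmod w)\<^sup>2)" by simp
  show ?thesis unfolding D_def[symmetric] r m using pos by (simp add: add_divide_distrib)
qed

lemma bmult_cnj_circ:
  "bmult I b (cnj (circ t)) = (\<Sum>i\<in>I. (1 - (cmod (b i))\<^sup>2) / (cmod (1 - b i * circ t))\<^sup>2)"
  unfolding bmult_def
proof (intro sum.cong refl)
  fix i
  have "cmod (cnj (circ t) - b i) = cmod (1 - cnj (b i) * cnj (circ t))"
    using mob_circle_num_den[of "cnj (circ t)" "b i"] by simp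
  also have "\<dots> = cmod (1 - b i * circ t)"
    by (metis complex_cnj_diff complex_cnj_mult complex_cnj_one complex_mod_cnj)
  finally show "(1 - (cmod (b i))\<^sup>2) / (cmod (cnj (circ t) - b i))\<^sup>2 = (1 - (cmod (b i))\<^sup>2) / (cmod (1 - b i * circ t))\<^sup>2" by simp
qed

lemma blift_deriv:
  assumes "\<And>i. cmod (b i) < 1"
  shows "(blift d b has_real_derivative - bmult {..<d} b (cnj (circ t))) (at t)"
proof -
  have "((\<lambda>t. Im (Ln (1 - b i * circ t)) / pi - t) has_real_derivative
      - ((1 - (cmod (b i))\<^sup>2) / (cmod (1 - b i * circ t))\<^sup>2)) (at t)" for i
  proof -
    let ?w = "b i * circ t"
    have w1: "?w \<noteq> 1" using one_minus_mult_circ(1)[OF assms[of i], of t] by auto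
    have nn: "1 - ?w \<notin> \<real>\<^sub>\<le>\<^sub>0"
      using one_minus_mult_circ(2)[OF assms[of i], of t] complex_nonpos_Reals_iff by force
    have dc: "(circ has_vector_derivative (2 * pi * \<i> * circ t)) (at t)"
    proof -
      have e: "circ = (\<lambda>t. exp (\<i> * (complex_of_real (2 * pi) * complex_of_real t)))"
        by (simp add: fun_eq_iff circ_def cis_conv_exp)
      have "((\<lambda>z. exp (\<i> * (complex_of_real (2 * pi) * z))) has_field_derivative 2 * pi * \<i> * circ t) (at (complex_of_real t))"
        unfolding e by (auto intro!: derivative_eq_intros)
      from has_vector_derivative_real_field[OF this] show ?thesis by (subst e)
    qed
    have d1: "((\<lambda>t. 1 - b i * circ t) has_vector_derivative (- (b i * (2 * pi * \<i> * circ t)))) (at t)"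
      by (auto intro!: derivative_eq_intros dc)
    have "(Ln has_field_derivative inverse (1 - ?w)) (at (1 - ?w))" by (rule has_field_derivative_Ln[OF nn])
    then have "((Ln \<circ> (\<lambda>t. 1 - b i * circ t)) has_vector_derivative (- (b i * (2 * pi * \<i> * circ t))) * inverse (1 - ?w)) (at t)"
      by (intro field_vector_diff_chain_at d1)
    then have "((\<lambda>t. Ln (1 - b i * circ t)) has_vector_derivative (- (b i * (2 * pi * \<i> * circ t))) * inverse (1 - ?w)) (at t)"
      by (simp only: o_def)
    then have "((\<lambda>t. Im (Ln (1 - b i * circ t))) has_vector_derivative Im ((- (b i * (2 * pi * \<i> * circ t))) * inverse (1 - ?w))) (at t)"
      by (rule bounded_linear.has_vector_derivative[OF bounded_linear_Im])
    then have "((\<lambda>t. Im (Ln (1 - b i * circ t))) has_real_derivative Im ((- (b i * (2 * pi * \<i> * circ t))) * inverse (1 - ?w))) (at t)"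
      by (simp add: has_real_derivative_iff_has_vector_derivative)
    then have "((\<lambda>t. Im (Ln (1 - b i * circ t)) / pi - t) has_real_derivative
        Im ((- (b i * (2 * pi * \<i> * circ t))) * inverse (1 - ?w)) / pi - 1) (at t)"
      by (intro DERIV_diff DERIV_cdivide DERIV_ident)
    moreover have "Im ((- (b i * (2 * pi * \<i> * circ t))) * inverse (1 - ?w)) / pi - 1 = - (1 + 2 * Re (?w / (1 - ?w)))"
    proof -
      have "(- (b i * (2 * pi * \<i> * circ t))) * inverse (1 - ?w) = of_real (- 2 * pi) * (\<i> * (?w / (1 - ?w)))"
        by (simp add: divide_inverse)
      then have "Im ((- (b i * (2 * pi * \<i> * circ t))) * inverse (1 - ?w)) = - 2 * pi * Re (?w / (1 - ?w))"
        by (simp only: Im_complex_of_real Re_complex_of_real times_complex.sel) simp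
      then show ?thesis by simp
    qed
    ultimately show ?thesis using kernel_Re[OF w1] by (simp add: norm_mult)
  qed
  then show ?thesis
    unfolding blift_def[abs_def] bmult_cnj_circ sum_negf[symmetric] by (intro DERIV_sum)
qed

lemma abs_ln_diff_le:
  assumes "1 \<le> x" "1 \<le> (y::real)"
  shows "\<bar>ln x - ln y\<bar> \<le> \<bar>x - y\<bar>"
proof -
  have *: "ln x - ln y \<le> x - y" if "1 \<le> y" "y \<le> x" for x y :: real
  proof -
    have "ln x - ln y = ln (x / y)" using that by (simp add: ln_div)
    also have "\<dots> \<le> x / y - 1" using that by (intro ln_le_minus_one) auto
    also have "\<dots> = (x - y) / y" using that by (simp add: field_simps)
    also have "\<dots> \<le> (x - y) / 1" using that by (intro divide_left_mono) auto
    finally show ?thesis by simp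
  qed
  show ?thesis
  proof (cases "y \<le> x")
    case True
    then have "ln y \<le> ln x" using assms by simp
    then show ?thesis using *[of y x] True assms by simp
  next
    case False
    then have "ln x \<le> ln y" using assms by simp
    then show ?thesis using *[of x y] False assms by simp
  qed
qed

text \<open>The factor with zero at 0 contributes exactly 1 to the derivative. Since d >= 2 there is
  a further factor, and its Poisson kernel is at least (1 - |b 0|) / (1 + |b 0|); hence \<mu> >
  1.\<close>

lemma blift_expanding:
  assumes "\<And>i. cmod (b i) < 1" "b (d - 1) = 0" "d \<ge> 2"
  obtains \<mu> L where "expanding_circle_lift d (blift d b) (\<lambda>t. bmult {..<d} b (cnj (circ t))) \<mu> (real d) L"
proof
  let ?q = "\<lambda>i t. (1 - (cmod (b i))\<^sup>2) / (cmod (1 - b i * circ t))\<^sup>2"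
  let ?\<mu> = "1 + (1 - cmod (b 0)) / (1 + cmod (b 0))" and ?L = "\<Sum>i<d. 4 * pi / (1 - cmod (b i))\<^sup>2"
  have q: "?q i t = 2 * Re (1 / (1 - b i * circ t)) - 1" for i t
  proof -
    have n: "1 - b i * circ t \<noteq> 0" by (rule one_minus_mult_circ[OF assms(1)])
    then have w: "b i * circ t \<noteq> 1" by auto
    have "b i * circ t / (1 - b i * circ t) = 1 / (1 - b i * circ t) - 1" using n by (simp add: field_simps)
    then show ?thesis using kernel_Re[OF w] by (simp add: norm_mult)
  qed
  have q0: "?q i t \<ge> 0" for i t using assms(1)[of i] by (simp add: power_le_one less_imp_le)
  have mult: "bmult {..<d} b (cnj (circ t)) = (\<Sum>i<d. ?q i t)" for t by (rule bmult_cnj_circ)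
  have low: "?\<mu> \<le> bmult {..<d} b (cnj (circ t))" for t
  proof -
    have "(1 - cmod (b 0)) / (1 + cmod (b 0)) \<le> ?q 0 t"
    proof -
      have p: "0 < 1 + cmod (b 0)" "0 < 1 - cmod (b 0)" using assms(1)[of 0] by (auto intro: add_pos_nonneg)
      have "cmod (1 - b 0 * circ t) \<le> 1 + cmod (b 0)"
        using norm_triangle_ineq4[of 1 "b 0 * circ t"] by (simp add: norm_mult)
      then have "(cmod (1 - b 0 * circ t))\<^sup>2 \<le> (1 + cmod (b 0))\<^sup>2" by (intro power_mono) auto
      then have "(1 - (cmod (b 0))\<^sup>2) / (1 + cmod (b 0))\<^sup>2 \<le> ?q 0 t"
        using assms(1)[of 0] one_minus_mult_circ(1)[OF assms(1)[of 0], of t] p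
        by (intro divide_left_mono mult_pos_pos zero_less_power) (auto simp: power_le_one less_imp_le)
      moreover have "(1 - (cmod (b 0))\<^sup>2) / (1 + cmod (b 0))\<^sup>2 = (1 - cmod (b 0)) / (1 + cmod (b 0))"
      proof -
        have "1 - (cmod (b 0))\<^sup>2 = (1 - cmod (b 0)) * (1 + cmod (b 0))" by (simp add: power2_eq_square algebra_simps)
        then show ?thesis using p by (simp add: power2_eq_square)
      qed
      ultimately show ?thesis by simp
    qed
    moreover have "?q (d - 1) t = 1" using assms(2) by simp
    moreover have "?q 0 t + ?q (d - 1) t \<le> (\<Sum>i<d. ?q i t)"
    proof -
      have "(\<Sum>i\<in>{0, d - 1}. ?q i t) \<le> (\<Sum>i<d. ?q i t)" using assms(3) q0 by (intro sum_mono2) auto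
      then show ?thesis using assms(3) by simp
    qed
    ultimately show ?thesis unfolding mult by linarith
  qed
  have mu: "?\<mu> > 1" using assms(1)[of 0] by (auto intro!: divide_pos_pos add_pos_nonneg)
  show "expanding_circle_lift d (blift d b) (\<lambda>t. bmult {..<d} b (cnj (circ t))) ?\<mu> (real d) ?L"
  proof
    show "\<bar>ln (bmult {..<d} b (cnj (circ s))) - ln (bmult {..<d} b (cnj (circ t)))\<bar> \<le> ?L * \<bar>s - t\<bar>" for s t
    proof -
      have "\<bar>ln (bmult {..<d} b (cnj (circ s))) - ln (bmult {..<d} b (cnj (circ t)))\<bar>
          \<le> \<bar>bmult {..<d} b (cnj (circ s)) - bmult {..<d} b (cnj (circ t))\<bar>"
        using low[of s] low[of t] mu by (intro abs_ln_diff_le) auto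
      also have "\<dots> = \<bar>\<Sum>i<d. (?q i s - ?q i t)\<bar>" unfolding mult by (simp only: sum_subtractf)
      also have "\<dots> \<le> (\<Sum>i<d. \<bar>?q i s - ?q i t\<bar>)" by (rule sum_abs)
      also have "\<dots> \<le> (\<Sum>i<d. 4 * pi / (1 - cmod (b i))\<^sup>2 * \<bar>s - t\<bar>)"
      proof (rule sum_mono)
        fix i
        let ?x = "1 - b i * circ s" and ?y = "1 - b i * circ t" and ?r = "1 - cmod (b i)"
        have r: "?r > 0" using assms(1)[of i] by simp
        have nz: "?x \<noteq> 0" "?y \<noteq> 0" using one_minus_mult_circ(1)[OF assms(1)[of i]] by auto
        have xr: "?r \<le> cmod ?x" "?r \<le> cmod ?y"
          using norm_triangle_ineq2[of 1 "b i * circ s"] norm_triangle_ineq2[of 1 "b i * circ t"] by (simp_all add: norm_mult)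
        have "?q i s - ?q i t = 2 * Re (1 / ?x - 1 / ?y)" unfolding q by simp
        then have "\<bar>?q i s - ?q i t\<bar> = 2 * \<bar>Re (1 / ?x - 1 / ?y)\<bar>" by (simp only: abs_mult abs_numeral)
        also have "\<dots> \<le> 2 * cmod (1 / ?x - 1 / ?y)" by (intro mult_left_mono abs_Re_le_cmod) auto
        also have "1 / ?x - 1 / ?y = b i * (circ s - circ t) / (?x * ?y)"
          using nz by (simp add: diff_frac_eq algebra_simps)
        also have "cmod (b i * (circ s - circ t) / (?x * ?y)) = cmod (b i) * cmod (circ s - circ t) / (cmod ?x * cmod ?y)"
          by (simp add: norm_mult norm_divide)
        also have "\<dots> \<le> 1 * (2 * pi * \<bar>s - t\<bar>) / (?r * ?r)"
          using assms(1)[of i] xr r circ_diff_le[of s t] by (intro frac_le mult_mono) auto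
        finally show "\<bar>?q i s - ?q i t\<bar> \<le> 4 * pi / ?r\<^sup>2 * \<bar>s - t\<bar>" by (simp add: power2_eq_square)
      qed
      also have "\<dots> = ?L * \<bar>s - t\<bar>" by (rule sum_distrib_right[symmetric])
      finally show ?thesis .
    qed
    show "0 \<le> ?L" by (intro sum_nonneg) auto
  qed (use assms blift_deriv blift_bound blift_period low mu in auto)
qed

text \<open>The range is connected and misses all half-integers.\<close>

lemma near_int_constant:
  fixes u :: "real \<Rightarrow> real"
  assumes "continuous_on UNIV u" "\<epsilon> \<le> 1 / 4" "\<And>t. \<exists>k::int. \<bar>u t - of_int k\<bar> < \<epsilon>"
  obtains k :: int where "\<And>t. \<bar>u t - of_int k\<bar> < \<epsilon>"
proof -
  have conn: "connected (range u)" using assms(1) by (intro connected_continuous_image) auto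
  obtain k :: int where k: "\<bar>u 0 - of_int k\<bar> < \<epsilon>" using assms(3) by blast
  have no: "of_int j + 1 / 2 \<notin> range u" for j :: int
  proof
    assume "of_int j + 1 / 2 \<in> range u"
    then obtain t where "u t = of_int j + 1 / 2" by auto
    then obtain i :: int where i: "\<bar>of_int j + 1 / 2 - of_int i\<bar> < (1::real) / 4"
      using assms(2,3) by (metis less_le_trans)
    then have "i \<le> j \<or> i \<ge> j + 1" by linarith
    then show False
    proof
      assume "i \<le> j"
      then have "real_of_int i \<le> real_of_int j" by simp
      then show False using i by (simp add: abs_less_iff)
    next
      assume "i \<ge> j + 1"
      then have "real_of_int i \<ge> real_of_int (j + 1)" by (simp only: of_int_le_iff)
      then show False using i by (simp add: abs_less_iff)
    qed
  qed
  have "\<bar>u t - of_int k\<bar> < \<epsilon>" for t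
  proof (rule ccontr)
    assume far: "\<not> ?thesis"
    obtain i :: int where i: "\<bar>u t - of_int i\<bar> < \<epsilon>" using assms(3) by blast
    then have "i \<noteq> k" using far by auto
    then have "i \<le> k - 1 \<or> i \<ge> k + 1" by linarith
    then show False
    proof
      assume "i \<le> k - 1"
      then have "real_of_int i \<le> real_of_int (k - 1)" by (simp only: of_int_le_iff)
      then have "u t \<le> of_int (k - 1) + 1 / 2" "of_int (k - 1) + 1 / 2 \<le> u 0"
        using i k assms(2) unfolding of_int_diff of_int_1 abs_less_iff by linarith+
      then have "of_int (k - 1) + 1 / 2 \<in> range u"
        using connectedD_interval[OF conn, of "u t" "u 0"] by auto
      then show False using no by blast
    next
      assume "i \<ge> k + 1"
      then have "real_of_int (k + 1) \<le> real_of_int i" by (simp only: of_int_le_iff)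
      then have "u 0 \<le> of_int k + 1 / 2" "of_int k + 1 / 2 \<le> u t"
        using i k assms(2) unfolding of_int_add of_int_1 abs_less_iff by linarith+
      then have "of_int k + 1 / 2 \<in> range u"
        using connectedD_interval[OF conn, of "u 0" "u t"] by auto
      then show False using no by blast
    qed
  qed
  then show ?thesis using that by blast
qed

lemma blift_cont:
  assumes "\<And>i. cmod (b i) < 1"
  shows "continuous_on S (blift d b)"
  by (intro continuous_at_imp_continuous_on ballI) (rule DERIV_isCont[OF blift_deriv[OF assms]])

lemma one_minus_mult_pos:
  assumes "cmod b < 1" "cmod z \<le> 1"
  shows "Re (1 - b * z) > 0"
proof -
  have "cmod (b * z) \<le> cmod b * 1" using assms(2) by (simp add: norm_mult mult_left_le)
  then have "Re (b * z) < 1" using complex_Re_le_cmod[of "b * z"] assms(1) by linarith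
  then show ?thesis by simp
qed

text \<open>Two lifts of nearby maps differ by nearly an integer; the integer vanishes since the difference
  is the boundary value of a harmonic function vanishing at \<open>0\<close>.\<close>

lemma blift_close:
  assumes b: "\<And>i. cmod (b i) < 1" and c: "\<And>i. cmod (c i) < 1" and \<epsilon>: "\<epsilon> \<le> 1 / 4"
    and near: "\<And>t. \<exists>k::int. \<bar>(blift d b t - blift d c t) - of_int k\<bar> < \<epsilon>"
  shows "\<bar>blift d b t - blift d c t\<bar> < \<epsilon>"
proof -
  have cu: "continuous_on UNIV (\<lambda>t. blift d b t - blift d c t)"
    by (intro continuous_intros blift_cont b c)
  obtain k :: int where k: "\<And>t. \<bar>(blift d b t - blift d c t) - of_int k\<bar> < \<epsilon>"
    by (rule near_int_constant[OF cu \<epsilon> near]) (rule that)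
  define W where "W = (\<lambda>z. (\<Sum>i<d. Ln (1 - b i * z)) - (\<Sum>i<d. Ln (1 - c i * z)))"
  have nn: "1 - a * z \<notin> \<real>\<^sub>\<le>\<^sub>0" if "cmod a < 1" "cmod z \<le> 1" for a z
    using one_minus_mult_pos[OF that] complex_nonpos_Reals_iff by force
  have holo: "W holomorphic_on ball 0 1"
    unfolding W_def by (intro holomorphic_intros nn) (auto simp: b c)
  have cont: "continuous_on (cball 0 1) W"
    unfolding W_def by (intro continuous_intros nn) (auto simp: b c)
  have W0: "W 0 = 0" by (simp add: W_def)
  have ImW: "Im (W (circ t)) = pi * (blift d b t - blift d c t)" for t
    by (simp add: W_def blift_def sum_subtractf sum_divide_distrib[symmetric] algebra_simps)
  \<comment> \<open>On the circle Im W is pi times the difference of the lifts. Were that difference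
    near a nonzero integer, exp (i \<sigma> W) would have modulus at most exp (- pi / 2) there, but
    it is 1 at the centre.\<close>
  have contra: False if \<sigma>: "\<sigma> = 1 \<or> \<sigma> = (-1::real)" and big: "\<And>t. \<sigma> * (blift d b t - blift d c t) \<ge> 1 / 2" for \<sigma>
  proof -
    let ?G = "\<lambda>z. exp (\<i> * of_real \<sigma> * W z)"
    have "cmod (?G 0) \<le> exp (- (pi / 2))"
    proof (rule maximum_modulus_frontier[of ?G "cball 0 1"])
      show "?G holomorphic_on interior (cball 0 1)" using holo by (auto intro!: holomorphic_intros)
      show "continuous_on (closure (cball 0 1)) ?G" using cont by (auto intro!: continuous_intros)
      fix z :: complex assume "z \<in> frontier (cball 0 1)"
      then have "cmod z = 1" by (simp add: frontier_cball)
      then obtain t where t: "circ t = z" by (rule circ_surj)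
      have "cmod (?G z) = exp (- (pi * (\<sigma> * (blift d b t - blift d c t))))"
        using ImW[of t] t by (simp add: mult.left_commute)
      also have "\<dots> \<le> exp (- (pi / 2))"
        using mult_left_mono[OF big[of t], of pi] by simp
      finally show "cmod (?G z) \<le> exp (- (pi / 2))" .
    qed auto
    then show False using pi_gt_zero by (simp add: W0)
  qed
  have "k = 0"
  proof (rule ccontr)
    assume "k \<noteq> 0"
    then have "k \<ge> 1 \<or> k \<le> -1" by linarith
    then show False
    proof
      assume "k \<ge> 1"
      then have "real_of_int k \<ge> 1" by simp
      then have "1 * (blift d b t - blift d c t) \<ge> 1 / 2" for t using k[of t] \<epsilon> unfolding abs_less_iff by simp
      then show False by (intro contra[of 1]) auto
    next
      assume "k \<le> -1"
      then have "real_of_int k \<le> real_of_int (-1)" by (simp only: of_int_le_iff)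
      then have "(-1) * (blift d b t - blift d c t) \<ge> 1 / 2" for t using k[of t] \<epsilon> unfolding abs_less_iff by simp
      then show False by (intro contra[of "-1"]) auto
    qed
  qed
  then show ?thesis using k[of t] by simp
qed

section \<open>The normalised conjugacy of a Blaschke product\<close>

definition blaschke_rep :: "nat \<Rightarrow> (complex \<Rightarrow> complex) \<Rightarrow> (nat \<Rightarrow> complex) \<Rightarrow> bool" where
  "blaschke_rep d f b \<longleftrightarrow> (\<forall>i. cmod (b i) < 1) \<and> b (d - 1) = 0 \<and> f = (\<lambda>z. bprod {..<d} b (cnj z))"

lemma Bminus_rep:
  assumes "d \<ge> 2" "f \<in> Bminus d"
  obtains b where "blaschke_rep d f b"
proof -
  obtain a where a: "f = blaschke_anti a" "length a = d - 1" "\<forall>x\<in>set a. cmod x < 1"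
    using assms by (auto simp: Bminus_def)
  have "blaschke_rep d f (\<lambda>i. if i < length a then a ! i else 0)"
    unfolding blaschke_rep_def using a assms(1) by (auto simp: fun_eq_iff blaschke_anti_eq_bprod)
  then show ?thesis by (rule that)
qed

lemma rep_Bminus:
  assumes "d \<ge> 2" "blaschke_rep d f b"
  shows "f \<in> Bminus d"
proof -
  let ?a = "map b [0..<d - 1]"
  have "f = blaschke_anti ?a"
  proof
    fix z
    have "blaschke_anti ?a z = bprod {..<d} (\<lambda>i. if i < length ?a then ?a ! i else 0) (cnj z)"
      using assms(1) unfolding blaschke_anti_eq_bprod by simp
    also have "\<dots> = bprod {..<d} b (cnj z)"
    proof -
      have "(if i < length ?a then ?a ! i else 0) = b i" if "i < d" for i
        using that assms by (cases "i = d - 1") (auto simp: blaschke_rep_def)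
      then show ?thesis unfolding bprod_def by (intro prod.cong) auto
    qed
    finally show "f z = blaschke_anti ?a z" using assms(2) by (simp add: blaschke_rep_def)
  qed
  moreover have "\<forall>x\<in>set ?a. cmod x < 1" using assms(2) by (auto simp: blaschke_rep_def)
  ultimately show ?thesis unfolding Bminus_def by (auto intro!: exI[of _ ?a])
qed

lemma rep_circ: "blaschke_rep d f b \<Longrightarrow> f (circ t) = circ (blift d b t)"
  by (auto simp: blaschke_rep_def bprod_cnj_circ)

text \<open>\<delta> comes from \<open>circ_near_one\<close> alone and so serves all d, f and g at
  once; closeness modulo integers is upgraded by \<open>blift_close\<close>.\<close>

lemma rep_lift_close:
  assumes "\<epsilon> > 0" "\<epsilon> \<le> 1 / 4"
  obtains \<delta> where "\<delta> > 0" "\<And>d f g b c t. blaschke_rep d f b \<Longrightarrow> blaschke_rep d g c \<Longrightarrow>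
     (\<And>z. cmod z = 1 \<Longrightarrow> cmod (f z - g z) < \<delta>) \<Longrightarrow> \<bar>blift d b t - blift d c t\<bar> < \<epsilon>"
proof -
  obtain \<delta> where \<delta>: "\<delta> > 0" "\<And>u. cmod (circ u - 1) < \<delta> \<Longrightarrow> \<exists>k::int. \<bar>u - of_int k\<bar> < \<epsilon>"
    using circ_near_one[OF assms(1)] by blast
  have "\<bar>blift d b t - blift d c t\<bar> < \<epsilon>"
    if r: "blaschke_rep d f b" "blaschke_rep d g c" and n: "\<And>z. cmod z = 1 \<Longrightarrow> cmod (f z - g z) < \<delta>" for d f g b c t
  proof (rule blift_close)
    fix t
    have "circ (blift d b t) - circ (blift d c t) = circ (blift d c t) * (circ (blift d b t - blift d c t) - 1)"
      using circ_add[of "blift d c t" "blift d b t - blift d c t"] by (simp add: algebra_simps)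
    then have "cmod (circ (blift d b t - blift d c t) - 1) = cmod (f (circ t) - g (circ t))"
      by (simp add: rep_circ[OF r(1)] rep_circ[OF r(2)] norm_mult)
    then show "\<exists>k::int. \<bar>(blift d b t - blift d c t) - of_int k\<bar> < \<epsilon>"
      using \<delta>(2) n[of "circ t"] by simp
  qed (use r assms(2) in \<open>auto simp: blaschke_rep_def\<close>)
  then show ?thesis using that \<delta>(1) by blast
qed

text \<open>The zeros may be listed in several orders, but for f = g the estimate of
  \<open>rep_lift_close\<close> holds with every small \<epsilon>. So the lift belongs to f and not
  to the chosen list.\<close>

lemma rep_lift_unique:
  assumes "blaschke_rep d f b" "blaschke_rep d f c"
  shows "blift d b = blift d c"
proof
  fix t
  show "blift d b t = blift d c t"
  proof (rule ccontr)
    assume "blift d b t \<noteq> blift d c t"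
    define \<epsilon> where "\<epsilon> = min (1 / 4) \<bar>blift d b t - blift d c t\<bar>"
    have "\<epsilon> > 0" using \<open>blift d b t \<noteq> blift d c t\<close> unfolding \<epsilon>_def by auto
    moreover have "\<epsilon> \<le> 1 / 4" unfolding \<epsilon>_def by (rule min.cobounded1)
    ultimately obtain \<delta> where "\<delta> > 0" and *: "\<And>d f g b c t. blaschke_rep d f b \<Longrightarrow> blaschke_rep d g c \<Longrightarrow>
       (\<And>z. cmod z = 1 \<Longrightarrow> cmod (f z - g z) < \<delta>) \<Longrightarrow> \<bar>blift d b t - blift d c t\<bar> < \<epsilon>"
      using rep_lift_close by blast
    have "\<bar>blift d b t - blift d c t\<bar> < \<epsilon>" by (rule *[OF assms]) (use \<open>\<delta> > 0\<close> in simp)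
    then show False by (simp add: \<epsilon>_def)
  qed
qed

definition lift_conjugacy :: "nat \<Rightarrow> (complex \<Rightarrow> complex) \<Rightarrow> (real \<Rightarrow> real) \<Rightarrow> bool" where
  "lift_conjugacy d f h \<longleftrightarrow> strict_mono h \<and> continuous_on UNIV h \<and> (\<forall>t. h (t + 1) = h t + 1) \<and>
     (\<exists>b. blaschke_rep d f b \<and> (\<forall>t. h (- real d * t) = blift d b (h t)))"

definition hlift :: "nat \<Rightarrow> (complex \<Rightarrow> complex) \<Rightarrow> real \<Rightarrow> real" where
  "hlift d f = (SOME h. lift_conjugacy d f h)"

lemma rep_expanding:
  assumes "d \<ge> 2" "blaschke_rep d f b"
  obtains \<mu> L where "expanding_circle_lift d (blift d b) (\<lambda>t. bmult {..<d} b (cnj (circ t))) \<mu> (real d) L"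
  using blift_expanding[of b d] assms by (auto simp: blaschke_rep_def)

lemma hlift_conjugacy:
  assumes "d \<ge> 2" "f \<in> Bminus d"
  shows "lift_conjugacy d f (hlift d f)"
proof -
  obtain b where b: "blaschke_rep d f b" using Bminus_rep[OF assms] by blast
  obtain \<mu> L where "expanding_circle_lift d (blift d b) (\<lambda>t. bmult {..<d} b (cnj (circ t))) \<mu> (real d) L"
    using rep_expanding[OF assms(1) b] by blast
  then interpret expanding_circle_lift d "blift d b" "\<lambda>t. bmult {..<d} b (cnj (circ t))" \<mu> "real d" L .
  have "lift_conjugacy d f H"
    unfolding lift_conjugacy_def using H_strict_mono H_cont H_period H_conj b by blast
  then show ?thesis unfolding hlift_def by (rule someI[of "lift_conjugacy d f"])
qed

lemma hlift_rep:
  assumes "d \<ge> 2" "f \<in> Bminus d" "blaschke_rep d f b"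
  shows "hlift d f (- real d * t) = blift d b (hlift d f t)"
proof -
  obtain c where "blaschke_rep d f c" "\<forall>t. hlift d f (- real d * t) = blift d c (hlift d f t)"
    using hlift_conjugacy[OF assms(1,2)] by (auto simp: lift_conjugacy_def)
  then show ?thesis using rep_lift_unique[OF assms(3)] by simp
qed

lemma hlift_mono: "d \<ge> 2 \<Longrightarrow> f \<in> Bminus d \<Longrightarrow> strict_mono (hlift d f)"
  and hlift_cont: "d \<ge> 2 \<Longrightarrow> f \<in> Bminus d \<Longrightarrow> continuous_on UNIV (hlift d f)"
  and hlift_period: "d \<ge> 2 \<Longrightarrow> f \<in> Bminus d \<Longrightarrow> hlift d f (t + 1) = hlift d f t + 1"
  using hlift_conjugacy[of d f] by (auto simp: lift_conjugacy_def)

text \<open>Stability with \<epsilon> = 0 identifies the conjugacy picked by \<open>SOME\<close>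
  with the one built from the linearising coordinate.\<close>

lemma hlift_eq_H:
  assumes "d \<ge> 2" "f \<in> Bminus d" "blaschke_rep d f b"
    and "expanding_circle_lift d (blift d b) (\<lambda>t. bmult {..<d} b (cnj (circ t))) \<mu> C L"
  shows "hlift d f = expanding_circle_lift.H d (blift d b)"
proof -
  interpret expanding_circle_lift d "blift d b" "\<lambda>t. bmult {..<d} b (cnj (circ t))" \<mu> C L by fact
  have "\<bar>H t - hlift d f t\<bar> \<le> 0 / (\<mu> - 1)" for t
    by (rule conjugacy_stable[where \<theta> = "blift d b"])
       (use hlift_mono hlift_period hlift_rep assms in auto)
  then show ?thesis by (simp add: fun_eq_iff)
qed

lemma hlift_period_int:
  assumes "d \<ge> 2" "f \<in> Bminus d"
  shows "hlift d f (t + of_int m) = hlift d f t + of_int m"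
proof -
  obtain b where b: "blaschke_rep d f b" using Bminus_rep[OF assms] by blast
  obtain \<mu> L where E: "expanding_circle_lift d (blift d b) (\<lambda>t. bmult {..<d} b (cnj (circ t))) \<mu> (real d) L"
    using rep_expanding[OF assms(1) b] by blast
  then interpret expanding_circle_lift d "blift d b" "\<lambda>t. bmult {..<d} b (cnj (circ t))" \<mu> "real d" L .
  show ?thesis unfolding hlift_eq_H[OF assms b E] by (rule H_period_int)
qed

lemma hlift_stable:
  assumes d: "d \<ge> 2" and f: "f \<in> Bminus d" and "\<epsilon> > 0"
  obtains \<delta> where "\<delta> > 0" "\<And>g t. g \<in> Bminus d \<Longrightarrow> (\<And>z. cmod z = 1 \<Longrightarrow> cmod (g z - f z) < \<delta>) \<Longrightarrow>
     \<bar>hlift d g t - hlift d f t\<bar> < \<epsilon>"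
proof -
  obtain b where b: "blaschke_rep d f b" using Bminus_rep[OF d f] by blast
  obtain \<mu> L where E: "expanding_circle_lift d (blift d b) (\<lambda>t. bmult {..<d} b (cnj (circ t))) \<mu> (real d) L"
    using rep_expanding[OF d b] by blast
  then interpret expanding_circle_lift d "blift d b" "\<lambda>t. bmult {..<d} b (cnj (circ t))" \<mu> "real d" L .
  \<comment> \<open>1/4 is the threshold of \<open>blift_close\<close>; the other term undoes the
    division by \<mu> - 1 in \<open>conjugacy_stable\<close>, halved to obtain a strict
    inequality.\<close>
  define e where "e = min (1 / 4) (\<epsilon> * (\<mu> - 1) / 2)"
  have e: "e > 0" "e \<le> 1 / 4" using mu \<open>\<epsilon> > 0\<close> by (auto simp: e_def)
  obtain \<delta> where \<delta>: "\<delta> > 0" "\<And>d f g b c t. blaschke_rep d f b \<Longrightarrow> blaschke_rep d g c \<Longrightarrow>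
       (\<And>z. cmod z = 1 \<Longrightarrow> cmod (f z - g z) < \<delta>) \<Longrightarrow> \<bar>blift d b t - blift d c t\<bar> < e"
    using rep_lift_close[OF e] by blast
  have "\<bar>hlift d g t - hlift d f t\<bar> < \<epsilon>"
    if g: "g \<in> Bminus d" and n: "\<And>z. cmod z = 1 \<Longrightarrow> cmod (g z - f z) < \<delta>" for g t
  proof -
    obtain c where c: "blaschke_rep d g c" using Bminus_rep[OF d g] by blast
    have close: "\<bar>blift d b t - blift d c t\<bar> \<le> e" for t
      by (rule less_imp_le[OF \<delta>(2)[OF b c]]) (use n in \<open>simp add: norm_minus_commute\<close>)
    have "\<bar>H t - hlift d g t\<bar> \<le> e / (\<mu> - 1)"
      by (rule conjugacy_stable[where \<theta> = "blift d c"])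
         (use hlift_mono hlift_period hlift_rep d g c close in auto)
    also have "\<dots> \<le> (\<epsilon> * (\<mu> - 1) / 2) / (\<mu> - 1)" using mu by (intro divide_right_mono) (auto simp: e_def)
    also have "\<dots> = \<epsilon> / 2" using mu by (simp add: field_simps)
    also have "\<dots> < \<epsilon>" using \<open>\<epsilon> > 0\<close> by simp
    finally show ?thesis unfolding hlift_eq_H[OF d f b E] by (simp add: abs_minus_commute)
  qed
  then show ?thesis using that \<delta>(1) by blast
qed

text \<open>p = (\<sigma>, k) encodes t -> \<sigma> t + k / (d + 1), with \<sigma> = 1 or -1. These
  maps commute with multiplication by -d on R/Z, so precomposing with one gives another
  conjugacy.\<close>

definition conj_cand :: "nat \<Rightarrow> (complex \<Rightarrow> complex) \<Rightarrow> real \<times> nat \<Rightarrow> real \<Rightarrow> complex" where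
  "conj_cand d f p t = circ (hlift d f (fst p * t + real (snd p) / (real d + 1)))"

text \<open>Lifting the conjugacy equation leaves an integer m, constant by continuity, and then
  \<open>conjugacy_rigid\<close> determines the lift.\<close>

lemma qs_conjugacy_cand:
  assumes d: "d \<ge> 2" and f: "f \<in> Bminus d" and e: "qs_circle_homeo e" "\<And>t. e (- real d * t) = f (e t)"
  obtains p where "p \<in> {1, -1} \<times> {..d}" "e = conj_cand d f p"
proof -
  obtain b where b: "blaschke_rep d f b" using Bminus_rep[OF d f] by blast
  then have b1: "\<And>i. cmod (b i) < 1" by (simp add: blaschke_rep_def)
  obtain \<mu> L where E: "expanding_circle_lift d (blift d b) (\<lambda>t. bmult {..<d} b (cnj (circ t))) \<mu> (real d) L"
    using rep_expanding[OF d b] by blast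
  then interpret expanding_circle_lift d "blift d b" "\<lambda>t. bmult {..<d} b (cnj (circ t))" \<mu> "real d" L .
  obtain g \<sigma> where g: "continuous_on UNIV g" "\<sigma> = 1 \<or> \<sigma> = -1" "\<And>t. g (t + 1) = g t + \<sigma>" "\<And>t. e t = circ (g t)"
  proof -
    obtain g M where g: "continuous_on UNIV g"
      "(strict_mono g \<and> (\<forall>t. g (t + 1) = g t + 1)) \<or> (strict_mono (\<lambda>t. - g t) \<and> (\<forall>t. g (t + 1) = g t - 1))"
      "\<forall>t. e t = circ (g t)" using e(1) unfolding qs_circle_homeo_def by blast
    from g(2) show ?thesis
    proof
      assume "strict_mono g \<and> (\<forall>t. g (t + 1) = g t + 1)"
      then show ?thesis using that[of g 1] g by auto
    next
      assume "strict_mono (\<lambda>t. - g t) \<and> (\<forall>t. g (t + 1) = g t - 1)"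
      then show ?thesis using that[of g "-1"] g by auto
    qed
  qed
  let ?v = "\<lambda>t. g (- real d * t) - blift d b (g t)"
  have int: "\<exists>k::int. ?v t = of_int k" for t
  proof -
    have "circ (g (- real d * t)) = circ (blift d b (g t))"
      using e(2)[of t] rep_circ[OF b] by (simp add: g(4))
    then show ?thesis unfolding circ_eq_iff by auto
  qed
  have "continuous_on UNIV (\<lambda>t. g (- real d * t))"
    by (rule continuous_on_compose2[OF g(1)]) (auto intro!: continuous_intros)
  moreover have "continuous_on UNIV (\<lambda>t. blift d b (g t))"
    by (rule continuous_on_compose2[OF blift_cont[OF b1] g(1)]) auto
  ultimately have cv: "continuous_on UNIV ?v" by (intro continuous_intros)
  have near: "\<exists>k::int. \<bar>?v t - of_int k\<bar> < 1 / 4" for t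
  proof -
    obtain k :: int where k: "?v t = of_int k" using int by blast
    show ?thesis unfolding k by (intro exI[of _ k]) simp
  qed
  obtain m :: int where m: "\<And>t. \<bar>?v t - of_int m\<bar> < 1 / 4"
    by (rule near_int_constant[OF cv order.refl near]) (rule that)
  have m': "g (- real d * t) = blift d b (g t) + of_int m" for t
  proof -
    obtain k :: int where k: "?v t = of_int k" using int by blast
    then have "\<bar>of_int k - of_int m\<bar> < (1::real) / 4" using m[of t] by simp
    then have "k = m" by linarith
    then show ?thesis using k by simp
  qed
  \<comment> \<open>Only m modulo d + 1 matters: the quotient q is an integer translation of the
    lift, invisible on the circle.\<close>
  define q where "q = m div (int d + 1)"
  define r where "r = nat (m mod (int d + 1))"
  have r: "int r = m mod (int d + 1)" by (simp add: r_def)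
  then have rd: "r \<le> d" using pos_mod_bound[of "int d + 1" m] by linarith
  have "m = (int d + 1) * q + int r" unfolding r q_def by (simp add: mult_div_mod_eq)
  from arg_cong[OF this, of "of_int :: int \<Rightarrow> real"]
  have "(of_int m :: real) = (real d + 1) * of_int q + real r" by simp
  then have "of_int m / (real d + 1) = real r / (real d + 1) + of_int q" by (simp add: field_simps)
  then have "g t = H (\<sigma> * t + real r / (real d + 1)) + of_int q" for t
    using conjugacy_rigid[OF g(1,2,3) m', of t] H_period_int[of "\<sigma> * t + real r / (real d + 1)" q]
    by (simp add: add.assoc)
  then have "e = conj_cand d f (\<sigma>, r)"
    by (simp add: fun_eq_iff g(4) conj_cand_def hlift_eq_H[OF d f b E])
  then show ?thesis using that[of "(\<sigma>, r)"] g(2) rd by auto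
qed

text \<open>The value at 0 determines the rotation. At 1/4 opposite orientations would differ by
  1/2, which is not an integer.\<close>

lemma conj_cand_distinct:
  assumes d: "d \<ge> 2" and f: "f \<in> Bminus d" and pq: "p \<in> {1, -1} \<times> {..d}" "q \<in> {1, -1} \<times> {..d}"
    and eq: "conj_cand d f p 0 = conj_cand d f q 0" "conj_cand d f p (1 / 4) = conj_cand d f q (1 / 4)"
  shows "p = q"
proof -
  have inj: "\<exists>m::int. s = t + of_int m" if c: "circ (hlift d f s) = circ (hlift d f t)" for s t
  proof -
    obtain m :: int where "hlift d f s = hlift d f t + of_int m" using c unfolding circ_eq_iff by blast
    then have "hlift d f s = hlift d f (t + of_int m)" by (simp add: hlift_period_int[OF d f])
    then show ?thesis using hlift_mono[OF d f] by (auto simp: strict_mono_eq)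
  qed
  obtain \<sigma> r \<tau> s where p: "p = (\<sigma>, r)" "q = (\<tau>, s)" by (metis surj_pair)
  obtain m :: int where "real r / (real d + 1) = real s / (real d + 1) + of_int m"
    using inj eq(1) by (auto simp: conj_cand_def p)
  then have "real r = real s + of_int m * (real d + 1)" by (simp add: field_simps)
  then have "(of_int (int r) :: real) = of_int (int s + m * (int d + 1))" by simp
  then have rs: "int r = int s + m * (int d + 1)" by (simp only: of_int_eq_iff)
  have "m = 0"
  proof (rule ccontr)
    assume "m \<noteq> 0"
    then have "m \<ge> 1 \<or> m \<le> -1" by linarith
    then have "m * (int d + 1) \<ge> int d + 1 \<or> m * (int d + 1) \<le> - (int d + 1)"
    proof
      assume "m \<ge> 1"
      then show ?thesis using mult_right_mono[of 1 m "int d + 1"] by simp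
    next
      assume "m \<le> -1"
      then show ?thesis using mult_right_mono[of m "-1" "int d + 1"] by simp
    qed
    moreover have "r \<le> d" "s \<le> d" using pq p by auto
    ultimately show False using rs by linarith
  qed
  then have r: "r = s" using rs by simp
  obtain k :: int where "\<sigma> * (1 / 4) + real r / (real d + 1) = \<tau> * (1 / 4) + real s / (real d + 1) + of_int k"
    using inj eq(2) by (auto simp: conj_cand_def p)
  then have "\<sigma> = \<tau> + of_int (4 * k)" using r by simp
  moreover have "\<sigma> = 1 \<or> \<sigma> = -1" "\<tau> = 1 \<or> \<tau> = -1" using pq p by auto
  ultimately have "\<sigma> = \<tau>"
  proof -
    have "(of_int (4 * k) :: real) \<noteq> of_int 2" "(of_int (4 * k) :: real) \<noteq> of_int (- 2)"
      unfolding of_int_eq_iff by presburger+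
    then show ?thesis using \<open>\<sigma> = \<tau> + of_int (4 * k)\<close> \<open>\<sigma> = 1 \<or> \<sigma> = -1\<close> \<open>\<tau> = 1 \<or> \<tau> = -1\<close> by auto
  qed
  then show ?thesis using p r by simp
qed

lemma conj_cand_stable:
  assumes d: "d \<ge> 2" and f: "f \<in> Bminus d" and "\<epsilon> > 0"
  obtains \<delta> where "\<delta> > 0" "\<And>g p t. g \<in> Bminus d \<Longrightarrow> (\<And>z. cmod z = 1 \<Longrightarrow> cmod (g z - f z) < \<delta>) \<Longrightarrow>
     cmod (conj_cand d g p t - conj_cand d f p t) < \<epsilon>"
proof -
  have "\<epsilon> / (2 * pi) > 0" using \<open>\<epsilon> > 0\<close> by simp
  then obtain \<delta> where \<delta>: "\<delta> > 0" "\<And>g t. g \<in> Bminus d \<Longrightarrow> (\<And>z. cmod z = 1 \<Longrightarrow> cmod (g z - f z) < \<delta>) \<Longrightarrow>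
     \<bar>hlift d g t - hlift d f t\<bar> < \<epsilon> / (2 * pi)" using hlift_stable[OF d f] by blast
  have "cmod (conj_cand d g p t - conj_cand d f p t) < \<epsilon>"
    if g: "g \<in> Bminus d" "\<And>z. cmod z = 1 \<Longrightarrow> cmod (g z - f z) < \<delta>" for g p t
  proof -
    let ?s = "fst p * t + real (snd p) / (real d + 1)"
    have "cmod (conj_cand d g p t - conj_cand d f p t) \<le> 2 * pi * \<bar>hlift d g ?s - hlift d f ?s\<bar>"
      unfolding conj_cand_def by (rule circ_diff_le)
    also have "\<dots> < 2 * pi * (\<epsilon> / (2 * pi))" using \<delta>(2)[OF g] by (intro mult_strict_left_mono) auto
    finally show ?thesis by simp
  qed
  then show ?thesis using that \<delta>(1) by blast
qed

text \<open>Uniform continuity in (r, z) on a compact set: scaling by r <= 1 keeps the zeros inside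
  the disk, so no denominator vanishes.\<close>

lemma bprod_ray_continuous:
  assumes "\<And>i. cmod (b i) < 1" "\<epsilon> > 0" "s \<in> {0..1::real}"
  obtains \<delta> where "\<delta> > 0" "\<And>r z. r \<in> {0..1} \<Longrightarrow> \<bar>r - s\<bar> < \<delta> \<Longrightarrow> cmod z \<le> 1 \<Longrightarrow>
    cmod (bprod {..<d} (\<lambda>i. of_real r * b i) (cnj z) - bprod {..<d} (\<lambda>i. of_real s * b i) (cnj z)) < \<epsilon>"
proof -
  let ?F = "\<lambda>(r, z). bprod {..<d} (\<lambda>i. of_real r * b i) (cnj z)"
  have "continuous_on ({0..1::real} \<times> cball (0::complex) 1) ?F"
  proof -
    have "1 - cnj (of_real r * b i) * cnj z \<noteq> 0" if "r \<in> {0..1}" "cmod z \<le> 1" for r :: real and z i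
    proof (rule mob_den_nz)
      have "\<bar>r\<bar> * cmod (b i) \<le> 1 * cmod (b i)" using that by (intro mult_right_mono) auto
      then show "cmod (of_real r * b i) < 1" using assms(1)[of i] by (simp add: norm_mult)
    qed (use that in auto)
    then show ?thesis
      unfolding bprod_def mob_to0_def case_prod_unfold by (intro continuous_intros) auto
  qed
  then have "uniformly_continuous_on ({0..1::real} \<times> cball (0::complex) 1) ?F"
    by (intro compact_uniformly_continuous compact_Times) auto
  then obtain \<delta> where \<delta>: "\<delta> > 0" "\<And>x y. x \<in> {0..1::real} \<times> cball (0::complex) 1 \<Longrightarrow> y \<in> {0..1::real} \<times> cball (0::complex) 1 \<Longrightarrow>
      dist y x < \<delta> \<Longrightarrow> dist (?F y) (?F x) < \<epsilon>"
    unfolding uniformly_continuous_on_def using assms(2) by meson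
  show ?thesis
  proof (rule that[OF \<delta>(1)])
    fix r :: real and z :: complex assume r: "r \<in> {0..1}" "\<bar>r - s\<bar> < \<delta>" "cmod z \<le> 1"
    have "dist (?F (r, z)) (?F (s, z)) < \<epsilon>"
      by (rule \<delta>(2)) (use r assms(3) in \<open>auto simp: dist_Pair_Pair dist_real_def\<close>)
    then show "cmod (bprod {..<d} (\<lambda>i. of_real r * b i) (cnj z) - bprod {..<d} (\<lambda>i. of_real s * b i) (cnj z)) < \<epsilon>"
      by (simp add: dist_norm)
  qed
qed

lemma power_rep:
  assumes "d \<ge> 2"
  shows "blaschke_rep d (\<lambda>z. cnj z ^ d) (\<lambda>_. 0)"
  by (simp add: blaschke_rep_def bprod_def mob_to0_def)

lemma hlift_power:
  assumes "d \<ge> 2"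
  shows "hlift d (\<lambda>z. cnj z ^ d) t = t"
proof -
  note b = power_rep[OF assms]
  have f: "(\<lambda>z. cnj z ^ d) \<in> Bminus d" by (rule rep_Bminus[OF assms b])
  obtain \<mu> L where E: "expanding_circle_lift d (blift d (\<lambda>_. 0)) (\<lambda>t. bmult {..<d} (\<lambda>_. 0) (cnj (circ t))) \<mu> (real d) L"
    using rep_expanding[OF assms b] by blast
  then interpret expanding_circle_lift d "blift d (\<lambda>_. 0)" "\<lambda>t. bmult {..<d} (\<lambda>_. 0) (cnj (circ t))" \<mu> "real d" L .
  have "\<bar>H t - t\<bar> \<le> 0 / (\<mu> - 1)"
    by (rule conjugacy_stable[where \<theta> = "blift d (\<lambda>_. 0)"]) (auto simp: strict_mono_def blift_def)
  then show ?thesis unfolding hlift_eq_H[OF assms f b E] by simp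
qed

text \<open>Scaling the zeros of f by s in [0, 1] joins the power map to f inside
  \<open>Bminus d\<close>. For each s the conjugacy is one of finitely many candidates, told apart
  by their values at 0 and 1/4; continuity makes the index locally constant, and the normalisation
  fixes it at s = 0.\<close>

lemma eta_family_unique:
  assumes d: "d \<ge> 2" and E: "eta_family_ok d E" and f: "f \<in> Bminus d"
  shows "E f t = circ (hlift d f t)"
proof -
  obtain b where b: "blaschke_rep d f b" using Bminus_rep[OF d f] by blast
  have b1: "\<And>i. cmod (b i) < 1" using b by (simp add: blaschke_rep_def)
  define F where "F = (\<lambda>s z. bprod {..<d} (\<lambda>i. complex_of_real s * b i) (cnj z))"
  let ?P = "{1, -1::real} \<times> {..d}"
  have F: "F s \<in> Bminus d" if "s \<in> {0..1}" for s
  proof (rule rep_Bminus[OF d])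
    have "\<bar>s\<bar> * cmod (b i) \<le> 1 * cmod (b i)" for i using that by (intro mult_right_mono) auto
    then show "blaschke_rep d (F s) (\<lambda>i. complex_of_real s * b i)"
      using b1 b unfolding blaschke_rep_def F_def by (auto simp: norm_mult intro: le_less_trans)
  qed
  have E1: "qs_circle_homeo (E g)" "E g (- real d * t) = g (E g t)" if "g \<in> Bminus d" for g t
    using E that unfolding eta_family_ok_def by auto
  have "\<exists>p. p \<in> ?P \<and> E (F s) = conj_cand d (F s) p" if "s \<in> {0..1}" for s
    by (rule qs_conjugacy_cand[OF d F[OF that] E1(1)[OF F[OF that]] E1(2)[OF F[OF that]]]) blast
  then obtain p where p: "\<And>s. s \<in> {0..1} \<Longrightarrow> p s \<in> ?P \<and> E (F s) = conj_cand d (F s) (p s)" by metis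
  have loc: "\<exists>T. openin (top_of_set {0..1}) T \<and> a \<in> T \<and> (\<forall>s\<in>T. p a = p s)" if a: "a \<in> {0..1}" for a
  proof -
    \<comment> \<open>The nonzero distances from the current candidate at the two test points; their
      minimum, capped by 1, separates it from the others.\<close>
    let ?D = "(\<lambda>(q, t). cmod (conj_cand d (F a) q t - conj_cand d (F a) (p a) t)) ` (?P \<times> {0, 1 / 4}) - {0}"
    define \<eta> where "\<eta> = Min (insert 1 ?D)"
    have fin: "finite (insert 1 ?D)" by simp
    have \<eta>: "\<eta> > 0" unfolding \<eta>_def using fin by (subst Min_gr_iff) auto
    have \<eta>2: "conj_cand d (F a) q t = conj_cand d (F a) (p a) t"
      if "q \<in> ?P" "t \<in> {0, 1 / 4}" "cmod (conj_cand d (F a) q t - conj_cand d (F a) (p a) t) < \<eta>" for q t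
    proof (rule ccontr)
      assume "\<not> ?thesis"
      then have "cmod (conj_cand d (F a) q t - conj_cand d (F a) (p a) t) \<in> ?D" using that(1,2) by force
      then have "\<eta> \<le> cmod (conj_cand d (F a) q t - conj_cand d (F a) (p a) t)" unfolding \<eta>_def using fin by (intro Min_le) auto
      then show False using that(3) by simp
    qed
    have h: "\<eta> / 2 > 0" using \<eta> by simp
    obtain \<delta>1 where \<delta>1: "\<delta>1 > 0" "\<And>g q t. g \<in> Bminus d \<Longrightarrow> (\<And>z. cmod z = 1 \<Longrightarrow> cmod (g z - F a z) < \<delta>1) \<Longrightarrow>
      cmod (conj_cand d g q t - conj_cand d (F a) q t) < \<eta> / 2" using conj_cand_stable[OF d F[OF a] h] by blast
    have "\<forall>\<epsilon>>0. \<exists>\<delta>>0. \<forall>g\<in>Bminus d. (\<forall>z. cmod z \<le> 1 \<longrightarrow> cmod (g z - F a z) < \<delta>) \<longrightarrow>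
        (\<forall>t. cmod (E g t - E (F a) t) < \<epsilon>)"
      using E F[OF a] unfolding eta_family_ok_def by blast
    then obtain \<delta>2 where \<delta>2: "\<delta>2 > 0" "\<And>g t. g \<in> Bminus d \<Longrightarrow> (\<And>z. cmod z \<le> 1 \<Longrightarrow> cmod (g z - F a z) < \<delta>2) \<Longrightarrow>
        cmod (E g t - E (F a) t) < \<eta> / 2" using h by meson
    have m: "min \<delta>1 \<delta>2 > 0" using \<delta>1 \<delta>2 by simp
    obtain \<delta> where \<delta>: "\<delta> > 0" "\<And>r z. r \<in> {0..1} \<Longrightarrow> \<bar>r - a\<bar> < \<delta> \<Longrightarrow> cmod z \<le> 1 \<Longrightarrow> cmod (F r z - F a z) < min \<delta>1 \<delta>2"
      by (rule bprod_ray_continuous[where b = b and d = d, OF b1 m a]) (rule that, auto simp: F_def)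
    have "p a = p s" if s: "s \<in> {0..1} \<inter> ball a \<delta>" for s
    proof (rule conj_cand_distinct[OF d F[OF a], symmetric])
      have close: "cmod (F s z - F a z) < min \<delta>1 \<delta>2" if "cmod z \<le> 1" for z
        using \<delta>(2)[of s z] s that by (auto simp: dist_real_def abs_minus_commute)
      have "cmod (conj_cand d (F a) (p s) t - conj_cand d (F a) (p a) t) < \<eta>" for t
      proof -
        have "cmod (conj_cand d (F s) (p s) t - conj_cand d (F a) (p s) t) < \<eta> / 2"
          by (rule \<delta>1(2)[OF F]) (use s close in auto)
        moreover have "cmod (E (F s) t - E (F a) t) < \<eta> / 2"
          by (rule \<delta>2(2)[OF F]) (use s close in auto)
        moreover have "E (F s) t - E (F a) t = conj_cand d (F s) (p s) t - conj_cand d (F a) (p a) t"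
          using p[of s] p[of a] s a by simp
        moreover have "conj_cand d (F a) (p s) t - conj_cand d (F a) (p a) t
           = (conj_cand d (F s) (p s) t - conj_cand d (F a) (p a) t) - (conj_cand d (F s) (p s) t - conj_cand d (F a) (p s) t)" by simp
        ultimately show ?thesis using norm_triangle_ineq4 by (smt (verit, ccfv_SIG) field_sum_of_halves)
      qed
      then show "conj_cand d (F a) (p s) 0 = conj_cand d (F a) (p a) 0"
        "conj_cand d (F a) (p s) (1 / 4) = conj_cand d (F a) (p a) (1 / 4)"
        using \<eta>2 p[of s] s by auto
      show "p s \<in> ?P" "p a \<in> ?P" using p s a by auto
    qed
    moreover have "openin (top_of_set {0..1}) ({0..1} \<inter> ball a \<delta>)" by (intro openin_open_Int) auto
    ultimately show ?thesis using a \<delta>(1) by (intro exI[of _ "{0..1} \<inter> ball a \<delta>"]) auto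
  qed
  have "p 0 = p 1"
    by (rule connected_equivalence_relation[of "{0..1::real}" 0 1 "\<lambda>x y. p x = p y"]) (use loc in auto)
  have F0: "F 0 = (\<lambda>z. cnj z ^ d)" by (simp add: F_def bprod_def mob_to0_def)
  have F1: "F 1 = f" using b by (simp add: F_def blaschke_rep_def)
  have "p 0 = (1, 0)"
  proof (rule conj_cand_distinct[OF d F[of 0]])
    have E0: "E (F 0) = circ" using E unfolding eta_family_ok_def F0 by blast
    have c: "conj_cand d (F 0) (1, 0) = circ" by (simp add: fun_eq_iff conj_cand_def F0 hlift_power[OF d])
    show "conj_cand d (F 0) (p 0) 0 = conj_cand d (F 0) (1, 0) 0"
      "conj_cand d (F 0) (p 0) (1 / 4) = conj_cand d (F 0) (1, 0) (1 / 4)"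
      using p[of 0] unfolding c E0 by auto
  qed (use p in auto)
  then have "E f = conj_cand d f (1, 0)" using p[of 1] \<open>p 0 = p 1\<close> by (simp add: F1)
  then show ?thesis by (simp add: conj_cand_def)
qed

lemma eta_family_exists:
  assumes d: "d \<ge> 2"
  shows "eta_family_ok d (\<lambda>f. if f \<in> Bminus d then \<lambda>t. circ (hlift d f t) else (\<lambda>_. 0))"
  unfolding eta_family_ok_def
proof (intro conjI ballI allI impI)
  fix f assume f: "f \<in> Bminus d"
  obtain b where b: "blaschke_rep d f b" using Bminus_rep[OF d f] by blast
  obtain \<mu> L where X: "expanding_circle_lift d (blift d b) (\<lambda>t. bmult {..<d} b (cnj (circ t))) \<mu> (real d) L"
    using rep_expanding[OF d b] by blast
  then interpret expanding_circle_lift d "blift d b" "\<lambda>t. bmult {..<d} b (cnj (circ t))" \<mu> "real d" L .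
  note hH = hlift_eq_H[OF d f b X]
  show "qs_circle_homeo (if f \<in> Bminus d then \<lambda>t. circ (hlift d f t) else (\<lambda>_. 0))"
  proof -
    obtain M where "M \<ge> 1" "\<forall>x t. t > 0 \<longrightarrow> \<bar>H (x + t) - H x\<bar> \<le> M * \<bar>H x - H (x - t)\<bar> \<and> \<bar>H x - H (x - t)\<bar> \<le> M * \<bar>H (x + t) - H x\<bar>"
      using H_quasisymmetric by blast
    then show ?thesis unfolding qs_circle_homeo_def hH
      using f H_cont H_strict_mono H_period by (intro exI[of _ H] exI[of _ M]) auto
  qed
  show "(if f \<in> Bminus d then \<lambda>t. circ (hlift d f t) else (\<lambda>_. 0)) (- real d * t) =
      f ((if f \<in> Bminus d then \<lambda>t. circ (hlift d f t) else (\<lambda>_. 0)) t)" for t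
    using f hlift_rep[OF d f b, of t] rep_circ[OF b] by simp
  fix \<epsilon> :: real assume "\<epsilon> > 0"
  then obtain \<delta> where \<delta>: "\<delta> > 0" "\<And>g p t. g \<in> Bminus d \<Longrightarrow> (\<And>z. cmod z = 1 \<Longrightarrow> cmod (g z - f z) < \<delta>) \<Longrightarrow>
     cmod (conj_cand d g p t - conj_cand d f p t) < \<epsilon>" using conj_cand_stable[OF d f] by blast
  show "\<exists>\<delta>>0. \<forall>g\<in>Bminus d. (\<forall>z. cmod z \<le> 1 \<longrightarrow> cmod (g z - f z) < \<delta>) \<longrightarrow>
     (\<forall>t. cmod ((if g \<in> Bminus d then \<lambda>t. circ (hlift d g t) else (\<lambda>_. 0)) t
         - (if f \<in> Bminus d then \<lambda>t. circ (hlift d f t) else (\<lambda>_. 0)) t) < \<epsilon>)"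
  proof (intro exI[of _ \<delta>] conjI \<delta>(1) ballI impI allI)
    fix g t assume g: "g \<in> Bminus d" "\<forall>z. cmod z \<le> 1 \<longrightarrow> cmod (g z - f z) < \<delta>"
    have "cmod (conj_cand d g (1, 0) t - conj_cand d f (1, 0) t) < \<epsilon>" by (rule \<delta>(2)) (use g in auto)
    then show "cmod ((if g \<in> Bminus d then \<lambda>t. circ (hlift d g t) else (\<lambda>_. 0)) t
         - (if f \<in> Bminus d then \<lambda>t. circ (hlift d f t) else (\<lambda>_. 0)) t) < \<epsilon>"
      using f g by (simp add: conj_cand_def)
  qed
next
  have "(\<lambda>z. cnj z ^ d) \<in> Bminus d" by (rule rep_Bminus[OF d power_rep[OF d]])
  then show "(if (\<lambda>z. cnj z ^ d) \<in> Bminus d then \<lambda>t. circ (hlift d (\<lambda>z. cnj z ^ d) t) else (\<lambda>_. 0)) = circ"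
    by (simp add: hlift_power[OF d])
qed auto

text \<open>Outside \<open>Bminus d\<close> the value of a family is prescribed, so uniqueness on
  \<open>Bminus d\<close> gives equality of functions, as the definite description requires.\<close>

lemma eta_eq:
  assumes d: "d \<ge> 2" and f: "f \<in> Bminus d"
  shows "eta d f t = circ (hlift d f t)"
proof -
  have "eta_family_ok d (eta d)"
    unfolding eta_def
  proof (rule theI[of "eta_family_ok d" "\<lambda>f. if f \<in> Bminus d then \<lambda>t. circ (hlift d f t) else (\<lambda>_. 0)"])
    show "eta_family_ok d (\<lambda>f. if f \<in> Bminus d then \<lambda>t. circ (hlift d f t) else (\<lambda>_. 0))"
      by (rule eta_family_exists[OF d])
    fix E assume E: "eta_family_ok d E"
    show "E = (\<lambda>f. if f \<in> Bminus d then \<lambda>t. circ (hlift d f t) else (\<lambda>_. 0))"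
    proof
      fix f
      show "E f = (if f \<in> Bminus d then \<lambda>t. circ (hlift d f t) else (\<lambda>_. 0))"
      proof (cases "f \<in> Bminus d")
        case True
        then show ?thesis using eta_family_unique[OF d E True] by (simp add: fun_eq_iff)
      next
        case False
        then show ?thesis using E unfolding eta_family_ok_def by simp
      qed
    qed
  qed
  then show ?thesis by (rule eta_family_unique[OF d _ f])
qed

section \<open>Fixed points and the half-plane model\<close>

text \<open>The derivative bound of the expanding lift, read on the circle: every fixed point there
  is repelling, so \<open>rep_fix\<close> contains all of them.\<close>

lemma norm_dbar_circle_gt1:
  assumes d: "d \<ge> 2" and f: "f \<in> Bminus d" and x: "cmod x = 1"
  shows "cmod (dbar f x) > 1"
proof -
  obtain b where b: "blaschke_rep d f b" using Bminus_rep[OF d f] by blast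
  obtain \<mu> L where "expanding_circle_lift d (blift d b) (\<lambda>t. bmult {..<d} b (cnj (circ t))) \<mu> (real d) L"
    using rep_expanding[OF d b] by blast
  then interpret expanding_circle_lift d "blift d b" "\<lambda>t. bmult {..<d} b (cnj (circ t))" \<mu> "real d" L .
  obtain t where t: "circ t = x" using circ_surj[OF x] by blast
  have "cmod (deriv (bprod {..<d} b) (cnj x)) = bmult {..<d} b (cnj x)"
    using b x by (intro bprod_deriv_norm_circle) (auto simp: blaschke_rep_def)
  moreover have "f = (\<lambda>z. bprod {..<d} b (cnj z))" using b by (simp add: blaschke_rep_def)
  ultimately have "cmod (dbar f x) = bmult {..<d} b (cnj x)" by (simp add: dbar_bprod)
  then show ?thesis using expand[of t] mu t by simp
qed

lemma hlift_circ_eq_iff: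
  assumes d: "d \<ge> 2" and f: "f \<in> Bminus d"
  shows "circ (hlift d f s) = circ (hlift d f t) \<longleftrightarrow> (\<exists>m::int. s = t + of_int m)"
proof
  assume "circ (hlift d f s) = circ (hlift d f t)"
  then obtain m :: int where "hlift d f s = hlift d f t + of_int m" unfolding circ_eq_iff by blast
  then have "hlift d f s = hlift d f (t + of_int m)" by (simp add: hlift_period_int[OF d f])
  then show "\<exists>m::int. s = t + of_int m" using hlift_mono[OF d f] by (auto simp: strict_mono_eq)
next
  assume "\<exists>m::int. s = t + of_int m"
  then show "circ (hlift d f s) = circ (hlift d f t)" by (auto simp: hlift_period_int[OF d f])
qed

lemma hlift_surj:
  assumes d: "d \<ge> 2" and f: "f \<in> Bminus d"
  shows "\<exists>t. hlift d f t = y"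
proof -
  define n where "n = \<lceil>\<bar>y - hlift d f 0\<bar>\<rceil>"
  have n: "\<bar>y - hlift d f 0\<bar> \<le> of_int n" unfolding n_def by (rule le_of_int_ceiling)
  have "hlift d f (0 + of_int (- n)) \<le> y" "y \<le> hlift d f (0 + of_int n)"
    unfolding hlift_period_int[OF d f] using n by simp_all
  moreover have "0 + of_int (- n) \<le> (0::real) + of_int n" using n by simp
  ultimately show ?thesis using IVT'[of "hlift d f" "0 + of_int (- n)" y "0 + of_int n"] hlift_cont[OF d f]
    by (meson continuous_on_subset subset_UNIV)
qed

text \<open>Through the conjugacy the equation becomes -d t = t modulo 1.\<close>

lemma circle_fixed_iff:
  assumes d: "d \<ge> 2" and f: "f \<in> Bminus d"
  shows "f (eta d f t) = eta d f t \<longleftrightarrow> (\<exists>m::int. t = of_int m / (real d + 1))"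
proof -
  obtain b where b: "blaschke_rep d f b" using Bminus_rep[OF d f] by blast
  have "f (eta d f t) = circ (hlift d f (- real d * t))"
    by (simp add: eta_eq[OF d f] rep_circ[OF b] hlift_rep[OF d f b, simplified])
  then have "f (eta d f t) = eta d f t \<longleftrightarrow> (\<exists>m::int. - real d * t = t + of_int m)"
    by (simp add: eta_eq[OF d f] hlift_circ_eq_iff[OF d f, simplified])
  also have "\<dots> \<longleftrightarrow> (\<exists>m::int. t = of_int m / (real d + 1))"
  proof
    assume "\<exists>m::int. - real d * t = t + of_int m"
    then obtain m :: int where "- real d * t = t + of_int m" by blast
    then have "t = of_int (- m) / (real d + 1)" by (simp add: field_simps)
    then show "\<exists>m::int. t = of_int m / (real d + 1)" by blast
  next
    assume "\<exists>m::int. t = of_int m / (real d + 1)"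
    then obtain m :: int where "t = of_int m / (real d + 1)" by blast
    then have "- real d * t = t + of_int (- m)" by (simp add: field_simps)
    then show "\<exists>m::int. - real d * t = t + of_int m" by blast
  qed
  finally show ?thesis .
qed

lemma rep_fix_eq:
  assumes d: "d \<ge> 2" and f: "f \<in> Bminus d"
  shows "rep_fix f = (\<lambda>k. eta d f (real k / (real d + 1))) ` {..d}"
proof (intro set_eqI iffI)
  fix z assume "z \<in> rep_fix f"
  then have z: "cmod z = 1" "f z = z" by (auto simp: rep_fix_def)
  obtain s where s: "circ s = z" using circ_surj[OF z(1)] by blast
  obtain t where t: "hlift d f t = s" using hlift_surj[OF d f] by blast
  have e: "eta d f t = z" using s t by (simp add: eta_eq[OF d f])
  then obtain m :: int where m: "t = of_int m / (real d + 1)" using z(2) circle_fixed_iff[OF d f, of t] by auto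
  define q where "q = m div (int d + 1)"
  define r where "r = nat (m mod (int d + 1))"
  have r: "int r = m mod (int d + 1)" by (simp add: r_def)
  then have rd: "r \<le> d" using pos_mod_bound[of "int d + 1" m] by linarith
  have "m = (int d + 1) * q + int r" unfolding r q_def by (simp add: mult_div_mod_eq)
  from arg_cong[OF this, of "of_int :: int \<Rightarrow> real"]
  have "(of_int m :: real) = (real d + 1) * of_int q + real r" by simp
  then have "t = real r / (real d + 1) + of_int q" unfolding m by (simp add: field_simps)
  then have "eta d f (real r / (real d + 1)) = z"
    using e by (simp add: eta_eq[OF d f] hlift_period_int[OF d f])
  then show "z \<in> (\<lambda>k. eta d f (real k / (real d + 1))) ` {..d}" using rd by auto
next
  fix z assume "z \<in> (\<lambda>k. eta d f (real k / (real d + 1))) ` {..d}"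
  then obtain k where k: "z = eta d f (real k / (real d + 1))" by auto
  have "real k / (real d + 1) = of_int (int k) / (real d + 1)" by simp
  then have "f z = z" unfolding k using circle_fixed_iff[OF d f, of "real k / (real d + 1)"] by blast
  moreover have "cmod z = 1" unfolding k by (simp add: eta_eq[OF d f])
  ultimately show "z \<in> rep_fix f" using norm_dbar_circle_gt1[OF d f] by (simp add: rep_fix_def)
qed

lemma card_rep_fix:
  assumes d: "d \<ge> 2" and f: "f \<in> Bminus d"
  shows "finite (rep_fix f)" "card (rep_fix f) = d + 1"
proof -
  have "inj_on (\<lambda>k. eta d f (real k / (real d + 1))) {..d}"
  proof (rule inj_onI)
    fix j k assume jk: "j \<in> {..d}" "k \<in> {..d}" and "eta d f (real j / (real d + 1)) = eta d f (real k / (real d + 1))"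
    then obtain m :: int where m: "real j / (real d + 1) = real k / (real d + 1) + of_int m"
      by (auto simp: eta_eq[OF d f] hlift_circ_eq_iff[OF d f])
    have j: "0 \<le> real j / (real d + 1)" "real j / (real d + 1) < 1" "0 \<le> real k / (real d + 1)" "real k / (real d + 1) < 1"
      using jk by auto
    then have "real_of_int m < 1" "- 1 < real_of_int m" using m by linarith+
    then have "m = 0" by linarith
    then show "j = k" using m by simp
  qed
  then show "card (rep_fix f) = d + 1" unfolding rep_fix_eq[OF d f] by (simp add: card_image)
  show "finite (rep_fix f)" unfolding rep_fix_eq[OF d f] by simp
qed

lemma marked_point_in_rep_fix:
  assumes d: "d \<ge> 2" and f: "f \<in> Bminus d"
  shows "marked_point d f \<in> rep_fix f"
  unfolding rep_fix_eq[OF d f] marked_point_def by (intro image_eqI[of _ _ 0]) auto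

lemma BminusK_multiplier:
  assumes d: "d \<ge> 2" and f: "f \<in> BminusK d K" and x: "x \<in> rep_fix f"
  shows "cmod (dbar f x) \<le> exp K"
proof -
  have fB: "f \<in> Bminus d" using f by (simp add: BminusK_def)
  obtain k where k: "x = eta d f (real k / (real d + 1))" using x unfolding rep_fix_eq[OF d fB] by auto
  have "- real d * (real k / (real d + 1)) - real k / (real d + 1) = of_int (- int k)"
  proof -
    define q where "q = real k / (real d + 1)"
    have "(real d + 1) * q = real k" by (simp add: q_def)
    then show ?thesis unfolding q_def[symmetric] by (simp add: algebra_simps)
  qed
  then have "- real d * (real k / (real d + 1)) - real k / (real d + 1) \<in> \<int>" by (metis Ints_of_int)
  then have "ln (cmod (dbar f x)) \<le> K" using f unfolding BminusK_def k by blast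
  moreover have "cmod (dbar f x) > 0" using norm_dbar_circle_gt1[OF d fB] x by (force simp: rep_fix_def)
  ultimately show ?thesis by (metis exp_le_cancel_iff exp_ln)
qed

section \<open>The Cayley transform to the upper half-plane\<close>

definition cay :: "complex \<Rightarrow> complex \<Rightarrow> complex" where
  "cay x0 \<zeta> = x0 * ((\<zeta> - \<i>) / (\<zeta> + \<i>))"

lemma plus_i_nonzero: "Im \<zeta> \<ge> 0 \<Longrightarrow> \<zeta> + \<i> \<noteq> 0"
  by (auto simp: complex_eq_iff)

lemma cay_norm:
  assumes "cmod x0 = 1" "Im \<zeta> \<ge> 0"
  shows "1 - (cmod (cay x0 \<zeta>))\<^sup>2 = 4 * Im \<zeta> / (cmod (\<zeta> + \<i>))\<^sup>2"
proof -
  have "(cmod (\<zeta> + \<i>))\<^sup>2 \<noteq> 0" using plus_i_nonzero[OF assms(2)] by simp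
  moreover have a: "4 * Im \<zeta> = (cmod (\<zeta> + \<i>))\<^sup>2 - (cmod (\<zeta> - \<i>))\<^sup>2"
    unfolding cmod_power2 by (simp add: power2_eq_square algebra_simps)
  moreover have b: "(cmod (cay x0 \<zeta>))\<^sup>2 = (cmod (\<zeta> - \<i>))\<^sup>2 / (cmod (\<zeta> + \<i>))\<^sup>2"
    unfolding cay_def norm_mult norm_divide assms(1) by (simp add: power_divide)
  ultimately show ?thesis unfolding a b diff_divide_distrib by simp
qed

lemma cay_norm_le1:
  assumes "cmod x0 = 1" "Im \<zeta> \<ge> 0"
  shows "cmod (cay x0 \<zeta>) \<le> 1"
proof -
  have "1 - (cmod (cay x0 \<zeta>))\<^sup>2 \<ge> 0" unfolding cay_norm[OF assms] using assms by simp
  then show ?thesis by (simp add: abs_square_le_1)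
qed

lemma cay_norm_less1:
  assumes "cmod x0 = 1" "Im \<zeta> > 0"
  shows "cmod (cay x0 \<zeta>) < 1"
proof -
  have "1 - (cmod (cay x0 \<zeta>))\<^sup>2 > 0"
    using cay_norm[of x0 \<zeta>] assms plus_i_nonzero[of \<zeta>] by (simp add: divide_pos_pos)
  then show ?thesis by (simp add: abs_square_less_1)
qed

lemma cay_norm_real: "cmod x0 = 1 \<Longrightarrow> cmod (cay x0 (of_real t)) = 1"
  using cay_norm[of x0 "of_real t"] by (simp add: abs_square_eq_1)

lemma cay_diff_pole:
  assumes "Im \<zeta> \<ge> 0"
  shows "x0 - cay x0 \<zeta> = x0 * (2 * \<i> / (\<zeta> + \<i>))"
  using plus_i_nonzero[OF assms] by (simp add: cay_def field_simps)

lemma cay_diff: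
  assumes "Im \<zeta> \<ge> 0" "Im \<omega> \<ge> 0"
  shows "cay x0 \<zeta> - cay x0 \<omega> = x0 * (2 * \<i> * (\<zeta> - \<omega>) / ((\<zeta> + \<i>) * (\<omega> + \<i>)))"
proof -
  have n: "\<zeta> + \<i> \<noteq> 0" "\<omega> + \<i> \<noteq> 0" using plus_i_nonzero assms by auto
  have "(\<zeta> - \<i>) / (\<zeta> + \<i>) - (\<omega> - \<i>) / (\<omega> + \<i>) = ((\<zeta> - \<i>) * (\<omega> + \<i>) - (\<omega> - \<i>) * (\<zeta> + \<i>)) / ((\<zeta> + \<i>) * (\<omega> + \<i>))"
    using n by (simp add: diff_frac_eq)
  also have "(\<zeta> - \<i>) * (\<omega> + \<i>) - (\<omega> - \<i>) * (\<zeta> + \<i>) = 2 * \<i> * (\<zeta> - \<omega>)" by (simp add: algebra_simps)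
  finally have e: "(\<zeta> - \<i>) / (\<zeta> + \<i>) - (\<omega> - \<i>) / (\<omega> + \<i>) = 2 * \<i> * (\<zeta> - \<omega>) / ((\<zeta> + \<i>) * (\<omega> + \<i>))" .
  show ?thesis unfolding cay_def right_diff_distrib[symmetric] e ..
qed

lemma cay_inj:
  assumes "x0 \<noteq> 0" "Im \<zeta> \<ge> 0" "Im \<omega> \<ge> 0" "cay x0 \<zeta> = cay x0 \<omega>"
  shows "\<zeta> = \<omega>"
proof -
  have "x0 * (2 * \<i> * (\<zeta> - \<omega>) / ((\<zeta> + \<i>) * (\<omega> + \<i>))) = 0" using cay_diff[OF assms(2,3), of x0] assms(4) by simp
  then show ?thesis using assms(1) plus_i_nonzero assms(2,3) by auto
qed

lemma cay_surj_disk: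
  assumes "cmod x0 = 1" "cmod z < 1"
  obtains \<zeta> where "Im \<zeta> > 0" "cay x0 \<zeta> = z"
proof
  have n: "x0 - z \<noteq> 0" using assms by auto
  let ?\<zeta> = "\<i> * ((x0 + z) / (x0 - z))"
  have x0: "x0 \<noteq> 0" using assms by auto
  have e: "?\<zeta> - \<i> = 2 * \<i> * z / (x0 - z)" "?\<zeta> + \<i> = 2 * \<i> * x0 / (x0 - z)"
    using n by (simp_all add: field_simps)
  show "cay x0 ?\<zeta> = z" unfolding cay_def e using n x0 by simp
  have "Re ((x0 + z) / (x0 - z)) = ((cmod x0)\<^sup>2 - (cmod z)\<^sup>2) / (cmod (x0 - z))\<^sup>2"
    unfolding Re_divide cmod_power2 by (simp add: power2_eq_square algebra_simps)
  also have "\<dots> > 0" using assms n by (intro divide_pos_pos) (auto simp: abs_square_less_1)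
  finally show "Im ?\<zeta> > 0" by (simp only: Im_i_times)
qed

lemma cay_surj_circle:
  assumes "cmod x0 = 1" "cmod z = 1" "z \<noteq> x0"
  obtains t where "cay x0 (of_real t) = z"
proof -
  have n: "x0 - z \<noteq> 0" using assms by auto
  let ?\<zeta> = "\<i> * ((x0 + z) / (x0 - z))"
  have x0: "x0 \<noteq> 0" using assms by auto
  have e: "?\<zeta> - \<i> = 2 * \<i> * z / (x0 - z)" "?\<zeta> + \<i> = 2 * \<i> * x0 / (x0 - z)"
    using n by (simp_all add: field_simps)
  have c: "cay x0 ?\<zeta> = z" unfolding cay_def e using n x0 by simp
  have "Re ((x0 + z) / (x0 - z)) = ((cmod x0)\<^sup>2 - (cmod z)\<^sup>2) / (cmod (x0 - z))\<^sup>2"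
    unfolding Re_divide cmod_power2 by (simp add: power2_eq_square algebra_simps)
  then have "Re ((x0 + z) / (x0 - z)) = 0" using assms by simp
  then have "Im ?\<zeta> = 0" by (simp only: Im_i_times)
  then have "?\<zeta> = of_real (Re ?\<zeta>)" by (simp add: complex_eq_iff)
  then show ?thesis using that[of "Re ?\<zeta>"] c by metis
qed

text \<open>Up to a rotation e, recentring at \<omega> is the half-plane quotient (\<zeta> -
  \<omega>) / (\<zeta> - cnj \<omega>). The point x0 is \<zeta> = infinity, where the quotient is
  1.\<close>

lemma mob_to0_cay:
  assumes "cmod x0 = 1" "Im \<omega> > 0"
  obtains e where "cmod e = 1"
    "\<And>\<zeta>. Im \<zeta> \<ge> 0 \<Longrightarrow> mob_to0 (cay x0 \<omega>) (cay x0 \<zeta>) = e * ((\<zeta> - \<omega>) / (\<zeta> - cnj \<omega>))"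
    "mob_to0 (cay x0 \<omega>) x0 = e"
proof
  have xx: "cnj x0 * x0 = 1" using assms by (simp add: mult.commute flip: complex_norm_square)
  have n: "\<omega> + \<i> \<noteq> 0" using plus_i_nonzero assms by simp
  have cn: "cnj \<omega> - \<i> \<noteq> 0" using n by (metis complex_cnj_add complex_cnj_cnj complex_cnj_i complex_cnj_zero_iff uminus_add_conv_diff add.commute)
  let ?e = "- x0 * ((cnj \<omega> - \<i>) / (\<omega> + \<i>))"
  have cc: "cnj (cay x0 \<omega>) = cnj x0 * ((cnj \<omega> + \<i>) / (cnj \<omega> - \<i>))" by (simp add: cay_def)
  have "cmod (cnj \<omega> - \<i>) = cmod (\<omega> + \<i>)" by (metis complex_cnj_add complex_cnj_i complex_mod_cnj uminus_add_conv_diff add.commute)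
  then show "cmod ?e = 1" using assms(1) n by (simp add: norm_mult norm_divide)
  show "mob_to0 (cay x0 \<omega>) (cay x0 \<zeta>) = ?e * ((\<zeta> - \<omega>) / (\<zeta> - cnj \<omega>))" if z: "Im \<zeta> \<ge> 0" for \<zeta>
  proof -
    have nz: "\<zeta> + \<i> \<noteq> 0" using plus_i_nonzero z by simp
    have nd: "\<zeta> - cnj \<omega> \<noteq> 0" using z assms(2) by (auto simp: complex_eq_iff)
    have num: "cay x0 \<zeta> - cay x0 \<omega> = x0 * (2 * \<i> * (\<zeta> - \<omega>) / ((\<zeta> + \<i>) * (\<omega> + \<i>)))"
      using cay_diff z assms(2) by simp
    have "1 - cnj (cay x0 \<omega>) * cay x0 \<zeta> = 1 - (cnj x0 * x0) * (((cnj \<omega> + \<i>) * (\<zeta> - \<i>)) / ((cnj \<omega> - \<i>) * (\<zeta> + \<i>)))"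
      unfolding cc by (simp add: cay_def)
    also have "\<dots> = ((cnj \<omega> - \<i>) * (\<zeta> + \<i>) - (cnj \<omega> + \<i>) * (\<zeta> - \<i>)) / ((cnj \<omega> - \<i>) * (\<zeta> + \<i>))"
      unfolding xx using cn nz by (simp add: diff_divide_distrib)
    also have "(cnj \<omega> - \<i>) * (\<zeta> + \<i>) - (cnj \<omega> + \<i>) * (\<zeta> - \<i>) = - (2 * \<i> * (\<zeta> - cnj \<omega>))" by (simp add: algebra_simps)
    finally have den: "1 - cnj (cay x0 \<omega>) * cay x0 \<zeta> = - (2 * \<i> * (\<zeta> - cnj \<omega>)) / ((cnj \<omega> - \<i>) * (\<zeta> + \<i>))" .
    show ?thesis unfolding mob_to0_def num den using n cn nz nd by simp
  qed
  show "mob_to0 (cay x0 \<omega>) x0 = ?e"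
  proof -
    have num: "x0 - cay x0 \<omega> = x0 * (2 * \<i> / (\<omega> + \<i>))" using cay_diff_pole assms(2) by simp
    have "1 - cnj (cay x0 \<omega>) * x0 = 1 - (cnj x0 * x0) * ((cnj \<omega> + \<i>) / (cnj \<omega> - \<i>))" unfolding cc by simp
    also have "\<dots> = - (2 * \<i>) / (cnj \<omega> - \<i>)" unfolding xx using cn by (simp add: field_simps)
    finally have den: "1 - cnj (cay x0 \<omega>) * x0 = - (2 * \<i>) / (cnj \<omega> - \<i>)" .
    have "x * (2 * \<i> / A) / (- (2 * \<i>) / C) = - x * (C / A)" if "A \<noteq> 0" "C \<noteq> 0" for x A C :: complex
      using that by (simp add: field_simps)
    from this[OF n cn] show ?thesis unfolding mob_to0_def num den .
  qed
qed

lemma one_minus_mob_cay: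
  assumes "cmod x0 = 1" "Im \<omega> > 0" "Im \<zeta> > 0"
  shows "1 - (cmod (mob_to0 (cay x0 \<omega>) (cay x0 \<zeta>)))\<^sup>2 = 4 * Im \<zeta> * Im \<omega> / (cmod (\<zeta> - cnj \<omega>))\<^sup>2"
proof -
  obtain e where e: "cmod e = 1" "mob_to0 (cay x0 \<omega>) (cay x0 \<zeta>) = e * ((\<zeta> - \<omega>) / (\<zeta> - cnj \<omega>))"
    by (rule mob_to0_cay[OF assms(1,2)]) (use assms(3) in auto)
  have "(cmod (\<zeta> - cnj \<omega>))\<^sup>2 \<noteq> 0" using assms(2,3) by (auto simp: complex_eq_iff)
  moreover have a: "4 * Im \<zeta> * Im \<omega> = (cmod (\<zeta> - cnj \<omega>))\<^sup>2 - (cmod (\<zeta> - \<omega>))\<^sup>2"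
    unfolding cmod_power2 by (simp add: power2_eq_square algebra_simps)
  moreover have b: "(cmod (mob_to0 (cay x0 \<omega>) (cay x0 \<zeta>)))\<^sup>2 = (cmod (\<zeta> - \<omega>))\<^sup>2 / (cmod (\<zeta> - cnj \<omega>))\<^sup>2"
    unfolding e(2) norm_mult norm_divide e(1) by (simp add: power_divide)
  ultimately show ?thesis unfolding a b diff_divide_distrib by simp
qed

lemma artanh_mono:
  fixes x y :: real
  assumes "0 \<le> x" "x \<le> y" "y < 1"
  shows "artanh x \<le> artanh y"
proof -
  have "(1 + x) / (1 - x) \<le> (1 + y) / (1 - y)" using assms by (intro frac_le) auto
  moreover have "0 < (1 + x) / (1 - x)" using assms by simp
  ultimately show ?thesis by (simp add: artanh_def)
qed

lemma hdist_le:
  assumes "cmod z < 1" "cmod p < 1" "0 < \<kappa>" "\<kappa> \<le> 1" "\<kappa> \<le> 1 - (cmod (mob_to0 p z))\<^sup>2"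
  shows "hdist z p \<le> 2 * artanh (sqrt (1 - \<kappa>))"
proof -
  have "cmod (mob_to0 p z) \<le> sqrt (1 - \<kappa>)" using assms by (intro real_le_rsqrt) auto
  then show ?thesis unfolding hdist_mob using assms by (intro mult_left_mono artanh_mono) (auto simp: real_sqrt_lt_1_iff)
qed

text \<open>A point seen under a definite angle between two boundary fixed points is moved a bounded distance:
  its image lies in two slightly enlarged horoballs.\<close>

lemma quasi_fixed:
  assumes d: "d \<ge> 2" and f: "f \<in> Bminus d" and L: "\<Lambda> \<ge> 1"
    and x0: "cmod x0 = 1" "f x0 = x0" "cmod (dbar f x0) \<le> \<Lambda>"
    and t: "f (cay x0 (of_real t)) = cay x0 (of_real t)" "cmod (dbar f (cay x0 (of_real t))) \<le> \<Lambda>"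
    and \<zeta>: "Im \<zeta> > 0" "cmod (\<zeta> - of_real t) \<le> 2 * Im \<zeta>"
  shows "hdist (f (cay x0 \<zeta>)) (cay x0 \<zeta>) \<le> 2 * artanh (sqrt (1 - 4 / (\<Lambda> * (2 + 4 * \<Lambda>)\<^sup>2)))"
proof -
  have d1: "d \<ge> 1" using d by simp
  let ?z = "cay x0 \<zeta>"
  have z1: "cmod ?z < 1" by (rule cay_norm_less1[OF x0(1) \<zeta>(1)])
  have fz1: "cmod (f ?z) < 1" by (rule Bminus_norm_less1[OF f d1 z1])
  obtain \<omega> where \<omega>: "Im \<omega> > 0" "cay x0 \<omega> = f ?z" using cay_surj_disk[OF x0(1) fz1] by blast
  let ?A = "(cmod (\<zeta> + \<i>))\<^sup>2" and ?B = "(cmod (\<omega> + \<i>))\<^sup>2"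
  have AB: "?A > 0" "?B > 0" using plus_i_nonzero[of \<zeta>] plus_i_nonzero[of \<omega>] \<zeta> \<omega> by auto
  have nz: "1 - (cmod ?z)\<^sup>2 = 4 * Im \<zeta> / ?A" using cay_norm[OF x0(1)] \<zeta> by simp
  have nw: "1 - (cmod (f ?z))\<^sup>2 = 4 * Im \<omega> / ?B" using cay_norm[OF x0(1) less_imp_le[OF \<omega>(1)]] \<omega>(2) by simp
  \<comment> \<open>Horoballs at infinity are half-planes, so Julia's inequality at x0 compares
    heights only.\<close>
  have 1: "Im \<zeta> \<le> \<Lambda> * Im \<omega>"
  proof -
    have "(cmod (x0 - f ?z))\<^sup>2 * (1 - (cmod ?z)\<^sup>2) \<le> cmod (dbar f x0) * (1 - (cmod (f ?z))\<^sup>2) * (cmod (x0 - ?z))\<^sup>2"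
      by (rule Bminus_julia[OF f d1 x0(1,2)]) (use z1 in simp)
    also have "\<dots> \<le> \<Lambda> * (1 - (cmod (f ?z))\<^sup>2) * (cmod (x0 - ?z))\<^sup>2"
      using x0(3) fz1 by (intro mult_right_mono) (auto simp: power_le_one)
    finally have "(cmod (x0 - f ?z))\<^sup>2 * (1 - (cmod ?z)\<^sup>2) \<le> \<Lambda> * (1 - (cmod (f ?z))\<^sup>2) * (cmod (x0 - ?z))\<^sup>2" .
    moreover have "(cmod (x0 - f ?z))\<^sup>2 = 4 / ?B" "(cmod (x0 - ?z))\<^sup>2 = 4 / ?A"
      unfolding \<omega>(2)[symmetric] using cay_diff_pole[of \<zeta> x0] cay_diff_pole[of \<omega> x0] \<zeta> \<omega> x0(1)
      by (simp_all add: norm_mult norm_divide power_divide)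
    ultimately have "4 / ?B * (4 * Im \<zeta> / ?A) \<le> \<Lambda> * (4 * Im \<omega> / ?B) * (4 / ?A)" by (simp only: nz nw)
    then have "Im \<zeta> * (16 / (?A * ?B)) \<le> (\<Lambda> * Im \<omega>) * (16 / (?A * ?B))" by (simp add: mult_ac)
    moreover have "16 / (?A * ?B) > 0" using AB by simp
    ultimately show ?thesis by (rule mult_right_le_imp_le)
  qed
  have 2: "(cmod (\<omega> - of_real t))\<^sup>2 * Im \<zeta> \<le> \<Lambda> * Im \<omega> * (cmod (\<zeta> - of_real t))\<^sup>2"
  proof -
    let ?x = "cay x0 (of_real t)" and ?T = "(cmod (of_real t + \<i>))\<^sup>2"
    have T: "?T > 0" using plus_i_nonzero[of "of_real t"] by simp
    have "(cmod (?x - f ?z))\<^sup>2 * (1 - (cmod ?z)\<^sup>2) \<le> cmod (dbar f ?x) * (1 - (cmod (f ?z))\<^sup>2) * (cmod (?x - ?z))\<^sup>2"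
      by (rule Bminus_julia[OF f d1 cay_norm_real[OF x0(1)] t(1)]) (use z1 in simp)
    also have "\<dots> \<le> \<Lambda> * (1 - (cmod (f ?z))\<^sup>2) * (cmod (?x - ?z))\<^sup>2"
      using t(2) fz1 by (intro mult_right_mono) (auto simp: power_le_one)
    finally have "(cmod (?x - f ?z))\<^sup>2 * (1 - (cmod ?z)\<^sup>2) \<le> \<Lambda> * (1 - (cmod (f ?z))\<^sup>2) * (cmod (?x - ?z))\<^sup>2" .
    moreover have "(cmod (?x - f ?z))\<^sup>2 = 4 * (cmod (\<omega> - of_real t))\<^sup>2 / (?T * ?B)"
      "(cmod (?x - ?z))\<^sup>2 = 4 * (cmod (\<zeta> - of_real t))\<^sup>2 / (?T * ?A)"
      unfolding \<omega>(2)[symmetric] using cay_diff[of "of_real t" \<omega> x0] cay_diff[of "of_real t" \<zeta> x0] \<zeta> \<omega> x0(1)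
      by (simp_all add: norm_mult norm_divide power_divide power_mult_distrib norm_minus_commute)
    ultimately have "4 * (cmod (\<omega> - of_real t))\<^sup>2 / (?T * ?B) * (4 * Im \<zeta> / ?A)
      \<le> \<Lambda> * (4 * Im \<omega> / ?B) * (4 * (cmod (\<zeta> - of_real t))\<^sup>2 / (?T * ?A))" by (simp only: nz nw)
    then have "((cmod (\<omega> - of_real t))\<^sup>2 * Im \<zeta>) * (16 / (?T * ?A * ?B))
      \<le> (\<Lambda> * Im \<omega> * (cmod (\<zeta> - of_real t))\<^sup>2) * (16 / (?T * ?A * ?B))" by (simp add: mult_ac)
    moreover have "16 / (?T * ?A * ?B) > 0" using AB T by simp
    ultimately show ?thesis by (rule mult_right_le_imp_le)
  qed
  let ?v = "Im \<zeta>" and ?r = "cmod (\<omega> - of_real t)"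
  have im: "Im \<omega> \<le> ?r" using abs_Im_le_cmod[of "\<omega> - of_real t"] by simp
  have r0: "?r > 0" using im \<omega>(1) by linarith
  have "?r\<^sup>2 * ?v \<le> \<Lambda> * ?r * (2 * ?v)\<^sup>2"
  proof -
    have "\<Lambda> * Im \<omega> * (cmod (\<zeta> - of_real t))\<^sup>2 \<le> \<Lambda> * ?r * (2 * ?v)\<^sup>2"
      using im \<zeta> \<omega> L by (intro mult_mono power_mono) auto
    then show ?thesis using 2 by linarith
  qed
  then have "?r * (?r * ?v) \<le> (\<Lambda> * 4 * ?v) * (?r * ?v)" by (simp add: power2_eq_square mult_ac)
  then have r: "?r \<le> \<Lambda> * 4 * ?v" using r0 \<zeta>(1) by (simp only: mult_le_cancel_right) (simp add: not_less)
  have "cmod (\<omega> - cnj \<zeta>) \<le> ?r + cmod (cnj (\<zeta> - of_real t))"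
    using norm_triangle_ineq4[of "\<omega> - of_real t" "cnj (\<zeta> - of_real t)"] by simp
  also have "\<dots> \<le> \<Lambda> * 4 * ?v + 2 * ?v" using r \<zeta>(2) by (simp only: complex_mod_cnj)
  also have "\<dots> = (2 + 4 * \<Lambda>) * ?v" by (simp add: algebra_simps)
  finally have den: "(cmod (\<omega> - cnj \<zeta>))\<^sup>2 \<le> ((2 + 4 * \<Lambda>) * ?v)\<^sup>2" by (intro power_mono) auto
  have den0: "(cmod (\<omega> - cnj \<zeta>))\<^sup>2 > 0" using \<zeta>(1) \<omega>(1) by (auto simp: complex_eq_iff)
  \<comment> \<open>The constant combines Im \<omega> >= Im \<zeta> / \<Lambda> with |\<omega> - cnj
    \<zeta>| <= (2 + 4 \<Lambda>) Im \<zeta>.\<close>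
  have "4 / (\<Lambda> * (2 + 4 * \<Lambda>)\<^sup>2) = 4 * (?v / \<Lambda>) * ?v / ((2 + 4 * \<Lambda>) * ?v)\<^sup>2"
    using \<zeta>(1) L by (simp add: power_mult_distrib power2_eq_square)
  also have "\<dots> \<le> 4 * Im \<omega> * ?v / (cmod (\<omega> - cnj \<zeta>))\<^sup>2"
  proof (rule frac_le)
    have "?v / \<Lambda> \<le> Im \<omega>" using 1 L by (simp add: divide_le_eq mult.commute)
    then show "4 * (?v / \<Lambda>) * ?v \<le> 4 * Im \<omega> * ?v" using \<zeta>(1) by (intro mult_right_mono mult_left_mono) auto
  qed (use den den0 \<omega> \<zeta> in auto)
  also have "\<dots> = 1 - (cmod (mob_to0 ?z (f ?z)))\<^sup>2"
    unfolding \<omega>(2)[symmetric] using one_minus_mob_cay[OF x0(1) \<zeta>(1) \<omega>(1)] by simp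
  finally have k: "4 / (\<Lambda> * (2 + 4 * \<Lambda>)\<^sup>2) \<le> 1 - (cmod (mob_to0 ?z (f ?z)))\<^sup>2" .
  have "1 * (2 + 4 * 1)\<^sup>2 \<le> \<Lambda> * (2 + 4 * \<Lambda>)\<^sup>2" using L by (intro mult_mono power_mono) auto
  then have "4 / (\<Lambda> * (2 + 4 * \<Lambda>)\<^sup>2) \<le> 1" using L by (simp add: divide_le_eq)
  moreover have "4 / (\<Lambda> * (2 + 4 * \<Lambda>)\<^sup>2) > 0" using L by (intro divide_pos_pos mult_pos_pos zero_less_power) auto
  ultimately show ?thesis using hdist_le[OF fz1 z1 _ _ k] by simp
qed

text \<open>Points of the geodesic from \<open>ih\<close> to \<open>y + i\<epsilon>\<close> in the half-plane, parametrised as in the disk model.\<close>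

lemma half_plane_edge:
  fixes h y \<epsilon> s :: real
  assumes h: "h > 0" and y: "0 \<le> y" "2 * y \<le> h" and \<epsilon>: "0 \<le> \<epsilon>" "2 * \<epsilon> < h"
    and s: "0 \<le> s" "s \<le> 1" "s < 1 \<or> \<epsilon> > 0"
  defines "w \<equiv> of_real s * ((Complex y \<epsilon> - Complex 0 h) / (Complex y \<epsilon> - Complex 0 (- h)))"
  obtains X v where "cmod w < 1"
    "(Complex X v - Complex 0 h) / (Complex X v - Complex 0 (- h)) = w"
    "0 \<le> X" "X \<le> y" "s > 0 \<Longrightarrow> y > 0 \<Longrightarrow> X > 0" "\<epsilon> \<le> v" "v > 0" "v \<le> h" "s > 0 \<Longrightarrow> v < h"
    "y * (X\<^sup>2 + v\<^sup>2 - h\<^sup>2) = X * (y\<^sup>2 + \<epsilon>\<^sup>2 - h\<^sup>2)" "v \<ge> 2 * (y - X)"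
proof -
  \<comment> \<open>D0 is |y + i (\<epsilon> + h)|^2, the point - \<alpha> - i \<beta> is the disk
    coordinate of the far end, and m is its squared modulus.\<close>
  define D0 where "D0 = y\<^sup>2 + (\<epsilon> + h)\<^sup>2"
  have D0: "D0 > 0" using h \<epsilon> unfolding D0_def by (intro add_nonneg_pos) auto
  define \<alpha> where "\<alpha> = (h\<^sup>2 - y\<^sup>2 - \<epsilon>\<^sup>2) / D0"
  define \<beta> where "\<beta> = 2 * h * y / D0"
  define m where "m = (y\<^sup>2 + (h - \<epsilon>)\<^sup>2) / D0"
  have yh: "y\<^sup>2 \<le> h\<^sup>2 / 4" using power_mono[of y "h / 2" 2] y by (simp add: power_divide)
  have eh: "\<epsilon>\<^sup>2 \<le> h\<^sup>2 / 4" using power_mono[of \<epsilon> "h / 2" 2] \<epsilon> by (simp add: power_divide)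
  have hh: "h\<^sup>2 > 0" using h by simp
  have "h\<^sup>2 - y\<^sup>2 - \<epsilon>\<^sup>2 > 0" using yh eh hh by linarith
  then have \<alpha>: "\<alpha> > 0" unfolding \<alpha>_def using D0 by (rule divide_pos_pos)
  have \<beta>: "\<beta> \<ge> 0" unfolding \<beta>_def using h y D0 by simp
  have m_eq: "m = \<alpha>\<^sup>2 + \<beta>\<^sup>2"
  proof -
    have "(y\<^sup>2 + (h - \<epsilon>)\<^sup>2) * D0 = (h\<^sup>2 - y\<^sup>2 - \<epsilon>\<^sup>2)\<^sup>2 + (2 * h * y)\<^sup>2"
      unfolding D0_def by (simp add: power2_eq_square algebra_simps)
    then have "(y\<^sup>2 + (h - \<epsilon>)\<^sup>2) / D0 = ((h\<^sup>2 - y\<^sup>2 - \<epsilon>\<^sup>2)\<^sup>2 + (2 * h * y)\<^sup>2) / (D0 * D0)"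
      using D0 by (simp add: nonzero_divide_eq_eq nonzero_eq_divide_eq)
    then show ?thesis unfolding m_def \<alpha>_def \<beta>_def by (simp add: power_divide add_divide_distrib power2_eq_square)
  qed
  have m1: "m \<le> 1"
  proof -
    have "4 * h * \<epsilon> \<ge> 0" using h \<epsilon> by simp
    then have "y\<^sup>2 + (h - \<epsilon>)\<^sup>2 \<le> D0" unfolding D0_def by (simp add: power2_eq_square algebra_simps)
    then show ?thesis unfolding m_def using D0 by (simp add: divide_le_eq)
  qed
  have m0: "m \<ge> 0" unfolding m_eq by simp
  have m1s: "m < 1" if "\<epsilon> > 0"
  proof -
    have "4 * h * \<epsilon> > 0" using h that by simp
    then have "y\<^sup>2 + (h - \<epsilon>)\<^sup>2 < D0" unfolding D0_def by (simp add: power2_eq_square algebra_simps)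
    then show ?thesis unfolding m_def using D0 by (simp add: divide_less_eq)
  qed
  have \<phi>: "(Complex y \<epsilon> - Complex 0 h) / (Complex y \<epsilon> - Complex 0 (- h)) = Complex (- \<alpha>) (- \<beta>)"
  proof -
    have "(Complex (- \<alpha>) (- \<beta>)) * (Complex y \<epsilon> - Complex 0 (- h)) = Complex y \<epsilon> - Complex 0 h"
    proof -
      have 1: "\<alpha> * D0 = h\<^sup>2 - y\<^sup>2 - \<epsilon>\<^sup>2" "\<beta> * D0 = 2 * h * y" using D0 by (simp_all add: \<alpha>_def \<beta>_def)
      have "(- \<alpha> * y + \<beta> * (\<epsilon> + h)) * D0 = y * D0" "(- \<alpha> * (\<epsilon> + h) - \<beta> * y) * D0 = (\<epsilon> - h) * D0"
      proof -
        have "(- \<alpha> * y + \<beta> * (\<epsilon> + h)) * D0 = - (\<alpha> * D0) * y + (\<beta> * D0) * (\<epsilon> + h)" by (simp add: algebra_simps)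
        also have "\<dots> = y * D0" unfolding 1 unfolding D0_def by (simp add: power2_eq_square algebra_simps)
        finally show "(- \<alpha> * y + \<beta> * (\<epsilon> + h)) * D0 = y * D0" .
        have "(- \<alpha> * (\<epsilon> + h) - \<beta> * y) * D0 = - (\<alpha> * D0) * (\<epsilon> + h) - (\<beta> * D0) * y" by (simp add: algebra_simps)
        also have "\<dots> = (\<epsilon> - h) * D0" unfolding 1 unfolding D0_def by (simp add: power2_eq_square algebra_simps)
        finally show "(- \<alpha> * (\<epsilon> + h) - \<beta> * y) * D0 = (\<epsilon> - h) * D0" .
      qed
      then have "- \<alpha> * y + \<beta> * (\<epsilon> + h) = y" "- \<alpha> * (\<epsilon> + h) - \<beta> * y = \<epsilon> - h" using D0 by simp_all
      then show ?thesis by (simp add: complex_eq_iff)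
    qed
    note eq = this
    have nz: "Complex y \<epsilon> - Complex 0 (- h) \<noteq> 0" using h \<epsilon> by (simp add: complex_eq_iff)
    show ?thesis by (rule iffD2[OF nonzero_divide_eq_eq[OF nz] sym[OF eq]])
  qed
  have w: "w = Complex (- (s * \<alpha>)) (- (s * \<beta>))" unfolding w_def \<phi> by (rule complex_eqI) simp_all
  have s2m: "s\<^sup>2 * m < 1"
  proof (cases "s < 1")
    case True
    have "s\<^sup>2 * m \<le> s\<^sup>2 * 1" using m1 by (intro mult_left_mono) auto
    also have "\<dots> < 1" using True s by (simp add: abs_square_less_1)
    finally show ?thesis .
  next
    case False
    then have "s = 1" using s by simp
    then show ?thesis using m1s s by auto
  qed
  have wn: "(cmod w)\<^sup>2 = s\<^sup>2 * m" unfolding w m_eq cmod_power2 by (simp add: power2_eq_square algebra_simps)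
  have "(cmod w)\<^sup>2 < 1" unfolding wn by (rule s2m)
  then have w1: "cmod w < 1" by (simp add: abs_square_less_1)
  \<comment> \<open>Inverting w = (\<zeta> - i h) / (\<zeta> + i h) gives \<zeta> = i h (1 + w) / (1
    - w). D is |1 - w|^2, and D1 is its value at s = 1.\<close>
  define D where "D = 1 + 2 * s * \<alpha> + s\<^sup>2 * m"
  have D: "D \<ge> 1" unfolding D_def using s \<alpha> m0 by simp
  define D1 where "D1 = 1 + 2 * \<alpha> + m"
  have D1: "D1 \<ge> 1" unfolding D1_def using \<alpha> m0 by simp
  define X where "X = 2 * h * s * \<beta> / D"
  define v where "v = h * (1 - s\<^sup>2 * m) / D"
  have D1D0: "D1 * D0 = 4 * h\<^sup>2"
  proof -
    have "D1 * D0 = D0 + 2 * (\<alpha> * D0) + m * D0" by (simp add: D1_def algebra_simps)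
    also have "\<dots> = D0 + 2 * (h\<^sup>2 - y\<^sup>2 - \<epsilon>\<^sup>2) + (y\<^sup>2 + (h - \<epsilon>)\<^sup>2)" using D0 by (simp add: \<alpha>_def m_def)
    finally show ?thesis unfolding D0_def by (simp add: power2_eq_square algebra_simps)
  qed
  have yD: "y = 2 * h * \<beta> / D1"
  proof -
    have bD: "\<beta> * D0 = 2 * h * y" using D0 by (simp add: \<beta>_def)
    have "(y * D1) * D0 = y * (D1 * D0)" by (simp only: mult.assoc)
    also have "\<dots> = (2 * h) * (\<beta> * D0)" unfolding D1D0 bD by (simp add: power2_eq_square)
    also have "\<dots> = (2 * h * \<beta>) * D0" by (simp only: mult.assoc)
    finally have "y * D1 = 2 * h * \<beta>" using D0 by simp
    then show ?thesis using D1 by (simp add: eq_divide_eq)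
  qed
  have eD: "\<epsilon> = h * (1 - m) / D1"
  proof -
    have "(1 - m) * D0 = 4 * h * \<epsilon>"
    proof -
      have "(1 - m) * D0 = D0 - (y\<^sup>2 + (h - \<epsilon>)\<^sup>2)" using D0 by (simp add: m_def left_diff_distrib)
      then show ?thesis unfolding D0_def by (simp add: power2_eq_square algebra_simps)
    qed
    note mD = this
    have "(\<epsilon> * D1) * D0 = \<epsilon> * (D1 * D0)" by (simp only: mult.assoc)
    also have "\<dots> = h * ((1 - m) * D0)" unfolding D1D0 mD by (simp add: power2_eq_square)
    also have "\<dots> = (h * (1 - m)) * D0" by (simp only: mult.assoc)
    finally have "\<epsilon> * D1 = h * (1 - m)" using D0 by simp
    then show ?thesis using D1 by (simp add: eq_divide_eq)
  qed
  have X0: "0 \<le> X" unfolding X_def using h s \<beta> D by simp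
  have Xy: "X \<le> y"
  proof -
    have "s * D1 \<le> D"
    proof -
      have "0 \<le> (1 - s) * (1 - s * m)" using s m0 m1 by (intro mult_nonneg_nonneg) (auto simp: mult_le_one)
      then show ?thesis unfolding D_def D1_def by (simp add: power2_eq_square algebra_simps)
    qed
    then have "s / D \<le> 1 / D1" using D D1 by (simp add: divide_le_eq mult.commute pos_le_divide_eq)
    then have "2 * h * \<beta> * (s / D) \<le> 2 * h * \<beta> * (1 / D1)" using h \<beta> by (intro mult_left_mono) auto
    then show ?thesis unfolding X_def by (subst yD) (simp add: mult_ac)
  qed
  have Xpos: "X > 0" if "s > 0" "y > 0"
  proof -
    have "\<beta> > 0" unfolding \<beta>_def using h that D0 by simp
    then show ?thesis unfolding X_def using h that D by simp
  qed
  have ev: "\<epsilon> \<le> v"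
  proof -
    have "s\<^sup>2 \<le> 1" using s by (simp add: power_le_one)
    moreover from this have "s\<^sup>2 * m \<le> 1 * m" using m0 by (rule mult_right_mono)
    ultimately have "h * (1 - m) / D1 \<le> h * (1 - s\<^sup>2 * m) / D"
    proof (intro frac_le mult_left_mono)
      have "s * \<alpha> \<le> 1 * \<alpha>" using s \<alpha> by (intro mult_right_mono) auto
      then show "D \<le> D1" unfolding D_def D1_def using \<open>s\<^sup>2 * m \<le> 1 * m\<close> by simp
    qed (use h s2m D in auto)
    then show ?thesis unfolding v_def by (subst eD)
  qed
  have v0: "v > 0" unfolding v_def using h s2m D by simp
  have hv: "h - v = h * (2 * s * \<alpha> + 2 * s\<^sup>2 * m) / D"
    unfolding v_def using D by (simp add: D_def field_simps)
  have vh: "v \<le> h"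
  proof -
    have "0 \<le> h * (2 * s * \<alpha> + 2 * s\<^sup>2 * m) / D" using h s \<alpha> m0 D by simp
    then show ?thesis using hv by simp
  qed
  have vh': "v < h" if "s > 0"
  proof -
    have "0 < 2 * s * \<alpha> + 2 * s\<^sup>2 * m" using that \<alpha> m0 by (intro add_pos_nonneg) auto
    then have "0 < h * (2 * s * \<alpha> + 2 * s\<^sup>2 * m) / D" using h D by simp
    then show ?thesis using hv by simp
  qed
  have circ0: "(2 * h * t * \<beta> / E)\<^sup>2 + (h * (1 - t\<^sup>2 * m) / E)\<^sup>2 - h\<^sup>2 = - 4 * h\<^sup>2 * t * \<alpha> / E"
    if "E = 1 + 2 * t * \<alpha> + t\<^sup>2 * m" "E \<ge> 1" for t E
  proof -
    have "(2 * h * t * \<beta>)\<^sup>2 + (h * (1 - t\<^sup>2 * m))\<^sup>2 - h\<^sup>2 * E\<^sup>2 = - 4 * h\<^sup>2 * t * \<alpha> * E"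
      unfolding that(1) m_eq by (simp add: power2_eq_square algebra_simps)
    then have "((2 * h * t * \<beta>)\<^sup>2 + (h * (1 - t\<^sup>2 * m))\<^sup>2 - h\<^sup>2 * E\<^sup>2) / E\<^sup>2 = - 4 * h\<^sup>2 * t * \<alpha> * E / E\<^sup>2" by simp
    then show ?thesis using that(2) by (simp add: power_divide diff_divide_distrib add_divide_distrib power2_eq_square)
  qed
  have c1: "X\<^sup>2 + v\<^sup>2 - h\<^sup>2 = - 4 * h\<^sup>2 * s * \<alpha> / D"
    unfolding X_def v_def by (rule circ0) (use D D_def in auto)
  have c2: "y\<^sup>2 + \<epsilon>\<^sup>2 - h\<^sup>2 = - 4 * h\<^sup>2 * \<alpha> / D1"
  proof -
    have "(2 * h * 1 * \<beta> / D1)\<^sup>2 + (h * (1 - 1\<^sup>2 * m) / D1)\<^sup>2 - h\<^sup>2 = - 4 * h\<^sup>2 * 1 * \<alpha> / D1"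
      by (rule circ0) (use D1 D1_def in auto)
    then show ?thesis by (subst yD, subst eD) simp
  qed
  \<comment> \<open>A circle through i h centred on the real axis satisfies x^2 + v^2 - h^2 = 2 c x;
    the centre c is eliminated between the moving point and the far end.\<close>
  have circle: "y * (X\<^sup>2 + v\<^sup>2 - h\<^sup>2) = X * (y\<^sup>2 + \<epsilon>\<^sup>2 - h\<^sup>2)"
    unfolding c1 c2 unfolding X_def by (subst yD) (simp add: mult_ac)
  \<comment> \<open>The circle equation gives y v^2 >= (y - X) h^2, and h >= 2 y makes the right
    side at least 4 y (y - X)^2.\<close>
  have steep: "v \<ge> 2 * (y - X)"
  proof (cases "y = 0")
    case True
    then show ?thesis using X0 v0 by simp
  next
    case False
    then have y0: "y > 0" using y by simp
    have "y * v\<^sup>2 = (y - X) * (h\<^sup>2 + X * y) + X * \<epsilon>\<^sup>2" using circle by (simp add: power2_eq_square algebra_simps)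
    also have "\<dots> \<ge> (y - X) * h\<^sup>2"
    proof -
      have "0 \<le> (y - X) * (X * y)" "0 \<le> X * \<epsilon>\<^sup>2" using Xy X0 y0 by (auto intro!: mult_nonneg_nonneg)
      then show ?thesis unfolding distrib_left by linarith
    qed
    finally have "(y - X) * h\<^sup>2 \<le> y * v\<^sup>2" .
    moreover have "(y - X) * (4 * y * (y - X)) \<le> (y - X) * h\<^sup>2"
    proof (rule mult_left_mono)
      have "4 * y * (y - X) \<le> (2 * y) * (2 * y)" using y0 X0 by (simp add: algebra_simps)
      also have "\<dots> \<le> h * h" using y by (intro mult_mono) auto
      finally show "4 * y * (y - X) \<le> h\<^sup>2" by (simp add: power2_eq_square)
    qed (use Xy in simp)
    ultimately have "y * (2 * (y - X))\<^sup>2 \<le> y * v\<^sup>2" by (simp add: power2_eq_square algebra_simps)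
    then have "(2 * (y - X))\<^sup>2 \<le> v\<^sup>2" using y0 by simp
    then show ?thesis by (rule power2_le_imp_le) (rule less_imp_le[OF v0])
  qed
  have "(Complex X v - Complex 0 h) / (Complex X v - Complex 0 (- h)) = w"
  proof -
    have "w * (Complex X v - Complex 0 (- h)) = Complex X v - Complex 0 h"
    proof -
      have XD: "X * D = 2 * h * s * \<beta>" "v * D = h * (1 - s\<^sup>2 * m)" using D by (simp_all add: X_def v_def)
      have "(- (s * \<alpha>) * X + s * \<beta> * (v + h)) * D = X * D" "(- (s * \<alpha>) * (v + h) - s * \<beta> * X) * D = (v - h) * D"
      proof -
        have "(- (s * \<alpha>) * X + s * \<beta> * (v + h)) * D = - (s * \<alpha>) * (X * D) + s * \<beta> * (v * D + h * D)" by (simp add: algebra_simps)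
        also have "\<dots> = X * D" unfolding XD unfolding D_def by (simp add: power2_eq_square algebra_simps)
        finally show "(- (s * \<alpha>) * X + s * \<beta> * (v + h)) * D = X * D" .
        have "(- (s * \<alpha>) * (v + h) - s * \<beta> * X) * D = - (s * \<alpha>) * (v * D + h * D) - s * \<beta> * (X * D)" by (simp add: algebra_simps)
        also have "\<dots> = v * D - h * D" unfolding XD unfolding D_def m_eq by (simp add: power2_eq_square algebra_simps)
        finally show "(- (s * \<alpha>) * (v + h) - s * \<beta> * X) * D = (v - h) * D" by (simp add: left_diff_distrib)
      qed
      then have "- (s * \<alpha>) * X + s * \<beta> * (v + h) = X" "- (s * \<alpha>) * (v + h) - s * \<beta> * X = v - h" using D by simp_all
      then show ?thesis unfolding w by (simp add: complex_eq_iff)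
    qed
    note eq = this
    have nz: "Complex X v - Complex 0 (- h) \<noteq> 0" using h v0 by (simp add: complex_eq_iff)
    show ?thesis by (rule iffD2[OF nonzero_divide_eq_eq[OF nz] sym[OF eq]])
  qed
  then show ?thesis by (rule that[of X v, OF w1 _ X0 Xy Xpos ev v0 vh vh' circle steep])
qed

section \<open>The tree of a laminar family\<close>

lemma cyclic_permutation_exists:
  assumes "finite S"
  obtains f where "bij_betw f S S" "\<And>u w. u \<in> S \<Longrightarrow> w \<in> S \<Longrightarrow> \<exists>k. (f ^^ k) u = w"
proof -
  define n where "n = card S"
  obtain g where g: "bij_betw g {0..<n} S" using ex_bij_betw_nat_finite[OF assms] unfolding n_def by blast
  define h where "h = the_inv_into {0..<n} g"
  have hg: "h (g i) = i" if "i < n" for i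
    unfolding h_def using g that by (intro the_inv_into_f_f) (auto simp: bij_betw_def)
  define f where "f = (\<lambda>x. g ((h x + 1) mod n))"
  have fg: "f (g i) = g ((i + 1) mod n)" if "i < n" for i using hg[OF that] by (simp add: f_def)
  have S: "\<exists>i<n. u = g i" if "u \<in> S" for u using g that by (auto simp: bij_betw_def)
  have gS: "g i \<in> S" if "i < n" for i using g that by (auto simp: bij_betw_def)
  have pow: "(f ^^ k) (g i) = g ((i + k) mod n)" if "i < n" for i k
  proof (induction k)
    case (Suc k)
    have "(f ^^ Suc k) (g i) = g (((i + k) mod n + 1) mod n)"
      using Suc that by (simp add: fg)
    then show ?case by (simp add: mod_Suc_eq)
  qed (use that in simp)
  have trans: "\<exists>k. (f ^^ k) u = w" if uw: "u \<in> S" "w \<in> S" for u w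
  proof -
    obtain i j where ij: "i < n" "u = g i" "j < n" "w = g j" using S uw by blast
    have "(f ^^ (j + (n - i))) u = g ((i + (j + (n - i))) mod n)" unfolding ij(2) by (rule pow[OF ij(1)])
    also have "i + (j + (n - i)) = j + n" using ij by simp
    finally show ?thesis using ij by auto
  qed
  have fS: "f x \<in> S" if "x \<in> S" for x
    using S[OF that] fg gS by (metis mod_less_divisor not_less_zero gr_implies_not0 neq0_conv)
  have "S \<subseteq> f ` S"
  proof
    fix w assume w: "w \<in> S"
    then obtain i where i: "i < n" "w = g i" using S by blast
    have "f (g ((i + (n - 1)) mod n)) = g (((i + (n - 1)) mod n + 1) mod n)" using i by (intro fg) simp
    also have "((i + (n - 1)) mod n + 1) mod n = (i + (n - 1) + 1) mod n" by (rule mod_add_left_eq)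
    also have "\<dots> = i" using i by simp
    finally have "w = f (g ((i + (n - 1)) mod n))" using i by simp
    then show "w \<in> f ` S" using gS[of "(i + (n - 1)) mod n"] i by auto
  qed
  moreover have "f ` S \<subseteq> S" using fS by auto
  ultimately have "bij_betw f S S"
    using finite_surj_inj[OF assms] by (auto simp: bij_betw_def)
  then show ?thesis using that trans by blast
qed

text \<open>The condition p v < v makes the parent map well-founded and orients every edge in the
  way \<open>is_tree\<close> demands.\<close>

locale parent_tree =
  fixes V :: "nat set" and root :: nat and p :: "nat \<Rightarrow> nat"
  assumes finV: "finite V" and root: "root \<in> V"
    and p: "\<And>v. v \<in> V \<Longrightarrow> v \<noteq> root \<Longrightarrow> p v \<in> V \<and> p v < v"
begin

definition tree_edges :: "(nat \<times> nat) set" where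
  "tree_edges = (\<lambda>v. (p v, v)) ` (V - {root})"

lemma tree_edges_is_tree: "is_tree V tree_edges"
proof -
  have "card tree_edges = card (V - {root})"
    unfolding tree_edges_def by (intro card_image inj_onI) auto
  also have "\<dots> = card V - 1" using finV root by simp
  finally have "card tree_edges + 1 = card V" using finV root card_gt_0_iff[of V] by auto
  moreover have con: "(v, root) \<in> (adj tree_edges)\<^sup>*" if "v \<in> V" for v
    using that
  proof (induction v rule: less_induct)
    case (less v)
    show ?case
    proof (cases "v = root")
      case False
      have "(v, p v) \<in> adj tree_edges" using less.prems False by (auto simp: adj_def tree_edges_def)
      then show ?thesis using less.IH[of "p v"] p[OF less.prems False] by (meson converse_rtrancl_into_rtrancl)
    qed simp
  qed
  moreover have "(v, w) \<in> (adj tree_edges)\<^sup>*" if "v \<in> V" "w \<in> V" for v w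
  proof -
    have "sym (adj tree_edges)" by (auto simp: adj_def sym_def)
    then have "sym ((adj tree_edges)\<^sup>*)" by (rule sym_rtrancl)
    then have "(root, w) \<in> (adj tree_edges)\<^sup>*" using con[OF that(2)] by (meson symD)
    then show ?thesis using con[OF that(1)] by (meson rtrancl_trans)
  qed
  moreover have "tree_edges \<subseteq> {(v, w). v \<in> V \<and> w \<in> V \<and> v < w}" using p by (auto simp: tree_edges_def)
  ultimately show ?thesis unfolding is_tree_def using finV root by auto
qed

lemma tree_nbrs:
  assumes "v \<in> V"
  shows "nbrs tree_edges v = {w \<in> V - {root}. p w = v} \<union> (if v = root then {} else {p v})"
  using assms by (auto simp: nbrs_def adj_def tree_edges_def)

lemma tree_val:
  assumes "v \<in> V"
  shows "val tree_edges v = card {w \<in> V - {root}. p w = v} + (if v = root then 0 else 1)"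
proof (cases "v = root")
  case False
  have "p v \<notin> {w \<in> V - {root}. p w = v}" using p[OF assms False] p by fastforce
  then show ?thesis unfolding val_def tree_nbrs[OF assms] using False finV by simp
next
  case True
  then show ?thesis unfolding val_def tree_nbrs[OF assms] by simp
qed

text \<open>A rotation system is a choice of cyclic permutation of the neighbours at each vertex,
  made independently at each of them.\<close>

lemma tree_ribbon: "\<exists>rot. ribbon V tree_edges rot"
proof -
  have "\<exists>f. bij_betw f (nbrs tree_edges v) (nbrs tree_edges v) \<and>
      (\<forall>u\<in>nbrs tree_edges v. \<forall>w\<in>nbrs tree_edges v. \<exists>k. (f ^^ k) u = w)" if "v \<in> V" for v
  proof -
    have "finite (nbrs tree_edges v)" unfolding tree_nbrs[OF that] using finV by auto
    then show ?thesis using cyclic_permutation_exists[of "nbrs tree_edges v"] by metis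
  qed
  then have "\<exists>rot. \<forall>v\<in>V. bij_betw (rot v) (nbrs tree_edges v) (nbrs tree_edges v) \<and>
      (\<forall>u\<in>nbrs tree_edges v. \<forall>w\<in>nbrs tree_edges v. \<exists>k. (rot v ^^ k) u = w)" by (intro bchoice) blast
  then show ?thesis unfolding ribbon_def .
qed

end

text \<open>A laminar family of intervals \<open>{l..r}\<close> of \<open>{..<d}\<close>, coded as pairs.\<close>

locale cluster_family =
  fixes d :: nat and CC :: "(nat \<times> nat) set"
  assumes d2: "d \<ge> 2"
    and bounds: "\<And>A. A \<in> CC \<Longrightarrow> fst A \<le> snd A \<and> snd A < d"
    and singles: "\<And>i. i < d \<Longrightarrow> (i, i) \<in> CC"
    and whole: "(0, d - 1) \<in> CC"
    and laminar: "\<And>A B. A \<in> CC \<Longrightarrow> B \<in> CC \<Longrightarrow> snd A < fst B \<or> snd B < fst A \<or>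
        (fst B \<le> fst A \<and> snd A \<le> snd B) \<or> (fst A \<le> fst B \<and> snd B \<le> snd A)"
begin

definition top :: "nat \<times> nat" where "top = (0, d - 1)"

definition sub :: "nat \<times> nat \<Rightarrow> nat \<times> nat \<Rightarrow> bool" where
  "sub A B \<longleftrightarrow> fst B \<le> fst A \<and> snd A \<le> snd B"

lemma finCC: "finite CC"
proof (rule finite_subset)
  show "CC \<subseteq> {..<d} \<times> {..<d}" using bounds by force
qed simp

lemma top_in: "top \<in> CC" using whole by (simp add: top_def)

lemma sub_top: "A \<in> CC \<Longrightarrow> sub A top" using bounds[of A] by (auto simp: sub_def top_def)

lemma sub_antisym: "sub A B \<Longrightarrow> sub B A \<Longrightarrow> A = B" by (auto simp: sub_def prod_eq_iff)

text \<open>Take the shortest cluster properly containing A; by laminarity it lies in all the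
  others.\<close>

lemma parent_exists:
  assumes "A \<in> CC" "A \<noteq> top"
  shows "\<exists>B. B \<in> CC \<and> sub A B \<and> A \<noteq> B \<and> (\<forall>C\<in>CC. sub A C \<longrightarrow> A \<noteq> C \<longrightarrow> sub B C)"
proof -
  let ?P = "\<lambda>C. C \<in> CC \<and> sub A C \<and> A \<noteq> C"
  have "?P top" using assms top_in sub_top by auto
  then obtain B where B: "?P B" "\<And>C. ?P C \<Longrightarrow> snd B - fst B \<le> snd C - fst C"
    using ex_has_least_nat[of ?P top "\<lambda>C. snd C - fst C"] by blast
  have "sub B C" if C: "C \<in> CC" "sub A C" "A \<noteq> C" for C
  proof -
    have "snd B - fst B \<le> snd C - fst C" using B(2) C by blast
    moreover have "fst A \<le> snd A" using bounds assms(1) by blast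
    ultimately show ?thesis using laminar[of B C] B(1) C unfolding sub_def by auto
  qed
  then show ?thesis using B(1) by blast
qed

definition par :: "nat \<times> nat \<Rightarrow> nat \<times> nat" where
  "par A = (SOME B. B \<in> CC \<and> sub A B \<and> A \<noteq> B \<and> (\<forall>C\<in>CC. sub A C \<longrightarrow> A \<noteq> C \<longrightarrow> sub B C))"

lemma par:
  assumes "A \<in> CC" "A \<noteq> top"
  shows "par A \<in> CC" "sub A (par A)" "A \<noteq> par A" "\<And>C. C \<in> CC \<Longrightarrow> sub A C \<Longrightarrow> A \<noteq> C \<Longrightarrow> sub (par A) C"
  using someI_ex[OF parent_exists[OF assms]] unfolding par_def[symmetric] by auto

definition children :: "nat \<times> nat \<Rightarrow> (nat \<times> nat) set" where
  "children B = {A \<in> CC. A \<noteq> top \<and> par A = B}"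

lemma finite_children: "finite (children B)"
  unfolding children_def using finCC by auto

text \<open>The longest proper subcluster of B through i is a child of B: a parent strictly inside B
  would be longer still. Singletons being clusters, there is one.\<close>

lemma child_containing:
  assumes B: "B \<in> CC" "fst B < snd B" and i: "fst B \<le> i" "i \<le> snd B"
  obtains A where "A \<in> children B" "fst A \<le> i" "i \<le> snd A"
proof -
  let ?P = "\<lambda>C. C \<in> CC \<and> sub C B \<and> C \<noteq> B \<and> fst C \<le> i \<and> i \<le> snd C"
  have id: "i < d" using bounds[OF B(1)] i by simp
  let ?S = "{C \<in> CC. sub C B \<and> C \<noteq> B \<and> fst C \<le> i \<and> i \<le> snd C}" and ?f = "\<lambda>C. snd C - fst C"
  have fS: "finite (?f ` ?S)" using finCC by simp
  have "(i, i) \<in> ?S" using singles[OF id] B i by (auto simp: sub_def)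
  then have "?f ` ?S \<noteq> {}" by blast
  then obtain A where A0: "A \<in> ?S" "?f A = Max (?f ` ?S)" using Max_in[OF fS] by (metis (no_types, lifting) imageE)
  have Amax: "?f C \<le> ?f A" if "?P C" for C
    unfolding A0(2) by (rule Max_ge[OF fS]) (use that in blast)
  have PA: "?P A" using A0(1) by simp
  have nt: "A \<noteq> top"
  proof
    assume "A = top"
    then have "sub B A" using sub_top B(1) by simp
    then show False using PA sub_antisym by blast
  qed
  have "par A = B"
  proof (rule ccontr)
    assume ne: "par A \<noteq> B"
    have s: "sub (par A) B" using par(4)[OF _ nt, of B] PA B(1) by blast
    have "?P (par A)" using par(1,2)[OF _ nt] PA s ne unfolding sub_def by auto
    then have "snd (par A) - fst (par A) \<le> snd A - fst A" by (rule Amax)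
    moreover have "sub A (par A)" "A \<noteq> par A" using par(2,3)[OF _ nt] PA by auto
    moreover have "fst A \<le> snd A" using bounds PA by blast
    moreover have "fst A \<noteq> fst (par A) \<or> snd A \<noteq> snd (par A)" using par(3)[OF _ nt] PA by (auto simp: prod_eq_iff)
    ultimately show False unfolding sub_def by arith
  qed
  then show ?thesis using that[of A] PA nt by (auto simp: children_def)
qed

lemma children_disjoint:
  assumes "A \<in> children B" "A' \<in> children B" "A \<noteq> A'"
  shows "snd A < fst A' \<or> snd A' < fst A"
proof (rule ccontr)
  assume "\<not> ?thesis"
  then have "sub A A' \<or> sub A' A" using laminar[of A A'] assms unfolding children_def sub_def by auto
  moreover have no: False if "C \<in> children B" "C' \<in> children B" "C \<noteq> C'" "sub C C'" for C C'
  proof -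
    have C: "C \<in> CC" "C \<noteq> top" "par C = B" "C' \<in> CC" "C' \<noteq> top" "par C' = B" using that by (auto simp: children_def)
    have "sub B C'" using par(4)[OF C(1,2,4) that(4,3)] C(3) by simp
    moreover have "sub C' B" "C' \<noteq> B" using par(2,3)[OF C(4,5)] C(6) by auto
    ultimately show False using sub_antisym by blast
  qed
  ultimately show False using no[OF assms] no[OF assms(2,1)] assms(3) by blast
qed

text \<open>The children through the two ends of B differ, since one containing both would be B
  itself.\<close>

lemma card_children_ge2:
  assumes B: "B \<in> CC" "fst B < snd B"
  shows "card (children B) \<ge> 2"
proof -
  obtain A1 where A1: "A1 \<in> children B" "fst A1 \<le> fst B" "fst B \<le> snd A1"
    using child_containing[OF B, of "fst B"] B by auto
  obtain A2 where A2: "A2 \<in> children B" "fst A2 \<le> snd B" "snd B \<le> snd A2"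
    using child_containing[OF B, of "snd B"] B by auto
  have "A1 \<noteq> A2"
  proof
    assume e: "A1 = A2"
    have "A1 \<in> CC" "A1 \<noteq> top" "par A1 = B" using A1 by (auto simp: children_def)
    then have "sub A1 B" "A1 \<noteq> B" using par(2,3)[of A1] by auto
    moreover have "sub B A1" using A1 A2 e by (simp add: sub_def)
    ultimately show False using sub_antisym by blast
  qed
  then have "card {A1, A2} = 2" by simp
  moreover have "card {A1, A2} \<le> card (children B)" using A1 A2 finite_children by (intro card_mono) auto
  ultimately show ?thesis by simp
qed

lemma children_single:
  assumes "B \<in> CC" "fst B = snd B"
  shows "children B = {}"
proof -
  have False if "A \<in> children B" for A
  proof -
    have A: "A \<in> CC" "A \<noteq> top" "par A = B" using that by (auto simp: children_def)
    then have "sub A B" "A \<noteq> B" using par(2,3)[of A] by auto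
    then show False using assms bounds[OF A(1)] by (auto simp: sub_def prod_eq_iff)
  qed
  then show ?thesis by blast
qed

definition branches :: "(nat \<times> nat) set" where
  "branches = {A \<in> CC. fst A < snd A}"

lemma CC_split: "CC = branches \<union> (\<lambda>i. (i, i)) ` {..<d}"
proof (rule antisym; rule subsetI)
  fix A assume A: "A \<in> CC"
  show "A \<in> branches \<union> (\<lambda>i. (i, i)) ` {..<d}"
  proof (cases "fst A < snd A")
    case False
    then have "A = (fst A, fst A)" "fst A < d" using bounds[OF A] by (auto simp: prod_eq_iff)
    then show ?thesis by blast
  qed (use A in \<open>simp add: branches_def\<close>)
next
  fix A assume "A \<in> branches \<union> (\<lambda>i. (i, i)) ` {..<d}"
  then show "A \<in> CC" using singles by (auto simp: branches_def)
qed

text \<open>Every cluster but \<open>top\<close> is a child of exactly one branch, so the numbers of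
  children add up to \<open>card branches + d - 1\<close>, the d singletons being clusters without
  children. This total will match the number of critical points.\<close>

lemma sum_children: "(\<Sum>A\<in>branches. card (children A) - 1) = d - 1"
proof -
  have fin: "finite branches" unfolding branches_def using finCC by auto
  let ?S = "(\<lambda>i. (i, i)) ` {..<d}"
  have CC: "CC = branches \<union> ?S" by (rule CC_split)
  have dis: "branches \<inter> ?S = {}" by (auto simp: branches_def)
  have cS: "card ?S = d" by (simp add: card_image inj_on_def)
  have "card CC = card branches + d" by (subst CC) (simp add: card_Un_disjoint[OF fin _ dis] cS)
  moreover have "card (CC - {top}) = (\<Sum>B\<in>CC. card (children B))"
  proof -
    have "CC - {top} = (\<Union>B\<in>CC. children B)" unfolding children_def using par(1) by blast
    also have "card \<dots> = (\<Sum>B\<in>CC. card (children B))"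
      using finCC finite_children by (intro card_UN_disjoint) (auto simp: children_def)
    finally show ?thesis .
  qed
  moreover have "(\<Sum>B\<in>CC. card (children B)) = (\<Sum>B\<in>branches. card (children B))"
  proof (rule sum.mono_neutral_right[OF finCC])
    show "\<forall>i\<in>CC - branches. card (children i) = 0"
    proof
      fix B assume "B \<in> CC - branches"
      then have "B \<in> CC" "fst B = snd B" using bounds[of B] by (auto simp: branches_def)
      then show "card (children B) = 0" using children_single by simp
    qed
  qed (auto simp: branches_def)
  moreover have "card (CC - {top}) = card CC - 1" using finCC top_in by simp
  ultimately have s: "(\<Sum>B\<in>branches. card (children B)) = card branches + d - 1" by simp
  have "(\<Sum>B\<in>branches. card (children B)) = (\<Sum>B\<in>branches. (card (children B) - 1) + 1)"
  proof (rule sum.cong[OF refl])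
    fix B assume "B \<in> branches"
    then have "card (children B) \<ge> 2" using card_children_ge2 by (simp add: branches_def)
    then show "card (children B) = card (children B) - 1 + 1" by simp
  qed
  also have "\<dots> = (\<Sum>B\<in>branches. card (children B) - 1) + card branches" unfolding sum.distrib by simp
  finally show ?thesis using s d2 by simp
qed

text \<open>Larger clusters get smaller codes, so that edges point away from the root.\<close>

definition cd :: "nat \<times> nat \<Rightarrow> nat" where
  "cd A = (d - (snd A - fst A)) * (d + 1) + fst A"

definition dec :: "nat \<Rightarrow> nat \<times> nat" where
  "dec v = (v mod (d + 1), v mod (d + 1) + (d - v div (d + 1)))"

text \<open>Code of the end at infinity. It exceeds all cluster codes, so the edge from
  \<open>top\<close> to it is increasing too.\<close>

definition N :: nat where "N = (d + 1) * (d + 1)"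

lemma dec_cd: "A \<in> CC \<Longrightarrow> dec (cd A) = A"
proof -
  assume "A \<in> CC"
  then have b: "fst A \<le> snd A" "snd A < d" using bounds by auto
  then have l: "fst A < d + 1" by simp
  \<comment> \<open>The left end is less than d + 1, so division with remainder recovers both parts
    of the code.\<close>
  have "cd A mod (d + 1) = fst A" "cd A div (d + 1) = d - (snd A - fst A)"
    unfolding cd_def using l by (simp_all add: div_mult_self3 del: mult_Suc mult_Suc_right)
  then show ?thesis unfolding dec_def using b by (simp add: prod_eq_iff)
qed

lemma cd_inj: "inj_on cd CC" by (rule inj_on_inverseI[of _ dec]) (rule dec_cd)

lemma cd_less_N: "A \<in> CC \<Longrightarrow> cd A < N"
proof -
  assume "A \<in> CC"
  then have b: "fst A \<le> snd A" "snd A < d" using bounds by auto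
  have "cd A < d * (d + 1) + (d + 1)" unfolding cd_def using b by (intro add_le_less_mono mult_le_mono) auto
  then show ?thesis by (simp add: N_def)
qed

lemma cd_sub_less:
  assumes "A \<in> CC" "B \<in> CC" "sub A B" "A \<noteq> B"
  shows "cd B < cd A"
proof -
  have b: "fst A \<le> snd A" "snd A < d" "fst B \<le> snd B" "snd B < d" using bounds assms by auto
  have "snd A - fst A < snd B - fst B" using assms(3,4) b unfolding sub_def prod_eq_iff by auto
  then have "d - (snd B - fst B) + 1 \<le> d - (snd A - fst A)" using b by linarith
  then have "(d - (snd B - fst B) + 1) * (d + 1) \<le> (d - (snd A - fst A)) * (d + 1)" by (rule mult_le_mono1)
  moreover have "fst B < d + 1" using b by simp
  ultimately show ?thesis unfolding cd_def by (simp add: algebra_simps)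
qed

definition VV :: "nat set" where "VV = insert N (cd ` CC)"

definition pp :: "nat \<Rightarrow> nat" where "pp v = (if v = N then cd top else cd (par (dec v)))"

lemma N_in_VV: "N \<in> VV" and cd_in_VV: "A \<in> CC \<Longrightarrow> cd A \<in> VV"
  by (auto simp: VV_def)

lemma cd_ne_N: "A \<in> CC \<Longrightarrow> cd A \<noteq> N" using cd_less_N by fastforce

lemma pp_cd: "A \<in> CC \<Longrightarrow> pp (cd A) = cd (par A)"
  using cd_ne_N by (simp add: pp_def dec_cd)

lemma cd_eq_top: "A \<in> CC \<Longrightarrow> cd A = cd top \<longleftrightarrow> A = top"
  using cd_inj top_in by (auto dest: inj_onD)

sublocale parent_tree VV "cd top" pp
proof
  show "finite VV" using finCC by (simp add: VV_def)
  show "cd top \<in> VV" using top_in by (simp add: VV_def)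
  fix v assume v: "v \<in> VV" "v \<noteq> cd top"
  show "pp v \<in> VV \<and> pp v < v"
  proof (cases "v = N")
    case True
    then show ?thesis using top_in cd_less_N[OF top_in] by (simp add: pp_def VV_def)
  next
    case False
    then obtain A where A: "A \<in> CC" "v = cd A" using v by (auto simp: VV_def)
    then have nt: "A \<noteq> top" using v by auto
    show ?thesis using cd_sub_less[OF A(1) par(1)[OF A(1) nt] par(2,3)[OF A(1) nt]] par(1)[OF A(1) nt]
      unfolding A(2) pp_cd[OF A(1)] by (auto simp: VV_def)
  qed
qed

lemma edge_cases:
  assumes "e \<in> tree_edges"
  obtains (edge) A where "A \<in> CC" "A \<noteq> top" "e = (cd (par A), cd A)" | (root) "e = (cd top, N)"
proof -
  obtain v where v: "v \<in> VV" "v \<noteq> cd top" "e = (pp v, v)" using assms by (auto simp: tree_edges_def)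
  show ?thesis
  proof (cases "v = N")
    case True
    then show ?thesis using root v by (simp add: pp_def)
  next
    case False
    then obtain A where "A \<in> CC" "v = cd A" using v by (auto simp: VV_def)
    then show ?thesis using edge[of A] v pp_cd by auto
  qed
qed

text \<open>The additional neighbour is the parent, and for \<open>top\<close> it is the end
  N.\<close>

lemma val_cd:
  assumes A: "A \<in> CC"
  shows "val tree_edges (cd A) = card (children A) + 1"
proof -
  have fin: "finite (children A)" by (rule finite_children)
  have pre: "{w \<in> VV - {cd top}. pp w = cd A} = cd ` children A \<union> (if A = top then {N} else {})"
  proof (intro set_eqI iffI)
    fix w assume w: "w \<in> {w \<in> VV - {cd top}. pp w = cd A}"
    show "w \<in> cd ` children A \<union> (if A = top then {N} else {})"
    proof (cases "w = N")
      case True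
      then have "cd top = cd A" using w by (simp add: pp_def)
      then show ?thesis using cd_eq_top[OF A] True by auto
    next
      case False
      then obtain C where C: "C \<in> CC" "w = cd C" using w by (auto simp: VV_def)
      then have nt: "C \<noteq> top" using w by auto
      have "cd (par C) = cd A" using w C pp_cd by auto
      then have "par C = A" using cd_inj par(1)[OF C(1) nt] A by (auto dest: inj_onD)
      then show ?thesis using C nt by (auto simp: children_def)
    qed
  next
    fix w assume w: "w \<in> cd ` children A \<union> (if A = top then {N} else {})"
    then show "w \<in> {w \<in> VV - {cd top}. pp w = cd A}"
    proof
      assume "w \<in> cd ` children A"
      then show ?thesis using pp_cd cd_eq_top by (auto simp: children_def VV_def)
    next
      assume "w \<in> (if A = top then {N} else {})"
      then have "A = top" "w = N" by (auto split: if_splits)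
      then show ?thesis using cd_ne_N[OF top_in] by (auto simp: VV_def pp_def)
    qed
  qed
  have "card (cd ` children A) = card (children A)"
    using cd_inj by (intro card_image) (auto intro: inj_on_subset simp: children_def)
  moreover have "N \<notin> cd ` children A" using cd_ne_N by (force simp: children_def)
  ultimately have "card {w \<in> VV - {cd top}. pp w = cd A} = card (children A) + (if A = top then 1 else 0)"
    unfolding pre using fin by auto
  moreover have "cd A \<in> VV" using A by (simp add: VV_def)
  ultimately show ?thesis using cd_eq_top[OF A] by (simp add: tree_val)
qed

lemma val_N: "val tree_edges N = 1"
proof -
  have "{w \<in> VV - {cd top}. pp w = N} = {}"
  proof -
    have "pp w \<noteq> N" if w: "w \<in> VV" "w \<noteq> cd top" for w
    proof (cases "w = N")
      case False
      then obtain C where C: "C \<in> CC" "w = cd C" using w by (auto simp: VV_def)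
      then have "C \<noteq> top" using w by auto
      then show ?thesis using C pp_cd cd_ne_N par(1) by simp
    qed (use cd_ne_N[OF top_in] in \<open>simp add: pp_def\<close>)
    then show ?thesis by blast
  qed
  moreover have "N \<in> VV" by (simp add: VV_def)
  ultimately show ?thesis using cd_ne_N[OF top_in] by (simp only: tree_val card.empty) auto
qed

lemma branch_eq: "branch VV tree_edges = cd ` branches"
proof (intro set_eqI iffI)
  fix v assume v: "v \<in> branch VV tree_edges"
  then have "v \<noteq> N" using val_N by (auto simp: branch_def)
  then obtain A where A: "A \<in> CC" "v = cd A" using v by (auto simp: branch_def VV_def)
  have "fst A < snd A"
  proof (rule ccontr)
    assume "\<not> fst A < snd A"
    then have "children A = {}" using children_single[OF A(1)] bounds[OF A(1)] by auto
    then show False using v A val_cd by (auto simp: branch_def)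
  qed
  then show "v \<in> cd ` branches" using A by (auto simp: branches_def)
next
  fix v assume "v \<in> cd ` branches"
  then obtain A where A: "A \<in> CC" "fst A < snd A" "v = cd A" by (auto simp: branches_def)
  then show "v \<in> branch VV tree_edges"
    using card_children_ge2[OF A(1,2)] cd_in_VV[OF A(1)] by (simp add: branch_def val_cd)
qed

lemma ends_eq: "ends VV tree_edges = insert N (cd ` (\<lambda>i. (i, i)) ` {..<d})"
proof (intro set_eqI iffI)
  fix v assume v: "v \<in> ends VV tree_edges"
  show "v \<in> insert N (cd ` (\<lambda>i. (i, i)) ` {..<d})"
  proof (cases "v = N")
    case False
    then obtain A where A: "A \<in> CC" "v = cd A" using v by (auto simp: ends_def VV_def)
    have "\<not> fst A < snd A" using card_children_ge2[OF A(1)] v A by (auto simp: ends_def val_cd)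
    then have "A = (fst A, fst A)" "fst A < d" using bounds[OF A(1)] by (auto simp: prod_eq_iff)
    then show ?thesis using A by auto
  qed simp
next
  fix v assume "v \<in> insert N (cd ` (\<lambda>i. (i, i)) ` {..<d})"
  then show "v \<in> ends VV tree_edges"
  proof
    assume "v = N"
    then show ?thesis using val_N N_in_VV by (simp add: ends_def)
  next
    assume "v \<in> cd ` (\<lambda>i. (i, i)) ` {..<d}"
    then obtain i where i: "i < d" "v = cd (i, i)" by auto
    then show ?thesis using singles[OF i(1)] children_single[of "(i, i)"] cd_in_VV[of "(i, i)"] by (simp add: ends_def val_cd)
  qed
qed

lemma cluster_tree_marked: "\<exists>rot. marked_ribbon_tree (d + 1) VV tree_edges N rot"
proof -
  obtain rot where rot: "ribbon VV tree_edges rot" using tree_ribbon by blast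
  have "VV = branch VV tree_edges \<union> ends VV tree_edges"
  proof -
    have "VV = insert N (cd ` (branches \<union> (\<lambda>i. (i, i)) ` {..<d}))"
      unfolding VV_def using CC_split by simp
    then show ?thesis unfolding branch_eq ends_eq by auto
  qed
  moreover have "card (ends VV tree_edges) = d + 1"
  proof -
    have "card (cd ` (\<lambda>i. (i, i)) ` {..<d}) = card ((\<lambda>i. (i, i)) ` {..<d})"
      using cd_inj singles by (intro card_image) (auto intro: inj_on_subset)
    also have "\<dots> = d" by (simp add: card_image inj_on_def)
    finally have "card (cd ` (\<lambda>i. (i, i)) ` {..<d}) = d" .
    moreover have "N \<notin> cd ` (\<lambda>i. (i, i)) ` {..<d}" using cd_ne_N[OF singles] by fastforce
    ultimately show ?thesis unfolding ends_eq by simp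
  qed
  moreover have "N \<in> ends VV tree_edges" unfolding ends_eq by simp
  ultimately show ?thesis unfolding marked_ribbon_tree_def using rot tree_edges_is_tree by blast
qed

end

section \<open>Geometric realisation\<close>

text \<open>One fixed configuration, without limits: each proper cluster is less than half as wide
  as either adjacent gap, which is true of the sequence for all large n.\<close>

locale cluster_geometry = cluster_family d CC for d :: nat and CC :: "(nat \<times> nat) set" +
  fixes t :: "nat \<Rightarrow> real" and x0 :: complex
  assumes x0: "cmod x0 = 1"
    and t_mono: "\<And>i j. i < j \<Longrightarrow> j < d \<Longrightarrow> t i < t j"
    and gapR: "\<And>A. A \<in> CC \<Longrightarrow> A \<noteq> top \<Longrightarrow> Suc (snd A) < d \<Longrightarrow> 2 * (t (snd A) - t (fst A)) < t (Suc (snd A)) - t (snd A)"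
    and gapL: "\<And>A. A \<in> CC \<Longrightarrow> A \<noteq> top \<Longrightarrow> 0 < fst A \<Longrightarrow> 2 * (t (snd A) - t (fst A)) < t (fst A) - t (fst A - 1)"
begin

definition hgt :: "nat \<times> nat \<Rightarrow> real" where "hgt A = 2 * (t (snd A) - t (fst A))"

definition om :: "nat \<times> nat \<Rightarrow> complex" where "om A = Complex (t (fst A)) (hgt A)"

definition pv :: "nat \<Rightarrow> complex" where "pv v = (if v = N then x0 else cay x0 (om (dec v)))"

text \<open>The parameter is proportional to the radius in the disk recentred at the first vertex,
  which makes the image literally \<open>hgeod_from\<close>.\<close>

definition pe :: "nat \<times> nat \<Rightarrow> real \<Rightarrow> complex" where
  "pe e s = mob_from0 (pv (fst e)) (of_real s * mob_to0 (pv (fst e)) (pv (snd e)))"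

lemma t_le: "i \<le> j \<Longrightarrow> j < d \<Longrightarrow> t i \<le> t j"
  using t_mono[of i j] by (cases "i = j") auto

lemma hgt_nonneg: "A \<in> CC \<Longrightarrow> hgt A \<ge> 0"
  using bounds[of A] t_le[of "fst A" "snd A"] by (simp add: hgt_def)

lemma hgt_pos: "A \<in> branches \<Longrightarrow> hgt A > 0"
  using bounds[of A] t_mono[of "fst A" "snd A"] by (simp add: hgt_def branches_def)

lemma hgt_mono: "A \<in> CC \<Longrightarrow> B \<in> CC \<Longrightarrow> sub A B \<Longrightarrow> hgt A \<le> hgt B"
  using bounds[of A] bounds[of B] t_le[of "fst B" "fst A"] t_le[of "snd A" "snd B"] by (simp add: hgt_def sub_def)

lemma par_branch: "A \<in> CC \<Longrightarrow> A \<noteq> top \<Longrightarrow> par A \<in> branches"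
proof -
  assume A: "A \<in> CC" "A \<noteq> top"
  have "fst A \<noteq> fst (par A) \<or> snd A \<noteq> snd (par A)" using par(3)[OF A] by (auto simp: prod_eq_iff)
  then have "fst (par A) < snd (par A)" using par(2)[OF A] bounds[OF A(1)] unfolding sub_def by arith
  then show ?thesis using par(1)[OF A] by (simp add: branches_def)
qed

lemma top_branch: "top \<in> branches"
  using top_in d2 by (simp add: branches_def top_def)

text \<open>These are the hypotheses of \<open>half_plane_edge\<close>. A proper subcluster leaves
  out a point of its parent, so one of its adjacent gaps lies in the parent, and this gap exceeds
  \<open>hgt A\<close>.\<close>

lemma par_metric:
  assumes A: "A \<in> CC" "A \<noteq> top"
  shows "0 \<le> t (fst A) - t (fst (par A))" "2 * (t (fst A) - t (fst (par A))) \<le> hgt (par A)" "2 * hgt A < hgt (par A)"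
proof -
  note p = par[OF A]
  have b: "fst (par A) \<le> fst A" "fst A \<le> snd A" "snd A \<le> snd (par A)" "snd (par A) < d"
    using p(2) bounds[OF A(1)] bounds[OF p(1)] by (auto simp: sub_def)
  show "0 \<le> t (fst A) - t (fst (par A))" using t_le[of "fst (par A)" "fst A"] b by simp
  show "2 * (t (fst A) - t (fst (par A))) \<le> hgt (par A)" using t_le[of "fst A" "snd (par A)"] b by (simp add: hgt_def)
  have "fst A \<noteq> fst (par A) \<or> snd A \<noteq> snd (par A)" using p(3) by (auto simp: prod_eq_iff)
  then consider "fst (par A) < fst A" | "snd A < snd (par A)" using b by linarith
  then show "2 * hgt A < hgt (par A)"
  proof cases
    case 1
    then have "hgt A < t (fst A) - t (fst A - 1)" using gapL[OF A] by (simp add: hgt_def)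
    also have "\<dots> \<le> t (snd (par A)) - t (fst (par A))"
    proof -
      have "t (fst A) \<le> t (snd (par A))" using b by (intro t_le) auto
      moreover have "t (fst (par A)) \<le> t (fst A - 1)" using b 1 by (intro t_le) linarith+
      ultimately show ?thesis by linarith
    qed
    finally show ?thesis by (simp add: hgt_def)
  next
    case 2
    then have "hgt A < t (Suc (snd A)) - t (snd A)" using gapR[OF A] b by (simp add: hgt_def)
    also have "\<dots> \<le> t (snd (par A)) - t (fst (par A))"
      using t_le[of "Suc (snd A)" "snd (par A)"] t_le[of "fst (par A)" "snd A"] b 2 by simp
    finally show ?thesis by (simp add: hgt_def)
  qed
qed

lemma pv_cd: "A \<in> CC \<Longrightarrow> pv (cd A) = cay x0 (om A)"
  using cd_ne_N[of A] by (simp add: pv_def dec_cd)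

lemma pv_N: "pv N = x0" by (simp add: pv_def)

lemma Im_om [simp]: "Im (om A) = hgt A" and Re_om [simp]: "Re (om A) = t (fst A)"
  by (simp_all add: om_def)

lemma pv_branch_norm: "A \<in> branches \<Longrightarrow> cmod (pv (cd A)) < 1"
  using pv_cd[of A] cay_norm_less1[OF x0, of "om A"] hgt_pos by (simp add: branches_def)

lemma pv_single: "i < d \<Longrightarrow> pv (cd (i, i)) = cay x0 (of_real (t i))"
  using pv_cd[OF singles, of i] by (simp add: om_def hgt_def complex_of_real_def)

text \<open>What is retained of the geodesic from the vertex of \<open>par A\<close> to that of A:
  its horizontal and vertical extent, the circle carrying it, and a cone over the left end of A.
  This suffices for injectivity and for the angle bound.\<close>

definition on_edge :: "nat \<times> nat \<Rightarrow> complex \<Rightarrow> bool" where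
  "on_edge A \<zeta> \<longleftrightarrow> t (fst (par A)) \<le> Re \<zeta> \<and> Re \<zeta> \<le> t (fst A) \<and> (t (fst (par A)) < t (fst A) \<longrightarrow> t (fst (par A)) < Re \<zeta>) \<and>
     hgt A \<le> Im \<zeta> \<and> Im \<zeta> < hgt (par A) \<and>
     (t (fst A) - t (fst (par A))) * ((Re \<zeta> - t (fst (par A)))\<^sup>2 + (Im \<zeta>)\<^sup>2 - (hgt (par A))\<^sup>2)
       = (Re \<zeta> - t (fst (par A))) * ((t (fst A) - t (fst (par A)))\<^sup>2 + (hgt A)\<^sup>2 - (hgt (par A))\<^sup>2) \<and>
     2 * (t (fst A) - Re \<zeta>) \<le> Im \<zeta>"

lemma edge_point:
  assumes A: "A \<in> CC" "A \<noteq> top" and s: "0 < s" "s \<le> 1" "s < 1 \<or> A \<in> branches"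
  obtains \<zeta> where "Im \<zeta> > 0" "cay x0 \<zeta> = pe (cd (par A), cd A) s" "on_edge A \<zeta>"
proof -
  let ?B = "par A"
  let ?h = "hgt ?B" and ?y = "t (fst A) - t (fst ?B)" and ?\<epsilon> = "hgt A"
  note m = par_metric[OF A]
  have B: "?B \<in> CC" "?B \<in> branches" using par(1)[OF A] par_branch[OF A] by auto
  have h: "?h > 0" by (rule hgt_pos[OF B(2)])
  then have imB: "Im (om ?B) > 0" by simp
  have s': "0 \<le> s" "s \<le> 1" "s < 1 \<or> hgt A > 0" using s hgt_pos[of A] by auto
  let ?\<phi> = "(Complex ?y ?\<epsilon> - Complex 0 ?h) / (Complex ?y ?\<epsilon> - Complex 0 (- ?h))"
  obtain X v where Xv: "(Complex X v - Complex 0 ?h) / (Complex X v - Complex 0 (- ?h)) = of_real s * ?\<phi>"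
    "0 \<le> X" "X \<le> ?y" "s > 0 \<Longrightarrow> ?y > 0 \<Longrightarrow> X > 0" "?\<epsilon> \<le> v" "v > 0" "s > 0 \<Longrightarrow> v < ?h"
    "?y * (X\<^sup>2 + v\<^sup>2 - ?h\<^sup>2) = X * (?y\<^sup>2 + ?\<epsilon>\<^sup>2 - ?h\<^sup>2)" "v \<ge> 2 * (?y - X)"
    by (rule half_plane_edge[OF h m(1,2) hgt_nonneg[OF A(1)] m(3) s']; rule that; blast)
  let ?\<zeta> = "Complex (t (fst ?B) + X) v"
  obtain e where e: "\<And>\<zeta>. Im \<zeta> \<ge> 0 \<Longrightarrow> mob_to0 (cay x0 (om ?B)) (cay x0 \<zeta>) = e * ((\<zeta> - om ?B) / (\<zeta> - cnj (om ?B)))"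
    by (rule mob_to0_cay[OF x0 imB]; rule that; blast)
  have 1: "?\<zeta> - om ?B = Complex X v - Complex 0 ?h" "?\<zeta> - cnj (om ?B) = Complex X v - Complex 0 (- ?h)"
    by (simp_all add: complex_eq_iff)
  have 2: "om A - om ?B = Complex ?y ?\<epsilon> - Complex 0 ?h" "om A - cnj (om ?B) = Complex ?y ?\<epsilon> - Complex 0 (- ?h)"
    by (simp_all add: complex_eq_iff)
  have "mob_to0 (pv (cd ?B)) (cay x0 ?\<zeta>) = e * (of_real s * ?\<phi>)"
    unfolding pv_cd[OF B(1)] using e[of ?\<zeta>] Xv(1,6) unfolding 1 by simp
  also have "\<dots> = of_real s * mob_to0 (pv (cd ?B)) (pv (cd A))"
    unfolding pv_cd[OF B(1)] pv_cd[OF A(1)] using e[of "om A"] hgt_nonneg[OF A(1)] unfolding 2 by simp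
  finally have 3: "mob_to0 (pv (cd ?B)) (cay x0 ?\<zeta>) = of_real s * mob_to0 (pv (cd ?B)) (pv (cd A))" .
  have "cmod (cay x0 ?\<zeta>) < 1" using cay_norm_less1[OF x0, of ?\<zeta>] Xv(6) by simp
  then have "mob_from0 (pv (cd ?B)) (mob_to0 (pv (cd ?B)) (cay x0 ?\<zeta>)) = cay x0 ?\<zeta>"
    unfolding mob_from0_eq by (intro mob_to0_inverse(2) pv_branch_norm[OF B(2)]) simp
  then have "cay x0 ?\<zeta> = pe (cd ?B, cd A) s" unfolding 3 pe_def by simp
  moreover have "on_edge A ?\<zeta>" unfolding on_edge_def using Xv s by auto
  ultimately show ?thesis using that[of ?\<zeta>] Xv(6) by simp
qed

text \<open>In the half-plane the edge to infinity is a vertical ray, and radius s corresponds to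
  height h (1 + s) / (1 - s).\<close>

lemma root_edge_point:
  assumes s: "0 \<le> s" "s < 1"
  obtains \<zeta> where "Im \<zeta> > 0" "cay x0 \<zeta> = pe (cd top, N) s" "hgt top \<le> Im \<zeta>" "Re \<zeta> = t 0"
proof -
  let ?h = "hgt top"
  have h: "?h > 0" by (rule hgt_pos[OF top_branch])
  then have imT: "Im (om top) > 0" by simp
  define v where "v = ?h * ((1 + s) / (1 - s))"
  have "1 \<le> (1 + s) / (1 - s)" using s by simp
  then have "?h * 1 \<le> ?h * ((1 + s) / (1 - s))" using h by (intro mult_left_mono) auto
  then have v: "?h \<le> v" unfolding v_def by (simp only: mult_1_right)
  then have ne: "v + ?h \<noteq> 0" using h by linarith
  let ?\<zeta> = "Complex (t 0) v"
  obtain e where e: "\<And>\<zeta>. Im \<zeta> \<ge> 0 \<Longrightarrow> mob_to0 (cay x0 (om top)) (cay x0 \<zeta>) = e * ((\<zeta> - om top) / (\<zeta> - cnj (om top)))"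
    "mob_to0 (cay x0 (om top)) x0 = e"
    by (rule mob_to0_cay[OF x0 imT]; rule that; blast)
  have 1: "?\<zeta> - om top = \<i> * of_real (v - ?h)" "?\<zeta> - cnj (om top) = \<i> * of_real (v + ?h)"
    by (simp_all add: complex_eq_iff top_def)
  have "v - ?h = s * (v + ?h)" unfolding v_def using s by (simp add: field_simps)
  then have "(v - ?h) / (v + ?h) = s" using ne by simp
  then have "(?\<zeta> - om top) / (?\<zeta> - cnj (om top)) = of_real s"
    unfolding 1 by (simp only: mult_divide_mult_cancel_left[OF complex_i_not_zero] of_real_divide[symmetric])
  then have 3: "mob_to0 (pv (cd top)) (cay x0 ?\<zeta>) = of_real s * mob_to0 (pv (cd top)) (pv N)"
    unfolding pv_cd[OF top_in] pv_N using e(1)[of ?\<zeta>] e(2) v h by (simp add: mult.commute)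
  have "cmod (cay x0 ?\<zeta>) < 1" using cay_norm_less1[OF x0, of ?\<zeta>] v h by simp
  then have "mob_from0 (pv (cd top)) (mob_to0 (pv (cd top)) (cay x0 ?\<zeta>)) = cay x0 ?\<zeta>"
    unfolding mob_from0_eq by (intro mob_to0_inverse(2) pv_branch_norm[OF top_branch]) simp
  then have "cay x0 ?\<zeta> = pe (cd top, N) s" unfolding 3 pe_def by simp
  then show ?thesis using that[of ?\<zeta>] v h by simp
qed

text \<open>With different parents, either the horizontal ranges are disjoint, or the edge of A
  stays lower than the gap to the right of its parent while the cone over A' demands more height.
  With a common parent, the two carrying circles pass through the same vertex, and their equations
  conflict with the gap condition.\<close>

lemma on_edge_left_right:
  assumes A: "A \<in> CC" "A \<noteq> top" and A': "A' \<in> CC" "A' \<noteq> top" and lt: "snd A < fst A'"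
    and o: "on_edge A \<zeta>" and o': "on_edge A' \<zeta>"
  shows False
proof -
  let ?B = "par A" and ?B' = "par A'"
  note p = par[OF A] and p' = par[OF A']
  have b: "fst A \<le> snd A" "fst A' \<le> snd A'" "snd A' < d" "snd ?B < d" "snd ?B' < d" "fst ?B \<le> snd ?B"
    using bounds A A' p p' by blast+
  have s: "fst ?B \<le> fst A" "snd A \<le> snd ?B" "fst ?B' \<le> fst A'" "snd A' \<le> snd ?B'" using p(2) p'(2) by (auto simp: sub_def)
  have o1: "Re \<zeta> \<le> t (fst A)" "Im \<zeta> < hgt ?B" and o2: "t (fst ?B') \<le> Re \<zeta>" "2 * (t (fst A') - Re \<zeta>) \<le> Im \<zeta>"
    using o o' by (auto simp: on_edge_def)
  have right: False if "fst A < fst ?B'"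
    using t_mono[of "fst A" "fst ?B'"] that s b o1 o2 by linarith
  show False
  proof (cases "?B = ?B'")
    case False
    from laminar[OF p(1) p'(1)] consider "snd ?B < fst ?B'" | "snd ?B' < fst ?B" | "sub ?B ?B'" | "sub ?B' ?B"
      unfolding sub_def by blast
    then show False
    proof cases
      case 1
      then show False using right s b by linarith
    next
      case 2
      then show False using s b lt by linarith
    next
      case 3
      have "\<not> sub ?B A'" using s b lt by (auto simp: sub_def)
      moreover have "\<not> sub A' ?B"
      proof
        assume x: "sub A' ?B"
        have "A' \<noteq> ?B" using calculation by (auto simp: sub_def)
        then have "sub ?B' ?B" using p'(4)[OF p(1) x] by simp
        then show False using 3 False sub_antisym by blast
      qed
      ultimately have "snd ?B < fst A'" using laminar[OF p(1) A'(1)] s b lt unfolding sub_def by linarith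
      moreover have "?B \<noteq> top"
      proof
        assume "?B = top"
        then have "sub ?B' ?B" using sub_top[OF p'(1)] by simp
        then show False using 3 False sub_antisym by blast
      qed
      ultimately have "hgt ?B < t (Suc (snd ?B)) - t (snd ?B)" using gapR[OF p(1)] b by (simp add: hgt_def)
      moreover have "t (Suc (snd ?B)) \<le> t (fst A')" using \<open>snd ?B < fst A'\<close> b by (intro t_le) auto
      moreover have "t (fst A) \<le> t (snd ?B)" using s b by (intro t_le) auto
      ultimately have "hgt ?B < t (fst A') - Re \<zeta>" using o1(1) by linarith
      moreover have "hgt ?B \<ge> 0" by (rule hgt_nonneg[OF p(1)])
      ultimately show False using o1(2) o2(2) by argo
    next
      case 4
      have "\<not> sub ?B' A" using s b lt by (auto simp: sub_def)
      moreover have "\<not> sub A ?B'"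
      proof
        assume x: "sub A ?B'"
        have "A \<noteq> ?B'" using calculation by (auto simp: sub_def)
        then have "sub ?B ?B'" using p(4)[OF p'(1) x] by simp
        then show False using 4 False sub_antisym by blast
      qed
      ultimately have "snd A < fst ?B'" using laminar[OF A(1) p'(1)] s b lt unfolding sub_def by linarith
      then show False using right b by linarith
    qed
  next
    case True
    let ?x = "t (fst ?B)" and ?h = "hgt ?B"
    define y1 where "y1 = t (fst A) - ?x"
    define y2 where "y2 = t (fst A') - ?x"
    define X where "X = Re \<zeta> - ?x"
    define v where "v = Im \<zeta>"
    have eps: "hgt A < y2 - y1"
    proof -
      have "hgt A < t (Suc (snd A)) - t (snd A)" using gapR[OF A] lt b by (simp add: hgt_def)
      moreover have "t (Suc (snd A)) \<le> t (fst A')" using lt b by (intro t_le) auto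
      moreover have "t (fst A) \<le> t (snd A)" using lt b by (intro t_le) auto
      ultimately show ?thesis by (simp add: y1_def y2_def)
    qed
    have e0: "0 \<le> hgt A" by (rule hgt_nonneg[OF A(1)])
    have q: "0 \<le> X" "X \<le> y1" "0 < y1 \<longrightarrow> 0 < X" "0 < y2 \<longrightarrow> 0 < X"
      "y1 * (X\<^sup>2 + v\<^sup>2 - ?h\<^sup>2) = X * (y1\<^sup>2 + (hgt A)\<^sup>2 - ?h\<^sup>2)"
      "y2 * (X\<^sup>2 + v\<^sup>2 - ?h\<^sup>2) = X * (y2\<^sup>2 + (hgt A')\<^sup>2 - ?h\<^sup>2)"
      using o o' unfolding on_edge_def True[symmetric] by (auto simp: y1_def y2_def X_def v_def)
    have y1: "y1 \<ge> 0" using par_metric(1)[OF A] by (simp add: y1_def)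
    have y2: "y2 > y1" using eps e0 by simp
    then have X0: "X > 0" using q(4) y1 by simp
    then have y10: "y1 > 0" using q(2) by simp
    have h: "2 * y2 \<le> ?h" "2 * hgt A < ?h" using par_metric[OF A'] par_metric[OF A] True by (simp_all add: y2_def)
    let ?W = "X\<^sup>2 + v\<^sup>2 - ?h\<^sup>2"
    \<comment> \<open>Eliminating X^2 + v^2 - h^2 from the two circle equations leaves a relation
      between the ends alone, which \<open>hgt A < y2 - y1\<close> refutes.\<close>
    have "X * ((y1\<^sup>2 + (hgt A)\<^sup>2 - ?h\<^sup>2) * y2) = y2 * (y1 * ?W)" unfolding q(5) by (simp add: mult_ac)
    also have "\<dots> = y1 * (y2 * ?W)" by (simp add: mult_ac)
    also have "\<dots> = X * ((y2\<^sup>2 + (hgt A')\<^sup>2 - ?h\<^sup>2) * y1)" unfolding q(6) by (simp add: mult_ac)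
    finally have "(y1\<^sup>2 + (hgt A)\<^sup>2 - ?h\<^sup>2) * y2 = (y2\<^sup>2 + (hgt A')\<^sup>2 - ?h\<^sup>2) * y1" using X0 by simp
    then have "(y2 - y1) * (y1 * y2 + ?h\<^sup>2) = (hgt A)\<^sup>2 * y2 - (hgt A')\<^sup>2 * y1"
      by (simp add: power2_eq_square algebra_simps)
    also have "\<dots> \<le> (hgt A * y2) * hgt A" using y10 by (simp add: power2_eq_square mult_ac)
    also have "\<dots> \<le> (?h * ?h) * (y2 - y1)"
      using h e0 eps y1 y2 by (intro mult_mono) auto
    finally have "(y2 - y1) * (y1 * y2) \<le> 0" by (simp add: power2_eq_square algebra_simps)
    moreover have "(y2 - y1) * (y1 * y2) > 0" using y10 y2 by simp
    ultimately show False by linarith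
  qed
qed

text \<open>Nested clusters are separated by height: the edge of the smaller C stays below
  \<open>hgt (par C)\<close>, which is at most \<open>hgt C'\<close>, where the edge of C'
  ends.\<close>

lemma on_edge_unique:
  assumes A: "A \<in> CC" "A \<noteq> top" and A': "A' \<in> CC" "A' \<noteq> top" and o: "on_edge A \<zeta>" "on_edge A' \<zeta>"
  shows "A = A'"
proof (rule ccontr)
  assume ne: "A \<noteq> A'"
  have nest: False if C: "C \<in> CC" "C \<noteq> top" and C': "C' \<in> CC" and "sub C C'" "C \<noteq> C'" "on_edge C \<zeta>" "on_edge C' \<zeta>" for C C'
  proof -
    have "sub (par C) C'" using par(4)[OF C C'] that by simp
    then have "hgt (par C) \<le> hgt C'" using hgt_mono par(1)[OF C] C' by simp
    then show False using that(6,7) by (auto simp: on_edge_def)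
  qed
  from laminar[OF A(1) A'(1)] consider "snd A < fst A'" | "snd A' < fst A" | "sub A A'" | "sub A' A"
    unfolding sub_def by blast
  then show False
  proof cases
    case 1 then show False using on_edge_left_right[OF A A'] o by blast
  next
    case 2 then show False using on_edge_left_right[OF A' A] o by blast
  next
    case 3 then show False using nest[OF A A'(1)] ne o by blast
  next
    case 4 then show False using nest[OF A' A(1)] ne o by blast
  qed
qed

lemma edge_ends:
  assumes "e \<in> tree_edges"
  obtains B where "B \<in> branches" "fst e = cd B" "cmod (pv (fst e)) < 1" "cmod (pv (snd e)) \<le> 1" "pv (snd e) \<noteq> pv (fst e)"
  using assms
proof (cases rule: edge_cases)
  case (edge A)
  have B: "par A \<in> branches" "par A \<in> CC" using par_branch par(1) edge by auto
  have hA: "hgt A \<ge> 0" using hgt_nonneg edge by simp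
  have "om A \<noteq> om (par A)" using par_metric(3)[OF edge(1,2)] hA by (auto simp: complex_eq_iff)
  moreover have x00: "x0 \<noteq> 0" using x0 by auto
  ultimately have "cay x0 (om A) \<noteq> cay x0 (om (par A))"
    using cay_inj[OF x00, of "om A" "om (par A)"] hA hgt_nonneg[OF B(2)] by auto
  then show ?thesis
    using that[of "par A"] B edge pv_branch_norm[OF B(1)] pv_cd cay_norm_le1[OF x0, of "om A"] hA by simp
next
  case root
  have "cmod (pv (cd top)) < 1" by (rule pv_branch_norm[OF top_branch])
  moreover from this have "x0 \<noteq> pv (cd top)" using x0 by auto
  ultimately show ?thesis using that[of top] root top_branch x0 by (simp add: pv_N)
qed

lemma pe_0: "e \<in> tree_edges \<Longrightarrow> pe e 0 = pv (fst e)"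
  by (simp add: pe_def mob_from0_def)

lemma pe_1:
  assumes "e \<in> tree_edges"
  shows "pe e 1 = pv (snd e)"
  using assms
proof (cases rule: edge_ends)
  case (1 B)
  then show ?thesis unfolding pe_def mob_from0_eq using mob_to0_inverse(2)[OF 1(3,4)] by simp
qed

lemma pe_inj:
  assumes e: "e \<in> tree_edges" and s: "0 \<le> s" "s \<le> 1" "0 \<le> s'" "s' \<le> 1" and eq: "pe e s = pe e s'"
  shows "s = s'"
  using e
proof (cases rule: edge_ends)
  case (1 B)
  let ?p = "pv (fst e)" and ?q = "pv (snd e)"
  have q1: "cmod (mob_to0 ?p ?q) \<le> 1" by (rule mob_to0_norm_le1[OF 1(3,4)])
  have inv: "mob_to0 ?p (pe e r) = of_real r * mob_to0 ?p ?q" if "0 \<le> r" "r \<le> 1" for r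
  proof -
    have "cmod (of_real r * mob_to0 ?p ?q) \<le> 1 * 1" unfolding norm_mult using that q1 by (intro mult_mono) auto
    then show ?thesis unfolding pe_def mob_from0_eq by (intro mob_to0_inverse(1) 1(3)) simp
  qed
  have "?q - ?p \<noteq> 0" "1 - cnj ?p * ?q \<noteq> 0" using 1(5) mob_den_nz[OF 1(3,4)] by auto
  then have nz: "mob_to0 ?p ?q \<noteq> 0" unfolding mob_to0_def by (metis divide_eq_0_iff)
  have "of_real s * mob_to0 ?p ?q = mob_to0 ?p (pe e s)" by (rule inv[OF s(1,2), symmetric])
  also have "\<dots> = of_real s' * mob_to0 ?p ?q" unfolding eq by (rule inv[OF s(3,4)])
  finally have "complex_of_real s = of_real s'" using nz by (metis mult_right_cancel)
  then show ?thesis by (simp only: of_real_eq_iff)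
qed

lemma edge_in: "A \<in> CC \<Longrightarrow> A \<noteq> top \<Longrightarrow> (cd (par A), cd A) \<in> tree_edges"
  unfolding tree_edges_def using pp_cd[of A] cd_eq_top[of A] cd_in_VV[of A]
  by (intro image_eqI[where x = "cd A"]) auto

lemma root_in: "(cd top, N) \<in> tree_edges"
proof -
  have "N \<in> VV - {cd top}" using cd_ne_N[OF top_in] N_in_VV by auto
  moreover have "pp N = cd top" by (simp add: pp_def)
  ultimately show ?thesis unfolding tree_edges_def by force
qed

text \<open>Every interior point gets one label on a half-open edge: a branch vertex other than
  \<open>top\<close> is the far end s = 1 of the edge from its parent, and \<open>top\<close> is the
  start s = 0 of the edge to infinity.\<close>

lemma interior_cases:
  assumes "x \<in> interior_pts VV tree_edges"
  obtains (edge) A s where "A \<in> CC" "A \<noteq> top" "0 < s" "s \<le> 1" "s < 1 \<or> A \<in> branches"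
      "tmap pv pe x = pe (cd (par A), cd A) s" "x = (if s = 1 then Inl (cd A) else Inr ((cd (par A), cd A), s))"
    | (root) s where "0 \<le> s" "s < 1" "tmap pv pe x = pe (cd top, N) s"
      "x = (if s = 0 then Inl (cd top) else Inr ((cd top, N), s))"
proof -
  from assms consider A where "A \<in> branches" "x = Inl (cd A)" | e s where "x = Inr (e, s)" "e \<in> tree_edges" "0 < s" "s < 1"
    unfolding interior_pts_def branch_eq by blast
  then show ?thesis
  proof cases
    case (1 A)
    show ?thesis
    proof (cases "A = top")
      case True
      then show ?thesis using root[of 0] 1 pe_0[OF root_in] by (simp add: tmap_def)
    next
      case False
      then show ?thesis using edge[of A 1] 1 pe_1[OF edge_in[OF _ False]] by (simp add: tmap_def branches_def)
    qed
  next
    case (2 e s)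
    from 2(2) show ?thesis
    proof (cases rule: edge_cases)
      case (edge A)
      then show ?thesis using that(1)[of A s] 2 by (simp add: tmap_def)
    next
      case root
      then show ?thesis using that(2)[of s] 2 by (simp add: tmap_def)
    qed
  qed
qed

text \<open>The cone in \<open>on_edge\<close> gives |Re \<zeta> - t j| <= Im \<zeta> / 2, within
  the aperture that \<open>quasi_fixed\<close> allows. The aperture is the same for all points of
  all trees, so the displacement bound is uniform.\<close>

lemma interior_point:
  assumes "x \<in> interior_pts VV tree_edges"
  obtains \<zeta> j where "Im \<zeta> > 0" "cay x0 \<zeta> = tmap pv pe x" "j < d" "cmod (\<zeta> - of_real (t j)) \<le> 2 * Im \<zeta>"
  using assms
proof (cases rule: interior_cases)
  case (edge A s)
  obtain \<zeta> where \<zeta>: "Im \<zeta> > 0" "cay x0 \<zeta> = pe (cd (par A), cd A) s" "on_edge A \<zeta>"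
    by (rule edge_point[OF edge(1-5)]) (rule that)
  have "cmod (\<zeta> - of_real (t (fst A))) \<le> \<bar>Re \<zeta> - t (fst A)\<bar> + \<bar>Im \<zeta>\<bar>"
    using cmod_le[of "\<zeta> - of_real (t (fst A))"] by simp
  also have "\<dots> \<le> 2 * Im \<zeta>" using \<zeta>(1,3) by (auto simp: on_edge_def)
  finally show ?thesis using that[of \<zeta> "fst A"] \<zeta> edge bounds[OF edge(1)] by simp
next
  case (root s)
  obtain \<zeta> where \<zeta>: "Im \<zeta> > 0" "cay x0 \<zeta> = pe (cd top, N) s" "Re \<zeta> = t 0"
    by (rule root_edge_point[OF root(1,2)]) (rule that)
  have "cmod (\<zeta> - of_real (t 0)) \<le> \<bar>Re \<zeta> - t 0\<bar> + \<bar>Im \<zeta>\<bar>" using cmod_le[of "\<zeta> - of_real (t 0)"] by simp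
  also have "\<dots> \<le> 2 * Im \<zeta>" using \<zeta> by simp
  finally show ?thesis using that[of \<zeta> 0] \<zeta> root d2 by simp
qed

lemma tmap_inj: "inj_on (tmap pv pe) (interior_pts VV tree_edges)"
proof (rule inj_onI)
  have x00: "x0 \<noteq> 0" using x0 by auto
  have mixed: False if A: "A \<in> CC" "A \<noteq> top" "0 < s" "s \<le> 1" "s < 1 \<or> A \<in> branches" and r: "0 \<le> r" "r < 1"
    and eq: "pe (cd (par A), cd A) s = pe (cd top, N) r" for A s r
  proof -
    obtain \<zeta> where \<zeta>: "Im \<zeta> > 0" "cay x0 \<zeta> = pe (cd (par A), cd A) s" "on_edge A \<zeta>" by (rule edge_point[OF A]) (rule that)
    obtain \<xi> where \<xi>: "Im \<xi> > 0" "cay x0 \<xi> = pe (cd top, N) r" "hgt top \<le> Im \<xi>" by (rule root_edge_point[OF r]) (rule that)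
    have "\<zeta> = \<xi>" using cay_inj[OF x00, of \<zeta> \<xi>] \<zeta> \<xi> eq by simp
    moreover have "hgt (par A) \<le> hgt top" using hgt_mono par(1)[OF A(1,2)] top_in sub_top by blast
    ultimately show False using \<zeta>(3) \<xi>(3) by (auto simp: on_edge_def)
  qed
  fix x y assume x: "x \<in> interior_pts VV tree_edges" and y: "y \<in> interior_pts VV tree_edges"
    and eq: "tmap pv pe x = tmap pv pe y"
  from x show "x = y"
  proof (cases rule: interior_cases)
    case (edge A s)
    note ex = this
    from y show ?thesis
    proof (cases rule: interior_cases)
      case (edge A' s')
      obtain \<zeta> where \<zeta>: "Im \<zeta> > 0" "cay x0 \<zeta> = pe (cd (par A), cd A) s" "on_edge A \<zeta>"
        by (rule edge_point[OF ex(1-5)]) (rule that)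
      obtain \<xi> where \<xi>: "Im \<xi> > 0" "cay x0 \<xi> = pe (cd (par A'), cd A') s'" "on_edge A' \<xi>"
        by (rule edge_point[OF edge(1-5)]) (rule that)
      have "\<zeta> = \<xi>" using cay_inj[OF x00, of \<zeta> \<xi>] \<zeta> \<xi> eq ex(6) edge(6) by simp
      then have A: "A = A'" using on_edge_unique[OF ex(1,2) edge(1,2)] \<zeta>(3) \<xi>(3) by blast
      then have "s = s'" using pe_inj[OF edge_in[OF ex(1,2)], of s s'] ex edge eq by simp
      then show ?thesis using ex(7) edge(7) A by simp
    next
      case (root r)
      then show ?thesis using mixed[OF ex(1-5) root(1,2)] ex(6) eq by simp
    qed
  next
    case (root r)
    note rx = this
    from y show ?thesis
    proof (cases rule: interior_cases)
      case (edge A s)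
      then show ?thesis using mixed[OF edge(1-5) rx(1,2)] rx(3) eq by simp
    next
      case (root r')
      have "r = r'" using pe_inj[OF root_in, of r r'] rx root eq by simp
      then show ?thesis using rx(4) root(4) by simp
    qed
  qed
qed

lemma good_tree: "good_tree_map VV tree_edges pv pe"
  unfolding good_tree_map_def
proof (intro conjI ballI allI impI)
  show "inj_on (tmap pv pe) (interior_pts VV tree_edges)" by (rule tmap_inj)
  show "cmod (tmap pv pe x) < 1" if x: "x \<in> interior_pts VV tree_edges" for x
    by (rule interior_point[OF x]) (use cay_norm_less1[OF x0] in metis)
  fix e assume e: "e \<in> tree_edges"
  obtain B where B: "B \<in> branches" "fst e = cd B" "cmod (pv (fst e)) < 1" "cmod (pv (snd e)) \<le> 1"
    by (rule edge_ends[OF e]) (rule that)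
  let ?m = "mob_to0 (pv (fst e)) (pv (snd e))"
  have m1: "cmod (of_real s * ?m) \<le> 1" if "s \<in> {0..1}" for s
  proof -
    have "cmod (of_real s * ?m) \<le> 1 * 1" unfolding norm_mult
      using that mob_to0_norm_le1[OF B(3,4)] by (intro mult_mono) auto
    then show ?thesis by simp
  qed
  have p': "cmod (- pv (fst e)) < 1" using B(3) by simp
  show cont: "continuous_on {0..1} (pe e)"
    unfolding pe_def[abs_def] mob_from0_eq mob_to0_def[of "- pv (fst e)"]
    using mob_den_nz[OF p' m1] by (intro continuous_intros) auto
  show "pe e 0 = pv (fst e)" "pe e 1 = pv (snd e)" using pe_0[OF e] pe_1[OF e] by auto
  show "pe e ` {0..1} \<subseteq> cball 0 1"
    unfolding pe_def[abs_def] mob_from0_eq using mob_to0_norm_le1[OF p' m1] by auto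
  fix C :: "complex set" assume C: "compact C \<and> C \<subseteq> ball 0 1"
  \<comment> \<open>Ends lie on the circle and C in the open disk, so parameters of ends drop out by
    themselves and properness reduces to a closed preimage in [0, 1].\<close>
  have "{s \<in> edge_int_dom VV tree_edges e. pe e s \<in> C} = {0..1} \<inter> pe e -` C"
  proof -
    have "fst e \<notin> ends VV tree_edges"
    proof -
      have "fst e \<in> branch VV tree_edges" using B(1,2) unfolding branch_eq by simp
      then show ?thesis by (simp add: ends_def branch_def)
    qed
    moreover have "snd e \<notin> ends VV tree_edges" if "pe e 1 \<in> C"
    proof
      assume "snd e \<in> ends VV tree_edges"
      then have "cmod (pv (snd e)) = 1"
        unfolding ends_eq using pv_N x0 pv_single cay_norm_real[OF x0] by auto
      then show False using that C pe_1[OF e] by auto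
    qed
    ultimately show ?thesis by (auto simp: edge_int_dom_def)
  qed
  moreover have "compact ({0..1} \<inter> pe e -` C)"
  proof -
    have "closed ({0..1} \<inter> pe e -` C)"
      using C by (intro continuous_closed_preimage[OF cont]) (auto simp: compact_imp_closed)
    then show ?thesis using compact_Int_closed[OF compact_Icc, of "{0..1} \<inter> pe e -` C" 0 1]
      by (simp add: Int_absorb1)
  qed
  ultimately show "compact {s \<in> edge_int_dom VV tree_edges e. pe e s \<in> C}" by simp
qed

lemma edge_geodesic:
  assumes "e \<in> tree_edges"
  shows "pe e ` {0..1} = hgeod (pv (fst e)) (pv (snd e))"
proof -
  have "cmod (pv (fst e)) < 1" by (rule edge_ends[OF assms])
  then show ?thesis by (auto simp: hgeod_def hgeod_from_def pe_def)
qed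

lemma ends_bij:
  assumes "F = insert x0 ((\<lambda>i. cay x0 (of_real (t i))) ` {..<d})"
  shows "bij_betw pv (ends VV tree_edges) F"
proof -
  have t_inj: "i = j" if "t i = t j" "i < d" "j < d" for i j
    using t_mono[of i j] t_mono[of j i] that by (cases i j rule: linorder_cases) auto
  have x00: "x0 \<noteq> 0" using x0 by auto
  have ne: "cay x0 (of_real s) \<noteq> x0" for s
    using cay_diff_pole[of "of_real s" x0] x00 plus_i_nonzero[of "of_real s"] by auto
  have "inj_on pv (insert N (cd ` (\<lambda>i. (i, i)) ` {..<d}))"
  proof (rule inj_onI)
    fix v w assume v: "v \<in> insert N (cd ` (\<lambda>i. (i, i)) ` {..<d})" and w: "w \<in> insert N (cd ` (\<lambda>i. (i, i)) ` {..<d})"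
      and eq: "pv v = pv w"
    have single: "\<exists>i<d. u = cd (i, i) \<and> pv u = cay x0 (of_real (t i))" if "u \<in> insert N (cd ` (\<lambda>i. (i, i)) ` {..<d})" "u \<noteq> N" for u
      using that pv_single by auto
    show "v = w"
    proof (cases "v = N \<or> w = N")
      case True
      then show ?thesis using single[OF v] single[OF w] eq pv_N ne by metis
    next
      case False
      then obtain i j where ij: "i < d" "v = cd (i, i)" "pv v = cay x0 (of_real (t i))" "j < d" "w = cd (j, j)" "pv w = cay x0 (of_real (t j))"
        using single[OF v] single[OF w] by blast
      have "complex_of_real (t i) = of_real (t j)" by (rule cay_inj[OF x00]) (use ij eq in auto)
      then have "i = j" using t_inj[of i j] ij(1,4) by (simp only: of_real_eq_iff)
      then show ?thesis using ij by simp
    qed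
  qed
  moreover have "pv ` insert N (cd ` (\<lambda>i. (i, i)) ` {..<d}) = F"
    unfolding assms by (auto simp: pv_N pv_single image_image)
  ultimately show ?thesis unfolding ends_eq bij_betw_def by blast
qed

lemma tree_realisation:
  "\<exists>pv pe. good_tree_map VV tree_edges pv pe \<and> pv N = x0 \<and>
    (\<forall>A\<in>CC. pv (cd A) = cay x0 (Complex (t (fst A)) (2 * (t (snd A) - t (fst A))))) \<and>
    (\<forall>e\<in>tree_edges. pe e ` {0..1} = hgeod (pv (fst e)) (pv (snd e))) \<and>
    bij_betw pv (ends VV tree_edges) (insert x0 ((\<lambda>i. cay x0 (of_real (t i))) ` {..<d})) \<and>
    (\<forall>x\<in>interior_pts VV tree_edges. \<exists>\<zeta> j. Im \<zeta> > 0 \<and> cay x0 \<zeta> = tmap pv pe x \<and> j < d \<and>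
       cmod (\<zeta> - of_real (t j)) \<le> 2 * Im \<zeta>)"
proof (rule exI[of _ pv], rule exI[of _ pe], intro conjI ballI)
  show "good_tree_map VV tree_edges pv pe" by (rule good_tree)
  show "pv N = x0" by (rule pv_N)
  show "pv (cd A) = cay x0 (Complex (t (fst A)) (2 * (t (snd A) - t (fst A))))" if "A \<in> CC" for A
    using pv_cd[OF that] by (simp add: om_def hgt_def)
  show "pe e ` {0..1} = hgeod (pv (fst e)) (pv (snd e))" if "e \<in> tree_edges" for e
    by (rule edge_geodesic[OF that])
  show "bij_betw pv (ends VV tree_edges) (insert x0 ((\<lambda>i. cay x0 (of_real (t i))) ` {..<d}))"
    by (rule ends_bij[OF refl])
  show "\<exists>\<zeta> j. Im \<zeta> > 0 \<and> cay x0 \<zeta> = tmap pv pe x \<and> j < d \<and> cmod (\<zeta> - of_real (t j)) \<le> 2 * Im \<zeta>"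
    if x: "x \<in> interior_pts VV tree_edges" for x
    by (rule interior_point[OF x]; intro exI conjI; assumption)
qed

end

section \<open>Clusters of fixed points\<close>

lemma artanh_unbounded:
  fixes Z :: real
  shows "\<exists>\<rho>. 0 < \<rho> \<and> \<rho> < 1 \<and> (\<forall>x. \<rho> \<le> x \<longrightarrow> x < 1 \<longrightarrow> Z < artanh x)"
proof -
  let ?y = "\<bar>Z\<bar> + 1"
  have a: "artanh (tanh ?y) = ?y" by (rule artanh_tanh_real)
  have b: "0 < tanh ?y" "tanh ?y < 1" using tanh_real_lt_1 by auto
  have "Z < artanh x" if "tanh ?y \<le> x" "x < 1" for x
  proof -
    have "artanh (tanh ?y) \<le> artanh x" using that b by (intro artanh_mono) linarith+
    then show ?thesis using a by linarith
  qed
  then show ?thesis using b by blast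
qed

lemma mob_norm_sym: "cmod (mob_to0 p z) = cmod (mob_to0 z p)"
proof -
  have "cnj (1 - cnj p * z) = 1 - cnj z * p" by (simp add: mult.commute)
  then have "cmod (1 - cnj p * z) = cmod (1 - cnj z * p)" by (metis complex_mod_cnj)
  then show ?thesis unfolding mob_to0_def norm_divide by (simp only: norm_minus_commute[of z p])
qed

lemma hdist_le_imp_mob:
  "\<exists>\<rho>. 0 < \<rho> \<and> \<rho> < 1 \<and> (\<forall>z p. cmod z < 1 \<longrightarrow> cmod p < 1 \<longrightarrow> hdist z p \<le> R \<longrightarrow> cmod (mob_to0 p z) < \<rho>)"
proof -
  obtain \<rho> where r: "0 < \<rho>" "\<rho> < 1" "\<forall>x. \<rho> \<le> x \<longrightarrow> x < 1 \<longrightarrow> R / 2 < artanh x"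
    using artanh_unbounded[of "R / 2"] by blast
  have "cmod (mob_to0 p z) < \<rho>" if zp: "cmod z < 1" "cmod p < 1" "hdist z p \<le> R" for z p
  proof (rule ccontr)
    assume "\<not> ?thesis"
    moreover have "cmod (mob_to0 p z) < 1" by (rule mob_to0_norm_less1[OF zp(2,1)])
    ultimately have "R / 2 < artanh (cmod (mob_to0 p z))" using r(3) by simp
    then show False using zp(3) unfolding hdist_mob by simp
  qed
  then show ?thesis using r by blast
qed

text \<open>A triangle inequality in terms of 1 - |.|^2. Seen from z, the points p and q have
  modulus below \<rho>, so in \<open>one_minus_mob_to0_norm_sq\<close> the numerator is at least (1
  - \<rho>^2)^2 and the denominator at most 4.\<close>

lemma mob_close:
  assumes r: "0 < \<rho>" "\<rho> < 1" and n: "cmod z < 1" "cmod p < 1" "cmod q < 1"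
    and c: "cmod (mob_to0 p z) < \<rho>" "cmod (mob_to0 q z) < \<rho>"
  shows "(1 - \<rho>\<^sup>2)\<^sup>2 / 4 \<le> 1 - (cmod (mob_to0 p q))\<^sup>2"
proof -
  define a where "a = mob_to0 z p"
  define b where "b = mob_to0 z q"
  have ab: "cmod a < \<rho>" "cmod b < \<rho>" using c unfolding a_def b_def by (simp_all add: mob_norm_sym[of z])
  then have ab1: "cmod a < 1" "cmod b < 1" using r by linarith+
  have "mob_to0 b (mob_to0 z p) = (1 + cnj z * b) / (1 + z * cnj b) * mob_to0 (mob_to0 (- z) b) p"
    by (rule mob_to0_comp) (use n ab1 in auto)
  also have "mob_to0 (- z) b = q" unfolding b_def using mob_to0_inverse(2)[of z q] n by simp
  finally have e: "mob_to0 b a = (1 + cnj z * b) / (1 + z * cnj b) * mob_to0 q p" unfolding a_def .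
  have "cnj (1 + cnj z * b) = 1 + z * cnj b" by simp
  then have nn: "cmod (1 + z * cnj b) = cmod (1 + cnj z * b)" by (metis complex_mod_cnj)
  have "1 - cnj (- z) * b \<noteq> 0" by (rule mob_den_nz) (use n ab1 in auto)
  then have "cmod (1 + cnj z * b) \<noteq> 0" by simp
  then have "cmod (mob_to0 b a) = cmod (mob_to0 q p)" unfolding e norm_mult norm_divide nn by simp
  then have eq: "1 - (cmod (mob_to0 p q))\<^sup>2 = (1 - (cmod b)\<^sup>2) * (1 - (cmod a)\<^sup>2) / (cmod (1 - cnj b * a))\<^sup>2"
    using one_minus_mob_to0_norm_sq[of b a] ab1 mob_norm_sym[of p q] by simp
  have "cmod (1 - cnj b * a) \<noteq> 0" using mob_den_nz[of b a] ab1 by simp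
  then have den0: "0 < (cmod (1 - cnj b * a))\<^sup>2" by simp
  have "cmod (1 - cnj b * a) \<le> cmod 1 + cmod (cnj b * a)" by (rule norm_triangle_ineq4)
  also have "cmod (cnj b * a) \<le> 1 * 1" unfolding norm_mult using ab1 by (intro mult_mono) auto
  finally have "(cmod (1 - cnj b * a))\<^sup>2 \<le> 2\<^sup>2" by (intro power_mono) auto
  then have den: "(cmod (1 - cnj b * a))\<^sup>2 \<le> 4" by simp
  have sq: "(cmod a)\<^sup>2 \<le> \<rho>\<^sup>2" "(cmod b)\<^sup>2 \<le> \<rho>\<^sup>2" "\<rho>\<^sup>2 \<le> 1" using ab r by (auto intro!: power_mono power_le_one)
  have "(1 - \<rho>\<^sup>2) * (1 - \<rho>\<^sup>2) \<le> (1 - (cmod b)\<^sup>2) * (1 - (cmod a)\<^sup>2)"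
    using sq by (intro mult_mono) linarith+
  moreover have "0 \<le> (1 - (cmod b)\<^sup>2) * (1 - (cmod a)\<^sup>2)" using sq by (intro mult_nonneg_nonneg) linarith+
  ultimately have "(1 - \<rho>\<^sup>2) * (1 - \<rho>\<^sup>2) / 4 \<le> (1 - (cmod b)\<^sup>2) * (1 - (cmod a)\<^sup>2) / (cmod (1 - cnj b * a))\<^sup>2"
    using den0 den by (intro frac_le)
  then show ?thesis unfolding eq by (simp only: power2_eq_square[of "1 - \<rho>\<^sup>2"])
qed

lemma hdist_tendsto_infinity:
  assumes n: "\<And>n. cmod (z n) < 1" "\<And>n. cmod (p n) < 1"
    and lim: "(\<lambda>n. 1 - (cmod (mob_to0 (p n) (z n)))\<^sup>2) \<longlonglongrightarrow> 0"
  shows "filterlim (\<lambda>n. hdist (z n) (p n)) at_top sequentially"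
  unfolding filterlim_at_top
proof
  fix Z :: real
  obtain \<rho> where r: "0 < \<rho>" "\<rho> < 1" "\<forall>x. \<rho> \<le> x \<longrightarrow> x < 1 \<longrightarrow> Z / 2 < artanh x"
    using artanh_unbounded[of "Z / 2"] by blast
  have "\<rho>\<^sup>2 < 1" using r(1,2) by (simp add: power_less_one_iff)
  then have "0 < 1 - \<rho>\<^sup>2" by simp
  then have "\<forall>\<^sub>F n in sequentially. 1 - (cmod (mob_to0 (p n) (z n)))\<^sup>2 < 1 - \<rho>\<^sup>2"
    by (rule order_tendstoD(2)[OF lim])
  then show "\<forall>\<^sub>F n in sequentially. Z \<le> hdist (z n) (p n)"
  proof eventually_elim
    case (elim n)
    then have "\<rho>\<^sup>2 < (cmod (mob_to0 (p n) (z n)))\<^sup>2" by simp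
    then have "\<rho> < cmod (mob_to0 (p n) (z n))" by (rule power_less_imp_less_base) simp
    moreover have "cmod (mob_to0 (p n) (z n)) < 1" by (rule mob_to0_norm_less1[OF n(2,1)])
    ultimately have "Z / 2 < artanh (cmod (mob_to0 (p n) (z n)))" using r(3) by simp
    then show ?case unfolding hdist_mob by simp
  qed
qed

lemma tendsto_null_bound:
  fixes a b :: "nat \<Rightarrow> real"
  assumes "\<And>n. norm (a n) \<le> b n" "b \<longlonglongrightarrow> 0"
  shows "a \<longlonglongrightarrow> 0"
  by (rule Lim_null_comparison[OF _ assms(2)]) (simp only: assms(1) eventually_True)

lemma finite_common_lower:
  fixes a b :: "'i \<Rightarrow> nat \<Rightarrow> real"
  assumes "finite I" "\<And>i. i \<in> I \<Longrightarrow> \<exists>\<delta>>0. \<forall>\<^sub>F n in sequentially. \<delta> * a i n \<le> b i n" "\<And>i n. i \<in> I \<Longrightarrow> 0 \<le> a i n"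
  shows "\<exists>\<delta>>0. \<forall>\<^sub>F n in sequentially. \<forall>i\<in>I. \<delta> * a i n \<le> b i n"
  using assms
proof (induction I)
  case empty
  show ?case by (rule exI[of _ 1]) simp
next
  case (insert i I)
  obtain \<delta>1 where 1: "\<delta>1 > 0" "\<forall>\<^sub>F n in sequentially. \<forall>i\<in>I. \<delta>1 * a i n \<le> b i n" using insert by blast
  obtain \<delta>2 where 2: "\<delta>2 > 0" "\<forall>\<^sub>F n in sequentially. \<delta>2 * a i n \<le> b i n" using insert by blast
  have "\<forall>\<^sub>F n in sequentially. \<forall>j\<in>insert i I. min \<delta>1 \<delta>2 * a j n \<le> b j n"
    using 1(2) 2(2)
  proof eventually_elim
    case (elim n)
    have m: "min \<delta>1 \<delta>2 * a j n \<le> \<delta>1 * a j n" "min \<delta>1 \<delta>2 * a j n \<le> \<delta>2 * a j n" if "j \<in> insert i I" for j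
      using insert.prems(2)[OF that, of n] by (auto intro!: mult_right_mono)
    show ?case
    proof
      fix j assume j: "j \<in> insert i I"
      then show "min \<delta>1 \<delta>2 * a j n \<le> b j n" using elim m[OF j] by (cases "j = i") force+
    qed
  qed
  then show ?case using 1(1) 2(1) by (intro exI[of _ "min \<delta>1 \<delta>2"]) simp
qed

lemma finite_common_upper:
  fixes P :: "'i \<Rightarrow> nat \<Rightarrow> real \<Rightarrow> bool"
  assumes "finite I" "\<And>i. i \<in> I \<Longrightarrow> \<exists>R. \<forall>\<^sub>F n in sequentially. P i n R"
    "\<And>i n R R'. P i n R \<Longrightarrow> R \<le> R' \<Longrightarrow> P i n R'"
  shows "\<exists>R. \<forall>\<^sub>F n in sequentially. \<forall>i\<in>I. P i n R"
  using assms(1,2)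
proof (induction I)
  case (insert i I)
  obtain R1 where 1: "\<forall>\<^sub>F n in sequentially. \<forall>i\<in>I. P i n R1" using insert by blast
  obtain R2 where 2: "\<forall>\<^sub>F n in sequentially. P i n R2" using insert by blast
  have "\<forall>\<^sub>F n in sequentially. \<forall>j\<in>insert i I. P j n (max R1 R2)"
    using 1 2 by eventually_elim (auto intro: assms(3))
  then show ?case by blast
qed simp

text \<open>For \<omega> = a + i h one has |s - cnj \<omega>| <= 3 h / 2. The first distance is 2 h
  / |s - cnj \<omega>| >= 4/3; the second is 2 h |s - s'| over a product of two such moduli, and 2 /
  (3/2)^2 = 8/9.\<close>

lemma cay_separation:
  assumes x0: "cmod x0 = 1" and h: "h > 0" and s: "\<bar>s - a\<bar> \<le> h / 2"
  shows "1 \<le> cmod (mob_to0 (cay x0 (Complex a h)) (cay x0 (of_real s)) - mob_to0 (cay x0 (Complex a h)) x0)"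
    and "\<bar>s' - a\<bar> \<le> h / 2 \<Longrightarrow> 8 / 9 * (\<bar>s - s'\<bar> / h) \<le>
      cmod (mob_to0 (cay x0 (Complex a h)) (cay x0 (of_real s)) - mob_to0 (cay x0 (Complex a h)) (cay x0 (of_real s')))"
proof -
  let ?\<omega> = "Complex a h"
  have im: "Im ?\<omega> > 0" using h by simp
  obtain e where e: "cmod e = 1" "\<And>\<zeta>. Im \<zeta> \<ge> 0 \<Longrightarrow> mob_to0 (cay x0 ?\<omega>) (cay x0 \<zeta>) = e * ((\<zeta> - ?\<omega>) / (\<zeta> - cnj ?\<omega>))"
    "mob_to0 (cay x0 ?\<omega>) x0 = e"
    by (rule mob_to0_cay[OF x0 im]; rule that; blast)
  have er: "mob_to0 (cay x0 ?\<omega>) (cay x0 (of_real u)) = e * ((of_real u - ?\<omega>) / (of_real u - cnj ?\<omega>))" for u :: real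
    by (rule e(2)) simp
  have v0: "of_real u - cnj ?\<omega> \<noteq> 0" for u :: real using h by (auto simp: complex_eq_iff)
  have vn: "cmod (of_real u - cnj ?\<omega>) \<le> 3 / 2 * h" if "\<bar>u - a\<bar> \<le> h / 2" for u :: real
    using cmod_le[of "of_real u - cnj ?\<omega>"] that h by simp
  have wn: "cmod (cnj ?\<omega> - ?\<omega>) = 2 * h"
  proof -
    have "cnj ?\<omega> - ?\<omega> = of_real (- 2 * h) * \<i>" by (simp add: complex_eq_iff)
    then show ?thesis using h by (simp add: norm_mult)
  qed
  have "(of_real s - ?\<omega>) - (of_real s - cnj ?\<omega>) = cnj ?\<omega> - ?\<omega>" by simp
  then have "(of_real s - ?\<omega>) / (of_real s - cnj ?\<omega>) - 1 = (cnj ?\<omega> - ?\<omega>) / (of_real s - cnj ?\<omega>)"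
    using v0[of s] by (metis diff_divide_distrib divide_self)
  then have "e * ((of_real s - ?\<omega>) / (of_real s - cnj ?\<omega>)) - e = e * ((cnj ?\<omega> - ?\<omega>) / (of_real s - cnj ?\<omega>))"
    by (metis mult.right_neutral right_diff_distrib)
  then have n1: "cmod (e * ((of_real s - ?\<omega>) / (of_real s - cnj ?\<omega>)) - e) = 2 * h / cmod (of_real s - cnj ?\<omega>)"
    by (simp only: norm_mult norm_divide e(1) wn mult_1_left)
  have p: "0 < cmod (of_real u - cnj ?\<omega>)" for u :: real using v0[of u] by simp
  have "1 \<le> 2 * h / cmod (of_real s - cnj ?\<omega>)" using vn[OF s] h by (simp only: pos_le_divide_eq[OF p])
  then show "1 \<le> cmod (mob_to0 (cay x0 ?\<omega>) (cay x0 (of_real s)) - mob_to0 (cay x0 ?\<omega>) x0)"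
    unfolding er e(3) n1 .
  assume s': "\<bar>s' - a\<bar> \<le> h / 2"
  have num: "(of_real s - ?\<omega>) * (of_real s' - cnj ?\<omega>) - (of_real s' - ?\<omega>) * (of_real s - cnj ?\<omega>)
      = of_real (s' - s) * (cnj ?\<omega> - ?\<omega>)" by (simp add: complex_eq_iff algebra_simps)
  have "e * ((of_real s - ?\<omega>) / (of_real s - cnj ?\<omega>)) - e * ((of_real s' - ?\<omega>) / (of_real s' - cnj ?\<omega>))
      = e * ((of_real (s' - s) * (cnj ?\<omega> - ?\<omega>)) / ((of_real s - cnj ?\<omega>) * (of_real s' - cnj ?\<omega>)))"
    unfolding right_diff_distrib[symmetric] diff_frac_eq[OF v0 v0] num ..
  then have n2: "cmod (e * ((of_real s - ?\<omega>) / (of_real s - cnj ?\<omega>)) - e * ((of_real s' - ?\<omega>) / (of_real s' - cnj ?\<omega>)))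
      = \<bar>s' - s\<bar> * (2 * h) / (cmod (of_real s - cnj ?\<omega>) * cmod (of_real s' - cnj ?\<omega>))"
    by (simp only: norm_mult norm_divide e(1) wn mult_1_left norm_of_real)
  have "8 / 9 * (u / h) = u * (2 * h) / ((3 / 2 * h) * (3 / 2 * h))" for u :: real
    using h by (simp add: field_simps)
  then have "8 / 9 * (\<bar>s - s'\<bar> / h) = \<bar>s' - s\<bar> * (2 * h) / ((3 / 2 * h) * (3 / 2 * h))"
    unfolding abs_minus_commute[of s s'] .
  also have "\<dots> \<le> \<bar>s' - s\<bar> * (2 * h) / (cmod (of_real s - cnj ?\<omega>) * cmod (of_real s' - cnj ?\<omega>))"
  proof (rule divide_left_mono)
    show "cmod (of_real s - cnj ?\<omega>) * cmod (of_real s' - cnj ?\<omega>) \<le> 3 / 2 * h * (3 / 2 * h)"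
      using vn[OF s] vn[OF s'] h by (intro mult_mono) auto
    show "0 \<le> \<bar>s' - s\<bar> * (2 * h)" using h by simp
    show "0 < 3 / 2 * h * (3 / 2 * h) * (cmod (of_real s - cnj ?\<omega>) * cmod (of_real s' - cnj ?\<omega>))"
      by (intro mult_pos_pos p) (use h in auto)
  qed
  finally show "8 / 9 * (\<bar>s - s'\<bar> / h) \<le>
      cmod (mob_to0 (cay x0 ?\<omega>) (cay x0 (of_real s)) - mob_to0 (cay x0 ?\<omega>) (cay x0 (of_real s')))"
    unfolding er n2 .
qed

lemma crit_count_points:
  assumes "f \<in> Bminus d" "d \<ge> 1"
  shows "\<exists>z. (\<forall>i. cmod (z i) < 1) \<and> (\<forall>q R. crit_count f q R = card {i. i < d - 1 \<and> hdist (z i) q \<le> R})"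
proof -
  have z: "cmod (0 :: complex) < 1" by simp
  obtain c where c: "\<And>i. cmod (c i) < 1"
    "\<And>q R. crit_count f q R = card {i. i < d - 1 \<and> hdist (mob_to0 (- 0) (cnj (c i))) q \<le> R}"
    by (rule Bminus_recentre[OF assms z]; rule that; (blast | simp))
  have "cmod (mob_to0 (- 0) (cnj (c i))) < 1" for i using c(1) by (intro mob_to0_norm_less1) auto
  then show ?thesis using c(2) by (intro exI[of _ "\<lambda>i. mob_to0 (- 0) (cnj (c i))"]) blast
qed

lemma crit_count_mono:
  assumes "f \<in> Bminus d" "d \<ge> 1" "R \<le> R'"
  shows "crit_count f q R \<le> crit_count f q R'"
proof -
  obtain z where "\<forall>q R. crit_count f q R = card {i. i < d - 1 \<and> hdist (z i) q \<le> R}"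
    using crit_count_points[OF assms(1,2)] by blast
  then show ?thesis using assms(3) by (auto intro!: card_mono)
qed

lemma finite_real_enumeration:
  fixes S :: "real set"
  assumes "finite S" "card S = d"
  obtains t :: "nat \<Rightarrow> real" where "\<And>i j. i < j \<Longrightarrow> j < d \<Longrightarrow> t i < t j" "t ` {..<d} = S"
proof
  define xs where "xs = sorted_list_of_set S"
  have xs: "sorted xs" "distinct xs" "set xs = S" "length xs = d" unfolding xs_def using assms by simp_all
  show "xs ! i < xs ! j" if "i < j" "j < d" for i j
  proof -
    have "xs ! i \<le> xs ! j" by (rule sorted_nth_mono[OF xs(1)]) (use xs(4) that in simp_all)
    moreover have "xs ! i \<noteq> xs ! j" using nth_eq_iff_index_eq[OF xs(2), of i j] xs(4) that by simp
    ultimately show ?thesis by linarith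
  qed
  have "(!) xs ` {0..<d} = set (take d xs)" by (rule nth_image) (use xs(4) in simp)
  then show "(!) xs ` {..<d} = S" using xs(3,4) by (simp add: lessThan_atLeast0)
qed

lemma rep_fix_coordinates:
  assumes d: "d \<ge> 2" and f: "f \<in> Bminus d"
  shows "\<exists>t :: nat \<Rightarrow> real. (\<forall>i j. i < j \<longrightarrow> j < d \<longrightarrow> t i < t j) \<and>
    rep_fix f = insert (marked_point d f) ((\<lambda>i. cay (marked_point d f) (of_real (t i))) ` {..<d})"
proof -
  define F where "F = rep_fix f"
  define m where "m = marked_point d f"
  have F: "finite F" "card F = d + 1" "m \<in> F"
    unfolding F_def m_def by (rule card_rep_fix[OF d f] marked_point_in_rep_fix[OF d f])+
  have F1: "cmod z = 1" if "z \<in> F" for z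
    using that unfolding F_def rep_fix_def by blast
  have m1: "cmod m = 1" by (rule F1[OF F(3)])
  then have m0: "m \<noteq> 0" by auto
  define c where "c = (\<lambda>s :: real. cay m (of_real s))"
  define S where "S = {s. c s \<in> F}"
  have ne: "c s \<noteq> m" for s
  proof
    assume e: "c s = m"
    have im: "Im (of_real s) \<ge> 0" by simp
    have "m - m = m * (2 * \<i> / (of_real s + \<i>))"
      using cay_diff_pole[OF im, of m] unfolding e[unfolded c_def] .
    moreover have "of_real s + \<i> \<noteq> 0" by (rule plus_i_nonzero[OF im])
    ultimately show False using m0 by simp
  qed
  have inj: "inj_on c S"
  proof (rule inj_onI)
    fix a b :: real assume e: "c a = c b"
    have "complex_of_real a = of_real b"
      by (rule cay_inj[OF m0 _ _ e[unfolded c_def]]) simp_all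
    then show "a = b" by (rule of_real_eq_iff[THEN iffD1])
  qed
  have im: "c ` S = F - {m}"
  proof (intro equalityI subsetI)
    fix z assume "z \<in> c ` S"
    then show "z \<in> F - {m}" using ne unfolding S_def by blast
  next
    fix z assume z: "z \<in> F - {m}"
    then have z1: "cmod z = 1" "z \<noteq> m" using F1 by blast+
    obtain s where "cay m (of_real s) = z" by (rule cay_surj_circle[OF m1 z1])
    then have "c s = z" by (simp only: c_def)
    then show "z \<in> c ` S" using z unfolding S_def by blast
  qed
  have "finite (c ` S)" unfolding im using F(1) by (rule finite_Diff)
  then have finS: "finite S" using inj by (rule finite_imageD)
  have "card (c ` S) = d" unfolding im using F by (simp only: card_Diff_singleton add_diff_cancel_right')
  then have cS: "card S = d" by (simp only: card_image[OF inj])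
  obtain t :: "nat \<Rightarrow> real" where t: "\<And>i j. i < j \<Longrightarrow> j < d \<Longrightarrow> t i < t j" "t ` {..<d} = S"
    by (rule finite_real_enumeration[OF finS cS]) (rule that)
  have "(\<lambda>i. c (t i)) ` {..<d} = F - {m}" unfolding im[symmetric] t(2)[symmetric] image_image ..
  then have Fm: "F = insert m ((\<lambda>i. c (t i)) ` {..<d})" using F(3) by blast
  show ?thesis
  proof (intro exI[of _ t] conjI allI impI)
    show "t i < t j" if "i < j" "j < d" for i j by (rule t(1)[OF that])
    show "rep_fix f = insert (marked_point d f) ((\<lambda>i. cay (marked_point d f) (of_real (t i))) ` {..<d})"
      using Fm unfolding F_def m_def c_def .
  qed
qed

text \<open>The quotient g_i / (g_i + g_j) lies in [0, 1], so compactness makes it converge along a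
  subsequence, whereas g_i / g_j may be unbounded.\<close>

locale gap_limits =
  fixes d :: nat and t :: "nat \<Rightarrow> nat \<Rightarrow> real"
  assumes d_ge2: "d \<ge> 2" and t_incr: "\<And>n i j. i < j \<Longrightarrow> j < d \<Longrightarrow> t n i < t n j"
    and ratios: "\<And>i j. Suc i < d \<Longrightarrow> Suc j < d \<Longrightarrow>
      convergent (\<lambda>n. (t n (Suc i) - t n i) / ((t n (Suc i) - t n i) + (t n (Suc j) - t n j)))"
begin

definition gap :: "nat \<Rightarrow> nat \<Rightarrow> real" where "gap n i = t n (Suc i) - t n i"

definition ll :: "nat \<Rightarrow> nat \<Rightarrow> bool" where "ll i j \<longleftrightarrow> (\<lambda>n. gap n i / gap n j) \<longlonglongrightarrow> 0"

lemma t_mono_le: "i \<le> j \<Longrightarrow> j < d \<Longrightarrow> t n i \<le> t n j"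
  using t_incr[of i j n] by (cases "i = j") auto

lemma gap_pos: "Suc i < d \<Longrightarrow> gap n i > 0" using t_incr[of i "Suc i" n] by (simp add: gap_def)

text \<open>If the bounded quotient tends to l, then l = 0 means \<open>ll i j\<close>, while l > 0
  yields \<delta> = l / 2.\<close>

lemma ll_dichotomy:
  assumes ij: "Suc i < d" "Suc j < d" and nl: "\<not> ll i j"
  shows "\<exists>\<delta>>0. \<forall>\<^sub>F n in sequentially. \<delta> * gap n j \<le> gap n i"
proof -
  let ?q = "\<lambda>n. gap n i / (gap n i + gap n j)"
  obtain l where l: "?q \<longlonglongrightarrow> l" using ratios[OF ij] unfolding gap_def convergent_def by blast
  have pos: "gap n i > 0" "gap n j > 0" "gap n i + gap n j > 0" for n
    using gap_pos[OF ij(1), of n] gap_pos[OF ij(2), of n] by auto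
  have "0 \<le> ?q n" for n using pos[of n] by simp
  then have l0: "0 \<le> l" by (intro LIMSEQ_le_const[OF l]) blast
  have "l \<noteq> 0"
  proof
    assume "l = 0"
    then have q0: "?q \<longlonglongrightarrow> 0" using l by (simp only:)
    have "(\<lambda>n. ?q n / (1 - ?q n)) \<longlonglongrightarrow> 0 / (1 - 0)"
      by (rule tendsto_divide[OF q0 tendsto_diff[OF tendsto_const q0]]) simp
    moreover have "?q n / (1 - ?q n) = gap n i / gap n j" for n
    proof -
      have "1 - ?q n = gap n j / (gap n i + gap n j)" using pos[of n] by (simp add: field_simps)
      then show ?thesis using pos[of n] by simp
    qed
    ultimately have "(\<lambda>n. gap n i / gap n j) \<longlonglongrightarrow> 0 / (1 - 0)" by (simp only:)
    then show False using nl by (simp add: ll_def)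
  qed
  then have lp: "l > 0" "l / 2 < l" using l0 by auto
  have "\<forall>\<^sub>F n in sequentially. l / 2 < ?q n" by (rule order_tendstoD(1)[OF l lp(2)])
  then have "\<forall>\<^sub>F n in sequentially. l / 2 * gap n j \<le> gap n i"
  proof eventually_elim
    case (elim n)
    have "l / 2 * (gap n i + gap n j) < gap n i" using elim unfolding pos_less_divide_eq[OF pos(3)] .
    moreover have "l / 2 * (gap n i + gap n j) = l / 2 * gap n i + l / 2 * gap n j" by (rule distrib_left)
    moreover have "0 \<le> l / 2 * gap n i" using lp pos[of n] by simp
    ultimately show ?case by linarith
  qed
  then show ?thesis using lp by (intro exI[of _ "l / 2"]) simp
qed

lemma ll_asym:
  assumes ij: "Suc i < d" "Suc j < d" and l: "ll i j" "ll j i"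
  shows False
proof -
  have "(\<lambda>n. gap n i / gap n j * (gap n j / gap n i)) \<longlonglongrightarrow> 0 * 0"
    using l unfolding ll_def by (rule tendsto_mult)
  moreover have "gap n i / gap n j * (gap n j / gap n i) = 1" for n
    using gap_pos[OF ij(1), of n] gap_pos[OF ij(2), of n] by simp
  ultimately have "(\<lambda>n :: nat. 1 :: real) \<longlonglongrightarrow> 0" by simp
  then show False by (simp add: LIMSEQ_const_iff)
qed

text \<open>By the dichotomy, gap m is eventually at most a multiple of gap j, so what is negligible
  against the former is negligible against the latter.\<close>

lemma ll_trans:
  assumes s: "Suc i < d" "Suc m < d" "Suc j < d" and l: "ll i m" "\<not> ll j m"
  shows "ll i j"
proof -
  obtain \<delta> where \<delta>: "\<delta> > 0" "\<forall>\<^sub>F n in sequentially. \<delta> * gap n m \<le> gap n j" using ll_dichotomy[OF s(3,2) l(2)] by blast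
  have "\<forall>\<^sub>F n in sequentially. norm (gap n i / gap n j) \<le> gap n i / gap n m / \<delta>"
    using \<delta>(2)
  proof eventually_elim
    case (elim n)
    note p = gap_pos[OF s(1), of n] gap_pos[OF s(2), of n] gap_pos[OF s(3), of n]
    have "gap n i / gap n j \<le> gap n i / (\<delta> * gap n m)" using p \<delta>(1) elim by (intro frac_le) auto
    then show ?case using p \<delta>(1) by (simp add: mult.commute)
  qed
  moreover have "(\<lambda>n. gap n i / gap n m / \<delta>) \<longlonglongrightarrow> 0 / \<delta>"
    by (rule tendsto_divide[OF l(1)[unfolded ll_def] tendsto_const]) (use \<delta>(1) in simp)
  then have "(\<lambda>n. gap n i / gap n m / \<delta>) \<longlonglongrightarrow> 0" by (simp only: div_0)
  ultimately show ?thesis unfolding ll_def by (rule Lim_null_comparison)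
qed

text \<open>Gap i lies between the points i and i + 1, so \<open>fst A - 1\<close> and
  \<open>snd A\<close> index the two neighbouring gaps. A missing neighbour imposes nothing, which
  admits the whole interval; singletons have no inner gap.\<close>

definition clusters :: "(nat \<times> nat) set" where
  "clusters = {A. fst A \<le> snd A \<and> snd A < d \<and>
     (\<forall>i. fst A \<le> i \<longrightarrow> i < snd A \<longrightarrow> (0 < fst A \<longrightarrow> ll i (fst A - 1)) \<and> (Suc (snd A) < d \<longrightarrow> ll i (snd A)))}"

text \<open>The gap just left of B would be inner to A, and the gap just right of A inner to B, so
  each would be negligible against the other.\<close>

lemma no_overlap:
  assumes A: "A \<in> clusters" and B: "B \<in> clusters" and o: "fst A < fst B" "fst B \<le> snd A" "snd A < snd B"
  shows False
proof -
  have b: "snd B < d" using B by (simp add: clusters_def)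
  have "ll (fst B - 1) (snd A)" using A o b unfolding clusters_def by auto
  moreover have "ll (snd A) (fst B - 1)" using B o unfolding clusters_def by auto
  ultimately show False using ll_asym[of "fst B - 1" "snd A"] o b by linarith
qed

sublocale cluster_family d clusters
proof
  show "d \<ge> 2" by (rule d_ge2)
  show "fst A \<le> snd A \<and> snd A < d" if "A \<in> clusters" for A using that by (simp add: clusters_def)
  show "(i, i) \<in> clusters" if "i < d" for i using that by (simp add: clusters_def)
  show "(0, d - 1) \<in> clusters" using d_ge2 by (simp add: clusters_def)
  fix A B assume A: "A \<in> clusters" and B: "B \<in> clusters"
  show "snd A < fst B \<or> snd B < fst A \<or> (fst B \<le> fst A \<and> snd A \<le> snd B) \<or> (fst A \<le> fst B \<and> snd B \<le> snd A)"
  proof (rule ccontr)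
    assume n: "\<not> ?thesis"
    show False
    proof (cases "fst A < fst B")
      case True
      have "fst B \<le> snd A" "snd A < snd B" using n True by auto
      then show False by (rule no_overlap[OF A B True])
    next
      case False
      have "fst B < fst A" "fst A \<le> snd B" "snd B < snd A" using n False by auto
      then show False by (rule no_overlap[OF B A])
    qed
  qed
qed

definition width :: "nat \<times> nat \<Rightarrow> nat \<Rightarrow> real" where "width A n = t n (snd A) - t n (fst A)"

lemma width_sum: "A \<in> clusters \<Longrightarrow> width A n = (\<Sum>i = fst A..<snd A. gap n i)"
  unfolding width_def gap_def using sum_Suc_diff'[of "fst A" "snd A" "t n"] bounds[of A] by simp

lemma width_pos: "A \<in> branches \<Longrightarrow> width A n > 0"
  using t_incr[of "fst A" "snd A" n] bounds[of A] by (simp add: width_def branches_def)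

definition bdry :: "nat \<times> nat \<Rightarrow> nat \<Rightarrow> bool" where
  "bdry A k \<longleftrightarrow> (k = fst A - 1 \<and> 0 < fst A) \<or> (k = snd A \<and> Suc (snd A) < d)"

lemma bdry_less: "A \<in> clusters \<Longrightarrow> bdry A k \<Longrightarrow> Suc k < d"
  using bounds[of A] by (auto simp: bdry_def)

lemma width_limit:
  assumes A: "A \<in> clusters" and k: "bdry A k"
  shows "(\<lambda>n. width A n / gap n k) \<longlonglongrightarrow> 0"
proof -
  have "ll i k" if "i \<in> {fst A..<snd A}" for i using A k that unfolding clusters_def bdry_def by auto
  then have "(\<lambda>n. \<Sum>i = fst A..<snd A. gap n i / gap n k) \<longlonglongrightarrow> (\<Sum>i = fst A..<snd A. 0)"
    unfolding ll_def by (intro tendsto_sum) blast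
  then show ?thesis by (simp add: width_sum[OF A] sum_divide_distrib)
qed

lemma width_eventually:
  assumes A: "A \<in> clusters" and k: "bdry A k"
  shows "\<forall>\<^sub>F n in sequentially. 2 * width A n < gap n k"
proof -
  have "\<forall>\<^sub>F n in sequentially. width A n / gap n k < 1 / 2" by (rule order_tendstoD(2)[OF width_limit[OF A k]]) simp
  then show ?thesis
  proof eventually_elim
    case (elim n)
    then show ?case using gap_pos[OF bdry_less[OF A k], of n] by (simp add: pos_divide_less_eq)
  qed
qed

text \<open>For each n the geometry needs only width / gap < 1/2 at finitely many borders, and these
  quotients tend to 0.\<close>

lemma geometry_eventually: "\<forall>\<^sub>F n in sequentially. \<forall>x. cmod x = 1 \<longrightarrow> cluster_geometry d clusters (t n) x"
proof -
  have "\<forall>\<^sub>F n in sequentially. \<forall>A\<in>clusters. (bdry A (fst A - 1) \<longrightarrow> 2 * width A n < gap n (fst A - 1)) \<and>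
      (bdry A (snd A) \<longrightarrow> 2 * width A n < gap n (snd A))"
  proof (intro eventually_ball_finite[OF finCC] ballI eventually_conj)
    fix A assume A: "A \<in> clusters"
    show "\<forall>\<^sub>F n in sequentially. bdry A (fst A - 1) \<longrightarrow> 2 * width A n < gap n (fst A - 1)"
      using width_eventually[OF A, of "fst A - 1"] by (cases "bdry A (fst A - 1)") auto
    show "\<forall>\<^sub>F n in sequentially. bdry A (snd A) \<longrightarrow> 2 * width A n < gap n (snd A)"
      using width_eventually[OF A, of "snd A"] by (cases "bdry A (snd A)") auto
  qed
  then show ?thesis
  proof eventually_elim
    case (elim n)
    show ?case
    proof (intro allI impI cluster_geometry.intro cluster_geometry_axioms.intro cluster_family_axioms)
      fix A assume A: "A \<in> clusters"
      show "2 * (t n (snd A) - t n (fst A)) < t n (Suc (snd A)) - t n (snd A)" if "Suc (snd A) < d"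
        using elim A that by (auto simp: bdry_def width_def gap_def)
      show "2 * (t n (snd A) - t n (fst A)) < t n (fst A) - t n (fst A - 1)" if pos: "0 < fst A"
      proof -
        have "2 * width A n < gap n (fst A - 1)" using elim A pos by (auto simp: bdry_def)
        moreover have "Suc (fst A - 1) = fst A" using pos by simp
        ultimately show ?thesis by (simp add: width_def gap_def)
      qed
    qed (use t_incr in auto)
  qed
qed

text \<open>Otherwise the maximal run of gaps around \<open>fst C - 1\<close> that are negligible against gap \<open>m\<close>
  would be a cluster strictly between \<open>C\<close> and its parent.\<close>

lemma child_start_gap:
  assumes A: "A \<in> clusters" and C: "C \<in> children A" and b: "fst A < fst C" and m: "fst A \<le> m" "m < snd A"
  shows "\<not> ll (fst C - 1) m"
proof
  assume l: "ll (fst C - 1) m"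
  define b where "b = fst C - 1"
  have C': "C \<in> clusters" "C \<noteq> top" "par C = A" using C by (auto simp: children_def)
  have sC: "fst A \<le> fst C" "snd C \<le> snd A" using par(2)[OF C'(1,2)] C'(3) by (auto simp: sub_def)
  have bC: "fst C \<le> snd C" "snd A < d" using bounds A C' by auto
  have b': "fst A \<le> b" "b < snd A" "Suc b = fst C" using assms(3) sC bC by (auto simp: b_def)
  \<comment> \<open>The run of gaps negligible against m is extended left by P and right by Q, as
    far as possible inside A.\<close>
  define P where "P = (\<lambda>p. fst A \<le> p \<and> p \<le> b \<and> (\<forall>i. p \<le> i \<longrightarrow> i \<le> b \<longrightarrow> ll i m))"
  define Q where "Q = (\<lambda>q. b \<le> q \<and> q < snd A \<and> (\<forall>i. b \<le> i \<longrightarrow> i \<le> q \<longrightarrow> ll i m))"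
  have "i = b" if "b \<le> i" "i \<le> b" for i using that by simp
  moreover have "ll b m" using l by (simp add: b_def)
  ultimately have P0: "P b" and Q0: "Q b" using b' unfolding P_def Q_def by auto
  obtain p where p: "P p" "\<And>p'. P p' \<Longrightarrow> p \<le> p'" using ex_has_least_nat[of P b "\<lambda>x. x"] P0 by blast
  have bd: "\<forall>y. Q y \<longrightarrow> y < snd A" by (auto simp: Q_def)
  note p1 = p(1)[unfolded P_def]
  obtain q where q: "Q q" "\<And>q'. Q q' \<Longrightarrow> q' \<le> q"
    using ex_has_greatest_nat[of Q b "\<lambda>x. x" "snd A", OF Q0 bd] by blast
  note q1 = q(1)[unfolded Q_def]
  have run: "ll i m" if "p \<le> i" "i \<le> q" for i
    using p1 q1 that by (cases "i \<le> b") auto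
  have md: "Suc m < d" using m bC by simp
  \<comment> \<open>If the run stops at the border of A, the cluster property of A applies; if it
    stops inside, the next gap is not negligible against m and \<open>ll_trans\<close>
    applies.\<close>
  have left: "ll i (p - 1)" if i: "p \<le> i" "i \<le> q" and p0: "0 < p" for i
  proof (cases "p = fst A")
    case True
    have "i < snd A" using i q1 by linarith
    then show ?thesis using A i p0 True unfolding clusters_def by auto
  next
    case False
    have "\<not> ll (p - 1) m"
    proof
      assume n: "ll (p - 1) m"
      have "ll i m" if "p - 1 \<le> i" "i \<le> b" for i
        using that n p1 p0 by (cases "i = p - 1") auto
      then have "P (p - 1)" using p1 False unfolding P_def by auto
      then have "p \<le> p - 1" by (rule p(2))
      then show False using p0 by linarith
    qed
    moreover have "Suc i < d" "Suc (p - 1) < d" using i q1 bC p1 b' p0 by linarith+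
    ultimately show ?thesis using ll_trans[of i m "p - 1"] md run[OF i] by blast
  qed
  have right: "ll i (Suc q)" if i: "p \<le> i" "i \<le> q" and qd: "Suc (Suc q) < d" for i
  proof (cases "Suc q = snd A")
    case True
    have "fst A \<le> i" "i < snd A" using i p1 True by linarith+
    then show ?thesis using A qd True unfolding clusters_def by auto
  next
    case False
    have "\<not> ll (Suc q) m"
    proof
      assume n: "ll (Suc q) m"
      have "ll i m" if "b \<le> i" "i \<le> Suc q" for i
        using that n q1 by (cases "i = Suc q") auto
      then have "Q (Suc q)" using q1 False unfolding Q_def by auto
      then have "Suc q \<le> q" by (rule q(2))
      then show False by simp
    qed
    moreover have "Suc i < d" using i qd by linarith
    ultimately show ?thesis using ll_trans[of i m "Suc q"] md run[OF i] qd by blast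
  qed
  let ?D = "(p, Suc q)"
  have D: "?D \<in> clusters" unfolding clusters_def using left right p1 q1 bC by auto
  have "\<not> ll m m" using ll_asym[OF md md] by blast
  then have nr: "\<not> (p \<le> m \<and> m \<le> q)" using run by blast
  have DA: "sub ?D A" "?D \<noteq> A"
  proof -
    show "sub ?D A" using p1 q1 by (simp add: sub_def)
    show "?D \<noteq> A" using nr m by auto
  qed
  have "sub C ?D"
    using laminar[OF C'(1) D] p1 q1 b' bC unfolding sub_def by auto
  moreover have "C \<noteq> ?D" using p1 b' by auto
  ultimately have "sub A ?D" using par(4)[OF C'(1,2) D] C'(3) by simp
  then show False using DA sub_antisym by blast
qed

text \<open>The width of A is the sum of its inner gaps, and by \<open>child_start_gap\<close> each
  is eventually at most a constant times the gap in front of C.\<close>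

lemma child_separation:
  assumes A: "A \<in> branches"
  shows "\<exists>\<delta>>0. \<forall>\<^sub>F n in sequentially. \<forall>C\<in>{C \<in> children A. fst A < fst C}. \<delta> * width A n \<le> gap n (fst C - 1)"
proof (rule finite_common_lower)
  have A': "A \<in> clusters" "fst A < snd A" "snd A < d" using A bounds by (auto simp: branches_def)
  show "finite {C \<in> children A. fst A < fst C}" using finite_children by simp
  show "0 \<le> width A n" for n using width_pos[OF A, of n] by simp
  fix C assume "C \<in> {C \<in> children A. fst A < fst C}"
  then have C: "C \<in> children A" "fst A < fst C" by auto
  have C': "C \<in> clusters" "C \<noteq> top" "par C = A" using C by (auto simp: children_def)
  have sC: "fst C \<le> snd C" "snd C \<le> snd A" using bounds[OF C'(1)] par(2)[OF C'(1,2)] C'(3) by (auto simp: sub_def)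
  have "\<exists>\<delta>>0. \<forall>\<^sub>F n in sequentially. \<forall>m\<in>{fst A..<snd A}. \<delta> * gap n m \<le> gap n (fst C - 1)"
  proof (rule finite_common_lower)
    fix m assume m: "m \<in> {fst A..<snd A}"
    show "0 \<le> gap n m" for n using gap_pos[of m n] m A' by simp
    have "\<not> ll (fst C - 1) m" using child_start_gap[OF A'(1) C] m by simp
    then show "\<exists>\<delta>>0. \<forall>\<^sub>F n in sequentially. \<delta> * gap n m \<le> gap n (fst C - 1)"
      using m C(2) sC A' by (intro ll_dichotomy) auto
  qed simp
  then obtain \<delta> where \<delta>: "\<delta> > 0" "\<forall>\<^sub>F n in sequentially. \<forall>m\<in>{fst A..<snd A}. \<delta> * gap n m \<le> gap n (fst C - 1)" by blast
  let ?k = "real (snd A - fst A)"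
  have k: "?k > 0" using A' by simp
  have "\<forall>\<^sub>F n in sequentially. \<delta> / ?k * width A n \<le> gap n (fst C - 1)"
    using \<delta>(2)
  proof eventually_elim
    case (elim n)
    have "\<delta> * width A n = (\<Sum>m = fst A..<snd A. \<delta> * gap n m)" unfolding width_sum[OF A'(1)] by (rule sum_distrib_left)
    also have "\<dots> \<le> (\<Sum>m = fst A..<snd A. gap n (fst C - 1))" using elim by (intro sum_mono) blast
    also have "\<dots> = gap n (fst C - 1) * ?k" by simp
    finally show ?case using k by (simp add: pos_divide_le_eq)
  qed
  then show "\<exists>\<delta>>0. \<forall>\<^sub>F n in sequentially. \<delta> * width A n \<le> gap n (fst C - 1)"
    using \<delta>(1) k by (intro exI[of _ "\<delta> / ?k"]) simp
qed

end

section \<open>Vertices and critical points along the sequence\<close>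

locale blaschke_limit = gap_limits d t for d :: nat and t :: "nat \<Rightarrow> nat \<Rightarrow> real" +
  fixes f :: "nat \<Rightarrow> complex \<Rightarrow> complex" and x0 :: "nat \<Rightarrow> complex" and L :: real
  assumes f_in: "\<And>n. f n \<in> Bminus d" and L1: "L \<ge> 1"
    and x0_circle: "\<And>n. cmod (x0 n) = 1" and x0_fixed: "\<And>n. f n (x0 n) = x0 n"
    and x0_mult: "\<And>n. cmod (dbar (f n) (x0 n)) \<le> L"
    and t_fixed: "\<And>n i. i < d \<Longrightarrow> f n (cay (x0 n) (of_real (t n i))) = cay (x0 n) (of_real (t n i))"
    and t_mult: "\<And>n i. i < d \<Longrightarrow> cmod (dbar (f n) (cay (x0 n) (of_real (t n i)))) \<le> L"
begin

definition om :: "nat \<times> nat \<Rightarrow> nat \<Rightarrow> complex" where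
  "om A n = Complex (t n (fst A)) (2 * width A n)"

definition vertex :: "nat \<times> nat \<Rightarrow> nat \<Rightarrow> complex" where "vertex A n = cay (x0 n) (om A n)"

lemma Im_om: "Im (om A n) = 2 * width A n" and Re_om: "Re (om A n) = t n (fst A)"
  by (simp_all add: om_def)

lemma Im_om_pos: "A \<in> branches \<Longrightarrow> Im (om A n) > 0" using width_pos[of A n] by (simp add: Im_om)

lemma vertex_norm: "A \<in> branches \<Longrightarrow> cmod (vertex A n) < 1"
  unfolding vertex_def using x0_circle Im_om_pos by (intro cay_norm_less1)

lemma branches_clusters: "A \<in> branches \<Longrightarrow> A \<in> clusters" by (simp add: branches_def)

lemma finite_branches: "finite branches"
  using finCC by (rule rev_finite_subset) (auto simp: branches_def)

lemma children_fst_inj: "inj_on fst (children A)"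
proof (rule inj_onI)
  fix C C' assume C: "C \<in> children A" "C' \<in> children A" "fst C = fst C'"
  have "C \<in> clusters" "C' \<in> clusters" using C by (auto simp: children_def)
  then have "fst C \<le> snd C" "fst C' \<le> snd C'" using bounds by blast+
  then show "C = C'" using children_disjoint[OF C(1,2)] C(3) by fastforce
qed

lemma child_start_bounds:
  assumes "A \<in> clusters" "C \<in> children A"
  shows "fst A \<le> fst C" "fst C \<le> snd A" "fst C < d"
proof -
  have C: "C \<in> clusters" "C \<noteq> top" "par C = A" using assms(2) by (auto simp: children_def)
  then show "fst A \<le> fst C" "fst C \<le> snd A" "fst C < d"
    using par(2)[OF C(1,2)] bounds[OF C(1)] by (auto simp: sub_def)
qed

text \<open>\<open>None\<close> stands for the fixed point at infinity and \<open>Some c\<close> for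
  the left end of a child, so k children give k + 1 points, and the loss of 2 in
  \<open>crit_count_lower_bound\<close> leaves k - 1. Shifting the sequence by M makes the
  separation hold from the first index.\<close>

lemma crit_lower:
  assumes A: "A \<in> branches"
  shows "\<exists>R. \<forall>\<^sub>F n in sequentially. card (children A) - 1 \<le> crit_count (f n) (vertex A n) R"
proof -
  have A': "A \<in> clusters" "snd A < d" using branches_clusters[OF A] bounds by auto
  obtain \<delta> M where \<delta>: "\<delta> > 0"
    and M: "\<And>n C. M \<le> n \<Longrightarrow> C \<in> children A \<Longrightarrow> fst A < fst C \<Longrightarrow> \<delta> * width A n \<le> gap n (fst C - 1)"
    using child_separation[OF A] unfolding eventually_sequentially by blast
  define S where "S = fst ` children A"
  define J where "J = insert None (Some ` S)"
  define x where "x = (\<lambda>n j. case j of None \<Rightarrow> x0 (n + M) | Some c \<Rightarrow> cay (x0 (n + M)) (of_real (t (n + M) c)))"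
  \<comment> \<open>8/9 from \<open>cay_separation\<close> times \<delta> / 2, since the height of a
    vertex is twice the width; 1 is the separation from infinity.\<close>
  define \<delta>' where "\<delta>' = min 1 (4 / 9 * \<delta>)"
  have xN: "x n None = x0 (n + M)" and xS: "x n (Some c) = cay (x0 (n + M)) (of_real (t (n + M) c))" for n c
    by (simp_all add: x_def)
  have Sb: "fst A \<le> c" "c \<le> snd A" "c < d" if "c \<in> S" for c
    using child_start_bounds[OF A'(1)] that unfolding S_def by auto
  have finS: "finite S" unfolding S_def using finite_children by simp
  have near: "\<bar>t n c - t n (fst A)\<bar> \<le> 2 * width A n / 2" if "c \<in> S" for n c
    using t_mono_le[of "fst A" c n] t_mono_le[of c "snd A" n] Sb[OF that] A' by (simp add: width_def)
  have h: "2 * width A n > 0" for n using width_pos[OF A, of n] by simp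
  have v: "vertex A n = cay (x0 n) (Complex (t n (fst A)) (2 * width A n))" for n by (simp add: vertex_def om_def)
  have sepN: "\<delta>' \<le> cmod (mob_to0 (vertex A (n + M)) (x n (Some c)) - mob_to0 (vertex A (n + M)) (x n None))"
    if c: "c \<in> S" for n c
  proof -
    have "\<delta>' \<le> 1" by (simp add: \<delta>'_def)
    also have "1 \<le> cmod (mob_to0 (vertex A (n + M)) (x n (Some c)) - mob_to0 (vertex A (n + M)) (x n None))"
      unfolding xN xS v by (rule cay_separation(1)[OF x0_circle h near[OF c]])
    finally show ?thesis .
  qed
  have sepS: "\<delta>' \<le> cmod (mob_to0 (vertex A (n + M)) (x n (Some c)) - mob_to0 (vertex A (n + M)) (x n (Some c')))"
    if c: "c \<in> S" "c' \<in> S" "c < c'" for n c c'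
  proof -
    let ?n = "n + M"
    let ?w = "width A ?n"
    obtain C' where C': "C' \<in> children A" "c' = fst C'" using c(2) unfolding S_def by blast
    have "fst A < fst C'" using Sb[OF c(1)] c(3) C'(2) by linarith
    then have "\<delta> * ?w \<le> gap ?n (c' - 1)" using M[OF _ C'(1), of ?n] C'(2) by simp
    moreover have "gap ?n (c' - 1) = t ?n c' - t ?n (c' - 1)" using c(3) by (simp add: gap_def)
    moreover have "t ?n c \<le> t ?n (c' - 1)" using c(3) Sb[OF c(2)] by (intro t_mono_le) linarith+
    ultimately have "\<delta> * ?w \<le> \<bar>t ?n c - t ?n c'\<bar>" by linarith
    then have "\<delta> * ?w / (2 * ?w) \<le> \<bar>t ?n c - t ?n c'\<bar> / (2 * ?w)" using h[of ?n] by (intro divide_right_mono) auto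
    moreover have "\<delta> * ?w / (2 * ?w) = \<delta> / 2" using h[of ?n] by simp
    ultimately have "\<delta>' \<le> 8 / 9 * (\<bar>t ?n c - t ?n c'\<bar> / (2 * ?w))" unfolding \<delta>'_def by linarith
    also have "\<dots> \<le> cmod (mob_to0 (vertex A ?n) (x n (Some c)) - mob_to0 (vertex A ?n) (x n (Some c')))"
      unfolding xS v by (rule cay_separation(2)[OF x0_circle h near[OF c(1)] near[OF c(2)]])
    finally show ?thesis .
  qed
  have "\<exists>R N. \<forall>n\<ge>N. card J \<le> crit_count (f (n + M)) (vertex A (n + M)) R + 2"
  proof (rule crit_count_lower_bound[where d = d and L = L and \<delta> = \<delta>' and x = x])
    show "d \<ge> 1" "L \<ge> 0" using d_ge2 L1 by auto
    show "f (n + M) \<in> Bminus d" for n by (rule f_in)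
    show "cmod (vertex A (n + M)) < 1" for n by (rule vertex_norm[OF A])
    show "finite J" using finS by (simp add: J_def)
    show "\<delta>' > 0" using \<delta> by (simp add: \<delta>'_def)
    show "cmod (x n j) = 1" if "j \<in> J" for n j
      using that cay_norm_real[OF x0_circle] x0_circle by (auto simp: J_def xN xS)
    show "f (n + M) (x n j) = x n j" if "j \<in> J" for n j
      using that Sb(3) t_fixed x0_fixed by (auto simp: J_def xN xS)
    show "cmod (dbar (f (n + M)) (x n j)) \<le> L" if "j \<in> J" for n j
      using that Sb(3) t_mult x0_mult by (auto simp: J_def xN xS)
    fix n i j assume ij: "i \<in> J" "j \<in> J" "i \<noteq> j"
    show "\<delta>' \<le> cmod (mob_to0 (vertex A (n + M)) (x n i) - mob_to0 (vertex A (n + M)) (x n j))"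
    proof (cases i)
      case None
      then obtain c where c: "j = Some c" "c \<in> S" using ij by (auto simp: J_def)
      show ?thesis unfolding None c(1)
        by (subst norm_minus_commute) (rule sepN[OF c(2)])
    next
      case (Some c)
      then have cS: "c \<in> S" using ij by (auto simp: J_def)
      show ?thesis
      proof (cases j)
        case None
        show ?thesis unfolding None Some by (rule sepN[OF cS])
      next
        case (Some c')
        then have c'S: "c' \<in> S" using ij by (auto simp: J_def)
        have "c \<noteq> c'" using ij \<open>i = Some c\<close> Some by simp
        then consider "c < c'" | "c' < c" by linarith
        then show ?thesis
        proof cases
          case 1
          show ?thesis unfolding \<open>i = Some c\<close> Some by (rule sepS[OF cS c'S 1])
        next
          case 2
          show ?thesis unfolding \<open>i = Some c\<close> Some
            by (subst norm_minus_commute) (rule sepS[OF c'S cS 2])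
        qed
      qed
    qed
  qed
  then obtain R N where RN: "\<forall>n\<ge>N. card J \<le> crit_count (f (n + M)) (vertex A (n + M)) R + 2" by blast
  have "card J = Suc (card (Some ` S))" unfolding J_def using finS by (intro card_insert_disjoint) auto
  also have "card (Some ` S) = card S" by (simp add: card_image)
  also have "card S = card (children A)" unfolding S_def by (rule card_image[OF children_fst_inj])
  finally have cJ: "card J = Suc (card (children A))" .
  have "card (children A) - 1 \<le> crit_count (f n) (vertex A n) R" if n: "n \<ge> N + M" for n
  proof -
    have "N \<le> n - M" "n - M + M = n" using n by auto
    then have "card J \<le> crit_count (f n) (vertex A n) R + 2" using RN by metis
    then show ?thesis unfolding cJ by simp
  qed
  then have "\<forall>\<^sub>F n in sequentially. card (children A) - 1 \<le> crit_count (f n) (vertex A n) R"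
    unfolding eventually_sequentially by blast
  then show ?thesis by blast
qed

lemma one_minus_vertex:
  assumes "A \<in> branches" "B \<in> branches"
  shows "1 - (cmod (mob_to0 (vertex B n) (vertex A n)))\<^sup>2 =
    16 * width A n * width B n / ((t n (fst A) - t n (fst B))\<^sup>2 + (2 * width A n + 2 * width B n)\<^sup>2)"
proof -
  have "(cmod (om A n - cnj (om B n)))\<^sup>2 = (t n (fst A) - t n (fst B))\<^sup>2 + (2 * width A n + 2 * width B n)\<^sup>2"
    unfolding cmod_power2 by (simp add: Im_om Re_om)
  moreover have "1 - (cmod (mob_to0 (vertex B n) (vertex A n)))\<^sup>2 = 4 * Im (om A n) * Im (om B n) / (cmod (om A n - cnj (om B n)))\<^sup>2"
    unfolding vertex_def using x0_circle Im_om_pos assms by (intro one_minus_mob_cay) auto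
  ultimately show ?thesis by (simp add: Im_om)
qed

text \<open>A gap adjacent to A lies inside B, so the width of A is negligible against that of B;
  the expression is at most 4 times the quotient.\<close>

lemma far_nested:
  assumes A: "A \<in> branches" and B: "B \<in> branches" and s: "sub A B" "A \<noteq> B"
  shows "(\<lambda>n. 1 - (cmod (mob_to0 (vertex B n) (vertex A n)))\<^sup>2) \<longlonglongrightarrow> 0"
proof -
  have b: "fst B \<le> fst A" "fst A \<le> snd A" "snd A \<le> snd B" "snd B < d" using s bounds branches_clusters A B by (auto simp: sub_def)
  have "fst A \<noteq> fst B \<or> snd A \<noteq> snd B" using s(2) by (auto simp: prod_eq_iff)
  then consider "fst B < fst A" | "snd A < snd B" using b by linarith
  then have "\<exists>k. bdry A k \<and> fst B \<le> k \<and> Suc k \<le> snd B"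
  proof cases
    case 1
    then show ?thesis using b by (intro exI[of _ "fst A - 1"]) (auto simp: bdry_def)
  next
    case 2
    then show ?thesis using b by (intro exI[of _ "snd A"]) (auto simp: bdry_def)
  qed
  then obtain k where k: "bdry A k" "fst B \<le> k" "Suc k \<le> snd B" by blast
  have kd: "Suc k < d" using k b by linarith
  have "norm (1 - (cmod (mob_to0 (vertex B n) (vertex A n)))\<^sup>2) \<le> 4 * (width A n / gap n k)" for n
  proof -
    let ?a = "width A n" and ?b = "width B n" and ?D = "(t n (fst A) - t n (fst B))\<^sup>2 + (2 * width A n + 2 * width B n)\<^sup>2"
    have p: "?a > 0" "?b > 0" "gap n k > 0" using width_pos A B gap_pos[OF kd] by auto
    have g: "gap n k \<le> ?b" using t_mono_le[of "fst B" k n] t_mono_le[of "Suc k" "snd B" n] k b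
      by (simp add: gap_def width_def)
    have "(2 * ?b)\<^sup>2 \<le> (2 * ?a + 2 * ?b)\<^sup>2" using p by (intro power_mono) auto
    moreover have "(t n (fst A) - t n (fst B))\<^sup>2 \<ge> 0" by simp
    moreover have "(2 * ?b)\<^sup>2 = 4 * ?b * ?b" by (simp add: power2_eq_square)
    ultimately have D: "4 * ?b * ?b \<le> ?D" by linarith
    have D0: "0 < 4 * ?b * ?b" using p by simp
    have "16 * ?a * ?b / ?D \<le> 16 * ?a * ?b / (4 * ?b * ?b)" using p D D0 by (intro frac_le) auto
    also have "\<dots> = 4 * (?a / ?b)" using p by simp
    also have "\<dots> \<le> 4 * (?a / gap n k)" using p g by (intro mult_left_mono frac_le) auto
    finally have "16 * ?a * ?b / ?D \<le> 4 * (?a / gap n k)" .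
    moreover have "0 \<le> 16 * ?a * ?b / ?D" using p D D0 by (intro divide_nonneg_nonneg) auto
    ultimately show ?thesis unfolding one_minus_vertex[OF A B] real_norm_def by linarith
  qed
  moreover have "(\<lambda>n. 4 * (width A n / gap n k)) \<longlonglongrightarrow> 4 * 0"
    by (rule tendsto_mult[OF tendsto_const width_limit[OF branches_clusters[OF A] k(1)]])
  then have "(\<lambda>n. 4 * (width A n / gap n k)) \<longlonglongrightarrow> 0" by (simp only: mult_zero_right)
  ultimately show ?thesis by (rule tendsto_null_bound)
qed

text \<open>The horizontal distance of the vertices exceeds both the gap right of A and the gap left
  of B, and each width is negligible against the gap on its side.\<close>

lemma far_disjoint:
  assumes A: "A \<in> branches" and B: "B \<in> branches" and s: "snd A < fst B"
  shows "(\<lambda>n. 1 - (cmod (mob_to0 (vertex B n) (vertex A n)))\<^sup>2) \<longlonglongrightarrow> 0"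
proof -
  have b: "fst A \<le> snd A" "fst B \<le> snd B" "snd B < d" using bounds branches_clusters A B by auto
  let ?k = "snd A" and ?l = "fst B - 1"
  have k: "bdry A ?k" "bdry B ?l" using b s by (auto simp: bdry_def)
  have kd: "Suc ?k < d" "Suc ?l < d" using b s by auto
  let ?g = "\<lambda>n. 16 * ((width A n / gap n ?k) * (width B n / gap n ?l))"
  have "norm (1 - (cmod (mob_to0 (vertex B n) (vertex A n)))\<^sup>2) \<le> ?g n" for n
  proof -
    let ?a = "width A n" and ?b = "width B n" and ?D = "(t n (fst A) - t n (fst B))\<^sup>2 + (2 * width A n + 2 * width B n)\<^sup>2"
    let ?T = "t n (fst B) - t n (fst A)"
    have p: "?a > 0" "?b > 0" "gap n ?k > 0" "gap n ?l > 0" using width_pos A B gap_pos[OF kd(1)] gap_pos[OF kd(2)] by auto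
    have "t n (fst A) \<le> t n (snd A)" "t n (Suc (snd A)) \<le> t n (fst B)" "t n (fst A) \<le> t n (fst B - 1)"
      by (intro t_mono_le; use b s in linarith)+
    moreover have "Suc (fst B - 1) = fst B" using s by simp
    ultimately have T: "gap n ?k \<le> ?T" "gap n ?l \<le> ?T" by (simp_all add: gap_def)
    have "gap n ?k * gap n ?l \<le> ?T * ?T" using T p by (intro mult_mono) auto
    also have "\<dots> = (t n (fst A) - t n (fst B))\<^sup>2" by (simp add: power2_eq_square algebra_simps)
    finally have D: "gap n ?k * gap n ?l \<le> ?D" by (rule order_trans) simp
    have D0: "0 < gap n ?k * gap n ?l" using p by simp
    have "16 * ?a * ?b / ?D \<le> 16 * ?a * ?b / (gap n ?k * gap n ?l)" using p D D0 by (intro frac_le) auto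
    also have "\<dots> = ?g n" by simp
    finally have "16 * ?a * ?b / ?D \<le> ?g n" .
    moreover have "0 \<le> 16 * ?a * ?b / ?D" using p D D0 by (intro divide_nonneg_nonneg) auto
    ultimately show ?thesis unfolding one_minus_vertex[OF A B] real_norm_def by linarith
  qed
  moreover have "?g \<longlonglongrightarrow> 16 * (0 * 0)"
    by (rule tendsto_mult[OF tendsto_const tendsto_mult[OF width_limit[OF branches_clusters[OF A] k(1)]
          width_limit[OF branches_clusters[OF B] k(2)]]])
  then have "?g \<longlonglongrightarrow> 0" by (simp only: mult_zero_right)
  ultimately show ?thesis by (rule tendsto_null_bound)
qed

lemma far:
  assumes A: "A \<in> branches" and B: "B \<in> branches" and ne: "A \<noteq> B"
  shows "(\<lambda>n. 1 - (cmod (mob_to0 (vertex B n) (vertex A n)))\<^sup>2) \<longlonglongrightarrow> 0"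
proof -
  have sym: "cmod (mob_to0 (vertex A n) (vertex B n)) = cmod (mob_to0 (vertex B n) (vertex A n))" for n
    by (rule mob_norm_sym)
  from laminar[OF branches_clusters[OF A] branches_clusters[OF B]]
  consider "snd A < fst B" | "snd B < fst A" | "sub A B" | "sub B A" unfolding sub_def by blast
  then show ?thesis
  proof cases
    case 1
    then show ?thesis by (rule far_disjoint[OF A B])
  next
    case 2
    then show ?thesis using far_disjoint[OF B A] unfolding sym by blast
  next
    case 3
    then show ?thesis using far_nested[OF A B] ne by blast
  next
    case 4
    then show ?thesis using far_nested[OF B A] ne unfolding sym by blast
  qed
qed

text \<open>The lower bounds add up to the total number \<open>d - 1\<close> of critical points, and no critical point
  is close to two vertices, so all of them are equalities.\<close>

lemma crit_exact:
  "\<exists>R. \<forall>\<^sub>F n in sequentially. \<forall>A\<in>branches. crit_count (f n) (vertex A n) R = card (children A) - 1"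
proof -
  have d1: "d \<ge> 1" using d_ge2 by simp
  have "\<exists>R. \<forall>\<^sub>F n in sequentially. \<forall>A\<in>branches. card (children A) - 1 \<le> crit_count (f n) (vertex A n) R"
  proof (rule finite_common_upper[OF finite_branches crit_lower])
    fix A n and R R' :: real
    assume "card (children A) - 1 \<le> crit_count (f n) (vertex A n) R" "R \<le> R'"
    then show "card (children A) - 1 \<le> crit_count (f n) (vertex A n) R'"
      using crit_count_mono[OF f_in d1, of R R' n "vertex A n"] by linarith
  qed
  then obtain R where R: "\<forall>\<^sub>F n in sequentially. \<forall>A\<in>branches. card (children A) - 1 \<le> crit_count (f n) (vertex A n) R" by blast
  obtain \<rho> where r: "0 < \<rho>" "\<rho> < 1"
    "\<forall>z p. cmod z < 1 \<longrightarrow> cmod p < 1 \<longrightarrow> hdist z p \<le> R \<longrightarrow> cmod (mob_to0 p z) < \<rho>" using hdist_le_imp_mob by blast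
  \<comment> \<open>By \<open>mob_close\<close>, two vertices sharing a critical point within R
    would keep 1 - |.|^2 at least \<kappa>, which \<open>far\<close> excludes for large n.\<close>
  define \<kappa> where "\<kappa> = (1 - \<rho>\<^sup>2)\<^sup>2 / 4"
  have "\<rho>\<^sup>2 < 1" using r(1,2) by (simp add: power_less_one_iff)
  then have \<kappa>: "\<kappa> > 0" unfolding \<kappa>_def by simp
  have "\<forall>\<^sub>F n in sequentially. \<forall>A\<in>branches. \<forall>B\<in>branches. A \<noteq> B \<longrightarrow> 1 - (cmod (mob_to0 (vertex B n) (vertex A n)))\<^sup>2 < \<kappa>"
  proof (intro eventually_ball_finite[OF finite_branches] ballI)
    fix A B assume AB: "A \<in> branches" "B \<in> branches"
    show "\<forall>\<^sub>F n in sequentially. A \<noteq> B \<longrightarrow> 1 - (cmod (mob_to0 (vertex B n) (vertex A n)))\<^sup>2 < \<kappa>"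
    proof (cases "A = B")
      case False
      show ?thesis using order_tendstoD(2)[OF far[OF AB False] \<kappa>] by eventually_elim simp
    qed simp
  qed
  with R have "\<forall>\<^sub>F n in sequentially. \<forall>A\<in>branches. crit_count (f n) (vertex A n) R = card (children A) - 1"
  proof eventually_elim
    case (elim n)
    obtain z where z: "\<forall>i. cmod (z i) < 1" "\<forall>q R. crit_count (f n) q R = card {i. i < d - 1 \<and> hdist (z i) q \<le> R}"
      using crit_count_points[OF f_in d1] by blast
    define S where "S = (\<lambda>A. {i. i < d - 1 \<and> hdist (z i) (vertex A n) \<le> R})"
    have cS: "crit_count (f n) (vertex A n) R = card (S A)" for A unfolding S_def using z(2) by simp
    have fS: "finite (S A)" for A unfolding S_def by simp
    have dis: "S A \<inter> S B = {}" if AB: "A \<in> branches" "B \<in> branches" "A \<noteq> B" for A B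
    proof (rule ccontr)
      assume "S A \<inter> S B \<noteq> {}"
      then obtain i where i: "hdist (z i) (vertex A n) \<le> R" "hdist (z i) (vertex B n) \<le> R" by (auto simp: S_def)
      note v = vertex_norm[OF AB(1), of n] vertex_norm[OF AB(2), of n]
      have z1: "cmod (z i) < 1" using z(1) by blast
      have m: "cmod (mob_to0 (vertex A n) (z i)) < \<rho>" "cmod (mob_to0 (vertex B n) (z i)) < \<rho>" using r(3) z1 v i by auto
      have "\<kappa> \<le> 1 - (cmod (mob_to0 (vertex B n) (vertex A n)))\<^sup>2"
        unfolding \<kappa>_def by (rule mob_close[OF r(1,2) z1 v(2,1) m(2,1)])
      moreover have "1 - (cmod (mob_to0 (vertex B n) (vertex A n)))\<^sup>2 < \<kappa>" using elim(2) AB by blast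
      ultimately show False by linarith
    qed
    have "(\<Sum>A\<in>branches. card (S A)) = card (\<Union>A\<in>branches. S A)"
      by (rule card_UN_disjoint[symmetric, OF finite_branches]) (use fS dis in auto)
    also have "\<dots> \<le> card {..<d - 1}" by (rule card_mono) (auto simp: S_def)
    finally have le: "(\<Sum>A\<in>branches. card (S A)) \<le> (\<Sum>A\<in>branches. card (children A) - 1)"
      unfolding sum_children by simp
    have ge: "card (children A) - 1 \<le> card (S A)" if "A \<in> branches" for A using elim(1) that unfolding cS by blast
    then have "(\<Sum>A\<in>branches. card (children A) - 1) \<le> (\<Sum>A\<in>branches. card (S A))" by (rule sum_mono)
    then have eq: "(\<Sum>A\<in>branches. card (children A) - 1) = (\<Sum>A\<in>branches. card (S A))" using le by (rule antisym)
    have "card (children A) - 1 = card (S A)" if "A \<in> branches" for A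
      by (rule sum_mono_inv[OF eq ge that finite_branches])
    then show ?case unfolding cS by simp
  qed
  then show ?thesis by blast
qed

definition end_set :: "nat \<Rightarrow> complex set" where
  "end_set n = insert (x0 n) ((\<lambda>i. cay (x0 n) (of_real (t n i))) ` {..<d})"

definition realises :: "nat \<Rightarrow> (nat \<Rightarrow> complex) \<Rightarrow> (nat \<times> nat \<Rightarrow> real \<Rightarrow> complex) \<Rightarrow> bool" where
  "realises n pv pe \<longleftrightarrow> good_tree_map VV tree_edges pv pe \<and> pv N = x0 n \<and>
    (\<forall>A\<in>clusters. pv (cd A) = vertex A n) \<and>
    (\<forall>e\<in>tree_edges. pe e ` {0..1} = hgeod (pv (fst e)) (pv (snd e))) \<and>
    bij_betw pv (ends VV tree_edges) (end_set n) \<and>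
    (\<forall>x\<in>interior_pts VV tree_edges. \<exists>\<zeta> j. Im \<zeta> > 0 \<and> cay (x0 n) \<zeta> = tmap pv pe x \<and> j < d \<and>
       cmod (\<zeta> - of_real (t n j)) \<le> 2 * Im \<zeta>)"

lemma realisation_exists:
  assumes "cluster_geometry d clusters (t n) (x0 n)"
  shows "\<exists>w. realises n (fst w) (snd w)"
proof -
  have "\<exists>pv pe. realises n pv pe"
    using cluster_geometry.tree_realisation[OF assms]
    unfolding realises_def end_set_def vertex_def om_def width_def .
  then obtain pv pe where "realises n pv pe" by blast
  then show ?thesis by (intro exI[of _ "(pv, pe)"]) simp
qed

lemma realises_quasi_fixed:
  assumes r: "realises n pv pe" and x: "x \<in> interior_pts VV tree_edges"
  shows "hdist (f n (tmap pv pe x)) (tmap pv pe x) \<le> 2 * artanh (sqrt (1 - 4 / (L * (2 + 4 * L)\<^sup>2)))"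
proof -
  obtain \<zeta> j where \<zeta>: "Im \<zeta> > 0" "cay (x0 n) \<zeta> = tmap pv pe x" "j < d" "cmod (\<zeta> - of_real (t n j)) \<le> 2 * Im \<zeta>"
  proof -
    have "\<forall>x\<in>interior_pts VV tree_edges. \<exists>\<zeta> j. Im \<zeta> > 0 \<and> cay (x0 n) \<zeta> = tmap pv pe x \<and> j < d \<and>
       cmod (\<zeta> - of_real (t n j)) \<le> 2 * Im \<zeta>" using r unfolding realises_def by (elim conjE)
    from bspec[OF this x] show ?thesis using that by (elim exE conjE)
  qed
  show ?thesis unfolding \<zeta>(2)[symmetric]
    by (rule quasi_fixed[OF d_ge2 f_in L1 x0_circle x0_fixed x0_mult t_fixed[OF \<zeta>(3)] t_mult[OF \<zeta>(3)] \<zeta>(1,4)])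
qed

text \<open>Discarding the first M maps turns what holds eventually into statements for every n. The
  tree depends only on the limiting clusters, so it is the same for all n.\<close>

lemma limit_tree:
  "\<exists>M V E m rot pv pe. marked_ribbon_tree (d + 1) V E m rot \<and>
    (\<forall>n. good_tree_map V E (pv n) (pe n)) \<and>
    (\<forall>n. bij_betw (pv n) (ends V E) (end_set (n + M))) \<and> (\<forall>n. pv n m = x0 (n + M)) \<and>
    (\<forall>v\<in>branch V E. \<forall>w\<in>branch V E. v \<noteq> w \<longrightarrow> filterlim (\<lambda>n. hdist (pv n v) (pv n w)) at_top sequentially) \<and>
    (\<forall>n. \<forall>e\<in>E. pe n e ` {0..1} = hgeod (pv n (fst e)) (pv n (snd e))) \<and>
    (\<exists>R. \<forall>v\<in>branch V E. \<forall>n. crit_count (f (n + M)) (pv n v) R = val E v - 2) \<and>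
    (\<forall>n. \<forall>x\<in>interior_pts V E. hdist (f (n + M) (tmap (pv n) (pe n) x)) (tmap (pv n) (pe n) x)
       \<le> 2 * artanh (sqrt (1 - 4 / (L * (2 + 4 * L)\<^sup>2))))"
proof -
  obtain R where R: "\<forall>\<^sub>F n in sequentially. \<forall>A\<in>branches. crit_count (f n) (vertex A n) R = card (children A) - 1"
    using crit_exact by blast
  obtain M where M: "\<forall>n\<ge>M. (\<forall>A\<in>branches. crit_count (f n) (vertex A n) R = card (children A) - 1) \<and>
      (\<forall>x. cmod x = 1 \<longrightarrow> cluster_geometry d clusters (t n) x)"
    using eventually_conj[OF R geometry_eventually] unfolding eventually_sequentially by blast
  have "\<exists>w. realises (n + M) (fst w) (snd w)" for n
    by (rule realisation_exists) (use M x0_circle[of "n + M"] in simp)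
  then have ex: "\<forall>n. \<exists>w. realises (n + M) (fst w) (snd w)" ..
  obtain W where W: "\<forall>n. realises (n + M) (fst (W n)) (snd (W n))" using choice[OF ex] ..
  define pv where "pv = (\<lambda>n. fst (W n))"
  define pe where "pe = (\<lambda>n. snd (W n))"
  have r: "realises (n + M) (pv n) (pe n)" for n using W by (simp add: pv_def pe_def)
  have vx: "pv n (cd A) = vertex A (n + M)" if "A \<in> branches" for n A
    using r[of n] branches_clusters[OF that] unfolding realises_def by blast
  obtain rot where rot: "marked_ribbon_tree (d + 1) VV tree_edges N rot" using cluster_tree_marked by blast
  show ?thesis
  proof (rule exI[of _ M], rule exI[of _ VV], rule exI[of _ tree_edges], rule exI[of _ N], rule exI[of _ rot],
      rule exI[of _ pv], rule exI[of _ pe], intro conjI allI ballI impI)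
    show "marked_ribbon_tree (d + 1) VV tree_edges N rot" by (rule rot)
    show "good_tree_map VV tree_edges (pv n) (pe n)" for n using r[of n] unfolding realises_def by blast
    show "bij_betw (pv n) (ends VV tree_edges) (end_set (n + M))" for n using r[of n] unfolding realises_def by blast
    show "pv n N = x0 (n + M)" for n using r[of n] unfolding realises_def by blast
    show "pe n e ` {0..1} = hgeod (pv n (fst e)) (pv n (snd e))" if "e \<in> tree_edges" for n e
      using r[of n] that unfolding realises_def by blast
    show "hdist (f (n + M) (tmap (pv n) (pe n) x)) (tmap (pv n) (pe n) x)
       \<le> 2 * artanh (sqrt (1 - 4 / (L * (2 + 4 * L)\<^sup>2)))" if "x \<in> interior_pts VV tree_edges" for n x
      by (rule realises_quasi_fixed[OF r that])
    show "filterlim (\<lambda>n. hdist (pv n v) (pv n w)) at_top sequentially"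
      if vw: "v \<in> branch VV tree_edges" "w \<in> branch VV tree_edges" "v \<noteq> w" for v w
    proof -
      obtain A B where AB: "A \<in> branches" "v = cd A" "B \<in> branches" "w = cd B" using vw unfolding branch_eq by blast
      have ne: "A \<noteq> B" using AB vw(3) by auto
      have h: "filterlim (\<lambda>n. hdist (vertex A n) (vertex B n)) at_top sequentially"
        by (rule hdist_tendsto_infinity[OF vertex_norm[OF AB(1)] vertex_norm[OF AB(3)] far[OF AB(1,3) ne]])
      have "strict_mono (\<lambda>n. n + M)" by (rule strict_monoI) simp
      then have "filterlim (\<lambda>n. hdist (vertex A (n + M)) (vertex B (n + M))) at_top sequentially"
        by (rule filterlim_compose[OF h filterlim_subseq])
      then show ?thesis unfolding AB(2,4) vx[OF AB(1)] vx[OF AB(3)] .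
    qed
    show "\<exists>R. \<forall>v\<in>branch VV tree_edges. \<forall>n. crit_count (f (n + M)) (pv n v) R = val tree_edges v - 2"
    proof (intro exI[of _ R] ballI allI)
      fix v n assume "v \<in> branch VV tree_edges"
      then obtain A where A: "A \<in> branches" "v = cd A" unfolding branch_eq by blast
      have "crit_count (f (n + M)) (vertex A (n + M)) R = card (children A) - 1" using M A(1) by simp
      then show "crit_count (f (n + M)) (pv n v) R = val tree_edges v - 2"
        unfolding A(2) vx[OF A(1)] val_cd[OF branches_clusters[OF A(1)]] by simp
    qed
  qed
qed

end

theorem theorem2p10:
  fixes d :: nat and K :: real
  assumes "d \<ge> 2" and "K > 0"
  shows "\<exists>K' > 0. \<forall>fs :: nat \<Rightarrow> complex \<Rightarrow> complex. (\<forall>n. fs n \<in> BminusK d K) \<longrightarrow>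
    (\<exists>r V E m rot pv pe.
       strict_mono r \<and>
       marked_ribbon_tree (d + 1) V E m rot \<and>
       (\<forall>n. good_tree_map V E (pv n) (pe n)) \<and>
       \<comment> \<open>(1) ends approximating\<close>
       (\<forall>n. bij_betw (pv n) (ends V E) (rep_fix (fs (r n))) \<and>
            pv n m = marked_point d (fs (r n))) \<and>
       \<comment> \<open>(2) degenerating vertices\<close>
       (\<forall>v\<in>branch V E. \<forall>w\<in>branch V E. v \<noteq> w \<longrightarrow>
          filterlim (\<lambda>n. hdist (pv n v) (pv n w)) at_top sequentially) \<and>
       \<comment> \<open>(3) geodesic edges\<close>
       (\<forall>n. \<forall>e\<in>E. pe n e ` {0..1} = hgeod (pv n (fst e)) (pv n (snd e))) \<and>
       \<comment> \<open>(4) critically approximating\<close>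
       (\<exists>R. \<forall>v\<in>branch V E. \<forall>n. crit_count (fs (r n)) (pv n v) R = val E v - 2) \<and>
       \<comment> \<open>(5) quasi-fixed\<close>
       (\<forall>n. \<forall>x\<in>interior_pts V E.
          hdist (fs (r n) (tmap (pv n) (pe n) x)) (tmap (pv n) (pe n) x) \<le> K'))"
proof -
  define L where "L = exp K"
  \<comment> \<open>The maximum with 1 secures positivity.\<close>
  define K' where "K' = max 1 (2 * artanh (sqrt (1 - 4 / (L * (2 + 4 * L)\<^sup>2))))"
  have L1: "L \<ge> 1" unfolding L_def using assms(2) by simp
  have main: "\<exists>r V E m rot pv pe.
       strict_mono r \<and>
       marked_ribbon_tree (d + 1) V E m rot \<and>
       (\<forall>n. good_tree_map V E (pv n) (pe n)) \<and>
       (\<forall>n. bij_betw (pv n) (ends V E) (rep_fix (fs (r n))) \<and>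
            pv n m = marked_point d (fs (r n))) \<and>
       (\<forall>v\<in>branch V E. \<forall>w\<in>branch V E. v \<noteq> w \<longrightarrow>
          filterlim (\<lambda>n. hdist (pv n v) (pv n w)) at_top sequentially) \<and>
       (\<forall>n. \<forall>e\<in>E. pe n e ` {0..1} = hgeod (pv n (fst e)) (pv n (snd e))) \<and>
       (\<exists>R. \<forall>v\<in>branch V E. \<forall>n. crit_count (fs (r n)) (pv n v) R = val E v - 2) \<and>
       (\<forall>n. \<forall>x\<in>interior_pts V E.
          hdist (fs (r n) (tmap (pv n) (pe n) x)) (tmap (pv n) (pe n) x) \<le> K')"
    if fs: "\<forall>n. fs n \<in> BminusK d K" for fs :: "nat \<Rightarrow> complex \<Rightarrow> complex"
  proof -
    have B: "fs n \<in> Bminus d" for n using fs by (simp add: BminusK_def)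
    let ?m = "\<lambda>n. marked_point d (fs n)"
    have ex: "\<forall>n. \<exists>t :: nat \<Rightarrow> real. (\<forall>i j. i < j \<longrightarrow> j < d \<longrightarrow> t i < t j) \<and>
        rep_fix (fs n) = insert (?m n) ((\<lambda>i. cay (?m n) (of_real (t i))) ` {..<d})"
      by (intro allI rep_fix_coordinates[OF assms(1) B])
    obtain T where T: "\<forall>n. (\<forall>i j. i < j \<longrightarrow> j < d \<longrightarrow> T n i < T n j) \<and>
        rep_fix (fs n) = insert (?m n) ((\<lambda>i. cay (?m n) (of_real (T n i))) ` {..<d})"
      using choice[OF ex] ..
    have Tinc: "T n i < T n j" if "i < j" "j < d" for n i j using T that by blast
    define g where "g = (\<lambda>n i. T n (Suc i) - T n i)"
    define I where "I = {i. Suc i < d} \<times> {i. Suc i < d}"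
    \<comment> \<open>The bounded quotients of gaps, one for each pair in I; compactness of [0, 1]
      gives a common subsequence.\<close>
    define X where "X = (\<lambda>p n. g n (fst p) / (g n (fst p) + g n (snd p)))"
    have finI: "finite I" unfolding I_def
      by (intro finite_cartesian_product; rule finite_subset[of _ "{..<d}"]; auto)
    have cC: "compact {0..1 :: real}" by simp
    have XC: "X p n \<in> {0..1}" if "p \<in> I" for p n
    proof -
      have "g n (fst p) > 0" "g n (snd p) > 0" using that Tinc by (auto simp: g_def I_def)
      then show ?thesis by (auto simp: X_def)
    qed
    obtain r l where r: "strict_mono (r :: nat \<Rightarrow> nat)" "\<forall>p\<in>I. (\<lambda>n. X p (r n)) \<longlonglongrightarrow> l p"
    proof (rule finite_family_subsequence[of I "\<lambda>_. {0..1}" X])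
      fix r l
      assume "strict_mono (r :: nat \<Rightarrow> nat)" "\<And>p. p \<in> I \<Longrightarrow> l p \<in> {0..1} \<and> (\<lambda>n. X p (r n)) \<longlonglongrightarrow> l p"
      then show thesis using that by blast
    qed (use finI cC XC in auto)
    have rf: "z \<in> rep_fix (fs n) \<Longrightarrow> cmod z = 1 \<and> fs n z = z \<and> cmod (dbar (fs n) z) \<le> L" for z n
      using BminusK_multiplier[OF assms(1), of "fs n" K z] fs by (simp add: rep_fix_def L_def)
    have mrep: "?m n \<in> rep_fix (fs n)" for n by (rule marked_point_in_rep_fix[OF assms(1) B])
    have trep: "cay (?m n) (of_real (T n i)) \<in> rep_fix (fs n)" if "i < d" for n i using T that by auto
    interpret lim: blaschke_limit d "\<lambda>n. T (r n)" "\<lambda>n. fs (r n)" "\<lambda>n. ?m (r n)" L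
    proof
      show "d \<ge> 2" "L \<ge> 1" by (fact assms(1), fact L1)
      show "T (r n) i < T (r n) j" if "i < j" "j < d" for n i j by (rule Tinc[OF that])
      show "convergent (\<lambda>n. (T (r n) (Suc i) - T (r n) i) / ((T (r n) (Suc i) - T (r n) i) + (T (r n) (Suc j) - T (r n) j)))"
        if "Suc i < d" "Suc j < d" for i j
      proof -
        have "(i, j) \<in> I" using that by (simp add: I_def)
        then have "(\<lambda>n. X (i, j) (r n)) \<longlonglongrightarrow> l (i, j)" using r(2) by blast
        then show ?thesis unfolding convergent_def X_def g_def by auto
      qed
      show "fs (r n) \<in> Bminus d" for n by (rule B)
      show "cmod (?m (r n)) = 1" "fs (r n) (?m (r n)) = ?m (r n)" "cmod (dbar (fs (r n)) (?m (r n))) \<le> L" for n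
        using rf[OF mrep] by auto
      show "fs (r n) (cay (?m (r n)) (of_real (T (r n) i))) = cay (?m (r n)) (of_real (T (r n) i))"
        "cmod (dbar (fs (r n)) (cay (?m (r n)) (of_real (T (r n) i)))) \<le> L" if "i < d" for n i
        using rf[OF trep[OF that]] by auto
    qed
    obtain M V E m rot pv pe where tree: "marked_ribbon_tree (d + 1) V E m rot"
      and good: "\<forall>n. good_tree_map V E (pv n) (pe n)"
      and bij: "\<forall>n. bij_betw (pv n) (ends V E) (lim.end_set (n + M))" and mark: "\<forall>n. pv n m = ?m (r (n + M))"
      and deg: "\<forall>v\<in>branch V E. \<forall>w\<in>branch V E. v \<noteq> w \<longrightarrow> filterlim (\<lambda>n. hdist (pv n v) (pv n w)) at_top sequentially"
      and geo: "\<forall>n. \<forall>e\<in>E. pe n e ` {0..1} = hgeod (pv n (fst e)) (pv n (snd e))"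
      and crit: "\<exists>R. \<forall>v\<in>branch V E. \<forall>n. crit_count (fs (r (n + M))) (pv n v) R = val E v - 2"
      and qf: "\<forall>n. \<forall>x\<in>interior_pts V E. hdist (fs (r (n + M)) (tmap (pv n) (pe n) x)) (tmap (pv n) (pe n) x)
         \<le> 2 * artanh (sqrt (1 - 4 / (L * (2 + 4 * L)\<^sup>2)))"
      using lim.limit_tree by (elim exE conjE) (rule that; (assumption | rule exI; assumption))
    have e: "lim.end_set n = rep_fix (fs (r n))" for n unfolding lim.end_set_def using T by simp
    have sm: "strict_mono (\<lambda>n. r (n + M))" using r(1) by (intro strict_monoI) (simp add: strict_mono_less)
    have qf': "\<forall>n. \<forall>x\<in>interior_pts V E. hdist (fs (r (n + M)) (tmap (pv n) (pe n) x)) (tmap (pv n) (pe n) x) \<le> K'"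
    proof (intro allI ballI)
      fix n x assume "x \<in> interior_pts V E"
      then have "hdist (fs (r (n + M)) (tmap (pv n) (pe n) x)) (tmap (pv n) (pe n) x)
         \<le> 2 * artanh (sqrt (1 - 4 / (L * (2 + 4 * L)\<^sup>2)))" using qf by blast
      also have "\<dots> \<le> K'" unfolding K'_def by simp
      finally show "hdist (fs (r (n + M)) (tmap (pv n) (pe n) x)) (tmap (pv n) (pe n) x) \<le> K'" .
    qed
    have bm: "\<forall>n. bij_betw (pv n) (ends V E) (rep_fix (fs (r (n + M)))) \<and> pv n m = ?m (r (n + M))"
      using bij mark unfolding e by blast
    show ?thesis
      by (rule exI[of _ "\<lambda>n. r (n + M)"], rule exI[of _ V], rule exI[of _ E], rule exI[of _ m], rule exI[of _ rot],
        rule exI[of _ pv], rule exI[of _ pe], intro conjI sm tree good bm deg geo crit qf')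
  qed
  have K': "K' > 0" unfolding K'_def by linarith
  show ?thesis by (rule exI[of _ K'], rule conjI, rule K', intro allI impI, rule main, assumption)
qed

end
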